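(* Let $\theta$ be an action of an inverse semigroup $S$ on a locally compact Hausdorff space $X$. Then there is an isomorphism of C*-algebras $$S\ltimes^{\mathrm{KS}}_r C_0(X)\;\cong\; C^*_r(S\ltimes X^{\mathrm{KS}}).$$
   Context: An inverse semigroup is a semigroup $S$ in which every $s$ has a unique $s^*$ with $ss^*s=s$, $s^*ss^*=s^*$; $E(S)$ is its commutative subsemigroup of idempotents; $s\le t$ means $ts^*s=s$. An action $\theta$ of $S$ on a topological space $X$ is a semigroup homomorphism $s\mapsto\theta_s$ from $S$ to the inverse semigroup of partial bijections of $X$ (bijections between subsets, composed on the largest possible domain) such that, writing $X_e$ for the subset on which $\theta_e$ ($e\in E(S)$) is the identity (so $\theta_s$ is a bijection $X_{s^*s}\to X_{ss^*}$): each $X_e$ is open, each $\theta_s\colon X_{s^*s}\to X_{ss^*}$ is continuous, and $\bigcup_{e\in E(S)}X_e=X$. The space $X^{\mathrm{KS}}$: let $\widetilde{X_e}=X_e\sqcup\{\infty_e\}$ be the one-point compactification of $X_e$ (a point $\infty_e$ is added even when $X_e$ is compact). Let $\widetilde{X^{\mathrm{KS}}}$ be the set of $\tau\in\prod_{e\in E(S)}\widetilde{X_e}$ such that (1) if $e_1\le e_2$ and $\tau(e_1)\ne\infty_{e_1}$, then $\tau(e_2)=\tau(e_1)$; (2) if $\tau(e_1)\neq\infty_{e_1}$ and $\tau(e_2)\neq\infty_{e_2}$, then $\tau(e_1e_2)\neq\infty_{e_1e_2}$; with the topology induced from the product topology. Set $X^{\mathrm{KS}}=\widetilde{X^{\mathrm{KS}}}\setminus\{\infty\}$,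 $\infty=(\infty_e)_e$; it is locally compact Hausdorff. $S$ acts on $X^{\mathrm{KS}}$ by $X^{\mathrm{KS}}_e=\{\tau\in X^{\mathrm{KS}}\mid\tau(e)\ne\infty_e\}$ and $\theta^{\mathrm{KS}}_s\colon X^{\mathrm{KS}}_{s^*s}\to X^{\mathrm{KS}}_{ss^*}$, $\theta^{\mathrm{KS}}_s(\tau)(e)=\theta_{es}(\tau(s^*es))$ if $\tau(s^*es)\neq\infty_{s^*es}$ and $\infty_e$ otherwise. Transformation groupoid: for an action $\theta$ of $S$ on a locally compact Hausdorff space $Z$, $S\ltimes Z$ is the set of classes $[s,z]$ of pairs $(s,z)$, $z\in Z_{s^*s}$, under $(s,z)\sim(t,w)$ iff $z=w$ and $se=te$, $z\in Z_e$ for some $e\in E(S)$; unit space $\{[e,z]\}\cong Z$, $d([s,z])=z$, $r([s,z])=\theta_s(z)$, $[t,\theta_s(z)][s,z]=[ts,z]$, $[s,z]^{-1}=[s^*,\theta_s(z)]$; basis of open sets $[s,U]=\{[s,z]\mid z\in U\}$, $U\subset Z_{s^*s}$ open. It is an étale groupoid (possibly non-Hausdorff). $S\ltimes X^{\mathrm{KS}}$ is the KS-groupoid. Reduced groupoid C*-algebra: for an étale groupoid $G$ (unit space locally compact Hausdorff), $\mathcal C(G)$ is the linear span in $\mathbb C^G$ of all $C_c(U)$, $U\subset G$ open bisection (open subset on which $d$ and $r$ are injective), functions being extended by zero; it is a $*$-algebra with $f*g(\gamma)=\sum_{\beta\in G_{d(\gamma)}}f(\gamma\beta^{-1})g(\beta)$,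 $f^*(\gamma)=\overline{f(\gamma^{-1})}$, where $G_x=\{\gamma\mid d(\gamma)=x\}$. For $x\in G^{(0)}$, $\lambda_x\colon\mathcal C(G)\to\mathbb B(l^2(G_x))$ is $\lambda_x(f)\delta_\gamma=\sum_{\beta\in G_{r(\gamma)}}f(\beta)\delta_{\beta\gamma}$. $C^*_r(G)$ is the completion of $\mathcal C(G)$ for $\|f\|_r=\sup_{x\in G^{(0)}}\|\lambda_x(f)\|$. Reduced KS-crossed product: $S$ acts on $A=C_0(X)$ via ideals $A_e=C_0(X_e)$ and $\alpha_s\colon C_0(X_{s^*s})\to C_0(X_{ss^*})$, $\alpha_s(f)=f\circ\theta_{s^*}$. Let $S\ltimes^{\mathrm{KS}}_{\mathrm{alg}}A=\bigoplus_{s\in S}A_{s^*s}$ (algebraic direct sum), with $\delta_s\,a$ the element having $a\in A_{s^*s}$ in the $s$-th component and $0$ elsewhere; it is a $*$-algebra with $(\delta_s a)(\delta_t b)=\delta_{st}\,\alpha_{t^*}(a\alpha_t(b))$ and $(\delta_s a)^*=\delta_{s^*}\,\alpha_s(a^* )$. For $e\in E(S)$ put $S_e=\{s\in S\mid s^*s=e\}$ and let $l^2(S_e,A_e)$ be the Hilbert $A_e$-module of square-summable families, with $\delta_t\,y$ ($t\in S_e$, $y\in A_e$) the elementary vectors. There is a $*$-homomorphism $\ell_e\colon S\ltimes^{\mathrm{KS}}_{\mathrm{alg}}A\to\mathbb B(l^2(S_e,A_e))$ into adjointable operators with $\ell_e(\delta_s a)(\delta_t y)=\delta_{st}\,\alpha_{t^*}(a\alpha_t(y))$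 if $s^*st=t$, and $0$ otherwise. $S\ltimes^{\mathrm{KS}}_rA$ is the completion of $S\ltimes^{\mathrm{KS}}_{\mathrm{alg}}A$ in the C*-norm $\|T\|_{\mathrm{KS},r}=\sup_{e\in E(S)}\|\ell_e(T)\|$. *)

theory Defs
  imports "HOL-Analysis.Analysis" "HOL-Library.Function_Algebras"
begin

class inverse_semigroup = semigroup_mult +
  assumes ex1_inverse: "\<exists>!t. s * t * s = s \<and> t * s * t = t"

definition istar :: "'s::inverse_semigroup \<Rightarrow> 's" (\<open>_\<^sup>\<star>\<close> [1000] 999) where
  "s\<^sup>\<star> = (THE t. s * t * s = s \<and> t * s * t = t)"

definition idempotents :: "'s::inverse_semigroup set" where
  "idempotents = {e. e * e = e}"

definition natural_le :: "'s::inverse_semigroup \<Rightarrow> 's \<Rightarrow> bool" where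
  "natural_le s t \<longleftrightarrow> t * (s\<^sup>\<star> * s) = s"

text \<open>Partial bijections are partial maps, and \<^term>\<open>(\<circ>\<^sub>m)\<close> is their composition on the largest
  possible domain.\<close>

definition partial_bijection :: "'x set \<Rightarrow> ('x \<rightharpoonup> 'x) \<Rightarrow> bool" where
  "partial_bijection A f \<longleftrightarrow> dom f \<subseteq> A \<and> ran f \<subseteq> A \<and> inj_on f (dom f)"

definition idset :: "('s \<Rightarrow> 'x \<rightharpoonup> 'x) \<Rightarrow> 's \<Rightarrow> 'x set" where
  "idset \<theta> e = {x. \<theta> e x = Some x}"

definition semigroup_action :: "'x topology \<Rightarrow> ('s::inverse_semigroup \<Rightarrow> 'x \<rightharpoonup> 'x) \<Rightarrow> bool" where
  "semigroup_action X \<theta> \<longleftrightarrow>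
     (\<forall>s. partial_bijection (topspace X) (\<theta> s)) \<and>
     (\<forall>s t. \<theta> (s * t) = \<theta> s \<circ>\<^sub>m \<theta> t) \<and>
     (\<forall>e\<in>idempotents. openin X (idset \<theta> e)) \<and>
     (\<forall>s. continuous_map (subtopology X (idset \<theta> (s\<^sup>\<star> * s))) (subtopology X (idset \<theta> (s * s\<^sup>\<star>)))
            (\<lambda>x. the (\<theta> s x))) \<and>
     (\<Union>e\<in>idempotents. idset \<theta> e) = topspace X"

text \<open>The point at infinity of each one-point compactification is \<^term>\<open>None\<close>. As elements of
  a product over \<^term>\<open>idempotents\<close>, the families are \<^term>\<open>undefined\<close> elsewhere.\<close>

definition KS_product :: "'x topology \<Rightarrow> ('s::inverse_semigroup \<Rightarrow> 'x \<rightharpoonup> 'x) \<Rightarrow> ('s \<Rightarrow> 'x option) topology" where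
  "KS_product X \<theta> =
     product_topology (\<lambda>e. Alexandroff_compactification (subtopology X (idset \<theta> e))) idempotents"

definition KS_tilde :: "'x topology \<Rightarrow> ('s::inverse_semigroup \<Rightarrow> 'x \<rightharpoonup> 'x) \<Rightarrow> ('s \<Rightarrow> 'x option) set" where
  "KS_tilde X \<theta> = {\<tau> \<in> topspace (KS_product X \<theta>).
     (\<forall>e1\<in>idempotents. \<forall>e2\<in>idempotents. natural_le e1 e2 \<and> \<tau> e1 \<noteq> None \<longrightarrow> \<tau> e2 = \<tau> e1) \<and>
     (\<forall>e1\<in>idempotents. \<forall>e2\<in>idempotents. \<tau> e1 \<noteq> None \<and> \<tau> e2 \<noteq> None \<longrightarrow> \<tau> (e1 * e2) \<noteq> None)}"

definition KS_infinity :: "'s::inverse_semigroup \<Rightarrow> 'x option" where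
  "KS_infinity = (\<lambda>e\<in>idempotents. None)"

definition KS_space :: "'x topology \<Rightarrow> ('s::inverse_semigroup \<Rightarrow> 'x \<rightharpoonup> 'x) \<Rightarrow> ('s \<Rightarrow> 'x option) topology" where
  "KS_space X \<theta> = subtopology (KS_product X \<theta>) (KS_tilde X \<theta> - {KS_infinity})"

definition KS_action :: "'x topology \<Rightarrow> ('s::inverse_semigroup \<Rightarrow> 'x \<rightharpoonup> 'x) \<Rightarrow>
    's \<Rightarrow> ('s \<Rightarrow> 'x option) \<rightharpoonup> ('s \<Rightarrow> 'x option)" where
  "KS_action X \<theta> s \<tau> =
     (if \<tau> \<in> topspace (KS_space X \<theta>) \<and> \<tau> (s\<^sup>\<star> * s) \<noteq> None
      then Some (\<lambda>e\<in>idempotents. case \<tau> (s\<^sup>\<star> * e * s) of None \<Rightarrow> None | Some x \<Rightarrow> \<theta> (e * s) x)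
      else None)"

text \<open>The unit space is kept as a separate space \<open>units\<close>, in which \<open>dm\<close> and \<open>rg\<close> take
  their values; \<open>cmp \<gamma> \<beta>\<close> is the product of \<open>\<gamma>\<close> and \<open>\<beta>\<close> when \<open>dm \<gamma> = rg \<beta>\<close>.\<close>

record ('g, 'u) topological_groupoid =
  arrows :: "'g topology"
  units :: "'u topology"
  dm :: "'g \<Rightarrow> 'u"
  rg :: "'g \<Rightarrow> 'u"
  cmp :: "'g \<Rightarrow> 'g \<Rightarrow> 'g"
  gpinv :: "'g \<Rightarrow> 'g"

definition germ_pairs :: "('s::inverse_semigroup \<Rightarrow> 'z \<rightharpoonup> 'z) \<Rightarrow> ('s \<times> 'z) set" where
  "germ_pairs \<theta> = {(s, z). z \<in> idset \<theta> (s\<^sup>\<star> * s)}"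

definition germ_rel :: "('s::inverse_semigroup \<Rightarrow> 'z \<rightharpoonup> 'z) \<Rightarrow> (('s \<times> 'z) \<times> ('s \<times> 'z)) set" where
  "germ_rel \<theta> = {((s, z), (t, w)). (s, z) \<in> germ_pairs \<theta> \<and> (t, w) \<in> germ_pairs \<theta> \<and>
     z = w \<and> (\<exists>e\<in>idempotents. s * e = t * e \<and> z \<in> idset \<theta> e)}"

definition germ :: "('s::inverse_semigroup \<Rightarrow> 'z \<rightharpoonup> 'z) \<Rightarrow> 's \<Rightarrow> 'z \<Rightarrow> ('s \<times> 'z) set" where
  "germ \<theta> s z = germ_rel \<theta> `` {(s, z)}"

text \<open>The operations on classes are independent of representatives, so the unions and images
  over all representatives below are over constant families.\<close>

definition transformation_groupoid :: "'z topology \<Rightarrow> ('s::inverse_semigroup \<Rightarrow> 'z \<rightharpoonup> 'z) \<Rightarrow>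
    (('s \<times> 'z) set, 'z) topological_groupoid" where
  "transformation_groupoid Z \<theta> = \<lparr>
     arrows = topology_generated_by {germ \<theta> s ` U | s U. openin Z U \<and> U \<subseteq> idset \<theta> (s\<^sup>\<star> * s)},
     units = Z,
     dm = (\<lambda>\<gamma>. the_elem (snd ` \<gamma>)),
     rg = (\<lambda>\<gamma>. the_elem ((\<lambda>(s, z). the (\<theta> s z)) ` \<gamma>)),
     cmp = (\<lambda>\<gamma> \<beta>. \<Union>(t, w)\<in>\<gamma>. \<Union>(s, z)\<in>\<beta>. germ \<theta> (t * s) z),
     gpinv = (\<lambda>\<gamma>. \<Union>(s, z)\<in>\<gamma>. germ \<theta> (s\<^sup>\<star>) (the (\<theta> s z)))\<rparr>"

definition KS_groupoid :: "'x topology \<Rightarrow> ('s::inverse_semigroup \<Rightarrow> 'x \<rightharpoonup> 'x) \<Rightarrow>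
    (('s \<times> ('s \<Rightarrow> 'x option)) set, 's \<Rightarrow> 'x option) topological_groupoid" where
  "KS_groupoid X \<theta> = transformation_groupoid (KS_space X \<theta>) (KS_action X \<theta>)"

definition fiber :: "('g, 'u) topological_groupoid \<Rightarrow> 'u \<Rightarrow> 'g set" where
  "fiber G x = {\<gamma> \<in> topspace (arrows G). dm G \<gamma> = x}"

definition open_bisection :: "('g, 'u) topological_groupoid \<Rightarrow> 'g set \<Rightarrow> bool" where
  "open_bisection G U \<longleftrightarrow> openin (arrows G) U \<and> inj_on (dm G) U \<and> inj_on (rg G) U"

record 'a normed_star_algebra =
  carr :: "'a set"
  add :: "'a \<Rightarrow> 'a \<Rightarrow> 'a"
  scl :: "complex \<Rightarrow> 'a \<Rightarrow> 'a"
  mul :: "'a \<Rightarrow> 'a \<Rightarrow> 'a"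
  adj :: "'a \<Rightarrow> 'a"
  nrm :: "'a \<Rightarrow> real"

definition nsa_dist :: "'a normed_star_algebra \<Rightarrow> 'a \<Rightarrow> 'a \<Rightarrow> real" where
  "nsa_dist A a b = nrm A (add A a (scl A (- 1) b))"

definition Cauchy_seqs :: "'a normed_star_algebra \<Rightarrow> (nat \<Rightarrow> 'a) set" where
  "Cauchy_seqs A = {u. range u \<subseteq> carr A \<and>
     (\<forall>\<epsilon>>0. \<exists>N. \<forall>m\<ge>N. \<forall>n\<ge>N. nsa_dist A (u m) (u n) < \<epsilon>)}"

definition Cauchy_rel :: "'a normed_star_algebra \<Rightarrow> ((nat \<Rightarrow> 'a) \<times> (nat \<Rightarrow> 'a)) set" where
  "Cauchy_rel A = {(u, v). u \<in> Cauchy_seqs A \<and> v \<in> Cauchy_seqs A \<and>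
     (\<lambda>n. nsa_dist A (u n) (v n)) \<longlonglongrightarrow> 0}"

text \<open>Again the unions are over constant families of classes.\<close>

definition completion_of :: "'a normed_star_algebra \<Rightarrow> (nat \<Rightarrow> 'a) set normed_star_algebra" where
  "completion_of A = \<lparr>
     carr = Cauchy_seqs A // Cauchy_rel A,
     add = (\<lambda>p q. \<Union>u\<in>p. \<Union>v\<in>q. Cauchy_rel A `` {\<lambda>n. add A (u n) (v n)}),
     scl = (\<lambda>c p. \<Union>u\<in>p. Cauchy_rel A `` {\<lambda>n. scl A c (u n)}),
     mul = (\<lambda>p q. \<Union>u\<in>p. \<Union>v\<in>q. Cauchy_rel A `` {\<lambda>n. mul A (u n) (v n)}),
     adj = (\<lambda>p. \<Union>u\<in>p. Cauchy_rel A `` {\<lambda>n. adj A (u n)}),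
     nrm = (\<lambda>p. the_elem ((\<lambda>u. lim (\<lambda>n. nrm A (u n))) ` p))\<rparr>"

text \<open>Between C*-algebras the last clause is automatic for a bijective *-homomorphism.\<close>

definition cstar_isomorphism ::
    "'a normed_star_algebra \<Rightarrow> 'b normed_star_algebra \<Rightarrow> ('a \<Rightarrow> 'b) \<Rightarrow> bool" where
  "cstar_isomorphism A B \<phi> \<longleftrightarrow>
     bij_betw \<phi> (carr A) (carr B) \<and>
     (\<forall>a\<in>carr A. \<forall>b\<in>carr A. \<phi> (add A a b) = add B (\<phi> a) (\<phi> b)) \<and>
     (\<forall>c. \<forall>a\<in>carr A. \<phi> (scl A c a) = scl B c (\<phi> a)) \<and>
     (\<forall>a\<in>carr A. \<forall>b\<in>carr A. \<phi> (mul A a b) = mul B (\<phi> a) (\<phi> b)) \<and>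
     (\<forall>a\<in>carr A. \<phi> (adj A a) = adj B (\<phi> a)) \<and>
     (\<forall>a\<in>carr A. nrm B (\<phi> a) = nrm A a)"

definition cstar_isomorphic :: "'a normed_star_algebra \<Rightarrow> 'b normed_star_algebra \<Rightarrow> bool" where
  "cstar_isomorphic A B \<longleftrightarrow> (\<exists>\<phi>. cstar_isomorphism A B \<phi>)"

text \<open>Functions on a space, or on a subspace, are extended by zero to the whole type.\<close>

definition Cc :: "'x topology \<Rightarrow> ('x \<Rightarrow> complex) set" where
  "Cc T = {f. continuous_map T euclidean f \<and>
     compactin T (T closure_of {x \<in> topspace T. f x \<noteq> 0}) \<and> (\<forall>x. x \<notin> topspace T \<longrightarrow> f x = 0)}"

definition C0 :: "'x topology \<Rightarrow> ('x \<Rightarrow> complex) set" where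
  "C0 T = {f. continuous_map T euclidean f \<and>
     (\<forall>\<epsilon>>0. compactin T {x \<in> topspace T. \<epsilon> \<le> cmod (f x)}) \<and> (\<forall>x. x \<notin> topspace T \<longrightarrow> f x = 0)}"

definition sup_norm :: "('x \<Rightarrow> complex) \<Rightarrow> real" where
  "sup_norm f = (SUP x. cmod (f x))"

definition delta :: "'i \<Rightarrow> 'b::zero \<Rightarrow> 'i \<Rightarrow> 'b" where
  "delta i b = (\<lambda>j. if j = i then b else 0)"

definition l2 :: "'i set \<Rightarrow> ('i \<Rightarrow> complex) set" where
  "l2 I = {\<xi>. (\<lambda>i. (cmod (\<xi> i))\<^sup>2) summable_on I \<and> (\<forall>i. i \<notin> I \<longrightarrow> \<xi> i = 0)}"

definition l2_norm :: "'i set \<Rightarrow> ('i \<Rightarrow> complex) \<Rightarrow> real" where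
  "l2_norm I \<xi> = sqrt (\<Sum>\<^sub>\<infinity>i\<in>I. (cmod (\<xi> i))\<^sup>2)"

text \<open>Operators are \<^term>\<open>undefined\<close> outside the space they act on, so that each is a single
  HOL function.\<close>

definition bounded_operators :: "'i set \<Rightarrow> (('i \<Rightarrow> complex) \<Rightarrow> 'i \<Rightarrow> complex) set" where
  "bounded_operators I = {L \<in> l2 I \<rightarrow>\<^sub>E l2 I.
     (\<forall>\<xi>\<in>l2 I. \<forall>\<eta>\<in>l2 I. L (\<xi> + \<eta>) = L \<xi> + L \<eta>) \<and>
     (\<forall>c. \<forall>\<xi>\<in>l2 I. L (\<lambda>i. c * \<xi> i) = (\<lambda>i. c * L \<xi> i)) \<and>
     (\<exists>K. \<forall>\<xi>\<in>l2 I. l2_norm I (L \<xi>) \<le> K * l2_norm I \<xi>)}"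

definition op_norm :: "'i set \<Rightarrow> (('i \<Rightarrow> complex) \<Rightarrow> 'i \<Rightarrow> complex) \<Rightarrow> real" where
  "op_norm I L = (SUP \<xi>\<in>{\<xi> \<in> l2 I. l2_norm I \<xi> \<le> 1}. l2_norm I (L \<xi>))"

definition groupoid_functions :: "('g, 'u) topological_groupoid \<Rightarrow> ('g \<Rightarrow> complex) set" where
  "groupoid_functions G = module.span (\<lambda>c f \<gamma>. c * f \<gamma>)
     (\<Union>U\<in>{U. open_bisection G U}. Cc (subtopology (arrows G) U))"

definition convolution ::
    "('g, 'u) topological_groupoid \<Rightarrow> ('g \<Rightarrow> complex) \<Rightarrow> ('g \<Rightarrow> complex) \<Rightarrow> 'g \<Rightarrow> complex" where
  "convolution G f g = (\<lambda>\<gamma>. if \<gamma> \<in> topspace (arrows G)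
     then \<Sum>\<^sub>\<infinity>\<beta>\<in>fiber G (dm G \<gamma>). f (cmp G \<gamma> (gpinv G \<beta>)) * g \<beta> else 0)"

definition groupoid_adjoint :: "('g, 'u) topological_groupoid \<Rightarrow> ('g \<Rightarrow> complex) \<Rightarrow> 'g \<Rightarrow> complex" where
  "groupoid_adjoint G f = (\<lambda>\<gamma>. if \<gamma> \<in> topspace (arrows G) then cnj (f (gpinv G \<gamma>)) else 0)"

definition regular_rep ::
    "('g, 'u) topological_groupoid \<Rightarrow> 'u \<Rightarrow> ('g \<Rightarrow> complex) \<Rightarrow> ('g \<Rightarrow> complex) \<Rightarrow> 'g \<Rightarrow> complex" where
  "regular_rep G x f = (THE L. L \<in> bounded_operators (fiber G x) \<and>
     (\<forall>\<gamma>\<in>fiber G x. L (delta \<gamma> 1) =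
        (\<lambda>\<eta>. \<Sum>\<^sub>\<infinity>\<beta>\<in>fiber G (rg G \<gamma>). f \<beta> * delta (cmp G \<beta> \<gamma>) 1 \<eta>)))"

text \<open>The inserted \<open>0\<close> makes the supremum \<open>0\<close> when the unit space is empty.\<close>

definition reduced_norm :: "('g, 'u) topological_groupoid \<Rightarrow> ('g \<Rightarrow> complex) \<Rightarrow> real" where
  "reduced_norm G f =
     Sup (insert 0 ((\<lambda>x. op_norm (fiber G x) (regular_rep G x f)) ` topspace (units G)))"

definition groupoid_algebra :: "('g, 'u) topological_groupoid \<Rightarrow> ('g \<Rightarrow> complex) normed_star_algebra" where
  "groupoid_algebra G = \<lparr>
     carr = groupoid_functions G,
     add = (+),
     scl = (\<lambda>c f \<gamma>. c * f \<gamma>),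
     mul = convolution G,
     adj = groupoid_adjoint G,
     nrm = reduced_norm G\<rparr>"

definition reduced_groupoid_algebra ::
    "('g, 'u) topological_groupoid \<Rightarrow> (nat \<Rightarrow> 'g \<Rightarrow> complex) set normed_star_algebra" where
  "reduced_groupoid_algebra G = completion_of (groupoid_algebra G)"

definition ideal_at :: "'x topology \<Rightarrow> ('s \<Rightarrow> 'x \<rightharpoonup> 'x) \<Rightarrow> 's \<Rightarrow> ('x \<Rightarrow> complex) set" where
  "ideal_at X \<theta> e = C0 (subtopology X (idset \<theta> e))"

definition induced :: "('s::inverse_semigroup \<Rightarrow> 'x \<rightharpoonup> 'x) \<Rightarrow> 's \<Rightarrow> ('x \<Rightarrow> complex) \<Rightarrow> 'x \<Rightarrow> complex" where
  "induced \<theta> s f = (\<lambda>x. case \<theta> (s\<^sup>\<star>) x of None \<Rightarrow> 0 | Some y \<Rightarrow> f y)"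

definition KS_algebraic :: "'x topology \<Rightarrow> ('s::inverse_semigroup \<Rightarrow> 'x \<rightharpoonup> 'x) \<Rightarrow> ('s \<Rightarrow> 'x \<Rightarrow> complex) set" where
  "KS_algebraic X \<theta> = {T. (\<forall>s. T s \<in> ideal_at X \<theta> (s\<^sup>\<star> * s)) \<and> finite {s. T s \<noteq> 0}}"

text \<open>Product and adjoint are the (bi)additive extensions of the formulas on \<open>\<delta>\<^sub>s a\<close>; sums and
  products of functions are pointwise.\<close>

definition KS_mult :: "('s::inverse_semigroup \<Rightarrow> 'x \<rightharpoonup> 'x) \<Rightarrow>
    ('s \<Rightarrow> 'x \<Rightarrow> complex) \<Rightarrow> ('s \<Rightarrow> 'x \<Rightarrow> complex) \<Rightarrow> 's \<Rightarrow> 'x \<Rightarrow> complex" where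
  "KS_mult \<theta> T U = (\<Sum>s\<in>{s. T s \<noteq> 0}. \<Sum>t\<in>{t. U t \<noteq> 0}.
     delta (s * t) (induced \<theta> (t\<^sup>\<star>) (T s * induced \<theta> t (U t))))"

definition KS_adjoint :: "('s::inverse_semigroup \<Rightarrow> 'x \<rightharpoonup> 'x) \<Rightarrow>
    ('s \<Rightarrow> 'x \<Rightarrow> complex) \<Rightarrow> 's \<Rightarrow> 'x \<Rightarrow> complex" where
  "KS_adjoint \<theta> T = (\<Sum>s\<in>{s. T s \<noteq> 0}. delta (s\<^sup>\<star>) (induced \<theta> s (\<lambda>x. cnj (T s x))))"

text \<open>The Hilbert module \<open>l\<^sup>2(I, B)\<close> over an algebra \<open>B\<close> of functions: square-summability is
  convergence of the sum in the norm of \<open>B\<close>, which is uniform convergence. The inner product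
  then converges as well, and its value is given by the pointwise sums.\<close>

definition l2_module :: "'i set \<Rightarrow> ('x \<Rightarrow> complex) set \<Rightarrow> ('i \<Rightarrow> 'x \<Rightarrow> complex) set" where
  "l2_module I B = {\<xi>. (\<forall>i\<in>I. \<xi> i \<in> B) \<and> (\<forall>i. i \<notin> I \<longrightarrow> \<xi> i = 0) \<and>
     (\<exists>h\<in>B. uniform_limit UNIV (\<lambda>F x. \<Sum>i\<in>F. cnj (\<xi> i x) * \<xi> i x) h (finite_subsets_at_top I))}"

definition module_inner :: "'i set \<Rightarrow> ('i \<Rightarrow> 'x \<Rightarrow> complex) \<Rightarrow> ('i \<Rightarrow> 'x \<Rightarrow> complex) \<Rightarrow> 'x \<Rightarrow> complex" where
  "module_inner I \<xi> \<eta> = (\<lambda>x. \<Sum>\<^sub>\<infinity>i\<in>I. cnj (\<xi> i x) * \<eta> i x)"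

definition module_norm :: "'i set \<Rightarrow> ('i \<Rightarrow> 'x \<Rightarrow> complex) \<Rightarrow> real" where
  "module_norm I \<xi> = sqrt (sup_norm (module_inner I \<xi> \<xi>))"

definition adjointable_operators ::
    "'i set \<Rightarrow> ('x \<Rightarrow> complex) set \<Rightarrow> (('i \<Rightarrow> 'x \<Rightarrow> complex) \<Rightarrow> 'i \<Rightarrow> 'x \<Rightarrow> complex) set" where
  "adjointable_operators I B = {L \<in> l2_module I B \<rightarrow>\<^sub>E l2_module I B.
     \<exists>M \<in> l2_module I B \<rightarrow> l2_module I B. \<forall>\<xi>\<in>l2_module I B. \<forall>\<eta>\<in>l2_module I B.
       module_inner I (L \<xi>) \<eta> = module_inner I \<xi> (M \<eta>)}"

definition module_op_norm ::
    "'i set \<Rightarrow> ('x \<Rightarrow> complex) set \<Rightarrow> (('i \<Rightarrow> 'x \<Rightarrow> complex) \<Rightarrow> 'i \<Rightarrow> 'x \<Rightarrow> complex) \<Rightarrow> real" where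
  "module_op_norm I B L = (SUP \<xi>\<in>{\<xi> \<in> l2_module I B. module_norm I \<xi> \<le> 1}. module_norm I (L \<xi>))"

definition source_fiber :: "'s::inverse_semigroup \<Rightarrow> 's set" where
  "source_fiber e = {s. s\<^sup>\<star> * s = e}"

definition KS_rep :: "'x topology \<Rightarrow> ('s::inverse_semigroup \<Rightarrow> 'x \<rightharpoonup> 'x) \<Rightarrow> 's \<Rightarrow>
    ('s \<Rightarrow> 'x \<Rightarrow> complex) \<Rightarrow> ('s \<Rightarrow> 'x \<Rightarrow> complex) \<Rightarrow> 's \<Rightarrow> 'x \<Rightarrow> complex" where
  "KS_rep X \<theta> e T = (THE L. L \<in> adjointable_operators (source_fiber e) (ideal_at X \<theta> e) \<and>
     (\<forall>t\<in>source_fiber e. \<forall>y\<in>ideal_at X \<theta> e. L (delta t y) =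
        (\<Sum>s\<in>{s. T s \<noteq> 0}. if s\<^sup>\<star> * s * t = t
           then delta (s * t) (induced \<theta> (t\<^sup>\<star>) (T s * induced \<theta> t y)) else 0)))"

definition KS_reduced_norm :: "'x topology \<Rightarrow> ('s::inverse_semigroup \<Rightarrow> 'x \<rightharpoonup> 'x) \<Rightarrow>
    ('s \<Rightarrow> 'x \<Rightarrow> complex) \<Rightarrow> real" where
  "KS_reduced_norm X \<theta> T =
     (SUP e\<in>idempotents. module_op_norm (source_fiber e) (ideal_at X \<theta> e) (KS_rep X \<theta> e T))"

definition KS_algebraic_crossed_product :: "'x topology \<Rightarrow> ('s::inverse_semigroup \<Rightarrow> 'x \<rightharpoonup> 'x) \<Rightarrow>
    ('s \<Rightarrow> 'x \<Rightarrow> complex) normed_star_algebra" where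
  "KS_algebraic_crossed_product X \<theta> = \<lparr>
     carr = KS_algebraic X \<theta>,
     add = (+),
     scl = (\<lambda>c T s x. c * T s x),
     mul = KS_mult \<theta>,
     adj = KS_adjoint \<theta>,
     nrm = KS_reduced_norm X \<theta>\<rparr>"

definition KS_reduced_crossed_product :: "'x topology \<Rightarrow> ('s::inverse_semigroup \<Rightarrow> 'x \<rightharpoonup> 'x) \<Rightarrow>
    (nat \<Rightarrow> 's \<Rightarrow> 'x \<Rightarrow> complex) set normed_star_algebra" where
  "KS_reduced_crossed_product X \<theta> = completion_of (KS_algebraic_crossed_product X \<theta>)"

end

theory Submission
  imports Defs
begin

text \<open>
  Both norms are suprema of operator norms of matrices with finitely supported rows and columns:
  on the fibre of \<open>S \<ltimes> X\<^sup>K\<^sup>S\<close> over \<open>\<tau>\<close> for the groupoid, and, since \<open>l\<^sup>2(S\<^sub>e, A\<^sub>e)\<close> is a module of functions on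
  \<open>X\<^sub>e\<close>, on \<open>S\<^sub>e\<close> at each point of \<open>X\<^sub>e\<close> for the crossed product. An element \<open>a \<in> C\<^sub>0(X\<^sub>e)\<close>
  gives the function \<open>\<tau> \<mapsto> a(\<tau>(e))\<close> on \<open>X\<^sup>K\<^sup>S\<close>, and \<open>\<delta>\<^sub>s a \<mapsto> (\<tau> \<mapsto> a(\<tau>(s\<^sup>*s)))\<close>, regarded as a function
  on the bisection of germs of \<open>s\<close>, is a *-homomorphism. It is isometric: the matrix on \<open>S\<^sub>e\<close> at \<open>x\<close> is
  the one on the fibre over the point \<open>\<tau>\<close> with \<open>\<tau>(f) = x\<close> for \<open>f \<ge> e\<close> and \<open>\<tau>(f) = \<infinity>\<close> otherwise, and
  each finite section of the matrix on the fibre over an arbitrary \<open>\<tau>\<close> is a section of the one on \<open>S\<^sub>e\<close>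
  at \<open>\<tau>(e)\<close> for some \<open>e\<close> small enough with \<open>\<tau>(e) \<noteq> \<infinity>\<close>. Its image need not lie in \<open>\<C>(G)\<close>, but by the
  theorem of Stone and Weierstrass image and \<open>\<C>(G)\<close> are dense in each other, so that their
  completions agree.
\<close>

section \<open>Inverse semigroups\<close>

text \<open>The KS-groupoid need not be Hausdorff, so elements of \<C>(G) need not be continuous on
  it, and no space of continuous functions on G holds both algebras. They are compared inside
  \<open>bounded_kernels\<close>, a class defined by finite supports along fibres and a uniform
  matrix bound. Topology enters sheet by sheet: a sheet consists of the germs of one s, is
  homeomorphic to an open set of units, and carries functions whose reduced norm is at most their
  supremum norm. Norms are not computed but characterized by their nonnegative upper bounds C, in
  terms of finite sections; two norms agree as soon as these bounds correspond. Finite sections are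
  also what permits the passage from \<tau> to one idempotent: germs over \<tau> agree when the
  elements agree below some e with \<tau>(e) finite, this e varies with the pair, and only finitely
  many conditions can be met by one e. The approximation must run in both directions: a function in
  C_0(X_e) need not have compact support, and a compactly supported function on X^KS need not be a
  finite sum of functions a(\<tau>(e)).\<close>

lemma istar_inverse:
  fixes s :: "'s::inverse_semigroup"
  shows "s * s\<^sup>\<star> * s = s" "s\<^sup>\<star> * s * s\<^sup>\<star> = s\<^sup>\<star>"
  using theI'[OF ex1_inverse[of s]] unfolding istar_def by auto

lemma istar_eqI:
  fixes s :: "'s::inverse_semigroup"
  assumes "s * t * s = s" "t * s * t = t"
  shows "s\<^sup>\<star> = t"
  using ex1_inverse[of s] assms istar_inverse[of s] by auto

lemma istar_istar [simp]: "(s\<^sup>\<star>)\<^sup>\<star> = (s::'s::inverse_semigroup)"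
  by (rule istar_eqI) (simp_all add: istar_inverse)

lemma idem_iff: "e \<in> idempotents \<longleftrightarrow> e * e = e"
  by (simp add: idempotents_def)

lemma istar_idem [simp]: "e \<in> idempotents \<Longrightarrow> e\<^sup>\<star> = (e::'s::inverse_semigroup)"
  by (rule istar_eqI) (simp_all add: idem_iff)

text \<open>Let x be the inverse of ef. Then fxe is an inverse of ef too, so x = fxe by uniqueness,
  which makes x idempotent; x is then its own inverse, and ef, the inverse of x, equals x.\<close>

lemma idem_mult [simp]:
  fixes e :: "'s::inverse_semigroup"
  assumes e: "e \<in> idempotents" and f: "f \<in> idempotents"
  shows "e * f \<in> idempotents"
proof -
  define x where "x = (e * f)\<^sup>\<star>"
  have x: "e * f * x * (e * f) = e * f" "x * (e * f) * x = x"
    by (simp_all add: x_def istar_inverse)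
  have ee: "e * (e * z) = e * z" and ff: "f * (f * z) = f * z" for z
    using e f by (simp_all add: idem_iff flip: mult.assoc)
  have x': "e * (f * (x * (e * f))) = e * f" "x * (e * (f * (x * z))) = x * z" for z
    using x by (simp_all add: mult.assoc) (metis mult.assoc)
  have fxe: "f * x * e = x"
    unfolding x_def[symmetric]
    by (rule istar_eqI[of "e * f" "f * x * e", folded x_def, symmetric])
       (simp_all add: mult.assoc ee ff x')
  have "x * x = x"
  proof -
    have "x * x = (f * x * e) * (f * x * e)" by (simp only: fxe)
    also have "\<dots> = f * x * e" by (simp add: mult.assoc x')
    finally show ?thesis by (simp only: fxe)
  qed
  then have "x\<^sup>\<star> = x" by (simp add: idem_iff)
  then have "e * f = x" by (simp add: x_def)
  with \<open>x * x = x\<close> show ?thesis by (simp add: idem_iff)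
qed

text \<open>Both ef and fe are idempotent, so fe is an inverse of ef, while the idempotent ef is its
  own inverse; uniqueness gives equality.\<close>

lemma idem_commute:
  fixes e :: "'s::inverse_semigroup"
  assumes e: "e \<in> idempotents" and f: "f \<in> idempotents"
  shows "e * f = f * e"
proof -
  have ef: "e * (f * (e * f)) = e * f" "f * (e * (f * e)) = f * e"
    using idem_mult[OF e f] idem_mult[OF f e] by (simp_all add: idem_iff mult.assoc)
  have ee: "e * (e * z) = e * z" and ff: "f * (f * z) = f * z" for z
    using e f by (simp_all add: idem_iff flip: mult.assoc)
  have "(e * f)\<^sup>\<star> = f * e"
    by (rule istar_eqI) (simp_all add: mult.assoc ee ff ef)
  then show ?thesis using idem_mult[OF e f] by simp
qed

lemma istar_mult_idem [simp]: "s\<^sup>\<star> * s \<in> idempotents" "s * s\<^sup>\<star> \<in> (idempotents :: 's::inverse_semigroup set)"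
  by (simp_all add: idem_iff istar_inverse flip: mult.assoc)

lemma istar_mult:
  fixes s :: "'s::inverse_semigroup"
  shows "(s * t)\<^sup>\<star> = t\<^sup>\<star> * s\<^sup>\<star>"
proof (rule istar_eqI)
  have c: "t * t\<^sup>\<star> * (s\<^sup>\<star> * s) = s\<^sup>\<star> * s * (t * t\<^sup>\<star>)" by (rule idem_commute) simp_all
  have "s * t * (t\<^sup>\<star> * s\<^sup>\<star>) * (s * t) = s * (t * t\<^sup>\<star> * (s\<^sup>\<star> * s)) * t" by (simp add: mult.assoc)
  also have "\<dots> = (s * s\<^sup>\<star> * s) * (t * t\<^sup>\<star> * t)" by (simp only: c) (simp add: mult.assoc)
  finally show "s * t * (t\<^sup>\<star> * s\<^sup>\<star>) * (s * t) = s * t" by (simp add: istar_inverse)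
  have "t\<^sup>\<star> * s\<^sup>\<star> * (s * t) * (t\<^sup>\<star> * s\<^sup>\<star>) = t\<^sup>\<star> * (s\<^sup>\<star> * s * (t * t\<^sup>\<star>)) * s\<^sup>\<star>" by (simp add: mult.assoc)
  also have "\<dots> = (t\<^sup>\<star> * t * t\<^sup>\<star>) * (s\<^sup>\<star> * s * s\<^sup>\<star>)" by (simp only: c[symmetric]) (simp add: mult.assoc)
  finally show "t\<^sup>\<star> * s\<^sup>\<star> * (s * t) * (t\<^sup>\<star> * s\<^sup>\<star>) = t\<^sup>\<star> * s\<^sup>\<star>" by (simp add: istar_inverse)
qed

lemma istar_assoc:
  fixes s :: "'s::inverse_semigroup"
  shows "s * (s\<^sup>\<star> * s) = s" "s\<^sup>\<star> * (s * s\<^sup>\<star>) = s\<^sup>\<star>" "s * (s\<^sup>\<star> * (s * z)) = s * z"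
    "s\<^sup>\<star> * (s * (s\<^sup>\<star> * z)) = s\<^sup>\<star> * z"
  by (simp_all add: istar_inverse flip: mult.assoc)

lemma idem_assoc:
  "e \<in> idempotents \<Longrightarrow> e * e = e" "e \<in> idempotents \<Longrightarrow> e * (e * z) = e * (z::'s::inverse_semigroup)"
  by (simp_all add: idem_iff flip: mult.assoc)

lemma idem_left_commute:
  "e \<in> idempotents \<Longrightarrow> f \<in> idempotents \<Longrightarrow> e * (f * z) = f * (e * (z::'s::inverse_semigroup))"
  by (metis idem_commute mult.assoc)

lemma idem_conj [simp]:
  fixes s :: "'s::inverse_semigroup"
  assumes e: "e \<in> idempotents"
  shows "s\<^sup>\<star> * e * s \<in> idempotents" "s\<^sup>\<star> * (e * s) \<in> idempotents"
proof -
  have "s\<^sup>\<star> * e * s * (s\<^sup>\<star> * e * s) = s\<^sup>\<star> * (e * (s * s\<^sup>\<star> * (e * s)))" by (simp add: mult.assoc)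
  also have "\<dots> = s\<^sup>\<star> * e * s"
    by (subst idem_left_commute) (use e in \<open>simp_all add: idem_assoc istar_assoc mult.assoc\<close>)
  finally show "s\<^sup>\<star> * e * s \<in> idempotents" by (simp add: idem_iff)
  then show "s\<^sup>\<star> * (e * s) \<in> idempotents" by (simp add: mult.assoc)
qed

lemma natural_le_idem:
  "e \<in> idempotents \<Longrightarrow> natural_le e f \<longleftrightarrow> f * e = (e::'s::inverse_semigroup)"
  by (simp add: natural_le_def idem_assoc)

lemma istar_mult_self_idem_right:
  fixes s :: "'s::inverse_semigroup"
  assumes e: "e \<in> idempotents"
  shows "(s * e)\<^sup>\<star> * (s * e) = s\<^sup>\<star> * s * e"
proof -
  have "(s * e)\<^sup>\<star> * (s * e) = e * (s\<^sup>\<star> * s * e)" using e by (simp add: istar_mult mult.assoc)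
  also have "\<dots> = s\<^sup>\<star> * s * (e * e)" using e by (subst idem_left_commute) simp_all
  finally show ?thesis using e by (simp add: idem_assoc)
qed

lemma istar_mult_self_idem_left:
  fixes s :: "'s::inverse_semigroup"
  assumes e: "e \<in> idempotents"
  shows "(e * s)\<^sup>\<star> * (e * s) = s\<^sup>\<star> * e * s"
  using e by (simp add: istar_mult mult.assoc idem_assoc)

lemma istar_mult_self_mult:
  fixes s :: "'s::inverse_semigroup"
  shows "(s * t)\<^sup>\<star> * (s * t) = t\<^sup>\<star> * (s\<^sup>\<star> * s) * t"
  by (simp add: istar_mult mult.assoc)

text \<open>For \<open>s\<^sup>\<star> * s\<close> in place of e, the left side is the condition in
  the formula for \<open>KS_rep\<close>, and the right side says that \<open>s * t\<close> and t
  have the same source projection, which is how it appears on the groupoid side. From the right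
  side, the left one follows by commuting e past \<open>t * t\<^sup>\<star>\<close>.\<close>

lemma idem_absorb_iff:
  fixes t :: "'s::inverse_semigroup"
  assumes e: "e \<in> idempotents"
  shows "e * t = t \<longleftrightarrow> t\<^sup>\<star> * e * t = t\<^sup>\<star> * t"
proof
  assume h: "t\<^sup>\<star> * e * t = t\<^sup>\<star> * t"
  have "e * t = e * (t * t\<^sup>\<star>) * t" by (simp add: istar_assoc mult.assoc)
  also have "\<dots> = (t * t\<^sup>\<star>) * e * t" using e by (subst idem_commute) simp_all
  also have "\<dots> = t * (t\<^sup>\<star> * e * t)" by (simp add: mult.assoc)
  also have "\<dots> = t" by (simp add: h istar_assoc)
  finally show "e * t = t" .
qed (simp add: mult.assoc)

section \<open>Actions\<close>

lemma in_idset: "z \<in> idset \<theta> e \<longleftrightarrow> \<theta> e z = Some z"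
  by (simp add: idset_def)

text \<open>Instantiated twice, with \<theta> on X and with the action on X^KS, so that germs and
  functions on sheets are treated once for both.\<close>

locale partial_action =
  fixes Z :: "'z topology" and \<theta> :: "'s::inverse_semigroup \<Rightarrow> 'z \<rightharpoonup> 'z"
  assumes action: "semigroup_action Z \<theta>"
begin

abbreviation source :: "'s \<Rightarrow> 'z set" where "source s \<equiv> idset \<theta> (s\<^sup>\<star> * s)"
abbreviation act :: "'s \<Rightarrow> 'z \<Rightarrow> 'z" where "act s z \<equiv> the (\<theta> s z)"

lemma mult_comp: "\<theta> (s * t) = \<theta> s \<circ>\<^sub>m \<theta> t"
  using action by (simp add: semigroup_action_def)

lemma openin_idset: "e \<in> idempotents \<Longrightarrow> openin Z (idset \<theta> e)"
  using action by (simp add: semigroup_action_def)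

lemma openin_source [simp]: "openin Z (source s)"
  by (simp add: openin_idset)

lemma idset_subset: "e \<in> idempotents \<Longrightarrow> idset \<theta> e \<subseteq> topspace Z"
  using openin_idset openin_subset by blast

lemma cover: "z \<in> topspace Z \<Longrightarrow> \<exists>e\<in>idempotents. z \<in> idset \<theta> e"
  using action by (auto simp: semigroup_action_def)

lemma map_inj: "\<theta> s z = Some y \<Longrightarrow> \<theta> s w = Some y \<Longrightarrow> z = w"
  using action unfolding semigroup_action_def partial_bijection_def inj_on_def
  by (metis domI)

text \<open>As \<theta>_e is idempotent, it fixes y; it is injective, so the two points with image y
  coincide. Thus \<open>idset \<theta> e\<close> is the whole domain of \<theta>_e.\<close>

lemma map_idem: 
  assumes "e \<in> idempotents" "\<theta> e z = Some y" shows "y = z"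
proof -
  have "\<theta> e z = (\<theta> e \<circ>\<^sub>m \<theta> e) z" using assms(1) by (simp add: idem_iff flip: mult_comp)
  then have "\<theta> e y = Some y" using assms(2) by (simp add: map_comp_def)
  then show ?thesis using map_inj assms(2) by blast
qed

text \<open>The domain of \<theta>_s is not prescribed in \<open>semigroup_action\<close>. That it
  is the set fixed by \<open>s\<^sup>\<star> * s\<close> follows from
  \<open>s = s * (s\<^sup>\<star> * s)\<close> and \<open>map_idem\<close>.\<close>

lemma map_defined_iff: "z \<in> source s \<longleftrightarrow> (\<exists>y. \<theta> s z = Some y)"
proof
  assume "z \<in> source s"
  then have "(\<theta> (s\<^sup>\<star>) \<circ>\<^sub>m \<theta> s) z = Some z" by (simp add: in_idset flip: mult_comp)
  then show "\<exists>y. \<theta> s z = Some y" by (auto simp: map_comp_def split: option.splits)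
next
  assume "\<exists>y. \<theta> s z = Some y"
  then obtain y where "\<theta> (s * (s\<^sup>\<star> * s)) z = Some y" by (auto simp: istar_assoc)
  then obtain w where w: "\<theta> (s\<^sup>\<star> * s) z = Some w"
    by (auto simp: mult_comp[of s] map_comp_def split: option.splits)
  then show "z \<in> source s" using map_idem[of "s\<^sup>\<star> * s"] by (auto simp: in_idset)
qed

lemma map_eq_Some_iff: "\<theta> s z = Some y \<longleftrightarrow> z \<in> source s \<and> y = act s z"
  by (auto simp: map_defined_iff)

lemma idset_mult:
  assumes "e \<in> idempotents" "f \<in> idempotents"
  shows "idset \<theta> (e * f) = idset \<theta> e \<inter> idset \<theta> f"
  unfolding set_eq_iff Int_iff in_idset mult_comp map_comp_def
  using map_idem[OF assms(1)] map_idem[OF assms(2)]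
  by (auto split: option.splits)

lemma idset_mono:
  "e \<in> idempotents \<Longrightarrow> f \<in> idempotents \<Longrightarrow> f * e = e \<Longrightarrow> idset \<theta> e \<subseteq> idset \<theta> f"
  using idset_mult[of f e] by auto

lemma source_mult: "z \<in> source (s * t) \<longleftrightarrow> z \<in> source t \<and> act t z \<in> source s"
  unfolding map_defined_iff mult_comp by (auto simp: map_comp_def split: option.splits)

lemma act_mult: "z \<in> source (s * t) \<Longrightarrow> act (s * t) z = act s (act t z)"
  unfolding map_defined_iff mult_comp by (auto simp: map_comp_def split: option.splits)

lemma source_idem [simp]: "e \<in> idempotents \<Longrightarrow> source e = idset \<theta> e"
  by (simp add: idem_assoc)

lemma act_idem: "e \<in> idempotents \<Longrightarrow> z \<in> idset \<theta> e \<Longrightarrow> act e z = z"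
  by (simp add: in_idset)

lemma act_istar: "z \<in> source s \<Longrightarrow> act (s\<^sup>\<star>) (act s z) = z"
  using act_mult[of z "s\<^sup>\<star>" s] act_idem[of "s\<^sup>\<star> * s" z] source_idem[of "s\<^sup>\<star> * s"] by simp

lemma act_in_range: "z \<in> source s \<Longrightarrow> act s z \<in> source (s\<^sup>\<star>)"
  using source_mult[of z "s\<^sup>\<star>" s] source_idem[of "s\<^sup>\<star> * s"] by simp

lemma act_istar': "z \<in> source (s\<^sup>\<star>) \<Longrightarrow> act s (act (s\<^sup>\<star>) z) = z"
  using act_istar[of z "s\<^sup>\<star>"] by simp

lemma act_in_source: "z \<in> source (s\<^sup>\<star>) \<Longrightarrow> act (s\<^sup>\<star>) z \<in> source s"
  using act_in_range[of z "s\<^sup>\<star>"] by simp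

lemma act_inj: "z \<in> source s \<Longrightarrow> w \<in> source s \<Longrightarrow> act s z = act s w \<Longrightarrow> z = w"
  by (metis act_istar)

lemma source_mult_idem: "e \<in> idempotents \<Longrightarrow> source (s * e) = source s \<inter> idset \<theta> e"
  by (simp add: istar_mult_self_idem_right idset_mult)

lemma act_mult_idem: "e \<in> idempotents \<Longrightarrow> z \<in> source s \<Longrightarrow> z \<in> idset \<theta> e \<Longrightarrow> act (s * e) z = act s z"
  by (simp add: act_mult source_mult_idem act_idem)

lemma source_subset: "source s \<subseteq> topspace Z"
  by (simp add: idset_subset)

lemma act_in_topspace: "z \<in> source s \<Longrightarrow> act s z \<in> topspace Z"
  using act_in_range source_subset by blast

lemma induced_istar:
  "induced \<theta> (s\<^sup>\<star>) f z = (if z \<in> source s then f (act s z) else 0)"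
  by (auto simp: induced_def map_defined_iff split: option.splits)

lemma induced_eq:
  "induced \<theta> s f z = (if z \<in> source (s\<^sup>\<star>) then f (act (s\<^sup>\<star>) z) else 0)"
  using induced_istar[of "s\<^sup>\<star>"] by simp

text \<open>The coefficient of a product in the crossed product, made explicit.
  \<open>section_function_convolution\<close> produces the same expression on the groupoid, which is
  why the comparison map is multiplicative.\<close>

lemma induced_product:
  "induced \<theta> (t\<^sup>\<star>) (a * induced \<theta> t b) z = (if z \<in> source t then a (act t z) * b z else 0)"
  using act_in_range[of z t] by (simp add: induced_istar induced_eq act_istar)

lemma continuous_map_act: "continuous_map (subtopology Z (source s)) (subtopology Z (source (s\<^sup>\<star>))) (act s)"
  using action by (simp add: semigroup_action_def)

end

section \<open>Bounds on finite sections of matrices\<close>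

text \<open>A bound for all finite sections, with rows R and columns F chosen independently. For
  matrices with finite rows and K nonnegative it amounts to norm at most K on l^2, but it involves
  no infinite sums and can be transported between index sets one finite set at a time.\<close>

definition matrix_bound :: "'i set \<Rightarrow> ('i \<Rightarrow> 'i \<Rightarrow> complex) \<Rightarrow> real \<Rightarrow> bool" where
  "matrix_bound I m K \<longleftrightarrow> (\<forall>F R \<xi>. finite F \<and> F \<subseteq> I \<and> finite R \<and> R \<subseteq> I \<longrightarrow>
     L2_set (\<lambda>r. cmod (\<Sum>i\<in>F. m r i * \<xi> i)) R \<le> K * L2_set (\<lambda>i. cmod (\<xi> i)) F)"

lemma matrix_boundD:
  "matrix_bound I m K \<Longrightarrow> finite F \<Longrightarrow> F \<subseteq> I \<Longrightarrow> finite R \<Longrightarrow> R \<subseteq> I \<Longrightarrow>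
     L2_set (\<lambda>r. cmod (\<Sum>i\<in>F. m r i * \<xi> i)) R \<le> K * L2_set (\<lambda>i. cmod (\<xi> i)) F"
  unfolding matrix_bound_def by blast

lemma matrix_boundI:
  "(\<And>F R \<xi>. finite F \<Longrightarrow> F \<subseteq> I \<Longrightarrow> finite R \<Longrightarrow> R \<subseteq> I \<Longrightarrow>
     L2_set (\<lambda>r. cmod (\<Sum>i\<in>F. m r i * \<xi> i)) R \<le> K * L2_set (\<lambda>i. cmod (\<xi> i)) F) \<Longrightarrow> matrix_bound I m K"
  unfolding matrix_bound_def by blast

lemma matrix_bound_zero: "0 \<le> K \<Longrightarrow> matrix_bound I (\<lambda>_ _. 0) K"
  by (rule matrix_boundI) (simp add: L2_set_def sum_nonneg)

lemma matrix_bound_add: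
  assumes "matrix_bound I m K" "matrix_bound I m' K'"
  shows "matrix_bound I (\<lambda>r i. m r i + m' r i) (K + K')"
proof (rule matrix_boundI)
  fix F R :: "'a set" and \<xi> :: "'a \<Rightarrow> complex"
  assume *: "finite F" "F \<subseteq> I" "finite R" "R \<subseteq> I"
  have "L2_set (\<lambda>r. cmod (\<Sum>i\<in>F. (m r i + m' r i) * \<xi> i)) R
      \<le> L2_set (\<lambda>r. cmod (\<Sum>i\<in>F. m r i * \<xi> i) + cmod (\<Sum>i\<in>F. m' r i * \<xi> i)) R"
    by (rule L2_set_mono) (simp_all add: distrib_right sum.distrib norm_triangle_ineq)
  also have "\<dots> \<le> L2_set (\<lambda>r. cmod (\<Sum>i\<in>F. m r i * \<xi> i)) R + L2_set (\<lambda>r. cmod (\<Sum>i\<in>F. m' r i * \<xi> i)) R"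
    by (rule L2_set_triangle_ineq)
  also have "\<dots> \<le> K * L2_set (\<lambda>i. cmod (\<xi> i)) F + K' * L2_set (\<lambda>i. cmod (\<xi> i)) F"
    by (intro add_mono matrix_boundD[OF assms(1)] matrix_boundD[OF assms(2)] *)
  finally show "L2_set (\<lambda>r. cmod (\<Sum>i\<in>F. (m r i + m' r i) * \<xi> i)) R \<le> (K + K') * L2_set (\<lambda>i. cmod (\<xi> i)) F"
    by (simp add: distrib_right)
qed

lemma matrix_bound_sum:
  assumes "finite S" "\<And>s. s \<in> S \<Longrightarrow> matrix_bound I (m s) (K s)"
  shows "matrix_bound I (\<lambda>r i. \<Sum>s\<in>S. m s r i) (\<Sum>s\<in>S. K s)"
  using assms by (induction S rule: finite_induct) (auto intro: matrix_bound_zero matrix_bound_add)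

lemma matrix_bound_scale:
  assumes "matrix_bound I m K"
  shows "matrix_bound I (\<lambda>r i. c * m r i) (cmod c * K)"
proof (rule matrix_boundI)
  fix F R :: "'a set" and \<xi> :: "'a \<Rightarrow> complex"
  assume *: "finite F" "F \<subseteq> I" "finite R" "R \<subseteq> I"
  have "L2_set (\<lambda>r. cmod (\<Sum>i\<in>F. c * m r i * \<xi> i)) R = cmod c * L2_set (\<lambda>r. cmod (\<Sum>i\<in>F. m r i * \<xi> i)) R"
    by (simp add: L2_set_right_distrib mult.assoc norm_mult flip: sum_distrib_left)
  then show "L2_set (\<lambda>r. cmod (\<Sum>i\<in>F. c * m r i * \<xi> i)) R \<le> cmod c * K * L2_set (\<lambda>i. cmod (\<xi> i)) F"
    using matrix_boundD[OF assms *, of \<xi>] by (simp add: mult.assoc mult_left_mono)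
qed

lemma matrix_bound_mult:
  assumes m: "matrix_bound I m K" and n: "matrix_bound I n K'" and K: "0 \<le> K"
    and fin: "\<And>i. i \<in> I \<Longrightarrow> finite {j \<in> I. n j i \<noteq> 0}"
  shows "matrix_bound I (\<lambda>r i. \<Sum>j\<in>{j \<in> I. n j i \<noteq> 0}. m r j * n j i) (K * K')"
proof (rule matrix_boundI)
  fix F R :: "'a set" and \<xi> :: "'a \<Rightarrow> complex"
  assume *: "finite F" "F \<subseteq> I" "finite R" "R \<subseteq> I"
  \<comment> \<open>J contains every row that the columns in F meet, so inserting the truncation to
    J between the factors changes nothing.\<close>
  define J where "J = (\<Union>i\<in>F. {j \<in> I. n j i \<noteq> 0})"
  have J: "finite J" "J \<subseteq> I" using * fin by (auto simp: J_def)
  have "(\<Sum>i\<in>F. (\<Sum>j\<in>{j \<in> I. n j i \<noteq> 0}. m r j * n j i) * \<xi> i) = (\<Sum>j\<in>J. m r j * (\<Sum>i\<in>F. n j i * \<xi> i))" for r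
  proof -
    have "(\<Sum>i\<in>F. (\<Sum>j\<in>{j \<in> I. n j i \<noteq> 0}. m r j * n j i) * \<xi> i) = (\<Sum>i\<in>F. (\<Sum>j\<in>J. m r j * n j i) * \<xi> i)"
      by (intro sum.cong refl arg_cong2[where f="(*)"] sum.mono_neutral_left J(1)) (auto simp: J_def)
    also have "\<dots> = (\<Sum>i\<in>F. \<Sum>j\<in>J. m r j * (n j i * \<xi> i))" by (simp add: sum_distrib_right mult.assoc)
    also have "\<dots> = (\<Sum>j\<in>J. \<Sum>i\<in>F. m r j * (n j i * \<xi> i))" by (rule sum.swap)
    finally show ?thesis by (simp add: sum_distrib_left)
  qed
  then have "L2_set (\<lambda>r. cmod (\<Sum>i\<in>F. (\<Sum>j\<in>{j \<in> I. n j i \<noteq> 0}. m r j * n j i) * \<xi> i)) R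
     \<le> K * L2_set (\<lambda>j. cmod (\<Sum>i\<in>F. n j i * \<xi> i)) J"
    using matrix_boundD[OF m J *(3,4)] by simp
  also have "\<dots> \<le> K * (K' * L2_set (\<lambda>i. cmod (\<xi> i)) F)"
    by (intro mult_left_mono K matrix_boundD[OF n *(1,2) J])
  finally show "L2_set (\<lambda>r. cmod (\<Sum>i\<in>F. (\<Sum>j\<in>{j \<in> I. n j i \<noteq> 0}. m r j * n j i) * \<xi> i)) R
     \<le> K * K' * L2_set (\<lambda>i. cmod (\<xi> i)) F" by simp
qed

lemma L2_set_square: "finite A \<Longrightarrow> (L2_set f A)\<^sup>2 = (\<Sum>i\<in>A. (f i)\<^sup>2)"
  by (simp add: L2_set_def sum_nonneg)

text \<open>Test the adjoint against its own image: with w the image of \<eta>, the squared norm of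
  w is the pairing of \<eta> with m w, at most K times the norms of \<eta> and w; divide by the norm
  of w.\<close>

lemma matrix_bound_adjoint:
  assumes m: "matrix_bound I m K"
  shows "matrix_bound I (\<lambda>r i. cnj (m i r)) K"
proof (rule matrix_boundI)
  fix F R :: "'a set" and \<eta> :: "'a \<Rightarrow> complex"
  assume *: "finite F" "F \<subseteq> I" "finite R" "R \<subseteq> I"
  define w where "w = (\<lambda>i. \<Sum>r\<in>F. cnj (m r i) * \<eta> r)"
  let ?w = "L2_set (\<lambda>i. cmod (w i)) R" and ?\<eta> = "L2_set (\<lambda>r. cmod (\<eta> r)) F"
  have "of_real (?w\<^sup>2) = (\<Sum>i\<in>R. w i * cnj (w i))"
    using * by (simp add: L2_set_square flip: complex_norm_square)
  also have "\<dots> = (\<Sum>i\<in>R. \<Sum>r\<in>F. \<eta> r * cnj (m r i * w i))"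
    by (simp add: w_def[of] sum_distrib_right mult_ac)
  also have "\<dots> = (\<Sum>r\<in>F. \<eta> r * cnj (\<Sum>i\<in>R. m r i * w i))"
    by (subst sum.swap) (simp add: sum_distrib_left)
  finally have "cmod (of_real (?w\<^sup>2)) = cmod (\<Sum>r\<in>F. \<eta> r * cnj (\<Sum>i\<in>R. m r i * w i))" by simp
  then have "?w\<^sup>2 = cmod (\<Sum>r\<in>F. \<eta> r * cnj (\<Sum>i\<in>R. m r i * w i))" by (simp only: norm_of_real) simp
  also have "\<dots> \<le> (\<Sum>r\<in>F. \<bar>cmod (\<eta> r)\<bar> * \<bar>cmod (\<Sum>i\<in>R. m r i * w i)\<bar>)"
    by (rule order_trans[OF norm_sum]) (simp add: norm_mult del: cnj_sum)
  also have "\<dots> \<le> ?\<eta> * L2_set (\<lambda>r. cmod (\<Sum>i\<in>R. m r i * w i)) F"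
    by (rule L2_set_mult_ineq)
  also have "\<dots> \<le> ?\<eta> * (K * ?w)"
    by (intro mult_left_mono matrix_boundD[OF m] *) simp
  finally have le: "?w * ?w \<le> (K * ?\<eta>) * ?w" by (simp add: power2_eq_square mult_ac)
  have "?w \<le> K * ?\<eta>"
  proof (cases "?w = 0")
    \<comment> \<open>K is not assumed nonnegative; that the right side is nonnegative is read off
      from the bound itself.\<close>
    case True
    have "0 \<le> L2_set (\<lambda>r. cmod (\<Sum>i\<in>F. m r i * \<eta> i)) F" by simp
    also have "\<dots> \<le> K * ?\<eta>" by (intro matrix_boundD[OF m] *)
    finally show ?thesis using True by simp
  next
    case False
    then have "0 < ?w" by (simp add: order_less_le)
    then show ?thesis using le by simp
  qed
  then show "L2_set (\<lambda>r. cmod (\<Sum>i\<in>F. cnj (m i r) * \<eta> i)) R \<le> K * ?\<eta>"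
    by (simp add: w_def)
qed

text \<open>The bound for n is applied to the moduli of the vector. It turns bounds for sums of
  moduli of partial permutations into bounds for \<open>fiber_matrix\<close> and for the matrix of
  its moduli.\<close>

lemma matrix_bound_dominated:
  assumes n: "matrix_bound I (\<lambda>r i. complex_of_real (n r i)) K"
    and le: "\<And>r i. r \<in> I \<Longrightarrow> i \<in> I \<Longrightarrow> cmod (m r i) \<le> n r i"
  shows "matrix_bound I m K"
proof (rule matrix_boundI)
  fix F R :: "'a set" and \<xi> :: "'a \<Rightarrow> complex"
  assume *: "finite F" "F \<subseteq> I" "finite R" "R \<subseteq> I"
  have "L2_set (\<lambda>r. cmod (\<Sum>i\<in>F. m r i * \<xi> i)) R
      \<le> L2_set (\<lambda>r. cmod (\<Sum>i\<in>F. of_real (n r i) * of_real (cmod (\<xi> i)))) R"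
  proof (rule L2_set_mono)
    fix r assume r: "r \<in> R"
    have nn: "0 \<le> n r i" if "i \<in> F" for i using le[of r i] norm_ge_zero[of "m r i"] r that * by (meson order_trans subsetD)
    have "cmod (\<Sum>i\<in>F. m r i * \<xi> i) \<le> (\<Sum>i\<in>F. cmod (m r i) * cmod (\<xi> i))"
      by (rule order_trans[OF norm_sum]) (simp add: norm_mult)
    also have "\<dots> \<le> (\<Sum>i\<in>F. n r i * cmod (\<xi> i))"
      using r * by (intro sum_mono mult_right_mono le) auto
    also have "\<dots> = cmod (of_real (\<Sum>i\<in>F. n r i * cmod (\<xi> i)))"
      by (simp only: norm_of_real) (simp add: sum_nonneg nn)
    finally show "cmod (\<Sum>i\<in>F. m r i * \<xi> i) \<le> cmod (\<Sum>i\<in>F. of_real (n r i) * of_real (cmod (\<xi> i)))"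
      by simp
  qed simp
  also have "\<dots> \<le> K * L2_set (\<lambda>i. cmod (of_real (cmod (\<xi> i)))) F"
    by (rule matrix_boundD[OF n *])
  finally show "L2_set (\<lambda>r. cmod (\<Sum>i\<in>F. m r i * \<xi> i)) R \<le> K * L2_set (\<lambda>i. cmod (\<xi> i)) F"
    by simp
qed

lemma sum_at_most_one:
  fixes f :: "'i \<Rightarrow> 'b::comm_monoid_add"
  assumes "finite A" "i \<in> A" "\<And>j. j \<in> A \<Longrightarrow> j \<noteq> i \<Longrightarrow> f j = 0"
  shows "sum f A = f i"
  using assms by (simp add: sum.remove[of A i])

text \<open>A matrix with at most one nonzero entry in each row and column sends basis vectors to
  multiples of distinct basis vectors, so a bound for its entries bounds its norm. One term
  \<delta>_s a, or a function on the sheet of one s, acts in this way.\<close>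

lemma matrix_bound_partial_permutation:
  assumes rows: "\<And>r i j. r \<in> I \<Longrightarrow> i \<in> I \<Longrightarrow> j \<in> I \<Longrightarrow> m r i \<noteq> 0 \<Longrightarrow> m r j \<noteq> 0 \<Longrightarrow> i = j"
    and cols: "\<And>r i j. r \<in> I \<Longrightarrow> i \<in> I \<Longrightarrow> j \<in> I \<Longrightarrow> m i r \<noteq> 0 \<Longrightarrow> m j r \<noteq> 0 \<Longrightarrow> i = j"
    and le: "\<And>r i. r \<in> I \<Longrightarrow> i \<in> I \<Longrightarrow> cmod (m r i) \<le> c" and c: "0 \<le> c"
  shows "matrix_bound I m c"
proof (rule matrix_boundI)
  fix F R :: "'a set" and \<xi> :: "'a \<Rightarrow> complex"
  assume *: "finite F" "F \<subseteq> I" "finite R" "R \<subseteq> I"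
  have 1: "(cmod (\<Sum>i\<in>F. m r i * \<xi> i))\<^sup>2 \<le> (\<Sum>i\<in>F. (cmod (m r i * \<xi> i))\<^sup>2)" if r: "r \<in> R" for r
  proof (cases "\<exists>i\<in>F. m r i \<noteq> 0")
    case True
    then obtain i where i: "i \<in> F" "m r i \<noteq> 0" by blast
    have z: "m r j = 0" if "j \<in> F" "j \<noteq> i" for j using rows[of r i j] that i r * by auto
    have "(\<Sum>i\<in>F. m r i * \<xi> i) = m r i * \<xi> i" "(\<Sum>i\<in>F. (cmod (m r i * \<xi> i))\<^sup>2) = (cmod (m r i * \<xi> i))\<^sup>2"
      by (rule sum_at_most_one; use * i z in simp)+
    then show ?thesis by simp
  qed (simp add: sum_nonneg)
  have 2: "(\<Sum>r\<in>R. (cmod (m r i * \<xi> i))\<^sup>2) \<le> c\<^sup>2 * (cmod (\<xi> i))\<^sup>2" if i: "i \<in> F" for i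
  proof (cases "\<exists>r\<in>R. m r i \<noteq> 0")
    case True
    then obtain r where r: "r \<in> R" "m r i \<noteq> 0" by blast
    have z: "m j i = 0" if "j \<in> R" "j \<noteq> r" for j using cols[of i r j] that r i * by auto
    have "(\<Sum>r\<in>R. (cmod (m r i * \<xi> i))\<^sup>2) = (cmod (m r i * \<xi> i))\<^sup>2"
      by (rule sum_at_most_one; use * r z in simp)
    also have "\<dots> \<le> c\<^sup>2 * (cmod (\<xi> i))\<^sup>2"
      using le[of r i] r i * by (auto simp: norm_mult power_mult_distrib intro!: mult_right_mono power_mono)
    finally show ?thesis .
  qed (simp add: sum_nonneg)
  have "(L2_set (\<lambda>r. cmod (\<Sum>i\<in>F. m r i * \<xi> i)) R)\<^sup>2 \<le> (\<Sum>r\<in>R. \<Sum>i\<in>F. (cmod (m r i * \<xi> i))\<^sup>2)"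
    using * 1 by (simp add: L2_set_square sum_mono)
  also have "\<dots> = (\<Sum>i\<in>F. \<Sum>r\<in>R. (cmod (m r i * \<xi> i))\<^sup>2)" by (rule sum.swap)
  also have "\<dots> \<le> (\<Sum>i\<in>F. c\<^sup>2 * (cmod (\<xi> i))\<^sup>2)" by (rule sum_mono) (rule 2)
  also have "\<dots> = (c * L2_set (\<lambda>i. cmod (\<xi> i)) F)\<^sup>2"
    using * by (simp add: L2_set_square power_mult_distrib sum_distrib_left)
  finally show "L2_set (\<lambda>r. cmod (\<Sum>i\<in>F. m r i * \<xi> i)) R \<le> c * L2_set (\<lambda>i. cmod (\<xi> i)) F"
    by (rule power2_le_imp_le) (simp add: c)
qed

text \<open>J, n and j may depend on F: over an arbitrary point of X^KS no single idempotent serves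
  all finite sections at once. The hypothesis is used for the union of F and R, which is why one
  finite set stands for rows and columns together.\<close>

lemma matrix_bound_locally:
  assumes "\<And>F. finite F \<Longrightarrow> F \<subseteq> I \<Longrightarrow> \<exists>J n j. matrix_bound J n K \<and> inj_on j F \<and> j ` F \<subseteq> J \<and>
     (\<forall>r\<in>F. \<forall>i\<in>F. m r i = n (j r) (j i))"
  shows "matrix_bound I m K"
proof (rule matrix_boundI)
  fix F R :: "'a set" and \<xi> :: "'a \<Rightarrow> complex"
  assume *: "finite F" "F \<subseteq> I" "finite R" "R \<subseteq> I"
  then obtain J n and j :: "'a \<Rightarrow> 'b" where n: "matrix_bound J n K" and j: "inj_on j (F \<union> R)" "j ` (F \<union> R) \<subseteq> J"
      and eq: "\<And>r i. r \<in> F \<union> R \<Longrightarrow> i \<in> F \<union> R \<Longrightarrow> m r i = n (j r) (j i)"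
    using assms[of "F \<union> R"] by auto
  define \<zeta> where "\<zeta> = (\<lambda>k. \<xi> (inv_into F j k))"
  have jF: "inj_on j F" "inj_on j R" using j(1) by (auto intro: inj_on_subset)
  have \<zeta>: "\<zeta> (j i) = \<xi> i" if "i \<in> F" for i using jF that by (simp add: \<zeta>_def)
  have "L2_set (\<lambda>r. cmod (\<Sum>i\<in>F. m r i * \<xi> i)) R = L2_set (\<lambda>r. cmod (\<Sum>i\<in>j ` F. n r i * \<zeta> i)) (j ` R)"
    using jF by (simp add: L2_set_def sum.reindex eq \<zeta>)
  also have "\<dots> \<le> K * L2_set (\<lambda>i. cmod (\<zeta> i)) (j ` F)"
    using * j by (intro matrix_boundD[OF n]) auto
  also have "L2_set (\<lambda>i. cmod (\<zeta> i)) (j ` F) = L2_set (\<lambda>i. cmod (\<xi> i)) F"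
    using jF by (simp add: L2_set_def sum.reindex \<zeta>)
  finally show "L2_set (\<lambda>r. cmod (\<Sum>i\<in>F. m r i * \<xi> i)) R \<le> K * L2_set (\<lambda>i. cmod (\<xi> i)) F" .
qed

lemma matrix_bound_reindex:
  fixes I :: "'a set" and J :: "'b set"
  assumes "matrix_bound J n K" "inj_on j I" "j ` I \<subseteq> J"
    and "\<And>r i. r \<in> I \<Longrightarrow> i \<in> I \<Longrightarrow> m r i = n (j r) (j i)"
  shows "matrix_bound I m K"
proof (rule matrix_bound_locally)
  fix F assume "finite F" "F \<subseteq> I"
  then show "\<exists>(J :: 'b set) n j. matrix_bound J n K \<and> inj_on j F \<and> j ` F \<subseteq> J \<and> (\<forall>r\<in>F. \<forall>i\<in>F. m r i = n (j r) (j i))"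
    using assms(1-3) by (intro exI[of _ J] exI[of _ n] exI[of _ j]) (auto intro: inj_on_subset assms(4))
qed

lemma matrix_bound_cong:
  assumes "\<And>r i. r \<in> I \<Longrightarrow> i \<in> I \<Longrightarrow> m r i = n r i"
  shows "matrix_bound I m K \<longleftrightarrow> matrix_bound I n K"
  using matrix_bound_reindex[of I n K id I m] matrix_bound_reindex[of I m K id I n] assms by auto

section \<open>Matrices as operators on square-summable families\<close>

lemma L2_set_le_iff: "finite F \<Longrightarrow> 0 \<le> c \<Longrightarrow> L2_set (\<lambda>i. cmod (\<xi> i)) F \<le> c \<longleftrightarrow> (\<Sum>i\<in>F. (cmod (\<xi> i))\<^sup>2) \<le> c\<^sup>2"
  by (simp add: L2_set_def real_sqrt_le_iff' sum_nonneg real_le_lsqrt sqrt_le_D)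

text \<open>Summability and norm together are expressed by finite sums. Read at a point of the base,
  the same statement serves the Hilbert modules.\<close>

lemma square_summable_iff:
  assumes "0 \<le> c"
  shows "(\<lambda>i. (cmod (\<xi> i))\<^sup>2) summable_on I \<and> sqrt (\<Sum>\<^sub>\<infinity>i\<in>I. (cmod (\<xi> i))\<^sup>2) \<le> c \<longleftrightarrow>
    (\<forall>F. finite F \<and> F \<subseteq> I \<longrightarrow> L2_set (\<lambda>i. cmod (\<xi> i)) F \<le> c)"
proof (intro iffI conjI allI impI)
  fix F assume h: "(\<lambda>i. (cmod (\<xi> i))\<^sup>2) summable_on I \<and> sqrt (\<Sum>\<^sub>\<infinity>i\<in>I. (cmod (\<xi> i))\<^sup>2) \<le> c" and F: "finite F \<and> F \<subseteq> I"
  then have "(\<Sum>i\<in>F. (cmod (\<xi> i))\<^sup>2) \<le> (\<Sum>\<^sub>\<infinity>i\<in>I. (cmod (\<xi> i))\<^sup>2)"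
    by (intro finite_sum_le_infsum) auto
  also have "\<dots> \<le> c\<^sup>2" using h by (simp add: sqrt_le_D)
  finally show "L2_set (\<lambda>i. cmod (\<xi> i)) F \<le> c" using assms F by (simp add: L2_set_le_iff)
next
  assume h: "\<forall>F. finite F \<and> F \<subseteq> I \<longrightarrow> L2_set (\<lambda>i. cmod (\<xi> i)) F \<le> c"
  then have h: "(\<Sum>i\<in>F. (cmod (\<xi> i))\<^sup>2) \<le> c\<^sup>2" if "finite F" "F \<subseteq> I" for F
    using that assms by (simp add: L2_set_le_iff)
  then show s: "(\<lambda>i. (cmod (\<xi> i))\<^sup>2) summable_on I"
    by (intro nonneg_bdd_above_summable_on bdd_aboveI[of _ "c\<^sup>2"]) auto
  have "(\<Sum>\<^sub>\<infinity>i\<in>I. (cmod (\<xi> i))\<^sup>2) \<le> c\<^sup>2"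
    by (rule infsum_le_finite_sums[OF s]) (rule h)
  then show "sqrt (\<Sum>\<^sub>\<infinity>i\<in>I. (cmod (\<xi> i))\<^sup>2) \<le> c"
    using assms by (simp add: real_le_lsqrt)
qed

lemma l2_iff:
  "0 \<le> c \<Longrightarrow> \<xi> \<in> l2 I \<and> l2_norm I \<xi> \<le> c \<longleftrightarrow>
     (\<forall>i. i \<notin> I \<longrightarrow> \<xi> i = 0) \<and> (\<forall>F. finite F \<and> F \<subseteq> I \<longrightarrow> L2_set (\<lambda>i. cmod (\<xi> i)) F \<le> c)"
  unfolding l2_def l2_norm_def square_summable_iff[symmetric] by auto

lemma l2_norm_nonneg [simp]: "0 \<le> l2_norm I \<xi>"
  by (simp add: l2_norm_def infsum_nonneg)

lemma L2_set_le_l2_norm: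
  "\<xi> \<in> l2 I \<Longrightarrow> finite F \<Longrightarrow> F \<subseteq> I \<Longrightarrow> L2_set (\<lambda>i. cmod (\<xi> i)) F \<le> l2_norm I \<xi>"
  using l2_iff[of "l2_norm I \<xi>" \<xi> I] by simp

lemma l2_finite_support:
  assumes "finite F" "F \<subseteq> I" "\<And>i. i \<notin> F \<Longrightarrow> \<xi> i = 0"
  shows "\<xi> \<in> l2 I" "l2_norm I \<xi> = L2_set (\<lambda>i. cmod (\<xi> i)) F"
proof -
  have le: "L2_set (\<lambda>i. cmod (\<xi> i)) F' \<le> L2_set (\<lambda>i. cmod (\<xi> i)) F" if "finite F'" for F'
  proof -
    have "(\<Sum>i\<in>F'. (cmod (\<xi> i))\<^sup>2) = (\<Sum>i\<in>F' \<inter> F. (cmod (\<xi> i))\<^sup>2)"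
      by (rule sum.mono_neutral_right) (use that assms in auto)
    also have "\<dots> \<le> (\<Sum>i\<in>F. (cmod (\<xi> i))\<^sup>2)"
      by (rule sum_mono2) (use assms in auto)
    finally show ?thesis by (simp add: L2_set_def)
  qed
  have "\<xi> \<in> l2 I \<and> l2_norm I \<xi> \<le> L2_set (\<lambda>i. cmod (\<xi> i)) F"
    by (subst l2_iff) (use le assms in auto)
  moreover from this have "L2_set (\<lambda>i. cmod (\<xi> i)) F \<le> l2_norm I \<xi>"
    using assms by (intro L2_set_le_l2_norm) auto
  ultimately show "\<xi> \<in> l2 I" "l2_norm I \<xi> = L2_set (\<lambda>i. cmod (\<xi> i)) F" by auto
qed

lemma l2_add: 
  assumes "\<xi> \<in> l2 I" "\<eta> \<in> l2 I" shows "\<xi> + \<eta> \<in> l2 I"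
proof -
  have "\<xi> + \<eta> \<in> l2 I \<and> l2_norm I (\<xi> + \<eta>) \<le> l2_norm I \<xi> + l2_norm I \<eta>"
  proof (subst l2_iff; (intro conjI allI impI)?)
    fix F assume F: "finite F \<and> F \<subseteq> I"
    have "L2_set (\<lambda>i. cmod ((\<xi> + \<eta>) i)) F \<le> L2_set (\<lambda>i. cmod (\<xi> i) + cmod (\<eta> i)) F"
      by (rule L2_set_mono) (simp_all add: norm_triangle_ineq)
    also have "\<dots> \<le> L2_set (\<lambda>i. cmod (\<xi> i)) F + L2_set (\<lambda>i. cmod (\<eta> i)) F"
      by (rule L2_set_triangle_ineq)
    also have "\<dots> \<le> l2_norm I \<xi> + l2_norm I \<eta>"
      using F assms by (intro add_mono L2_set_le_l2_norm) auto
    finally show "L2_set (\<lambda>i. cmod ((\<xi> + \<eta>) i)) F \<le> l2_norm I \<xi> + l2_norm I \<eta>" .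
  qed (use assms in \<open>auto simp: l2_def\<close>)
  then show ?thesis ..
qed

lemma l2_scale: 
  assumes "\<xi> \<in> l2 I" shows "(\<lambda>i. c * \<xi> i) \<in> l2 I"
  using assms summable_on_cmult_right[of "\<lambda>i. (cmod (\<xi> i))\<^sup>2" I "(cmod c)\<^sup>2"]
  by (simp add: l2_def norm_mult power_mult_distrib)

text \<open>In \<open>bounded_matrix\<close> the support of each row is finite, so the operator is
  given by finite sums on all of l^2 and needs no extension by continuity.\<close>

definition matrix_operator :: "'i set \<Rightarrow> ('i \<Rightarrow> 'i \<Rightarrow> complex) \<Rightarrow> ('i \<Rightarrow> complex) \<Rightarrow> 'i \<Rightarrow> complex" where
  "matrix_operator I m = (\<lambda>\<xi>\<in>l2 I. \<lambda>r. if r \<in> I then \<Sum>i\<in>{i \<in> I. m r i \<noteq> 0}. m r i * \<xi> i else 0)"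

text \<open>K is a witness of boundedness, not the norm; the norm is characterized in
  \<open>op_norm_le_iff\<close>, with an arbitrary C.\<close>

locale bounded_matrix =
  fixes I :: "'i set" and m :: "'i \<Rightarrow> 'i \<Rightarrow> complex" and K :: real
  assumes rows: "\<And>r. r \<in> I \<Longrightarrow> finite {i \<in> I. m r i \<noteq> 0}"
    and bound: "matrix_bound I m K" and bound_nonneg: "0 \<le> K"
begin

lemma matrix_operator_apply:
  "\<xi> \<in> l2 I \<Longrightarrow> r \<in> I \<Longrightarrow> finite F \<Longrightarrow> {i \<in> I. m r i \<noteq> 0} \<subseteq> F \<Longrightarrow> F \<subseteq> I \<Longrightarrow>
     matrix_operator I m \<xi> r = (\<Sum>i\<in>F. m r i * \<xi> i)"
  by (auto simp: matrix_operator_def intro!: sum.mono_neutral_left)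

lemma matrix_operator_bound:
  assumes "matrix_bound I m C" "0 \<le> C" and \<xi>: "\<xi> \<in> l2 I"
  shows "matrix_operator I m \<xi> \<in> l2 I \<and> l2_norm I (matrix_operator I m \<xi>) \<le> C * l2_norm I \<xi>"
proof (subst l2_iff; (intro conjI allI impI)?)
  fix R assume R: "finite R \<and> R \<subseteq> I"
  define F where "F = (\<Union>r\<in>R. {i \<in> I. m r i \<noteq> 0})"
  have F: "finite F" "F \<subseteq> I" using R rows by (auto simp: F_def)
  have "L2_set (\<lambda>r. cmod (matrix_operator I m \<xi> r)) R = L2_set (\<lambda>r. cmod (\<Sum>i\<in>F. m r i * \<xi> i)) R"
    using R F by (intro L2_set_cong refl arg_cong[of _ _ cmod] matrix_operator_apply \<xi>) (auto simp: F_def)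
  also have "\<dots> \<le> C * L2_set (\<lambda>i. cmod (\<xi> i)) F"
    using R F by (intro matrix_boundD[OF assms(1)]) auto
  also have "\<dots> \<le> C * l2_norm I \<xi>"
    by (intro mult_left_mono L2_set_le_l2_norm \<xi> F assms)
  finally show "L2_set (\<lambda>r. cmod (matrix_operator I m \<xi> r)) R \<le> C * l2_norm I \<xi>" .
qed (use assms in \<open>auto simp: matrix_operator_def\<close>)

lemma matrix_operator_bounded: "matrix_operator I m \<in> bounded_operators I"
  unfolding bounded_operators_def
proof (intro CollectI conjI ballI allI exI[of _ K])
  show "matrix_operator I m \<in> l2 I \<rightarrow>\<^sub>E l2 I"
    using matrix_operator_bound[OF bound bound_nonneg] by (auto simp: PiE_iff matrix_operator_def)
  show "matrix_operator I m (\<xi> + \<eta>) = matrix_operator I m \<xi> + matrix_operator I m \<eta>"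
    if "\<xi> \<in> l2 I" "\<eta> \<in> l2 I" for \<xi> \<eta>
    using that l2_add[OF that] by (auto simp: matrix_operator_def distrib_left sum.distrib fun_eq_iff)
  show "matrix_operator I m (\<lambda>i. c * \<xi> i) = (\<lambda>i. c * matrix_operator I m \<xi> i)" if "\<xi> \<in> l2 I" for c \<xi>
    using that l2_scale[OF that] by (auto simp: matrix_operator_def sum_distrib_left fun_eq_iff mult_ac)
qed (use matrix_operator_bound[OF bound bound_nonneg] in auto)

lemma matrix_operator_delta:
  assumes "i \<in> I"
  shows "matrix_operator I m (delta i 1) = (\<lambda>r. if r \<in> I then m r i else 0)"
proof
  fix r
  have l: "delta i (1::complex) \<in> l2 I"
    by (rule l2_finite_support(1)[of "{i}"]) (use assms in \<open>auto simp: delta_def\<close>)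
  show "matrix_operator I m (delta i 1) r = (if r \<in> I then m r i else 0)"
  proof (cases "r \<in> I")
    case True
    then have "matrix_operator I m (delta i 1) r = (\<Sum>j\<in>insert i {i \<in> I. m r i \<noteq> 0}. m r j * delta i 1 j)"
      using assms rows by (intro matrix_operator_apply l) auto
    also have "\<dots> = m r i * delta i 1 i"
      by (rule sum_at_most_one) (use rows True in \<open>auto simp: delta_def\<close>)
    finally show ?thesis using True by (simp add: delta_def)
  qed (simp add: matrix_operator_def l)
qed

text \<open>For the converse the operator is tested on the finitely supported vector proportional to
  the given one and of norm one. The witness K makes the set under the supremum bounded above, so
  that test vectors bound \<open>op_norm\<close> from below.\<close>

lemma op_norm_le_iff:
  assumes "0 \<le> C"
  shows "op_norm I (matrix_operator I m) \<le> C \<longleftrightarrow> matrix_bound I m C"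
proof
  assume C: "matrix_bound I m C"
  have "0 \<in> {\<xi> \<in> l2 I. l2_norm I \<xi> \<le> 1}" using l2_iff[of 1 0 I] by (simp add: L2_set_def)
  then show "op_norm I (matrix_operator I m) \<le> C"
    unfolding op_norm_def
  proof (intro cSUP_least)
    fix \<xi> assume "\<xi> \<in> {\<xi> \<in> l2 I. l2_norm I \<xi> \<le> 1}"
    then have "l2_norm I (matrix_operator I m \<xi>) \<le> C * l2_norm I \<xi>" "l2_norm I \<xi> \<le> 1"
      using matrix_operator_bound[OF C assms] by auto
    then show "l2_norm I (matrix_operator I m \<xi>) \<le> C"
      using mult_left_mono[of "l2_norm I \<xi>" 1 C] assms by simp
  qed auto
next
  assume C: "op_norm I (matrix_operator I m) \<le> C"
  have bdd: "bdd_above ((\<lambda>\<xi>. l2_norm I (matrix_operator I m \<xi>)) ` {\<xi> \<in> l2 I. l2_norm I \<xi> \<le> 1})"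
  proof (rule bdd_aboveI2)
    fix \<xi> assume "\<xi> \<in> {\<xi> \<in> l2 I. l2_norm I \<xi> \<le> 1}"
    then have "l2_norm I (matrix_operator I m \<xi>) \<le> K * l2_norm I \<xi>" "l2_norm I \<xi> \<le> 1"
      using matrix_operator_bound[OF bound bound_nonneg] by auto
    then show "l2_norm I (matrix_operator I m \<xi>) \<le> K"
      using mult_left_mono[of "l2_norm I \<xi>" 1 K] bound_nonneg by simp
  qed
  show "matrix_bound I m C"
  proof (rule matrix_boundI)
    fix F R :: "'i set" and \<xi> :: "'i \<Rightarrow> complex"
    assume *: "finite F" "F \<subseteq> I" "finite R" "R \<subseteq> I"
    let ?c = "L2_set (\<lambda>i. cmod (\<xi> i)) F"
    show "L2_set (\<lambda>r. cmod (\<Sum>i\<in>F. m r i * \<xi> i)) R \<le> C * ?c"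
    proof (cases "?c = 0")
      case True
      then have "\<xi> i = 0" if "i \<in> F" for i using * that by (simp add: L2_set_eq_0_iff)
      then show ?thesis by (simp add: True L2_set_def)
    next
      case False
      then have c: "0 < ?c" by (simp add: order_less_le)
      define a where "a = 1 / ?c"
      have a: "0 < a" "a * ?c = 1" using c by (simp_all add: a_def)
      define \<zeta> where "\<zeta> = (\<lambda>i. if i \<in> F then of_real a * \<xi> i else 0)"
      have \<zeta>: "\<zeta> \<in> l2 I" "l2_norm I \<zeta> = L2_set (\<lambda>i. cmod (\<zeta> i)) F"
        using * by (auto intro!: l2_finite_support simp: \<zeta>_def)
      have "L2_set (\<lambda>i. cmod (\<zeta> i)) F = L2_set (\<lambda>i. a * cmod (\<xi> i)) F"
        using a by (intro L2_set_cong) (auto simp: \<zeta>_def norm_mult)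
      also have "\<dots> = 1" using a by (simp flip: L2_set_right_distrib)
      finally have n1: "l2_norm I \<zeta> \<le> 1" using \<zeta> by simp
      have eq: "matrix_operator I m \<zeta> r = of_real a * (\<Sum>i\<in>F. m r i * \<xi> i)" if "r \<in> R" for r
      proof -
        have "matrix_operator I m \<zeta> r = (\<Sum>i\<in>F \<union> {i \<in> I. m r i \<noteq> 0}. m r i * \<zeta> i)"
          using that * rows by (intro matrix_operator_apply \<zeta>) auto
        also have "\<dots> = (\<Sum>i\<in>F. m r i * \<zeta> i)"
          using that * rows by (intro sum.mono_neutral_right) (auto simp: \<zeta>_def)
        also have "\<dots> = of_real a * (\<Sum>i\<in>F. m r i * \<xi> i)"
          by (simp add: \<zeta>_def sum_distrib_left mult_ac)
        finally show ?thesis .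
      qed
      have "a * L2_set (\<lambda>r. cmod (\<Sum>i\<in>F. m r i * \<xi> i)) R = L2_set (\<lambda>r. a * cmod (\<Sum>i\<in>F. m r i * \<xi> i)) R"
        using a by (simp add: L2_set_right_distrib)
      also have "\<dots> = L2_set (\<lambda>r. cmod (matrix_operator I m \<zeta> r)) R"
        using a by (intro L2_set_cong) (auto simp: eq norm_mult)
      also have "\<dots> \<le> l2_norm I (matrix_operator I m \<zeta>)"
        using * matrix_operator_bound[OF bound bound_nonneg \<zeta>(1)] by (intro L2_set_le_l2_norm) auto
      also have "\<dots> \<le> op_norm I (matrix_operator I m)"
        unfolding op_norm_def by (rule cSUP_upper) (use \<zeta> n1 bdd in auto)
      finally have "a * L2_set (\<lambda>r. cmod (\<Sum>i\<in>F. m r i * \<xi> i)) R \<le> C" using C by simp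
      then show ?thesis using c by (simp add: a_def field_simps)
    qed
  qed
qed

end

text \<open>Finitely supported vectors are dense and the operators are bounded. This is the
  uniqueness behind the definite description in \<open>regular_rep\<close>.\<close>

lemma bounded_operators_determined:
  assumes L: "L \<in> bounded_operators I" and L': "L' \<in> bounded_operators I"
    and eq: "\<And>i. i \<in> I \<Longrightarrow> L (delta i 1) = L' (delta i 1)"
  shows "L = L'"
proof
  fix \<xi>
  note lin = L[unfolded bounded_operators_def] L'[unfolded bounded_operators_def]
  show "L \<xi> = L' \<xi>"
  proof (cases "\<xi> \<in> l2 I")
    case False
    then show ?thesis using lin by (auto simp: PiE_iff extensional_def)
  next
    case \<xi>: True
    define t where "t = (\<lambda>F i. if i \<in> F then \<xi> i else 0)"
    have t: "t F \<in> l2 I" if "finite F" "F \<subseteq> I" for F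
      using that by (intro l2_finite_support(1)[of F]) (auto simp: t_def)
    have fin: "L (t F) = L' (t F)" if "finite F" "F \<subseteq> I" for F
      using that
    proof (induction F rule: finite_induct)
      case empty
      \<comment> \<open>The value at the zero vector comes from homogeneity with scalar 0.\<close>
      have "t {} = (\<lambda>i. 0 * t {} i)" by (simp add: t_def)
      moreover have "L (\<lambda>i. 0 * t {} i) = (\<lambda>i. 0 * L (t {}) i)" "L' (\<lambda>i. 0 * t {} i) = (\<lambda>i. 0 * L' (t {}) i)"
        using lin t[of "{}"] by blast+
      ultimately show ?case by simp
    next
      case (insert i F)
      have d: "delta i 1 \<in> l2 I" by (rule l2_finite_support(1)[of "{i}"]) (use insert in \<open>auto simp: delta_def\<close>)
      have "t (insert i F) = t F + (\<lambda>j. \<xi> i * delta i 1 j)"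
        using insert by (auto simp: t_def delta_def fun_eq_iff)
      moreover have "M (t F + (\<lambda>j. \<xi> i * delta i 1 j)) = M (t F) + (\<lambda>j. \<xi> i * M (delta i 1) j)"
        if "M \<in> {L, L'}" for M
      proof -
        have "M (t F + (\<lambda>j. \<xi> i * delta i 1 j)) = M (t F) + M (\<lambda>j. \<xi> i * delta i 1 j)"
          using that lin l2_scale[OF d, of "\<xi> i"] t[of F] insert by blast
        also have "M (\<lambda>j. \<xi> i * delta i 1 j) = (\<lambda>j. \<xi> i * M (delta i 1) j)"
          using that lin d by blast
        finally show ?thesis .
      qed
      ultimately show ?case using insert eq[of i] by (metis insertCI insert_subset)
    qed
    obtain K where K: "\<And>\<xi>. \<xi> \<in> l2 I \<Longrightarrow> l2_norm I (L \<xi>) \<le> K * l2_norm I \<xi>"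
      using lin(1) by blast
    obtain K' where K': "\<And>\<xi>. \<xi> \<in> l2 I \<Longrightarrow> l2_norm I (L' \<xi>) \<le> K' * l2_norm I \<xi>"
      using lin(2) by blast
    have ent: "cmod (\<eta> r) \<le> l2_norm I \<eta>" if "\<eta> \<in> l2 I" for \<eta> r
    proof (cases "r \<in> I")
      case True then show ?thesis using L2_set_le_l2_norm[OF that, of "{r}"] by simp
    qed (use that in \<open>simp add: l2_def\<close>)
    have "cmod (L \<xi> r - L' \<xi> r) \<le> 0" for r
    proof (rule field_le_epsilon)
      fix e :: real assume e: "0 < e"
      \<comment> \<open>Absolute values because K and K' may be negative, and 1 to keep the
        denominator positive; a tail of norm at most d then contributes at most e to the two images
        together.\<close>
      define d where "d = e / (1 + \<bar>K\<bar> + \<bar>K'\<bar>)"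
      have d: "0 < d" using e by (simp add: d_def add_pos_nonneg)
      have sm: "(\<lambda>i. (cmod (\<xi> i))\<^sup>2) summable_on I" using \<xi> by (simp add: l2_def)
      obtain F where F: "finite F" "F \<subseteq> I"
        and Fd: "dist (\<Sum>i\<in>F. (cmod (\<xi> i))\<^sup>2) (\<Sum>\<^sub>\<infinity>i\<in>I. (cmod (\<xi> i))\<^sup>2) \<le> d\<^sup>2"
        using infsum_finite_approximation[OF sm, of "d\<^sup>2"] d by auto
      define u where "u = (\<lambda>i. \<xi> i - t F i)"
      have u: "u \<in> l2 I \<and> l2_norm I u \<le> d"
      proof (subst l2_iff; (intro conjI allI impI)?)
        fix F' assume F': "finite F' \<and> F' \<subseteq> I"
        have "(\<Sum>i\<in>F'. (cmod (u i))\<^sup>2) = (\<Sum>i\<in>F' - F. (cmod (\<xi> i))\<^sup>2)"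
          using F' by (intro sum.mono_neutral_cong_right) (auto simp: u_def t_def)
        also have "\<dots> = (\<Sum>i\<in>F \<union> F'. (cmod (\<xi> i))\<^sup>2) - (\<Sum>i\<in>F. (cmod (\<xi> i))\<^sup>2)"
          using F F' sum.union_disjoint[of F "F' - F" "\<lambda>i. (cmod (\<xi> i))\<^sup>2"] by auto
        also have "\<dots> \<le> (\<Sum>\<^sub>\<infinity>i\<in>I. (cmod (\<xi> i))\<^sup>2) - (\<Sum>i\<in>F. (cmod (\<xi> i))\<^sup>2)"
          using F F' by (intro diff_right_mono finite_sum_le_infsum sm) auto
        also have "\<dots> \<le> d\<^sup>2" using Fd by (simp add: dist_real_def)
        finally show "L2_set (\<lambda>i. cmod (u i)) F' \<le> d"
          using F' d by (simp add: L2_set_le_iff)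
      qed (use d \<xi> F in \<open>auto simp: u_def t_def l2_def\<close>)
      have "\<xi> = t F + u" by (simp add: u_def fun_eq_iff)
      moreover have "L (t F + u) = L (t F) + L u" "L' (t F + u) = L' (t F) + L' u"
        using lin t[OF F] u by blast+
      ultimately have "L \<xi> = L (t F) + L u" "L' \<xi> = L' (t F) + L' u" by simp_all
      then have "cmod (L \<xi> r - L' \<xi> r) = cmod (L u r - L' u r)" using fin[OF F] by simp
      also have "\<dots> \<le> cmod (L u r) + cmod (L' u r)" by (rule norm_triangle_ineq4)
      also have "\<dots> \<le> l2_norm I (L u) + l2_norm I (L' u)"
        using u lin by (intro add_mono ent) (auto simp: PiE_iff)
      also have "\<dots> \<le> K * l2_norm I u + K' * l2_norm I u" using K[of u] K'[of u] u by simp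
      also have "\<dots> \<le> (1 + \<bar>K\<bar> + \<bar>K'\<bar>) * d"
      proof -
        have "K * l2_norm I u + K' * l2_norm I u \<le> \<bar>K\<bar> * d + \<bar>K'\<bar> * d"
          using u by (intro add_mono mult_mono) auto
        then show ?thesis using d by (simp add: distrib_right)
      qed
      also have "\<dots> = e" by (simp add: d_def add_nonneg_eq_0_iff)
      finally show "cmod (L \<xi> r - L' \<xi> r) \<le> 0 + e" by simp
    qed
    then show ?thesis by (auto simp: fun_eq_iff)
  qed
qed

section \<open>Regular representations of a groupoid\<close>

text \<open>Units are not arrows in this encoding, so the unit laws take the form of the
  cancellation (\<gamma>\<beta>)\<beta>^{-1} = \<gamma>. The regular representations are algebra on
  the fibres, so the axioms mention only the sets of arrows and units.\<close>

locale algebraic_groupoid =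
  fixes G :: "('g, 'u) topological_groupoid"
  assumes cmp_closed: "\<lbrakk>\<gamma> \<in> topspace (arrows G); \<beta> \<in> topspace (arrows G); dm G \<gamma> = rg G \<beta>\<rbrakk> \<Longrightarrow>
      cmp G \<gamma> \<beta> \<in> topspace (arrows G) \<and> dm G (cmp G \<gamma> \<beta>) = dm G \<beta> \<and> rg G (cmp G \<gamma> \<beta>) = rg G \<gamma>"
    and inv_closed: "\<gamma> \<in> topspace (arrows G) \<Longrightarrow>
      gpinv G \<gamma> \<in> topspace (arrows G) \<and> dm G (gpinv G \<gamma>) = rg G \<gamma> \<and> rg G (gpinv G \<gamma>) = dm G \<gamma>"
    and unit_closed: "\<gamma> \<in> topspace (arrows G) \<Longrightarrow> rg G \<gamma> \<in> topspace (units G)"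
    and cmp_assoc: "\<lbrakk>\<alpha> \<in> topspace (arrows G); \<beta> \<in> topspace (arrows G); \<gamma> \<in> topspace (arrows G);
      dm G \<alpha> = rg G \<beta>; dm G \<beta> = rg G \<gamma>\<rbrakk> \<Longrightarrow> cmp G (cmp G \<alpha> \<beta>) \<gamma> = cmp G \<alpha> (cmp G \<beta> \<gamma>)"
    and inv_inv: "\<gamma> \<in> topspace (arrows G) \<Longrightarrow> gpinv G (gpinv G \<gamma>) = \<gamma>"
    and cmp_inv_cancel: "\<lbrakk>\<gamma> \<in> topspace (arrows G); \<beta> \<in> topspace (arrows G); dm G \<gamma> = rg G \<beta>\<rbrakk> \<Longrightarrow>
      cmp G (cmp G \<gamma> \<beta>) (gpinv G \<beta>) = \<gamma>"
    and inv_cmp: "\<lbrakk>\<gamma> \<in> topspace (arrows G); \<beta> \<in> topspace (arrows G); dm G \<gamma> = rg G \<beta>\<rbrakk> \<Longrightarrow>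
      gpinv G (cmp G \<gamma> \<beta>) = cmp G (gpinv G \<beta>) (gpinv G \<gamma>)"
begin

text \<open>The entry at (\<eta>, \<beta>) of the matrix of \<lambda>_z(f): the coefficient of
  \<delta>_\<eta> in \<lambda>_z(f) applied to \<delta>_\<beta>.\<close>

definition kernel :: "('g \<Rightarrow> complex) \<Rightarrow> 'g \<Rightarrow> 'g \<Rightarrow> complex" where
  "kernel f \<eta> \<beta> = f (cmp G \<eta> (gpinv G \<beta>))"

text \<open>The common host of \<C>(G) and of the image of the crossed product. Finite support along
  the fibres of d and of r makes convolutions finite sums and matrices finite in rows and columns; a
  bound uniform in z makes the reduced norm finite.\<close>

definition bounded_kernels :: "('g \<Rightarrow> complex) set" where
  "bounded_kernels = {f. (\<forall>\<gamma>. \<gamma> \<notin> topspace (arrows G) \<longrightarrow> f \<gamma> = 0) \<and>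
     (\<forall>z. finite {\<gamma> \<in> fiber G z. f \<gamma> \<noteq> 0}) \<and>
     (\<forall>z. finite {\<gamma> \<in> topspace (arrows G). rg G \<gamma> = z \<and> f \<gamma> \<noteq> 0}) \<and>
     (\<exists>K\<ge>0. \<forall>z\<in>topspace (units G). matrix_bound (fiber G z) (kernel f) K)}"

lemma div_closed:
  assumes "\<eta> \<in> fiber G z" "\<beta> \<in> fiber G z"
  shows "cmp G \<eta> (gpinv G \<beta>) \<in> fiber G (rg G \<beta>)" "rg G (cmp G \<eta> (gpinv G \<beta>)) = rg G \<eta>"
    "cmp G (cmp G \<eta> (gpinv G \<beta>)) \<beta> = \<eta>" "gpinv G (cmp G \<eta> (gpinv G \<beta>)) = cmp G \<beta> (gpinv G \<eta>)"
    "cmp G \<eta> (gpinv G \<beta>) \<in> topspace (arrows G)"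
  using assms cmp_closed[of \<eta> "gpinv G \<beta>"] inv_closed[of \<beta>] cmp_inv_cancel[of \<eta> "gpinv G \<beta>"]
    inv_inv[of \<beta>] inv_cmp[of \<eta> "gpinv G \<beta>"] inv_closed[of \<eta>]
  by (auto simp: fiber_def)

lemma mult_closed:
  assumes "\<gamma> \<in> fiber G (rg G \<beta>)" "\<beta> \<in> fiber G z"
  shows "cmp G \<gamma> \<beta> \<in> fiber G z" "cmp G (cmp G \<gamma> \<beta>) (gpinv G \<beta>) = \<gamma>" "rg G (cmp G \<gamma> \<beta>) = rg G \<gamma>"
  using assms cmp_closed[of \<gamma> \<beta>] cmp_inv_cancel[of \<gamma> \<beta>] by (auto simp: fiber_def)

lemma div_div:
  assumes "\<eta> \<in> fiber G z" "\<beta> \<in> fiber G z" "\<zeta> \<in> fiber G z"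
  shows "cmp G (cmp G \<eta> (gpinv G \<beta>)) (gpinv G (cmp G \<zeta> (gpinv G \<beta>))) = cmp G \<eta> (gpinv G \<zeta>)"
proof -
  have "cmp G (cmp G \<eta> (gpinv G \<beta>)) (gpinv G (cmp G \<zeta> (gpinv G \<beta>)))
      = cmp G (cmp G \<eta> (gpinv G \<beta>)) (cmp G \<beta> (gpinv G \<zeta>))"
    using div_closed[OF assms(3,2)] by simp
  also have "\<dots> = cmp G (cmp G (cmp G \<eta> (gpinv G \<beta>)) \<beta>) (gpinv G \<zeta>)"
    using assms div_closed[OF assms(1,2)] inv_closed[of \<zeta>]
    by (intro cmp_assoc[symmetric]) (auto simp: fiber_def)
  finally show ?thesis using div_closed[OF assms(1,2)] by simp
qed

lemma bij_div: "\<beta> \<in> fiber G z \<Longrightarrow> bij_betw (\<lambda>\<zeta>. cmp G \<zeta> (gpinv G \<beta>)) (fiber G z) (fiber G (rg G \<beta>))"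
  by (rule bij_betw_byWitness[of _ "\<lambda>\<gamma>. cmp G \<gamma> \<beta>"]) (auto simp: div_closed mult_closed)

lemma finite_kernel_column:
  assumes f: "f \<in> bounded_kernels" and \<beta>: "\<beta> \<in> fiber G z"
  shows "finite {\<eta> \<in> fiber G z. kernel f \<eta> \<beta> \<noteq> 0}"
proof (rule finite_subset)
  show "finite ((\<lambda>\<gamma>. cmp G \<gamma> \<beta>) ` {\<gamma> \<in> fiber G (rg G \<beta>). f \<gamma> \<noteq> 0})"
    using f by (auto simp: bounded_kernels_def)
  show "{\<eta> \<in> fiber G z. kernel f \<eta> \<beta> \<noteq> 0} \<subseteq> (\<lambda>\<gamma>. cmp G \<gamma> \<beta>) ` {\<gamma> \<in> fiber G (rg G \<beta>). f \<gamma> \<noteq> 0}"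
  proof
    fix \<eta> assume "\<eta> \<in> {\<eta> \<in> fiber G z. kernel f \<eta> \<beta> \<noteq> 0}"
    then show "\<eta> \<in> (\<lambda>\<gamma>. cmp G \<gamma> \<beta>) ` {\<gamma> \<in> fiber G (rg G \<beta>). f \<gamma> \<noteq> 0}"
      using div_closed[OF _ \<beta>, of \<eta>]
      by (intro image_eqI[of _ _ "cmp G \<eta> (gpinv G \<beta>)"]) (auto simp: kernel_def)
  qed
qed

text \<open>A nonzero entry in the row of \<eta> comes from an arrow \<gamma> = \<eta>\<beta>^{-1}
  in the support of f with the range of \<eta>, and \<beta> = \<gamma>^{-1}\<eta>. Hence the
  condition on range fibres in \<open>bounded_kernels\<close>.\<close>

lemma finite_kernel_row:
  assumes f: "f \<in> bounded_kernels" and \<eta>: "\<eta> \<in> fiber G z"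
  shows "finite {\<beta> \<in> fiber G z. kernel f \<eta> \<beta> \<noteq> 0}"
proof (rule finite_subset)
  show "finite ((\<lambda>\<gamma>. cmp G (gpinv G \<gamma>) \<eta>) ` {\<gamma> \<in> topspace (arrows G). rg G \<gamma> = rg G \<eta> \<and> f \<gamma> \<noteq> 0})"
    using f by (auto simp: bounded_kernels_def)
  show "{\<beta> \<in> fiber G z. kernel f \<eta> \<beta> \<noteq> 0} \<subseteq>
      (\<lambda>\<gamma>. cmp G (gpinv G \<gamma>) \<eta>) ` {\<gamma> \<in> topspace (arrows G). rg G \<gamma> = rg G \<eta> \<and> f \<gamma> \<noteq> 0}"
  proof
    fix \<beta> assume "\<beta> \<in> {\<beta> \<in> fiber G z. kernel f \<eta> \<beta> \<noteq> 0}"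
    then show "\<beta> \<in> (\<lambda>\<gamma>. cmp G (gpinv G \<gamma>) \<eta>) ` {\<gamma> \<in> topspace (arrows G). rg G \<gamma> = rg G \<eta> \<and> f \<gamma> \<noteq> 0}"
      using div_closed[OF \<eta>, of \<beta>] div_closed(3)[OF _ \<eta>, of \<beta>]
      by (intro image_eqI[of _ _ "cmp G \<eta> (gpinv G \<beta>)"]) (auto simp: kernel_def)
  qed
qed

text \<open>The matrix operator satisfies the definite description in \<open>regular_rep\<close>,
  and \<open>bounded_operators_determined\<close> excludes any other.\<close>

lemma regular_rep_eq:
  assumes f: "f \<in> bounded_kernels" and z: "z \<in> topspace (units G)"
  shows "regular_rep G z f = matrix_operator (fiber G z) (kernel f)"
proof -
  obtain K where K: "0 \<le> K" "matrix_bound (fiber G z) (kernel f) K"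
    using f z by (auto simp: bounded_kernels_def)
  interpret bounded_matrix "fiber G z" "kernel f" K
    using K finite_kernel_row[OF f] by unfold_locales auto
  let ?L = "matrix_operator (fiber G z) (kernel f)"
  have eq: "(\<lambda>\<eta>. \<Sum>\<^sub>\<infinity>\<beta>\<in>fiber G (rg G \<gamma>). f \<beta> * delta (cmp G \<beta> \<gamma>) 1 \<eta>) = ?L (delta \<gamma> 1)"
    if \<gamma>: "\<gamma> \<in> fiber G z" for \<gamma>
  proof
    fix \<eta>
    show "(\<Sum>\<^sub>\<infinity>\<beta>\<in>fiber G (rg G \<gamma>). f \<beta> * delta (cmp G \<beta> \<gamma>) 1 \<eta>) = ?L (delta \<gamma> 1) \<eta>"
    proof (cases "\<eta> \<in> fiber G z")
      case True
      have "(\<Sum>\<^sub>\<infinity>\<beta>\<in>fiber G (rg G \<gamma>). f \<beta> * delta (cmp G \<beta> \<gamma>) 1 \<eta>)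
          = (\<Sum>\<^sub>\<infinity>\<beta>\<in>{cmp G \<eta> (gpinv G \<gamma>)}. f \<beta> * delta (cmp G \<beta> \<gamma>) 1 \<eta>)"
        using div_closed[OF True \<gamma>] mult_closed(2)[OF _ \<gamma>]
        by (intro infsum_cong_neutral) (auto simp: delta_def)
      also have "\<dots> = kernel f \<eta> \<gamma>" using div_closed[OF True \<gamma>] by (simp add: delta_def kernel_def)
      finally show ?thesis using matrix_operator_delta[OF \<gamma>] True by simp
    next
      case False
      then have "f \<beta> * delta (cmp G \<beta> \<gamma>) 1 \<eta> = 0" if "\<beta> \<in> fiber G (rg G \<gamma>)" for \<beta>
        using mult_closed(1)[OF that \<gamma>] by (auto simp: delta_def)
      then have "(\<Sum>\<^sub>\<infinity>\<beta>\<in>fiber G (rg G \<gamma>). f \<beta> * delta (cmp G \<beta> \<gamma>) 1 \<eta>) = 0"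
        by (rule infsum_0)
      then show ?thesis using matrix_operator_delta[OF \<gamma>] False by simp
    qed
  qed
  show ?thesis unfolding regular_rep_def
  proof (rule the_equality)
    show "?L \<in> bounded_operators (fiber G z) \<and> (\<forall>\<gamma>\<in>fiber G z. ?L (delta \<gamma> 1) =
        (\<lambda>\<eta>. \<Sum>\<^sub>\<infinity>\<beta>\<in>fiber G (rg G \<gamma>). f \<beta> * delta (cmp G \<beta> \<gamma>) 1 \<eta>))"
      using matrix_operator_bounded eq by simp
    show "L = ?L" if "L \<in> bounded_operators (fiber G z) \<and> (\<forall>\<gamma>\<in>fiber G z. L (delta \<gamma> 1) =
        (\<lambda>\<eta>. \<Sum>\<^sub>\<infinity>\<beta>\<in>fiber G (rg G \<gamma>). f \<beta> * delta (cmp G \<beta> \<gamma>) 1 \<eta>))" for L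
      using that matrix_operator_bounded eq by (intro bounded_operators_determined[of L "fiber G z"]) auto
  qed
qed

lemma op_norm_regular_rep_le_iff:
  assumes f: "f \<in> bounded_kernels" and z: "z \<in> topspace (units G)" and C: "0 \<le> C"
  shows "op_norm (fiber G z) (regular_rep G z f) \<le> C \<longleftrightarrow> matrix_bound (fiber G z) (kernel f) C"
proof -
  obtain K where K: "0 \<le> K" "matrix_bound (fiber G z) (kernel f) K"
    using f z by (auto simp: bounded_kernels_def)
  interpret bounded_matrix "fiber G z" "kernel f" K
    using K finite_kernel_row[OF f] by unfold_locales auto
  show ?thesis using op_norm_le_iff[OF C] regular_rep_eq[OF f z] by simp
qed

text \<open>Later estimates read the norm off from this equivalence. As C is nonnegative, the 0
  inserted in the supremum is harmless.\<close>

lemma reduced_norm_le_iff: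
  assumes f: "f \<in> bounded_kernels" and C: "0 \<le> C"
  shows "reduced_norm G f \<le> C \<longleftrightarrow> (\<forall>z\<in>topspace (units G). matrix_bound (fiber G z) (kernel f) C)"
proof -
  obtain K where K: "0 \<le> K" "\<And>z. z \<in> topspace (units G) \<Longrightarrow> matrix_bound (fiber G z) (kernel f) K"
    using f by (auto simp: bounded_kernels_def)
  have "bdd_above (insert 0 ((\<lambda>x. op_norm (fiber G x) (regular_rep G x f)) ` topspace (units G)))"
    using K op_norm_regular_rep_le_iff[OF f _ K(1)] by (intro bdd_aboveI[of _ K]) auto
  then have "reduced_norm G f \<le> C \<longleftrightarrow>
      (\<forall>y\<in>insert 0 ((\<lambda>x. op_norm (fiber G x) (regular_rep G x f)) ` topspace (units G)). y \<le> C)"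
    unfolding reduced_norm_def by (intro cSup_le_iff) auto
  then show ?thesis using C op_norm_regular_rep_le_iff[OF f _ C] by auto
qed

lemma reduced_norm_nonneg: 
  assumes f: "f \<in> bounded_kernels"
  shows "0 \<le> reduced_norm G f"
proof -
  obtain K where K: "0 \<le> K" "\<And>z. z \<in> topspace (units G) \<Longrightarrow> matrix_bound (fiber G z) (kernel f) K"
    using f by (auto simp: bounded_kernels_def)
  have "bdd_above (insert 0 ((\<lambda>x. op_norm (fiber G x) (regular_rep G x f)) ` topspace (units G)))"
    using K op_norm_regular_rep_le_iff[OF f _ K(1)] by (intro bdd_aboveI[of _ K]) auto
  then show ?thesis unfolding reduced_norm_def by (intro cSup_upper) auto
qed

lemma matrix_bound_reduced_norm:
  "f \<in> bounded_kernels \<Longrightarrow> z \<in> topspace (units G) \<Longrightarrow> matrix_bound (fiber G z) (kernel f) (reduced_norm G f)"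
  using reduced_norm_le_iff[of f "reduced_norm G f"] reduced_norm_nonneg[of f] by simp

section \<open>Functions with bounded kernels as a normed *-algebra\<close>

lemma kernel_add: "kernel (f + g) = (\<lambda>\<eta> \<beta>. kernel f \<eta> \<beta> + kernel g \<eta> \<beta>)"
  by (simp add: kernel_def fun_eq_iff)

lemma kernel_scale: "kernel (\<lambda>\<gamma>. c * f \<gamma>) = (\<lambda>\<eta> \<beta>. c * kernel f \<eta> \<beta>)"
  by (simp add: kernel_def fun_eq_iff)

lemma bounded_kernels_add:
  assumes f: "f \<in> bounded_kernels" and g: "g \<in> bounded_kernels"
  shows "f + g \<in> bounded_kernels" "reduced_norm G (f + g) \<le> reduced_norm G f + reduced_norm G g"
proof -
  have b: "matrix_bound (fiber G z) (kernel (f + g)) (reduced_norm G f + reduced_norm G g)"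
    if "z \<in> topspace (units G)" for z
    unfolding kernel_add using that f g by (intro matrix_bound_add matrix_bound_reduced_norm)
  have fin: "finite {\<gamma> \<in> A. (f + g) \<gamma> \<noteq> 0}" if "finite {\<gamma> \<in> A. f \<gamma> \<noteq> 0}" "finite {\<gamma> \<in> A. g \<gamma> \<noteq> 0}" for A
    by (rule finite_subset[OF _ finite_UnI[OF that]]) auto
  show fg: "f + g \<in> bounded_kernels"
    unfolding bounded_kernels_def
  proof (intro CollectI conjI allI exI[of _ "reduced_norm G f + reduced_norm G g"])
    show "finite {\<gamma> \<in> fiber G z. (f + g) \<gamma> \<noteq> 0}" for z
      using f g by (intro fin) (auto simp: bounded_kernels_def)
    show "finite {\<gamma> \<in> topspace (arrows G). rg G \<gamma> = z \<and> (f + g) \<gamma> \<noteq> 0}" for z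
      using f g fin[of "{\<gamma> \<in> topspace (arrows G). rg G \<gamma> = z}"] by (auto simp: bounded_kernels_def)
  qed (use f g b in \<open>auto simp: reduced_norm_nonneg bounded_kernels_def\<close>)
  show "reduced_norm G (f + g) \<le> reduced_norm G f + reduced_norm G g"
    using reduced_norm_le_iff[OF fg] b f g by (simp add: reduced_norm_nonneg)
qed

lemma bounded_kernels_scale:
  assumes f: "f \<in> bounded_kernels"
  shows "(\<lambda>\<gamma>. c * f \<gamma>) \<in> bounded_kernels" "reduced_norm G (\<lambda>\<gamma>. c * f \<gamma>) \<le> cmod c * reduced_norm G f"
proof -
  have b: "matrix_bound (fiber G z) (kernel (\<lambda>\<gamma>. c * f \<gamma>)) (cmod c * reduced_norm G f)"
    if "z \<in> topspace (units G)" for z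
    unfolding kernel_scale using that f by (intro matrix_bound_scale matrix_bound_reduced_norm)
  have fin: "finite {\<gamma> \<in> A. c * f \<gamma> \<noteq> 0}" if "finite {\<gamma> \<in> A. f \<gamma> \<noteq> 0}" for A
    by (rule finite_subset[OF _ that]) auto
  show cf: "(\<lambda>\<gamma>. c * f \<gamma>) \<in> bounded_kernels"
    unfolding bounded_kernels_def
  proof (intro CollectI conjI allI exI[of _ "cmod c * reduced_norm G f"])
    show "finite {\<gamma> \<in> fiber G z. c * f \<gamma> \<noteq> 0}" for z
      using f by (intro fin) (auto simp: bounded_kernels_def)
    show "finite {\<gamma> \<in> topspace (arrows G). rg G \<gamma> = z \<and> c * f \<gamma> \<noteq> 0}" for z
      using f fin[of "{\<gamma> \<in> topspace (arrows G). rg G \<gamma> = z}"] by (auto simp: bounded_kernels_def)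
  qed (use f b in \<open>auto simp: reduced_norm_nonneg bounded_kernels_def\<close>)
  show "reduced_norm G (\<lambda>\<gamma>. c * f \<gamma>) \<le> cmod c * reduced_norm G f"
    using reduced_norm_le_iff[OF cf] b f by (simp add: reduced_norm_nonneg)
qed

lemma kernel_adjoint:
  "\<eta> \<in> fiber G z \<Longrightarrow> \<beta> \<in> fiber G z \<Longrightarrow> kernel (groupoid_adjoint G f) \<eta> \<beta> = cnj (kernel f \<beta> \<eta>)"
  by (simp add: kernel_def groupoid_adjoint_def div_closed)

lemma bounded_kernels_adjoint:
  assumes f: "f \<in> bounded_kernels"
  shows "groupoid_adjoint G f \<in> bounded_kernels" "reduced_norm G (groupoid_adjoint G f) \<le> reduced_norm G f"
proof -
  have b: "matrix_bound (fiber G z) (kernel (groupoid_adjoint G f)) (reduced_norm G f)"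
    if "z \<in> topspace (units G)" for z
    using matrix_bound_adjoint[OF matrix_bound_reduced_norm[OF f that]] kernel_adjoint
    by (subst matrix_bound_cong) auto
  show af: "groupoid_adjoint G f \<in> bounded_kernels"
    unfolding bounded_kernels_def
  proof (intro CollectI conjI allI exI[of _ "reduced_norm G f"])
    fix z
    have "finite (gpinv G ` {\<gamma> \<in> topspace (arrows G). rg G \<gamma> = z \<and> f \<gamma> \<noteq> 0})"
      using f by (auto simp: bounded_kernels_def)
    then show "finite {\<gamma> \<in> fiber G z. groupoid_adjoint G f \<gamma> \<noteq> 0}"
    proof (rule finite_subset[rotated], intro subsetI)
      fix \<gamma> assume "\<gamma> \<in> {\<gamma> \<in> fiber G z. groupoid_adjoint G f \<gamma> \<noteq> 0}"
      then show "\<gamma> \<in> gpinv G ` {\<gamma> \<in> topspace (arrows G). rg G \<gamma> = z \<and> f \<gamma> \<noteq> 0}"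
        by (intro image_eqI[of _ "gpinv G" "gpinv G \<gamma>"])
          (auto simp: fiber_def groupoid_adjoint_def inv_closed inv_inv split: if_splits)
    qed
    have "finite (gpinv G ` {\<gamma> \<in> fiber G z. f \<gamma> \<noteq> 0})"
      using f by (auto simp: bounded_kernels_def)
    then show "finite {\<gamma> \<in> topspace (arrows G). rg G \<gamma> = z \<and> groupoid_adjoint G f \<gamma> \<noteq> 0}"
    proof (rule finite_subset[rotated], intro subsetI)
      fix \<gamma> assume "\<gamma> \<in> {\<gamma> \<in> topspace (arrows G). rg G \<gamma> = z \<and> groupoid_adjoint G f \<gamma> \<noteq> 0}"
      then show "\<gamma> \<in> gpinv G ` {\<gamma> \<in> fiber G z. f \<gamma> \<noteq> 0}"
        by (intro image_eqI[of _ "gpinv G" "gpinv G \<gamma>"])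
          (auto simp: fiber_def groupoid_adjoint_def inv_closed inv_inv split: if_splits)
    qed
  qed (use f b in \<open>auto simp: reduced_norm_nonneg groupoid_adjoint_def\<close>)
  show "reduced_norm G (groupoid_adjoint G f) \<le> reduced_norm G f"
    using reduced_norm_le_iff[OF af] b f by (simp add: reduced_norm_nonneg)
qed

text \<open>The change of variable \<zeta>\<beta>^{-1}, by \<open>bij_div\<close> and
  \<open>div_div\<close>, moves the sum from the fibre at r(\<beta>) to the fibre at z and gives a
  matrix product. Submultiplicativity of the norm is then that of matrix bounds.\<close>

lemma kernel_convolution:
  assumes g: "g \<in> bounded_kernels" and \<eta>: "\<eta> \<in> fiber G z" and \<beta>: "\<beta> \<in> fiber G z"
  shows "kernel (convolution G f g) \<eta> \<beta> = (\<Sum>\<zeta>\<in>{\<zeta> \<in> fiber G z. kernel g \<zeta> \<beta> \<noteq> 0}. kernel f \<eta> \<zeta> * kernel g \<zeta> \<beta>)"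
proof -
  let ?\<gamma> = "cmp G \<eta> (gpinv G \<beta>)"
  have \<gamma>: "?\<gamma> \<in> topspace (arrows G)" "dm G ?\<gamma> = rg G \<beta>"
    using div_closed[OF \<eta> \<beta>] by (auto simp: fiber_def)
  have "kernel (convolution G f g) \<eta> \<beta> = (\<Sum>\<^sub>\<infinity>\<beta>'\<in>fiber G (rg G \<beta>). f (cmp G ?\<gamma> (gpinv G \<beta>')) * g \<beta>')"
    unfolding kernel_def convolution_def using \<gamma> by simp
  also have "\<dots> = (\<Sum>\<^sub>\<infinity>\<zeta>\<in>fiber G z. f (cmp G ?\<gamma> (gpinv G (cmp G \<zeta> (gpinv G \<beta>)))) * g (cmp G \<zeta> (gpinv G \<beta>)))"
    by (rule infsum_reindex_bij_betw[OF bij_div[OF \<beta>], symmetric])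
  also have "\<dots> = (\<Sum>\<^sub>\<infinity>\<zeta>\<in>fiber G z. kernel f \<eta> \<zeta> * kernel g \<zeta> \<beta>)"
    by (rule infsum_cong) (simp add: div_div[OF \<eta> \<beta>] kernel_def)
  also have "\<dots> = (\<Sum>\<^sub>\<infinity>\<zeta>\<in>{\<zeta> \<in> fiber G z. kernel g \<zeta> \<beta> \<noteq> 0}. kernel f \<eta> \<zeta> * kernel g \<zeta> \<beta>)"
    by (rule infsum_cong_neutral) auto
  finally show ?thesis using finite_kernel_column[OF g \<beta>] by simp
qed

lemma convolution_eq:
  assumes g: "g \<in> bounded_kernels" and \<gamma>: "\<gamma> \<in> topspace (arrows G)"
  shows "convolution G f g \<gamma> = (\<Sum>\<beta>\<in>{\<beta> \<in> fiber G (dm G \<gamma>). g \<beta> \<noteq> 0}. f (cmp G \<gamma> (gpinv G \<beta>)) * g \<beta>)"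
proof -
  have "convolution G f g \<gamma> = (\<Sum>\<^sub>\<infinity>\<beta>\<in>{\<beta> \<in> fiber G (dm G \<gamma>). g \<beta> \<noteq> 0}. f (cmp G \<gamma> (gpinv G \<beta>)) * g \<beta>)"
    unfolding convolution_def using \<gamma> by simp (rule infsum_cong_neutral; auto)
  then show ?thesis using g by (simp add: bounded_kernels_def)
qed

lemma bounded_kernels_convolution:
  assumes f: "f \<in> bounded_kernels" and g: "g \<in> bounded_kernels"
  shows "convolution G f g \<in> bounded_kernels"
    "reduced_norm G (convolution G f g) \<le> reduced_norm G f * reduced_norm G g"
proof -
  have b: "matrix_bound (fiber G z) (kernel (convolution G f g)) (reduced_norm G f * reduced_norm G g)"
    if z: "z \<in> topspace (units G)" for z
    using kernel_convolution[OF g] finite_kernel_column[OF g]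
      matrix_bound_mult[OF matrix_bound_reduced_norm[OF f z] matrix_bound_reduced_norm[OF g z]]
    by (subst matrix_bound_cong) (auto simp: reduced_norm_nonneg f g)
  \<comment> \<open>An arrow in the support of the convolution factors through arrows in the
    supports of f and g; finiteness along fibres is inherited by following the factors.\<close>
  have nz: "\<exists>\<alpha> \<beta>. \<alpha> \<in> topspace (arrows G) \<and> f \<alpha> \<noteq> 0 \<and> dm G \<alpha> = rg G \<beta> \<and> rg G \<alpha> = rg G \<gamma> \<and>
      \<beta> \<in> fiber G (dm G \<gamma>) \<and> g \<beta> \<noteq> 0 \<and> \<gamma> = cmp G \<alpha> \<beta>" if "\<gamma> \<in> topspace (arrows G)" "convolution G f g \<gamma> \<noteq> 0" for \<gamma>
  proof -
    have "\<exists>\<beta>\<in>{\<beta> \<in> fiber G (dm G \<gamma>). g \<beta> \<noteq> 0}. f (cmp G \<gamma> (gpinv G \<beta>)) * g \<beta> \<noteq> 0"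
    proof (rule ccontr)
      assume "\<not> ?thesis"
      then have "convolution G f g \<gamma> = 0" unfolding convolution_eq[OF g that(1)] by (intro sum.neutral) auto
      then show False using that by simp
    qed
    then obtain \<beta> where \<beta>: "\<beta> \<in> fiber G (dm G \<gamma>)" "g \<beta> \<noteq> 0" "f (cmp G \<gamma> (gpinv G \<beta>)) \<noteq> 0" by auto
    have "\<gamma> \<in> fiber G (dm G \<gamma>)" using that by (simp add: fiber_def)
    from div_closed[OF this \<beta>(1)] \<beta> show ?thesis
      by (intro exI[of _ "cmp G \<gamma> (gpinv G \<beta>)"] exI[of _ \<beta>]) (auto simp: fiber_def)
  qed
  show fg: "convolution G f g \<in> bounded_kernels"
    unfolding bounded_kernels_def
  proof (intro CollectI conjI allI exI[of _ "reduced_norm G f * reduced_norm G g"])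
    fix z
    let ?A = "{\<beta> \<in> fiber G z. g \<beta> \<noteq> 0}"
    have "finite (\<Union>\<beta>\<in>?A. (\<lambda>\<alpha>. cmp G \<alpha> \<beta>) ` {\<alpha> \<in> fiber G (rg G \<beta>). f \<alpha> \<noteq> 0})"
      using f g by (intro finite_UN_I finite_imageI) (auto simp: bounded_kernels_def)
    then show "finite {\<gamma> \<in> fiber G z. convolution G f g \<gamma> \<noteq> 0}"
      by (rule finite_subset[rotated]) (use nz in \<open>fastforce simp: fiber_def\<close>)
    let ?B = "{\<alpha> \<in> topspace (arrows G). rg G \<alpha> = z \<and> f \<alpha> \<noteq> 0}"
    have "finite (\<Union>\<alpha>\<in>?B. (\<lambda>\<beta>. cmp G \<alpha> \<beta>) ` {\<beta> \<in> topspace (arrows G). rg G \<beta> = dm G \<alpha> \<and> g \<beta> \<noteq> 0})"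
      using f g by (intro finite_UN_I finite_imageI) (auto simp: bounded_kernels_def)
    then show "finite {\<gamma> \<in> topspace (arrows G). rg G \<gamma> = z \<and> convolution G f g \<gamma> \<noteq> 0}"
      by (rule finite_subset[rotated]) (use nz in \<open>fastforce simp: fiber_def\<close>)
  qed (use f g b in \<open>auto simp: reduced_norm_nonneg convolution_def\<close>)
  show "reduced_norm G (convolution G f g) \<le> reduced_norm G f * reduced_norm G g"
    using reduced_norm_le_iff[OF fg] b f g by (simp add: reduced_norm_nonneg)
qed

lemma convolution_add_right:
  assumes g: "g \<in> bounded_kernels" "g' \<in> bounded_kernels"
  shows "convolution G f (g + g') = convolution G f g + convolution G f g'"
proof
  fix \<gamma>
  show "convolution G f (g + g') \<gamma> = (convolution G f g + convolution G f g') \<gamma>"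
  proof (cases "\<gamma> \<in> topspace (arrows G)")
    case True
    let ?A = "\<lambda>g. {\<beta> \<in> fiber G (dm G \<gamma>). g \<beta> \<noteq> 0}"
    let ?B = "?A g \<union> ?A g'"
    have fin: "finite ?B" using g by (auto simp: bounded_kernels_def)
    have eq: "convolution G f h \<gamma> = (\<Sum>\<beta>\<in>?B. f (cmp G \<gamma> (gpinv G \<beta>)) * h \<beta>)" 
      if "h \<in> bounded_kernels" "?A h \<subseteq> ?B" for h
      unfolding convolution_eq[OF that(1) True] by (rule sum.mono_neutral_left) (use that fin in auto)
    have "?A (g + g') \<subseteq> ?B" by auto
    then show ?thesis
      using eq[OF g(1)] eq[OF g(2)] eq[OF bounded_kernels_add(1)[OF g]] by (simp add: distrib_left sum.distrib)
  qed (simp add: convolution_def)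
qed

lemma convolution_add_left:
  assumes g: "g \<in> bounded_kernels"
  shows "convolution G (f + f') g = convolution G f g + convolution G f' g"
proof
  fix \<gamma>
  show "convolution G (f + f') g \<gamma> = (convolution G f g + convolution G f' g) \<gamma>"
  proof (cases "\<gamma> \<in> topspace (arrows G)")
    case True
    then show ?thesis by (simp add: convolution_eq[OF g] distrib_right sum.distrib)
  qed (simp add: convolution_def)
qed

lemma convolution_scale_left:
  assumes g: "g \<in> bounded_kernels"
  shows "convolution G (\<lambda>\<gamma>. c * f \<gamma>) g = (\<lambda>\<gamma>. c * convolution G f g \<gamma>)"
proof
  fix \<gamma>
  show "convolution G (\<lambda>\<gamma>. c * f \<gamma>) g \<gamma> = c * convolution G f g \<gamma>"
  proof (cases "\<gamma> \<in> topspace (arrows G)")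
    case True
    then show ?thesis by (simp add: convolution_eq[OF g] sum_distrib_left mult.assoc)
  qed (simp add: convolution_def)
qed

lemma convolution_scale_right:
  assumes g: "g \<in> bounded_kernels"
  shows "convolution G f (\<lambda>\<gamma>. c * g \<gamma>) = (\<lambda>\<gamma>. c * convolution G f g \<gamma>)"
proof
  fix \<gamma>
  show "convolution G f (\<lambda>\<gamma>. c * g \<gamma>) \<gamma> = c * convolution G f g \<gamma>"
  proof (cases "\<gamma> \<in> topspace (arrows G)")
    case True
    then show ?thesis 
      \<comment> \<open>For c = 0 the support of the second factor collapses, so the two finite sums
        are matched by support only when c is nonzero.\<close>
      by (cases "c = 0") (simp add: convolution_def, simp add: convolution_eq[OF g] convolution_eq[OF bounded_kernels_scale(1)[OF g]] 
          sum_distrib_left mult_ac)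
  qed (simp add: convolution_def)
qed

lemma bounded_kernels_zero: "0 \<in> bounded_kernels"
proof -
  have "kernel 0 = (\<lambda>_ _. 0)" by (simp add: kernel_def fun_eq_iff)
  then show ?thesis by (auto simp: bounded_kernels_def intro!: exI[of _ 0] matrix_bound_zero)
qed

lemma groupoid_adjoint_add: "groupoid_adjoint G (f + g) = groupoid_adjoint G f + groupoid_adjoint G g"
  by (auto simp: groupoid_adjoint_def fun_eq_iff)

lemma groupoid_adjoint_scale: "groupoid_adjoint G (\<lambda>\<gamma>. c * f \<gamma>) = (\<lambda>\<gamma>. cnj c * groupoid_adjoint G f \<gamma>)"
  by (auto simp: groupoid_adjoint_def fun_eq_iff)

end

section \<open>Groupoids of germs\<close>

lemma constant_UN: "A \<noteq> {} \<Longrightarrow> (\<And>x. x \<in> A \<Longrightarrow> f x = c) \<Longrightarrow> (\<Union>x\<in>A. f x) = c"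
  by auto

context partial_action
begin

abbreviation "GG \<equiv> transformation_groupoid Z \<theta>"

lemma germ_pairs_iff: "(s, z) \<in> germ_pairs \<theta> \<longleftrightarrow> z \<in> source s"
  by (simp add: germ_pairs_def)

lemma mem_germ:
  "(t, w) \<in> germ \<theta> s z \<longleftrightarrow> z \<in> source s \<and> z \<in> source t \<and> w = z \<and> (\<exists>e\<in>idempotents. s * e = t * e \<and> z \<in> idset \<theta> e)"
  by (auto simp: germ_def germ_rel_def germ_pairs_iff)

lemma equiv_germ_rel: "equiv (germ_pairs \<theta>) (germ_rel \<theta>)"
proof (rule equivI)
  show "germ_rel \<theta> \<subseteq> germ_pairs \<theta> \<times> germ_pairs \<theta>" by (auto simp: germ_rel_def)
  show "refl_on (germ_pairs \<theta>) (germ_rel \<theta>)"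
    unfolding refl_on_def by (auto simp: germ_rel_def germ_pairs_iff intro!: bexI[of _ "_\<^sup>\<star> * _"])
  show "sym (germ_rel \<theta>)" unfolding sym_def by (force simp: germ_rel_def)
  show "trans (germ_rel \<theta>)"
  proof (rule transI)
    fix a b c assume "(a, b) \<in> germ_rel \<theta>" "(b, c) \<in> germ_rel \<theta>"
    then obtain s t u z e f where *: "a = (s, z)" "b = (t, z)" "c = (u, z)" "z \<in> source s" "z \<in> source t" "z \<in> source u"
      "e \<in> idempotents" "f \<in> idempotents" "s * e = t * e" "t * f = u * f" "z \<in> idset \<theta> e" "z \<in> idset \<theta> f"
      by (auto simp: germ_rel_def germ_pairs_iff)
    have "s * (e * f) = t * (e * f)" using * by (simp flip: mult.assoc)
    also have "\<dots> = t * (f * e)" using * by (simp add: idem_commute)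
    also have "\<dots> = u * (f * e)" using * by (simp flip: mult.assoc)
    also have "\<dots> = u * (e * f)" using * by (simp add: idem_commute)
    finally show "(a, c) \<in> germ_rel \<theta>"
      using * by (auto simp: germ_rel_def germ_pairs_iff idset_mult intro!: bexI[of _ "e * f"])
  qed
qed

lemma germ_eq_iff:
  assumes "z \<in> source s" "w \<in> source t"
  shows "germ \<theta> s z = germ \<theta> t w \<longleftrightarrow> z = w \<and> (\<exists>e\<in>idempotents. s * e = t * e \<and> z \<in> idset \<theta> e)"
  unfolding germ_def using assms
  by (subst eq_equiv_class_iff[OF equiv_germ_rel]) (auto simp: germ_pairs_iff germ_rel_def)

lemma germ_mult_idem:
  assumes "z \<in> source s" "e \<in> idempotents" "z \<in> idset \<theta> e"
  shows "germ \<theta> (s * e) z = germ \<theta> s z"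
  using assms by (subst germ_eq_iff) (auto simp: source_mult_idem mult.assoc idem_assoc intro!: bexI[of _ e])

lemma mem_germ_iff: "z \<in> source s \<Longrightarrow> (t, w) \<in> germ \<theta> s z \<longleftrightarrow> w = z \<and> z \<in> source t \<and> germ \<theta> t z = germ \<theta> s z"
  unfolding mem_germ using germ_eq_iff[of z s z t] by metis

lemma self_mem_germ: "z \<in> source s \<Longrightarrow> (s, z) \<in> germ \<theta> s z"
  by (simp add: mem_germ_iff)

lemma topspace_units [simp]: "units GG = Z"
  by (simp add: transformation_groupoid_def)

lemma topspace_arrows: "topspace (arrows GG) = {germ \<theta> s z | s z. z \<in> source s}"
  by (auto simp: transformation_groupoid_def) (use openin_source in blast)

lemma germ_in_arrows [simp]: "z \<in> source s \<Longrightarrow> germ \<theta> s z \<in> topspace (arrows GG)"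
  by (auto simp: topspace_arrows)

lemma arrowE:
  assumes "\<gamma> \<in> topspace (arrows GG)"
  obtains s z where "z \<in> source s" "\<gamma> = germ \<theta> s z"
  using assms by (auto simp: topspace_arrows)

lemma constant_image:
  assumes "A \<noteq> {}" "\<And>x. x \<in> A \<Longrightarrow> f x = c" shows "f ` A = {c}"
  using assms by auto

lemma dm_germ [simp]:
  assumes "z \<in> source s" shows "dm GG (germ \<theta> s z) = z"
proof -
  have "snd ` germ \<theta> s z = {z}"
  proof (rule constant_image)
    show "germ \<theta> s z \<noteq> {}" using self_mem_germ[OF assms] by blast
    show "snd x = z" if "x \<in> germ \<theta> s z" for x using that by (cases x) (simp add: mem_germ)
  qed
  then show ?thesis by (simp add: transformation_groupoid_def)
qed

lemma germ_eq_act: 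
  assumes "z \<in> source s" "z \<in> source t" "germ \<theta> s z = germ \<theta> t z"
  shows "act s z = act t z"
  using assms by (auto simp: germ_eq_iff) (metis act_mult_idem)

lemma rg_germ [simp]:
  assumes "z \<in> source s" shows "rg GG (germ \<theta> s z) = act s z"
proof -
  have "(\<lambda>(t, w). act t w) ` germ \<theta> s z = {act s z}"
  proof (rule constant_image)
    show "germ \<theta> s z \<noteq> {}" using self_mem_germ[OF assms] by blast
    fix x assume "x \<in> germ \<theta> s z"
    moreover obtain t w where "x = (t, w)" by (cases x)
    ultimately show "(case x of (t, w) \<Rightarrow> act t w) = act s z"
      using germ_eq_act[of z t s] assms by (simp add: mem_germ_iff[OF assms])
  qed
  then show ?thesis by (simp add: transformation_groupoid_def)
qed

lemma germ_mult_cong: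
  assumes z: "z \<in> source s" "z \<in> source s'" "germ \<theta> s z = germ \<theta> s' z"
    and t: "act s z \<in> source t" "act s z \<in> source t'" "germ \<theta> t (act s z) = germ \<theta> t' (act s z)"
  shows "germ \<theta> (t * s) z = germ \<theta> (t' * s') z"
proof -
  obtain e where e: "e \<in> idempotents" "s * e = s' * e" "z \<in> idset \<theta> e" using z by (auto simp: germ_eq_iff)
  obtain f where f: "f \<in> idempotents" "t * f = t' * f" "act s z \<in> idset \<theta> f" using t by (auto simp: germ_eq_iff)
  have a: "act s' z = act s z" using germ_eq_act z by metis
  \<comment> \<open>g is f pulled back along s, with \<open>s * g = f * s\<close>. After
    multiplication by \<open>g * e\<close> the factor t can be replaced by t' through f, and s by s'
    through e.\<close>
  define g where "g = s\<^sup>\<star> * f * s"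
  have g: "g \<in> idempotents" using f by (simp add: g_def)
  have sg: "s * g = f * s"
  proof -
    have "s * g = (s * s\<^sup>\<star>) * f * s" by (simp add: g_def mult.assoc)
    also have "\<dots> = f * (s * s\<^sup>\<star>) * s" using f by (subst idem_commute) simp_all
    finally show ?thesis by (simp add: mult.assoc istar_assoc)
  qed
  have zg: "z \<in> idset \<theta> g"
    using source_mult[of z f s] f z by (simp add: istar_mult_self_idem_left g_def idem_assoc)
  have "t * s * (g * e) = t * (s * g) * e" by (simp add: mult.assoc)
  also have "\<dots> = (t' * f) * s * e" by (simp only: sg f(2)[symmetric] mult.assoc)
  also have "\<dots> = t' * (s * g) * e" by (simp only: sg mult.assoc)
  also have "\<dots> = t' * s * (g * e)" by (simp only: mult.assoc)
  also have "\<dots> = t' * s * (e * g)" using g e by (simp add: idem_commute)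
  also have "\<dots> = t' * s' * (e * g)" using e(2) by (metis mult.assoc)
  also have "\<dots> = t' * s' * (g * e)" using g e by (simp add: idem_commute)
  finally show ?thesis
    using z t a g e zg by (subst germ_eq_iff) (auto simp: source_mult idset_mult intro!: bexI[of _ "g * e"])
qed

lemma cmp_germ [simp]:
  assumes "z \<in> source s" "act s z \<in> source t"
  shows "cmp GG (germ \<theta> t (act s z)) (germ \<theta> s z) = germ \<theta> (t * s) z"
  unfolding transformation_groupoid_def topological_groupoid.simps
proof (rule constant_UN)
  show "germ \<theta> t (act s z) \<noteq> {}" using self_mem_germ assms by blast
  fix x assume x: "x \<in> germ \<theta> t (act s z)"
  obtain t' w where tw: "x = (t', w)" by (cases x)
  show "(case x of (t, w) \<Rightarrow> \<Union>(s, z)\<in>germ \<theta> s z. germ \<theta> (t * s) z) = germ \<theta> (t * s) z"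
    unfolding tw prod.case
  proof (rule constant_UN)
    show "germ \<theta> s z \<noteq> {}" using self_mem_germ assms by blast
    fix y assume y: "y \<in> germ \<theta> s z"
    obtain s' u where su: "y = (s', u)" by (cases y)
    show "(case y of (s, z) \<Rightarrow> germ \<theta> (t' * s) z) = germ \<theta> (t * s) z"
      using x y assms germ_mult_cong[of z s s' t t'] by (auto simp: tw su mem_germ_iff)
  qed
qed

lemma germ_istar_cong:
  assumes z: "z \<in> source s" "z \<in> source s'" "germ \<theta> s z = germ \<theta> s' z"
  shows "germ \<theta> (s\<^sup>\<star>) (act s z) = germ \<theta> (s'\<^sup>\<star>) (act s z)"
proof -
  obtain e where e: "e \<in> idempotents" "s * e = s' * e" "z \<in> idset \<theta> e" using z by (auto simp: germ_eq_iff)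
  have a: "act s' z = act s z" using germ_eq_act z by metis
  \<comment> \<open>f is e pushed forward along s. It is the same element for s and s', and
    \<open>s\<^sup>\<star> * f = e * s\<^sup>\<star>\<close>, so f witnesses that the two inverses
    have the same germ.\<close>
  define f where "f = s * e * s\<^sup>\<star>"
  have f: "f \<in> idempotents" using idem_conj(1)[OF e(1), of "s\<^sup>\<star>"] by (simp add: f_def)
  have eq: "t\<^sup>\<star> * (t * e * t\<^sup>\<star>) = e * t\<^sup>\<star>" for t
  proof -
    have "t\<^sup>\<star> * (t * e * t\<^sup>\<star>) = (t\<^sup>\<star> * t) * e * t\<^sup>\<star>" by (simp add: mult.assoc)
    also have "\<dots> = e * (t\<^sup>\<star> * t) * t\<^sup>\<star>" using e by (subst idem_commute) simp_all
    finally show ?thesis by (simp add: mult.assoc istar_assoc)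
  qed
  have est: "e * s\<^sup>\<star> = e * s'\<^sup>\<star>" using arg_cong[OF e(2), of istar] e(1) by (simp add: istar_mult)
  have "f = s * e * (e * s\<^sup>\<star>)" using e(1) by (simp add: f_def mult.assoc idem_assoc)
  also have "\<dots> = s' * e * (e * s'\<^sup>\<star>)" by (simp only: est e(2))
  finally have f': "f = s' * e * s'\<^sup>\<star>" using e(1) by (simp add: mult.assoc idem_assoc)
  have "s\<^sup>\<star> * f = s'\<^sup>\<star> * f" using eq[of s] eq[of s'] est by (simp add: f'[symmetric] f_def[symmetric])
  moreover have "act s z \<in> idset \<theta> f"
    using source_mult[of "act s z" e "s\<^sup>\<star>"] act_in_range[OF z(1)] act_istar[OF z(1)] e
      istar_mult_self_idem_left[of e "s\<^sup>\<star>"]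
    by (simp add: f_def idem_assoc)
  ultimately show ?thesis
    using act_in_range[OF z(1)] act_in_range[OF z(2)] a f by (subst germ_eq_iff) auto
qed

lemma gpinv_germ [simp]:
  assumes "z \<in> source s"
  shows "gpinv GG (germ \<theta> s z) = germ \<theta> (s\<^sup>\<star>) (act s z)"
  unfolding transformation_groupoid_def topological_groupoid.simps
proof (rule constant_UN)
  show "germ \<theta> s z \<noteq> {}" using self_mem_germ assms by blast
  fix y assume y: "y \<in> germ \<theta> s z"
  obtain s' u where su: "y = (s', u)" by (cases y)
  show "(case y of (s, z) \<Rightarrow> germ \<theta> (s\<^sup>\<star>) (act s z)) = germ \<theta> (s\<^sup>\<star>) (act s z)"
    using y assms germ_istar_cong[of z s s'] germ_eq_act[of z s s'] by (auto simp: su mem_germ_iff)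
qed

section \<open>The groupoid laws for germs\<close>

sublocale algebraic_groupoid GG
proof
  fix \<gamma> \<beta>
  assume \<gamma>: "\<gamma> \<in> topspace (arrows GG)" and \<beta>: "\<beta> \<in> topspace (arrows GG)" and c: "dm GG \<gamma> = rg GG \<beta>"
  obtain t w where t: "w \<in> source t" "\<gamma> = germ \<theta> t w" using \<gamma> by (rule arrowE)
  obtain s z where s: "z \<in> source s" "\<beta> = germ \<theta> s z" using \<beta> by (rule arrowE)
  have w: "w = act s z" using c t s by simp
  have ts: "z \<in> source (t * s)" using t s w by (simp add: source_mult)
  note r = act_in_range[OF s(1)] act_istar[OF s(1)] act_in_range[OF t(1)] act_istar[OF t(1)]
  show "cmp GG \<gamma> \<beta> \<in> topspace (arrows GG) \<and> dm GG (cmp GG \<gamma> \<beta>) = dm GG \<beta> \<and> rg GG (cmp GG \<gamma> \<beta>) = rg GG \<gamma>"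
    using t s w ts by (simp add: act_mult)
  have "cmp GG (cmp GG \<gamma> \<beta>) (gpinv GG \<beta>) = cmp GG (germ \<theta> (t * s) (act (s\<^sup>\<star>) (act s z))) (germ \<theta> (s\<^sup>\<star>) (act s z))"
    using t s w r by simp
  also have "\<dots> = germ \<theta> (t * s * s\<^sup>\<star>) (act s z)"
    using t s w ts r by (intro cmp_germ) simp_all
  also have "\<dots> = germ \<theta> (t * (s * s\<^sup>\<star>)) (act s z)" by (simp add: mult.assoc)
  also have "\<dots> = germ \<theta> t (act s z)"
    using t s w r by (intro germ_mult_idem) simp_all
  finally show "cmp GG (cmp GG \<gamma> \<beta>) (gpinv GG \<beta>) = \<gamma>" using t w by simp
  have "gpinv GG (cmp GG \<gamma> \<beta>) = germ \<theta> (s\<^sup>\<star> * t\<^sup>\<star>) (act t (act s z))"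
    using t s w ts by (simp add: act_mult istar_mult)
  also have "\<dots> = cmp GG (germ \<theta> (s\<^sup>\<star>) (act (t\<^sup>\<star>) (act t (act s z)))) (germ \<theta> (t\<^sup>\<star>) (act t (act s z)))"
    using t s w r by (intro cmp_germ[symmetric]) simp_all
  also have "\<dots> = cmp GG (gpinv GG \<beta>) (gpinv GG \<gamma>)" using t s w r by simp
  finally show "gpinv GG (cmp GG \<gamma> \<beta>) = cmp GG (gpinv GG \<beta>) (gpinv GG \<gamma>)" .
next
  fix \<gamma> assume \<gamma>: "\<gamma> \<in> topspace (arrows GG)"
  obtain t w where t: "w \<in> source t" "\<gamma> = germ \<theta> t w" using \<gamma> by (rule arrowE)
  note r = act_in_range[OF t(1)] act_istar[OF t(1)]
  show "gpinv GG \<gamma> \<in> topspace (arrows GG) \<and> dm GG (gpinv GG \<gamma>) = rg GG \<gamma> \<and> rg GG (gpinv GG \<gamma>) = dm GG \<gamma>"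
    using t r by simp
  show "rg GG \<gamma> \<in> topspace (units GG)" using t act_in_topspace by simp
  show "gpinv GG (gpinv GG \<gamma>) = \<gamma>" using t r by simp
next
  fix \<alpha> \<beta> \<gamma>
  assume *: "\<alpha> \<in> topspace (arrows GG)" "\<beta> \<in> topspace (arrows GG)" "\<gamma> \<in> topspace (arrows GG)"
    and c: "dm GG \<alpha> = rg GG \<beta>" "dm GG \<beta> = rg GG \<gamma>"
  obtain u x where u: "x \<in> source u" "\<alpha> = germ \<theta> u x" using *(1) by (rule arrowE)
  obtain t w where t: "w \<in> source t" "\<beta> = germ \<theta> t w" using *(2) by (rule arrowE)
  obtain s z where s: "z \<in> source s" "\<gamma> = germ \<theta> s z" using *(3) by (rule arrowE)
  have w: "w = act s z" "x = act t (act s z)" using c u t s by simp_all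
  have 1: "z \<in> source (t * s)" "act s z \<in> source (u * t)" "act (t * s) z = act t (act s z)"
    using u t s w by (simp_all add: source_mult act_mult)
  have "cmp GG (cmp GG \<alpha> \<beta>) \<gamma> = germ \<theta> (u * t * s) z" using u t s w 1 by simp
  moreover have "cmp GG \<alpha> (cmp GG \<beta> \<gamma>) = cmp GG (germ \<theta> u (act (t * s) z)) (germ \<theta> (t * s) z)"
    using u t s w 1 by simp
  moreover have "\<dots> = germ \<theta> (u * (t * s)) z" using u w 1 by (intro cmp_germ) simp_all
  ultimately show "cmp GG (cmp GG \<alpha> \<beta>) \<gamma> = cmp GG \<alpha> (cmp GG \<beta> \<gamma>)" by (simp add: mult.assoc)
qed

section \<open>Functions carried by the germs of one element\<close>

lemma fiber_eq: "fiber GG z = {germ \<theta> s z | s. z \<in> source s}"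
  by (auto simp: fiber_def topspace_arrows)

lemma germ_in_fiber [simp]: "z \<in> source s \<Longrightarrow> germ \<theta> s z \<in> fiber GG z"
  by (auto simp: fiber_eq)

text \<open>Only the values of h on the source of s count. For h compactly supported there, these
  functions span \<C>(G); the comparison map uses them with more general h.\<close>

definition section_function :: "'s \<Rightarrow> ('z \<Rightarrow> complex) \<Rightarrow> ('s \<times> 'z) set \<Rightarrow> complex" where
  "section_function s h \<gamma> = (if \<gamma> \<in> germ \<theta> s ` source s then h (dm GG \<gamma>) else 0)"

lemma section_function_germ:
  "z \<in> source t \<Longrightarrow> section_function s h (germ \<theta> t z) = (if z \<in> source s \<and> germ \<theta> t z = germ \<theta> s z then h z else 0)"
  by (auto simp: section_function_def germ_eq_iff)

lemma section_function_add: "section_function s (h + k) = section_function s h + section_function s k"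
  by (auto simp: section_function_def fun_eq_iff)

lemma section_function_scale: "section_function s (\<lambda>z. c * h z) = (\<lambda>\<gamma>. c * section_function s h \<gamma>)"
  by (auto simp: section_function_def fun_eq_iff)

lemma section_function_zero: "section_function s 0 = 0"
  by (auto simp: section_function_def fun_eq_iff)

text \<open>Right multiplication by the germ of t, or by its inverse, shows that the quotient of the
  germs of r and t is a germ of s exactly if r and \<open>s * t\<close> have the same germ.\<close>

lemma kernel_section_function:
  assumes z: "z \<in> source t" "z \<in> source r"
  shows "kernel (section_function s h) (germ \<theta> r z) (germ \<theta> t z) =
    (if z \<in> source (s * t) \<and> germ \<theta> r z = germ \<theta> (s * t) z then h (act t z) else 0)"
proof -
  note rt = act_in_range[OF z(1)] act_istar[OF z(1)]
  have d: "cmp GG (germ \<theta> r z) (gpinv GG (germ \<theta> t z)) = germ \<theta> (r * t\<^sup>\<star>) (act t z)"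
    using cmp_germ[of "act t z" "t\<^sup>\<star>" r] rt z by simp
  have s: "act t z \<in> source (r * t\<^sup>\<star>)" using rt z by (simp add: source_mult)
  have iff: "germ \<theta> (r * t\<^sup>\<star>) (act t z) = germ \<theta> s (act t z) \<longleftrightarrow> germ \<theta> r z = germ \<theta> (s * t) z"
    if st: "act t z \<in> source s"
  proof
    assume "germ \<theta> (r * t\<^sup>\<star>) (act t z) = germ \<theta> s (act t z)"
    then have "cmp GG (germ \<theta> (r * t\<^sup>\<star>) (act t z)) (germ \<theta> t z) = cmp GG (germ \<theta> s (act t z)) (germ \<theta> t z)" by simp
    then show "germ \<theta> r z = germ \<theta> (s * t) z"
      using d div_closed(3)[of "germ \<theta> r z" z "germ \<theta> t z"] z st by simp
  next
    assume "germ \<theta> r z = germ \<theta> (s * t) z"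
    then have "germ \<theta> (r * t\<^sup>\<star>) (act t z) = cmp GG (cmp GG (germ \<theta> s (act t z)) (germ \<theta> t z)) (gpinv GG (germ \<theta> t z))"
      using d z st by simp
    then show "germ \<theta> (r * t\<^sup>\<star>) (act t z) = germ \<theta> s (act t z)"
      using cmp_inv_cancel[of "germ \<theta> s (act t z)" "germ \<theta> t z"] z st by simp
  qed
  show ?thesis
    unfolding kernel_def d section_function_germ[OF s] source_mult using iff z by auto
qed

text \<open>In each regular representation the function is a partial permutation with entries from
  h. Hence the supremum norm bounds the reduced norm on a single sheet, the estimate on which both
  directions of the density argument rest.\<close>

lemma bounded_section_function:
  assumes c: "\<And>z. z \<in> source s \<Longrightarrow> cmod (h z) \<le> c" and c0: "0 \<le> c"
  shows "section_function s h \<in> bounded_kernels" "reduced_norm GG (section_function s h) \<le> c"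
proof -
  have b: "matrix_bound (fiber GG z) (kernel (section_function s h)) c" for z
  proof (rule matrix_bound_partial_permutation)
    fix \<gamma> \<alpha> \<beta> assume "\<gamma> \<in> fiber GG z" "\<alpha> \<in> fiber GG z" "\<beta> \<in> fiber GG z"
    then obtain r t u where *: "\<gamma> = germ \<theta> r z" "\<alpha> = germ \<theta> t z" "\<beta> = germ \<theta> u z"
       "z \<in> source r" "z \<in> source t" "z \<in> source u" by (auto simp: fiber_eq)
    show "\<alpha> = \<beta>" if "kernel (section_function s h) \<gamma> \<alpha> \<noteq> 0" "kernel (section_function s h) \<gamma> \<beta> \<noteq> 0"
    proof -
      have st: "act t z \<in> source s" "act u z \<in> source s" "germ \<theta> (s * t) z = germ \<theta> (s * u) z"
        using that * by (auto simp: kernel_section_function source_mult split: if_splits)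
      have a: "act s (act t z) = act s (act u z)"
        using germ_eq_act[OF _ _ st(3)] st * by (simp add: source_mult act_mult)
      then have a': "act t z = act u z" using act_inj st by blast
      \<comment> \<open>For two nonzero entries in one row, multiplication by
        \<open>s\<^sup>\<star>\<close> recovers the germs of t and u from those of
        \<open>s * t\<close> and \<open>s * u\<close>.\<close>
      have "germ \<theta> (s\<^sup>\<star> * (s * t)) z = germ \<theta> (s\<^sup>\<star> * (s * u)) z"
        by (rule germ_mult_cong) (use st * act_in_range[OF st(1)] a in \<open>simp_all add: source_mult act_mult\<close>)
      moreover have absorb: "germ \<theta> (s\<^sup>\<star> * (s * v)) z = germ \<theta> v z" if v: "z \<in> source v" "act v z \<in> source s" for v
      proof -
        have "s\<^sup>\<star> * (s * v) = v * (v\<^sup>\<star> * (s\<^sup>\<star> * s) * v)"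
        proof -
          have "v * (v\<^sup>\<star> * (s\<^sup>\<star> * s) * v) = (v * v\<^sup>\<star>) * (s\<^sup>\<star> * s) * v" by (simp add: mult.assoc)
          also have "\<dots> = (s\<^sup>\<star> * s) * (v * v\<^sup>\<star>) * v" by (subst idem_commute) simp_all
          finally show ?thesis by (simp add: mult.assoc istar_assoc)
        qed
        moreover have "z \<in> idset \<theta> (v\<^sup>\<star> * (s\<^sup>\<star> * s) * v)"
          using source_mult[of z s v] v by (simp add: istar_mult_self_mult)
        ultimately show ?thesis using v by (simp add: germ_mult_idem)
      qed
      ultimately show "\<alpha> = \<beta>" using absorb[of t] absorb[of u] st(1,2) *(2,3,5,6) by metis
    qed
    show "\<alpha> = \<beta>" if "kernel (section_function s h) \<alpha> \<gamma> \<noteq> 0" "kernel (section_function s h) \<beta> \<gamma> \<noteq> 0"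
      using that * by (auto simp: kernel_section_function split: if_splits)
  next
    fix \<gamma> \<alpha> assume "\<gamma> \<in> fiber GG z" "\<alpha> \<in> fiber GG z"
    then obtain r t where *: "\<gamma> = germ \<theta> r z" "\<alpha> = germ \<theta> t z" "z \<in> source r" "z \<in> source t" by (auto simp: fiber_eq)
    then show "cmod (kernel (section_function s h) \<gamma> \<alpha>) \<le> c"
      using c c0 by (auto simp: kernel_section_function source_mult)
  qed (rule c0)
  show f: "section_function s h \<in> bounded_kernels"
    unfolding bounded_kernels_def
  proof (intro CollectI conjI allI impI exI[of _ c] ballI c0 b)
    show "section_function s h \<gamma> = 0" if "\<gamma> \<notin> topspace (arrows GG)" for \<gamma>
      using that by (auto simp: section_function_def)
    show "finite {\<gamma> \<in> fiber GG z. section_function s h \<gamma> \<noteq> 0}" for z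
      by (rule finite_subset[of _ "{germ \<theta> s z}"]) (auto simp: fiber_eq section_function_germ split: if_splits)
    show "finite {\<gamma> \<in> topspace (arrows GG). rg GG \<gamma> = z \<and> section_function s h \<gamma> \<noteq> 0}" for z
    proof (rule finite_subset[of _ "{germ \<theta> s (act (s\<^sup>\<star>) z)}"])
      show "{\<gamma> \<in> topspace (arrows GG). rg GG \<gamma> = z \<and> section_function s h \<gamma> \<noteq> 0} \<subseteq> {germ \<theta> s (act (s\<^sup>\<star>) z)}"
        by (auto simp: section_function_def act_istar)
    qed simp
  qed
  show "reduced_norm GG (section_function s h) \<le> c"
    using reduced_norm_le_iff[OF f c0] b by simp
qed

text \<open>Over z the only arrow in the sheet of t is the germ of t at z, so the sum has at most
  one term.\<close>

lemma section_function_convolution: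
  assumes "section_function t k \<in> bounded_kernels"
  shows "convolution GG (section_function s h) (section_function t k) =
    section_function (s * t) (\<lambda>z. if z \<in> source t then h (act t z) * k z else 0)"
proof
  fix \<gamma>
  show "convolution GG (section_function s h) (section_function t k) \<gamma> =
    section_function (s * t) (\<lambda>z. if z \<in> source t then h (act t z) * k z else 0) \<gamma>"
  proof (cases "\<gamma> \<in> topspace (arrows GG)")
    case False
    then show ?thesis by (auto simp: convolution_def section_function_def)
  next
    case True
    then obtain r z where r: "z \<in> source r" "\<gamma> = germ \<theta> r z" by (rule arrowE)
    let ?F = "\<lambda>\<beta>. section_function s h (cmp GG \<gamma> (gpinv GG \<beta>)) * section_function t k \<beta>"
    have A: "{\<beta> \<in> fiber GG z. section_function t k \<beta> \<noteq> 0} \<subseteq> (if z \<in> source t then {germ \<theta> t z} else {})"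
      by (auto simp: fiber_eq section_function_germ split: if_splits)
    have "convolution GG (section_function s h) (section_function t k) \<gamma>
       = (\<Sum>\<beta>\<in>{\<beta> \<in> fiber GG z. section_function t k \<beta> \<noteq> 0}. ?F \<beta>)"
      using convolution_eq[OF assms True] r by simp
    also have "\<dots> = (\<Sum>\<beta>\<in>(if z \<in> source t then {germ \<theta> t z} else {}). ?F \<beta>)"
      by (rule sum.mono_neutral_left) (use A in \<open>auto split: if_splits\<close>)
    also have "\<dots> = (if z \<in> source t then kernel (section_function s h) (germ \<theta> r z) (germ \<theta> t z) * k z else 0)"
      using r by (simp add: kernel_def section_function_germ)
    also have "\<dots> = section_function (s * t) (\<lambda>z. if z \<in> source t then h (act t z) * k z else 0) \<gamma>"
      using r by (auto simp: kernel_section_function section_function_germ source_mult)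
    finally show ?thesis .
  qed
qed

lemma section_function_adjoint:
  "groupoid_adjoint GG (section_function s h) =
    section_function (s\<^sup>\<star>) (\<lambda>z. if z \<in> source (s\<^sup>\<star>) then cnj (h (act (s\<^sup>\<star>) z)) else 0)"
proof
  fix \<gamma>
  show "groupoid_adjoint GG (section_function s h) \<gamma> =
    section_function (s\<^sup>\<star>) (\<lambda>z. if z \<in> source (s\<^sup>\<star>) then cnj (h (act (s\<^sup>\<star>) z)) else 0) \<gamma>"
  proof (cases "\<gamma> \<in> topspace (arrows GG)")
    case False
    then show ?thesis using germ_in_arrows[of _ "s\<^sup>\<star>"] by (auto simp: groupoid_adjoint_def section_function_def)
  next
    case True
    then obtain r z where r: "z \<in> source r" "\<gamma> = germ \<theta> r z" by (rule arrowE)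
    note rr = act_in_range[OF r(1)] act_istar[OF r(1)]
    have iff: "act r z \<in> source s \<and> germ \<theta> (r\<^sup>\<star>) (act r z) = germ \<theta> s (act r z) \<longleftrightarrow>
        z \<in> source (s\<^sup>\<star>) \<and> germ \<theta> r z = germ \<theta> (s\<^sup>\<star>) z" (is "?L \<longleftrightarrow> ?R")
    proof
      assume L: ?L
      have a: "act s (act r z) = z"
        using germ_eq_act[of "act r z" "r\<^sup>\<star>" s] L rr by simp
      have "germ \<theta> r z = gpinv GG (germ \<theta> (r\<^sup>\<star>) (act r z))" using rr by simp
      also have "\<dots> = gpinv GG (germ \<theta> s (act r z))" using L by simp
      also have "\<dots> = germ \<theta> (s\<^sup>\<star>) z" using L a by simp
      finally show ?R using L a act_in_range[of "act r z" s] by simp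
    next
      assume R: ?R
      have a: "act r z = act (s\<^sup>\<star>) z"
        using germ_eq_act[of z r "s\<^sup>\<star>"] R r by simp
      have "germ \<theta> (r\<^sup>\<star>) (act r z) = gpinv GG (germ \<theta> r z)" using r by simp
      also have "\<dots> = gpinv GG (germ \<theta> (s\<^sup>\<star>) z)" using R by simp
      also have "\<dots> = germ \<theta> s (act r z)" using R a by simp
      finally show ?L using R a act_in_source[of z s] by simp
    qed
    have a: "act (s\<^sup>\<star>) z = act r z" if "z \<in> source (s\<^sup>\<star>)" "germ \<theta> r z = germ \<theta> (s\<^sup>\<star>) z"
      using germ_eq_act[of z r "s\<^sup>\<star>"] that r by simp
    have "groupoid_adjoint GG (section_function s h) \<gamma> = cnj (section_function s h (germ \<theta> (r\<^sup>\<star>) (act r z)))"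
      using True r by (simp add: groupoid_adjoint_def)
    also have "\<dots> = cnj (if act r z \<in> source s \<and> germ \<theta> (r\<^sup>\<star>) (act r z) = germ \<theta> s (act r z) then h (act r z) else 0)"
      using section_function_germ[OF rr(1), of s h] by simp
    also have "\<dots> = section_function (s\<^sup>\<star>) (\<lambda>z. if z \<in> source (s\<^sup>\<star>) then cnj (h (act (s\<^sup>\<star>) z)) else 0) \<gamma>"
      unfolding iff r(2) section_function_germ[OF r(1)] using a by auto
    finally show ?thesis .
  qed
qed

end

lemma sum_fun_apply: "(\<Sum>i\<in>I. f i) x = (\<Sum>i\<in>I. (f i x :: 'b::comm_monoid_add))"
  by (induction I rule: infinite_finite_induct) simp_all

section \<open>Functions vanishing at infinity\<close>

lemma continuous_map_complex_mult:
  fixes f g :: "'a \<Rightarrow> complex"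
  shows "continuous_map T euclidean f \<Longrightarrow> continuous_map T euclidean g \<Longrightarrow> continuous_map T euclidean (\<lambda>x. f x * g x)"
  by (simp add: continuous_map_atin tendsto_mult)

lemma continuous_map_prod:
  fixes f :: "'i \<Rightarrow> 'a \<Rightarrow> complex"
  shows "(\<And>i. i \<in> I \<Longrightarrow> continuous_map T euclidean (f i)) \<Longrightarrow> continuous_map T euclidean (\<lambda>x. \<Prod>i\<in>I. f i x)"
  by (simp add: continuous_map_atin tendsto_prod)

lemma closedin_superlevel:
  fixes f :: "'a \<Rightarrow> complex"
  assumes "continuous_map T euclidean f"
  shows "closedin T {x \<in> topspace T. \<epsilon> \<le> cmod (f x)}"
  using closedin_continuous_map_preimage[OF continuous_map_norm[OF assms], of "{\<epsilon>..}"] by simp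

lemma C0I:
  assumes f: "continuous_map T euclidean f" "\<And>x. x \<notin> topspace T \<Longrightarrow> f x = 0"
    and K: "\<And>\<epsilon>. 0 < \<epsilon> \<Longrightarrow> \<exists>K. compactin T K \<and> (\<forall>x\<in>topspace T - K. cmod (f x) < \<epsilon>)"
  shows "f \<in> C0 T"
  unfolding C0_def
proof (intro CollectI conjI allI impI f)
  fix \<epsilon> :: real assume "0 < \<epsilon>"
  then obtain K where "compactin T K" "\<forall>x\<in>topspace T - K. cmod (f x) < \<epsilon>" using K by blast
  then show "compactin T {x \<in> topspace T. \<epsilon> \<le> cmod (f x)}"
    by (intro closed_compactin[OF _ _ closedin_superlevel[OF f(1)]]) force+
qed

lemma C0D:
  assumes "f \<in> C0 T"
  shows "continuous_map T euclidean f" "x \<notin> topspace T \<Longrightarrow> f x = 0"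
    "0 < \<epsilon> \<Longrightarrow> compactin T {x \<in> topspace T. \<epsilon> \<le> cmod (f x)}"
  using assms by (auto simp: C0_def)

lemma C0_bounded:
  assumes f: "f \<in> C0 T"
  obtains M where "0 \<le> M" "\<And>x. cmod (f x) \<le> M"
proof -
  have "compact (f ` {x \<in> topspace T. 1 \<le> cmod (f x)})"
    using image_compactin[OF C0D(3)[OF f, of 1] C0D(1)[OF f]] by simp
  then have "bounded (f ` {x \<in> topspace T. 1 \<le> cmod (f x)})" by (rule compact_imp_bounded)
  then obtain M where M: "\<forall>y\<in>f ` {x \<in> topspace T. 1 \<le> cmod (f x)}. cmod y \<le> M"
    unfolding bounded_iff by (elim exE)
  have "cmod (f x) \<le> max 1 M" for x
  proof (cases "x \<in> topspace T \<and> 1 \<le> cmod (f x)")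
    case True
    then have "cmod (f x) \<le> M" using M by (simp only: ball_simps mem_Collect_eq)
    then show ?thesis by simp
  next
    case False
    then show ?thesis using C0D(2)[OF f, of x] by (cases "x \<in> topspace T") auto
  qed
  then show thesis using that[of "max 1 M"] by simp
qed

lemma C0_dominated:
  assumes f: "continuous_map T euclidean f" and g: "g \<in> C0 T"
    and le: "\<And>x. cmod (f x) \<le> c * cmod (g x)"
  shows "f \<in> C0 T"
proof (rule C0I[OF f])
  show "f x = 0" if "x \<notin> topspace T" for x using le[of x] C0D(2)[OF g that] by simp
  fix \<epsilon> :: real assume e: "0 < \<epsilon>"
  define d where "d = \<epsilon> / (\<bar>c\<bar> + 1)"
  have d: "0 < d" using e by (simp add: d_def add_nonneg_pos)
  have "cmod (f x) < \<epsilon>" if "cmod (g x) < d" for x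
  proof -
    have "cmod (f x) \<le> (\<bar>c\<bar> + 1) * cmod (g x)"
      by (rule order_trans[OF le mult_right_mono]) simp_all
    also have "\<dots> < (\<bar>c\<bar> + 1) * d" using that by (intro mult_strict_left_mono) auto
    also have "\<dots> = \<epsilon>" by (simp add: d_def add_nonneg_eq_0_iff)
    finally show ?thesis .
  qed
  then show "\<exists>K. compactin T K \<and> (\<forall>x\<in>topspace T - K. cmod (f x) < \<epsilon>)"
    using C0D(3)[OF g d] by (intro exI[of _ "{x \<in> topspace T. d \<le> cmod (g x)}"]) (auto simp: not_le)
qed

lemma C0_zero [simp]: "0 \<in> C0 T" "(\<lambda>_. 0) \<in> C0 T"
proof -
  show "(\<lambda>_. 0) \<in> C0 T" by (rule C0I) (auto intro!: exI[of _ "{}"])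
  then show "0 \<in> C0 T" by (simp add: zero_fun_def)
qed

lemma C0_add: 
  assumes f: "f \<in> C0 T" and g: "g \<in> C0 T" shows "f + g \<in> C0 T"
proof (rule C0I)
  show "continuous_map T euclidean (f + g)" 
    using continuous_map_add[OF C0D(1)[OF f] C0D(1)[OF g]] by (simp add: plus_fun_def)
  show "(f + g) x = 0" if "x \<notin> topspace T" for x using C0D(2)[OF f that] C0D(2)[OF g that] by simp
  fix \<epsilon> :: real assume e: "0 < \<epsilon>"
  have "cmod (f x + g x) < \<epsilon>" if "cmod (f x) < \<epsilon> / 2" "cmod (g x) < \<epsilon> / 2" for x
    using norm_triangle_ineq[of "f x" "g x"] that by simp
  then show "\<exists>K. compactin T K \<and> (\<forall>x\<in>topspace T - K. cmod ((f + g) x) < \<epsilon>)"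
    using compactin_Un[OF C0D(3)[OF f, of "\<epsilon>/2"] C0D(3)[OF g, of "\<epsilon>/2"]] e
    by (intro exI[of _ "{x \<in> topspace T. \<epsilon>/2 \<le> cmod (f x)} \<union> {x \<in> topspace T. \<epsilon>/2 \<le> cmod (g x)}"]) (auto simp: not_le)
qed

lemma C0_sum: "(\<And>i. i \<in> I \<Longrightarrow> f i \<in> C0 T) \<Longrightarrow> (\<Sum>i\<in>I. f i) \<in> C0 T"
  by (induction I rule: infinite_finite_induct) (auto intro: C0_add)

lemma C0_scale: 
  assumes f: "f \<in> C0 T" shows "(\<lambda>x. c * f x) \<in> C0 T"
proof (rule C0_dominated[OF _ f])
  show "continuous_map T euclidean (\<lambda>x. c * f x)"
    by (intro continuous_map_complex_mult C0D(1)[OF f]) simp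
  show "cmod (c * f x) \<le> cmod c * cmod (f x)" for x by (simp add: norm_mult)
qed

lemma C0_cnj: 
  assumes f: "f \<in> C0 T" shows "(\<lambda>x. cnj (f x)) \<in> C0 T"
proof (rule C0_dominated[OF _ f])
  show "continuous_map T euclidean (\<lambda>x. cnj (f x))"
    using C0D(1)[OF f] by (simp add: continuous_map_atin tendsto_cnj)
  show "cmod (cnj (f x)) \<le> 1 * cmod (f x)" for x by simp
qed

lemma C0_mult: 
  assumes f: "f \<in> C0 T" and g: "g \<in> C0 T" shows "f * g \<in> C0 T"
proof -
  obtain M where M: "0 \<le> M" "\<And>x. cmod (f x) \<le> M" using C0_bounded[OF f] by blast
  have "continuous_map T euclidean (f * g)"
    using continuous_map_complex_mult[OF C0D(1)[OF f] C0D(1)[OF g]] by (simp add: times_fun_def)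
  then show ?thesis
    by (rule C0_dominated[OF _ g, of _ M]) (simp add: norm_mult mult_right_mono M)
qed

text \<open>Feeds \<open>l2_moduleI\<close>, where the sum of squares of a family with uniformly
  small tails is a uniform limit of finite sums.\<close>

lemma C0_uniform_closed:
  assumes f: "\<And>\<epsilon>. 0 < \<epsilon> \<Longrightarrow> \<exists>g\<in>C0 T. \<forall>x. cmod (f x - g x) \<le> \<epsilon>"
  shows "f \<in> C0 T"
proof -
  have "\<exists>g. g \<in> C0 T \<and> (\<forall>x. cmod (f x - g x) \<le> inverse (Suc n))" for n using f[of "inverse (Suc n)"] by auto
  then obtain g where g: "\<And>n. g n \<in> C0 T" "\<And>n x. cmod (f x - g n x) \<le> inverse (Suc n)" by metis
  have small: "\<exists>n. inverse (real (Suc n)) < e" if "0 < e" for e :: real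
    using reals_Archimedean[OF that] by auto
  show ?thesis
  proof (rule C0I)
    show "continuous_map T euclidean f"
      unfolding continuous_map_atin limitin_canonical_iff
    proof (intro ballI tendstoI)
      fix x and e :: real assume x: "x \<in> topspace T" and e: "0 < e"
      obtain n where n: "inverse (real (Suc n)) < e / 3" using small[of "e / 3"] e by auto
      have "((g n) \<longlongrightarrow> g n x) (atin T x)"
        using C0D(1)[OF g(1)[of n]] x by (simp add: continuous_map_atin)
      then have "\<forall>\<^sub>F y in atin T x. dist (g n y) (g n x) < e / 3" using e by (intro tendstoD) auto
      then show "\<forall>\<^sub>F y in atin T x. dist (f y) (f x) < e"
      proof (rule eventually_mono)
        fix y assume y: "dist (g n y) (g n x) < e / 3"
        have "f y - f x = (f y - g n y) + (g n y - g n x) - (f x - g n x)" by simp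
        then have "cmod (f y - f x) \<le> cmod (f y - g n y) + cmod (g n y - g n x) + cmod (f x - g n x)"
          by (metis norm_triangle_ineq norm_triangle_ineq4 add_right_mono order_trans)
        then show "dist (f y) (f x) < e"
          using y n g(2)[of y n] g(2)[of x n] by (simp add: dist_norm)
      qed
    qed
    show "f x = 0" if "x \<notin> topspace T" for x
    proof -
      have "cmod (f x) \<le> 0"
      proof (rule field_le_epsilon)
        fix e :: real assume "0 < e"
        then obtain n where "inverse (real (Suc n)) < e" using small by blast
        then show "cmod (f x) \<le> 0 + e" using g(2)[of x n] C0D(2)[OF g(1) that, of n] by simp
      qed
      then show ?thesis by simp
    qed
    fix e :: real assume e: "0 < e"
    obtain n where n: "inverse (real (Suc n)) < e / 2" using small[of "e / 2"] e by auto
    have "cmod (f x) < e" if "cmod (g n x) < e / 2" for x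
      using norm_triangle_ineq[of "f x - g n x" "g n x"] g(2)[of x n] n that by simp
    then show "\<exists>K. compactin T K \<and> (\<forall>x\<in>topspace T - K. cmod (f x) < e)"
      using C0D(3)[OF g(1)[of n], of "e / 2"] e
      by (intro exI[of _ "{x \<in> topspace T. e / 2 \<le> cmod (g n x)}"]) (auto simp: not_le)
  qed
qed

lemma Cc_compact_support:
  assumes "f \<in> Cc T"
  obtains K where "compactin T K" "\<And>x. x \<notin> K \<Longrightarrow> f x = 0"
proof
  let ?S = "{x \<in> topspace T. f x \<noteq> 0}"
  show "compactin T (T closure_of ?S)" using assms by (simp add: Cc_def)
  show "f x = 0" if "x \<notin> T closure_of ?S" for x
    using that closure_of_subset[of ?S T] assms by (auto simp: Cc_def)
qed

lemma CcI:
  assumes "Hausdorff_space T" "continuous_map T euclidean f" "compactin T K" "\<And>x. x \<notin> K \<Longrightarrow> f x = 0"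
  shows "f \<in> Cc T"
  unfolding Cc_def
proof (intro CollectI conjI allI impI)
  have "T closure_of {x \<in> topspace T. f x \<noteq> 0} \<subseteq> K"
    using assms compactin_imp_closedin by (intro closure_of_minimal) auto
  then show "compactin T (T closure_of {x \<in> topspace T. f x \<noteq> 0})"
    by (intro closed_compactin[OF assms(3)]) auto
qed (use assms compactin_subset_topspace in auto)

lemma Cc_subset_C0: 
  assumes f: "f \<in> Cc T" shows "f \<in> C0 T"
proof -
  obtain K where K: "compactin T K" "\<And>x. x \<notin> K \<Longrightarrow> f x = 0" using Cc_compact_support[OF f] by blast
  show ?thesis by (rule C0I) (use f K in \<open>auto simp: Cc_def intro!: exI[of _ K]\<close>)
qed

text \<open>Continuity of the extension by zero is the point. Preimages of open sets that miss 0 lie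
  inside U; for open sets containing 0 the complement of a compact superlevel set is added, and that
  complement is open because Z is Hausdorff.\<close>

lemma C0_subtopology_iff:
  assumes Z: "Hausdorff_space Z" and U: "openin Z U"
  shows "f \<in> C0 (subtopology Z U) \<longleftrightarrow> f \<in> C0 Z \<and> (\<forall>x. x \<notin> U \<longrightarrow> f x = 0)"
proof -
  have UZ: "U \<subseteq> topspace Z" using U by (rule openin_subset)
  then have top: "topspace (subtopology Z U) = U" by (simp add: Int_absorb1)
  show ?thesis
  proof (intro iffI conjI allI impI)
    assume f: "f \<in> C0 (subtopology Z U)"
    have K: "compactin Z {x \<in> U. e \<le> cmod (f x)}" if "0 < e" for e
      using C0D(3)[OF f that] unfolding top compactin_subtopology by blast
    show z: "f x = 0" if "x \<notin> U" for x using C0D(2)[OF f] that top by simp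
    show "f \<in> C0 Z"
    proof (rule C0I)
      show "continuous_map Z euclidean f"
        unfolding continuous_map_def
      proof (intro conjI allI impI)
        fix V :: "complex set" assume V: "openin euclidean V"
        have "openin (subtopology Z U) {x \<in> U. f x \<in> V}"
          using openin_continuous_map_preimage[OF C0D(1)[OF f] V] unfolding top .
        then have o: "openin Z {x \<in> U. f x \<in> V}" using U by (simp add: openin_open_subtopology)
        show "openin Z {x \<in> topspace Z. f x \<in> V}"
        proof (cases "0 \<in> V")
          case False
          then have "{x \<in> topspace Z. f x \<in> V} = {x \<in> U. f x \<in> V}" using z UZ by force
          then show ?thesis using o by simp
        next
          case True
          then obtain e where e: "0 < e" "ball 0 e \<subseteq> V" using V open_contains_ball[of V] True by (auto simp flip: open_openin)
          have "{x \<in> topspace Z. f x \<in> V} = {x \<in> U. f x \<in> V} \<union> (topspace Z - {x \<in> U. e \<le> cmod (f x)})"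
          proof -
            have "f x \<in> V" if "cmod (f x) < e" for x using e that by auto
            moreover have "f x \<in> V" if "x \<notin> U" for x using z that True by simp
            ultimately show ?thesis using UZ by fastforce
          qed
          then show ?thesis using o compactin_imp_closedin[OF Z K[OF e(1)]] by auto
        qed
      qed auto
      show "f x = 0" if "x \<notin> topspace Z" for x using z that UZ by blast
      show "\<exists>K. compactin Z K \<and> (\<forall>x\<in>topspace Z - K. cmod (f x) < e)" if "0 < e" for e
      proof (intro exI[of _ "{x \<in> U. e \<le> cmod (f x)}"] conjI K[OF that] ballI)
        show "cmod (f x) < e" if "x \<in> topspace Z - {x \<in> U. e \<le> cmod (f x)}" for x
          using that z[of x] \<open>0 < e\<close> by (cases "x \<in> U") auto
      qed
    qed
  next
    assume f: "f \<in> C0 Z \<and> (\<forall>x. x \<notin> U \<longrightarrow> f x = 0)"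
    show "f \<in> C0 (subtopology Z U)"
    proof (rule C0I)
      show "continuous_map (subtopology Z U) euclidean f"
        using f C0D(1) by (blast intro: continuous_map_from_subtopology)
      fix e :: real assume e: "0 < e"
      have "{x \<in> topspace Z. e \<le> cmod (f x)} \<subseteq> U" using f e by force
      then show "\<exists>K. compactin (subtopology Z U) K \<and> (\<forall>x\<in>topspace (subtopology Z U) - K. cmod (f x) < e)"
        using C0D(3)[of f Z e] f e
        by (intro exI[of _ "{x \<in> topspace Z. e \<le> cmod (f x)}"]) (auto simp: compactin_subtopology)
    qed (use f top in auto)
  qed
qed

lemma Cc_subtopology_iff:
  assumes Z: "Hausdorff_space Z" and U: "openin Z U"
  shows "f \<in> Cc (subtopology Z U) \<longleftrightarrow>
    continuous_map Z euclidean f \<and> (\<exists>K. compactin Z K \<and> K \<subseteq> U \<and> (\<forall>x. x \<notin> K \<longrightarrow> f x = 0))"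
proof
  assume f: "f \<in> Cc (subtopology Z U)"
  obtain K where "compactin (subtopology Z U) K" "\<And>x. x \<notin> K \<Longrightarrow> f x = 0" using Cc_compact_support[OF f] by blast
  then show "continuous_map Z euclidean f \<and> (\<exists>K. compactin Z K \<and> K \<subseteq> U \<and> (\<forall>x. x \<notin> K \<longrightarrow> f x = 0))"
    using C0D(1)[of f Z] Cc_subset_C0[OF f] C0_subtopology_iff[OF Z U] by (auto simp: compactin_subtopology)
next
  assume "continuous_map Z euclidean f \<and> (\<exists>K. compactin Z K \<and> K \<subseteq> U \<and> (\<forall>x. x \<notin> K \<longrightarrow> f x = 0))"
  then obtain K where "continuous_map Z euclidean f" "compactin Z K" "K \<subseteq> U" "\<And>x. x \<notin> K \<Longrightarrow> f x = 0" by blast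
  then show "f \<in> Cc (subtopology Z U)"
    by (intro CcI[OF Hausdorff_space_subtopology[OF Z], of _ _ K])
      (auto intro: continuous_map_from_subtopology simp: compactin_subtopology)
qed

text \<open>Urysohn's lemma is applied in U, which is locally compact Hausdorff and so completely
  regular, to K and the complement of a neighbourhood V of K inside a compact set; that compact set
  supports the extension by zero.\<close>

lemma bump_function:
  assumes Y: "locally_compact_space Y" "Hausdorff_space Y" and U: "openin Y U"
    and K: "compactin Y K" "K \<subseteq> U"
  obtains \<rho> where "\<rho> \<in> Cc (subtopology Y U)" "\<And>y. y \<in> K \<Longrightarrow> \<rho> y = 1" "\<And>y. cmod (\<rho> y) \<le> 1"
proof -
  let ?Y = "subtopology Y U"
  have top: "topspace ?Y = U" using openin_subset[OF U] by (simp add: Int_absorb1)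
  have lc: "locally_compact_space ?Y" "Hausdorff_space ?Y"
    using Y U by (auto intro: locally_compact_space_open_subset Hausdorff_space_subtopology)
  have "compactin ?Y K" using K by (simp add: compactin_subtopology)
  then obtain V L where VL: "openin ?Y V" "compactin ?Y L" "K \<subseteq> V" "V \<subseteq> L"
    using locally_compact_space_compact_closed_compact[of ?Y] lc by metis
  have "completely_regular_space ?Y" using lc locally_compact_regular_imp_completely_regular_space by blast
  moreover have "closedin ?Y (topspace ?Y - V)" using VL by blast
  ultimately obtain f where f: "continuous_map ?Y (top_of_set {0..1::real}) f" "f ` (topspace ?Y - V) \<subseteq> {0}" "f ` K \<subseteq> {1}"
    using Urysohn_completely_regular_compact_closed[of 0 1 ?Y K "topspace ?Y - V"] \<open>compactin ?Y K\<close> VL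
    by (auto simp: disjnt_def) 
  define \<rho> where "\<rho> = (\<lambda>y. if y \<in> U then complex_of_real (f y) else 0)"
  have cf: "continuous_map ?Y euclideanreal f" using f(1) continuous_map_in_subtopology by blast
  have "continuous_map ?Y euclidean (\<lambda>y. complex_of_real (f y))"
    using cf by (simp add: continuous_map_atin tendsto_of_real)
  then have cr: "continuous_map ?Y euclidean \<rho>"
    by (rule continuous_map_eq) (simp add: \<rho>_def)
  show thesis
  proof
    show "\<rho> \<in> Cc ?Y"
      by (rule CcI[OF lc(2) cr VL(2)]) (use f(2) VL(4) top in \<open>auto simp: \<rho>_def\<close>)
    show "\<rho> y = 1" if "y \<in> K" for y using that f(3) K by (auto simp: \<rho>_def)
    show "cmod (\<rho> y) \<le> 1" for y
      using f(1) top by (auto simp: \<rho>_def continuous_map_in_subtopology Pi_iff)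
  qed
qed

text \<open>The value 1 on a whole neighbourhood, not only at x, is what lets finitely many such
  functions replace a partition of unity over a compact set.\<close>

lemma local_bump_function:
  assumes Y: "locally_compact_space Y" "Hausdorff_space Y" and U: "openin Y U" and x: "x \<in> U"
  obtains \<rho> V where "\<rho> \<in> Cc (subtopology Y U)" "openin Y V" "x \<in> V" "V \<subseteq> U" "\<And>y. y \<in> V \<Longrightarrow> \<rho> y = 1" "\<And>y. cmod (\<rho> y) \<le> 1"
proof -
  let ?Y = "subtopology Y U"
  have lc: "locally_compact_space ?Y" "Hausdorff_space ?Y"
    using Y U by (auto intro: locally_compact_space_open_subset Hausdorff_space_subtopology)
  have "compactin ?Y {x}" using x openin_subset[OF U] by auto
  then obtain V L where VL: "openin ?Y V" "compactin ?Y L" "{x} \<subseteq> V" "V \<subseteq> L"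
    using locally_compact_space_compact_closed_compact[of ?Y] lc by metis
  have L: "compactin Y L" "L \<subseteq> U" "openin Y V" using VL U by (auto simp: compactin_subtopology openin_open_subtopology)
  show thesis
  proof (rule bump_function[OF Y U L(1,2)])
    fix \<rho> assume \<rho>: "\<rho> \<in> Cc ?Y" "\<And>y. y \<in> L \<Longrightarrow> \<rho> y = 1" "\<And>y. cmod (\<rho> y) \<le> 1"
    show thesis by (rule that[of \<rho> V]) (use \<rho> VL L in auto)
  qed
qed

section \<open>The functions on a transformation groupoid\<close>

text \<open>The scalar multiplication is written exactly as in \<open>groupoid_functions\<close>, so
  that the span there is \<open>fun_module.span\<close>.\<close>

interpretation fun_module: module "\<lambda>(c :: complex) f (\<gamma> :: 'g). c * f \<gamma>"
  by unfold_locales (auto simp: fun_eq_iff algebra_simps)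

locale locally_compact_action = partial_action Z \<theta>
  for Z :: "'z topology" and \<theta> :: "'s::inverse_semigroup \<Rightarrow> 'z \<rightharpoonup> 'z" +
  assumes locally_compact: "locally_compact_space Z" and Hausdorff: "Hausdorff_space Z"
begin

lemma topspace_source [simp]: "topspace (subtopology Z (source s)) = source s"
  using source_subset[of s] by (simp add: Int_absorb1)

lemma C0_source_iff: "f \<in> C0 (subtopology Z (source s)) \<longleftrightarrow> f \<in> C0 Z \<and> (\<forall>z. z \<notin> source s \<longrightarrow> f z = 0)"
  by (rule C0_subtopology_iff[OF Hausdorff openin_source])

lemma Cc_source_iff: "f \<in> Cc (subtopology Z (source s)) \<longleftrightarrow>
    continuous_map Z euclidean f \<and> (\<exists>K. compactin Z K \<and> K \<subseteq> source s \<and> (\<forall>z. z \<notin> K \<longrightarrow> f z = 0))"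
  by (rule Cc_subtopology_iff[OF Hausdorff openin_source])

section \<open>Coefficient functions of products and adjoints\<close>

lemma continuous_map_act_full: "continuous_map (subtopology Z (source s)) Z (act s)"
  using continuous_map_act continuous_map_into_fulltopology by blast

lemma C0_product:
  assumes f: "f \<in> C0 (subtopology Z (source s))" and k: "k \<in> C0 (subtopology Z (source t))"
  shows "(\<lambda>z. if z \<in> source t then f (act t z) * k z else 0) \<in> C0 (subtopology Z (source (s * t)))"
    (is "?g \<in> _")
proof -
  have fZ: "f \<in> C0 Z" using f C0_source_iff by blast
  obtain M where M: "0 \<le> M" "\<And>x. cmod (f x) \<le> M" using C0_bounded[OF fZ] by blast
  have "?g \<in> C0 (subtopology Z (source t))"
  proof (rule C0_dominated[OF _ k, of _ M])
    have "continuous_map (subtopology Z (source t)) euclidean (\<lambda>z. f (act t z) * k z)"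
      using continuous_map_compose[OF continuous_map_act_full[of t] C0D(1)[OF fZ]] C0D(1)[OF k]
      by (intro continuous_map_complex_mult) (auto simp: o_def)
    then show "continuous_map (subtopology Z (source t)) euclidean ?g"
      by (rule continuous_map_eq) simp
    show "cmod (?g x) \<le> M * cmod (k x)" for x
      using M by (auto simp: norm_mult intro!: mult_right_mono)
  qed
  moreover have "?g z = 0" if "z \<notin> source (s * t)" for z
    using that f by (auto simp: source_mult C0_source_iff)
  ultimately show ?thesis by (simp add: C0_source_iff)
qed

lemma C0_adjoint:
  assumes f: "f \<in> C0 (subtopology Z (source s))"
  shows "(\<lambda>z. if z \<in> source (s\<^sup>\<star>) then cnj (f (act (s\<^sup>\<star>) z)) else 0) \<in> C0 (subtopology Z (source (s\<^sup>\<star>)))"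
    (is "?g \<in> _")
proof (rule C0I)
  have fZ: "f \<in> C0 Z" using f C0_source_iff by blast
  have "continuous_map (subtopology Z (source (s\<^sup>\<star>))) euclidean (\<lambda>z. cnj (f (act (s\<^sup>\<star>) z)))"
    using continuous_map_compose[OF continuous_map_act_full[of "s\<^sup>\<star>"] C0D(1)[OF C0_cnj[OF fZ]]] by (simp add: o_def)
  then show "continuous_map (subtopology Z (source (s\<^sup>\<star>))) euclidean ?g"
    by (rule continuous_map_eq) (use topspace_source[of "s\<^sup>\<star>"] in simp)
  show "?g z = 0" if "z \<notin> topspace (subtopology Z (source (s\<^sup>\<star>)))" for z using that unfolding topspace_source by simp
  fix e :: real assume e: "0 < e"
  let ?K = "{x \<in> source s. e \<le> cmod (f x)}"
  have "compactin (subtopology Z (source s)) ?K" using C0D(3)[OF f e] unfolding topspace_source .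
  then have "compactin (subtopology Z (source (s\<^sup>\<star>))) (act s ` ?K)"
    using image_compactin continuous_map_act by blast
  moreover have "cmod (?g z) < e" if "z \<notin> act s ` ?K" for z
    using that e act_in_source[of z s] act_istar'[of z s] by (force simp: not_le)
  ultimately show "\<exists>K. compactin (subtopology Z (source (s\<^sup>\<star>))) K \<and>
      (\<forall>z\<in>topspace (subtopology Z (source (s\<^sup>\<star>))) - K. cmod (?g z) < e)" by blast
qed

lemma Cc_product:
  assumes f: "f \<in> Cc (subtopology Z (source s))" and k: "k \<in> Cc (subtopology Z (source t))"
  shows "(\<lambda>z. if z \<in> source t then f (act t z) * k z else 0) \<in> Cc (subtopology Z (source (s * t)))"
    (is "?g \<in> _")
proof -
  obtain K where K: "compactin Z K" "K \<subseteq> source s" "\<And>z. z \<notin> K \<Longrightarrow> f z = 0" using f Cc_source_iff by blast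
  obtain L where L: "compactin Z L" "L \<subseteq> source t" "\<And>z. z \<notin> L \<Longrightarrow> k z = 0" using k Cc_source_iff by blast
  let ?P = "{z \<in> source t. act t z \<in> K}"
  show ?thesis unfolding Cc_source_iff
  proof (intro conjI exI[of _ "?P \<inter> L"])
  show "continuous_map Z euclidean ?g"
    using C0_product[OF Cc_subset_C0[OF f] Cc_subset_C0[OF k]] unfolding C0_source_iff by (blast intro: C0D(1))
  have "closedin (subtopology Z (source t)) ?P"
    using closedin_continuous_map_preimage[OF continuous_map_act_full compactin_imp_closedin[OF Hausdorff K(1)], of t] unfolding topspace_source .
  moreover have "compactin (subtopology Z (source t)) L" using L by (simp add: compactin_subtopology)
  ultimately have "compactin (subtopology Z (source t)) (?P \<inter> L)" by (rule closed_Int_compactin)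
  then show "compactin Z (?P \<inter> L)" by (simp add: compactin_subtopology)
  show "?P \<inter> L \<subseteq> source (s * t)" using K(2) by (auto simp: source_mult)
  show "\<forall>z. z \<notin> ?P \<inter> L \<longrightarrow> ?g z = 0" using K(3) L(3) by auto
  qed
qed

lemma Cc_adjoint:
  assumes f: "f \<in> Cc (subtopology Z (source s))"
  shows "(\<lambda>z. if z \<in> source (s\<^sup>\<star>) then cnj (f (act (s\<^sup>\<star>) z)) else 0) \<in> Cc (subtopology Z (source (s\<^sup>\<star>)))"
    (is "?g \<in> _")
proof -
  obtain K where K: "compactin Z K" "K \<subseteq> source s" "\<And>z. z \<notin> K \<Longrightarrow> f z = 0" using f Cc_source_iff by blast
  show ?thesis unfolding Cc_source_iff
  proof (intro conjI exI[of _ "act s ` K"])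
  show "continuous_map Z euclidean ?g"
    using C0_adjoint[OF Cc_subset_C0[OF f]] unfolding C0_source_iff by (blast intro: C0D(1))
  show "compactin Z (act s ` K)"
    using K by (intro image_compactin[OF _ continuous_map_act_full]) (simp add: compactin_subtopology)
  show "act s ` K \<subseteq> source (s\<^sup>\<star>)" using K(2) act_in_range by blast
  show "\<forall>z. z \<notin> act s ` K \<longrightarrow> ?g z = 0"
    using K(3) act_istar' by force
  qed
qed

text \<open>The sheets over open sets generate the topology as a subbasis, yet they form a basis:
  two that meet in a germ agree near it, on the set fixed by the idempotent that witnesses equality
  of the germs.\<close>

lemma openin_arrows_basis:
  assumes "openin (arrows GG) W" "\<gamma> \<in> W"
  shows "\<exists>s U z. openin Z U \<and> U \<subseteq> source s \<and> z \<in> U \<and> \<gamma> = germ \<theta> s z \<and> germ \<theta> s ` U \<subseteq> W"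
proof -
  have "generate_topology_on {germ \<theta> s ` U |s U. openin Z U \<and> U \<subseteq> source s} W"
    using assms by (simp add: transformation_groupoid_def openin_topology_generated_by_iff)
  then show ?thesis using assms(2)
  proof (induction arbitrary: \<gamma>)
    case (Int A B)
    have "\<gamma> \<in> A" "\<gamma> \<in> B" using Int.prems by auto
    obtain s U z where s: "openin Z U" "U \<subseteq> source s" "z \<in> U" "\<gamma> = germ \<theta> s z" "germ \<theta> s ` U \<subseteq> A"
      using Int.IH(1)[OF \<open>\<gamma> \<in> A\<close>] by (elim exE conjE) (rule that)
    obtain t V w where t: "openin Z V" "V \<subseteq> source t" "w \<in> V" "\<gamma> = germ \<theta> t w" "germ \<theta> t ` V \<subseteq> B"
      using Int.IH(2)[OF \<open>\<gamma> \<in> B\<close>] by (elim exE conjE) (rule that)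
    have "w = z \<and> (\<exists>e\<in>idempotents. s * e = t * e \<and> z \<in> idset \<theta> e)"
      using germ_eq_iff[OF subsetD[OF s(2,3)] subsetD[OF t(2,3)]] s(4) t(4) by metis
    then obtain e where e: "w = z" "e \<in> idempotents" "s * e = t * e" "z \<in> idset \<theta> e" by blast
    let ?U = "U \<inter> V \<inter> idset \<theta> e"
    have "germ \<theta> s y = germ \<theta> t y" if "y \<in> ?U" for y
      using that e s(2) t(2) germ_eq_iff[of y s y t] by auto
    then have "germ \<theta> s ` ?U \<subseteq> A \<inter> B" using s(5) t(5) by (auto simp: image_subset_iff)
    then show ?case using s t e openin_idset by (intro exI[of _ s] exI[of _ ?U] exI[of _ z]) auto
  next
    case (UN K)
    then obtain k where "k \<in> K" "\<gamma> \<in> k" by blast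
    then show ?case using UN.IH[of k \<gamma>] by (meson Sup_upper subset_trans)
  qed auto
qed

lemma openin_germ_image: "openin Z U \<Longrightarrow> U \<subseteq> source s \<Longrightarrow> openin (arrows GG) (germ \<theta> s ` U)"
  unfolding transformation_groupoid_def topological_groupoid.simps
  by (rule topology_generated_by_Basis) blast

lemma continuous_map_germ: "continuous_map (subtopology Z (source s)) (arrows GG) (germ \<theta> s)"
  unfolding transformation_groupoid_def topological_groupoid.simps
proof (rule continuous_on_generated_topo)
  fix W assume "W \<in> {germ \<theta> s ` U |s U. openin Z U \<and> U \<subseteq> source s}"
  then obtain t U where W: "W = germ \<theta> t ` U" "openin Z U" "U \<subseteq> source t" by blast
  \<comment> \<open>Equality of germs is witnessed by an idempotent e, and each witness works on the
    whole open set fixed by e; so the preimage is a union of open sets.\<close>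
  have eq: "germ \<theta> s -` W \<inter> source s = (\<Union>e\<in>{e \<in> idempotents. s * e = t * e}. U \<inter> idset \<theta> e) \<inter> source s"
  proof (intro set_eqI iffI)
    fix x assume x: "x \<in> germ \<theta> s -` W \<inter> source s"
    then obtain u where "u \<in> U" "germ \<theta> s x = germ \<theta> t u" using W(1) by auto
    then show "x \<in> (\<Union>e\<in>{e \<in> idempotents. s * e = t * e}. U \<inter> idset \<theta> e) \<inter> source s"
      using x W(3) germ_eq_iff[of x s u t] by auto
  next
    fix x assume "x \<in> (\<Union>e\<in>{e \<in> idempotents. s * e = t * e}. U \<inter> idset \<theta> e) \<inter> source s"
    then have x: "x \<in> source s" "x \<in> U" "\<exists>e\<in>idempotents. s * e = t * e \<and> x \<in> idset \<theta> e" by auto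
    then have "germ \<theta> s x = germ \<theta> t x" using W(3) germ_eq_iff[of x s x t] by auto
    then show "x \<in> germ \<theta> s -` W \<inter> source s" using x W(1) by auto
  qed
  have "openin Z (germ \<theta> s -` W \<inter> source s)"
    unfolding eq using W openin_idset by (intro openin_Int openin_Union openin_source) auto
  then show "openin (subtopology Z (source s)) (germ \<theta> s -` W \<inter> topspace (subtopology Z (source s)))"
    unfolding topspace_source by (simp add: openin_open_subtopology)
next
  show "germ \<theta> s ` topspace (subtopology Z (source s)) \<subseteq> \<Union> {germ \<theta> s ` U |s U. openin Z U \<and> U \<subseteq> source s}"
    unfolding topspace_source
    by (rule Union_upper) (auto intro!: exI[of _ s] exI[of _ "source s"] source_subset)
qed

abbreviation sheet :: "'s \<Rightarrow> ('s \<times> 'z) set set" where "sheet s \<equiv> germ \<theta> s ` source s"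

lemma topspace_sheet [simp]: "topspace (subtopology (arrows GG) (sheet s)) = sheet s"
  by auto

lemma continuous_map_dm_sheet: "continuous_map (subtopology (arrows GG) (sheet s)) Z (dm GG)"
  unfolding continuous_map_def
proof (intro conjI allI impI)
  show "dm GG \<in> topspace (subtopology (arrows GG) (sheet s)) \<rightarrow> topspace Z"
    by (auto intro: subsetD[OF source_subset])
  fix V assume V: "openin Z V"
  have "{\<gamma> \<in> topspace (subtopology (arrows GG) (sheet s)). dm GG \<gamma> \<in> V} = germ \<theta> s ` (V \<inter> source s)" by auto
  then show "openin (subtopology (arrows GG) (sheet s)) {\<gamma> \<in> topspace (subtopology (arrows GG) (sheet s)). dm GG \<gamma> \<in> V}"
    using V by (simp add: openin_open_subtopology openin_germ_image openin_Int)  auto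
qed

lemma open_bisection_sheet: "open_bisection GG (sheet s)"
  unfolding open_bisection_def
proof (intro conjI)
  show "openin (arrows GG) (sheet s)" by (simp add: openin_germ_image)
  show "inj_on (dm GG) (sheet s)" by (auto simp: inj_on_def)
  show "inj_on (rg GG) (sheet s)" by (auto simp: inj_on_def dest: act_inj)
qed

lemma section_function_Cc:
  assumes h: "h \<in> Cc (subtopology Z (source s))"
  shows "section_function s h \<in> Cc (subtopology (arrows GG) (sheet s))"
proof -
  obtain K where K: "compactin Z K" "K \<subseteq> source s" "\<And>z. z \<notin> K \<Longrightarrow> h z = 0" using h Cc_source_iff by blast
  show ?thesis
  proof (rule CcI)
    \<comment> \<open>The sheet is Hausdorff although the groupoid need not be: d is continuous and
      injective on it.\<close>
    have "inj_on (dm GG) (topspace (subtopology (arrows GG) (sheet s)))"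
      using open_bisection_sheet[of s] unfolding open_bisection_def topspace_sheet by blast
    then show "Hausdorff_space (subtopology (arrows GG) (sheet s))"
      by (rule Hausdorff_space_injective_preimage[OF Hausdorff continuous_map_dm_sheet])
    have "continuous_map (subtopology (arrows GG) (sheet s)) euclidean (h \<circ> dm GG)"
      using h Cc_source_iff by (intro continuous_map_compose[OF continuous_map_dm_sheet]) blast
    then show "continuous_map (subtopology (arrows GG) (sheet s)) euclidean (section_function s h)"
      by (rule continuous_map_eq) (simp add: section_function_def)
    have "compactin (arrows GG) (germ \<theta> s ` K)"
      using K by (intro image_compactin[OF _ continuous_map_germ]) (simp add: compactin_subtopology)
    then show "compactin (subtopology (arrows GG) (sheet s)) (germ \<theta> s ` K)"
      using K(2) by (auto simp: compactin_subtopology)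
    show "section_function s h \<gamma> = 0" if "\<gamma> \<notin> germ \<theta> s ` K" for \<gamma>
      using that K(3) by (force simp: section_function_def)
  qed
qed

text \<open>With bump functions for \<open>r\<close>, the summands replace a partition of unity.\<close>

lemma prod_one_minus_telescope:
  fixes r :: "nat \<Rightarrow> 'b::comm_ring_1"
  shows "(\<Sum>i<n. r i * (\<Prod>j<i. 1 - r j)) = 1 - (\<Prod>j<n. 1 - r j)"
  by (induction n) (simp_all add: algebra_simps)

text \<open>An open bisection W need not lie in one sheet, but the compact support is covered by
  finitely many pieces of sheets inside W, and multiplying f by weights in d(\<gamma>) splits it
  accordingly. Injectivity of d on W ensures that an arrow of W over the base of a piece lies on
  that piece.\<close>

lemma Cc_bisection_decomposition:
  assumes W: "open_bisection GG W" and f: "f \<in> Cc (subtopology (arrows GG) W)"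
  obtains n s h where "\<And>i. i < n \<Longrightarrow> h i \<in> Cc (subtopology Z (source (s i)))"
    "f = (\<Sum>i<(n::nat). section_function (s i) (h i))"
proof -
  have Wo: "openin (arrows GG) W" and Wi: "inj_on (dm GG) W" using W by (auto simp: open_bisection_def)
  have topW: "topspace (subtopology (arrows GG) W) = W" using openin_subset[OF Wo] by (simp add: Int_absorb1)
  have fcont: "continuous_map (subtopology (arrows GG) W) euclidean f" using f by (simp add: Cc_def)
  obtain K where K: "compactin (arrows GG) K" "K \<subseteq> W" "\<And>\<gamma>. \<gamma> \<notin> K \<Longrightarrow> f \<gamma> = 0"
    using Cc_compact_support[OF f] by (metis compactin_subtopology)
  \<comment> \<open>A piece: s and U give part of a sheet inside W, and \<rho> is supported in U and
    equals 1 on the smaller open set V. The germs over the sets V are what has to cover the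
    support.\<close>
  define P where "P = (\<lambda>(s, U, V, \<rho>). openin Z U \<and> U \<subseteq> source s \<and> germ \<theta> s ` U \<subseteq> W \<and> openin Z V \<and> V \<subseteq> U \<and>
      \<rho> \<in> Cc (subtopology Z U) \<and> (\<forall>z\<in>V. \<rho> z = (1::complex)))"
  define c where "c = (\<lambda>(s, U :: 'z set, V, \<rho> :: 'z \<Rightarrow> complex). germ \<theta> s ` V)"
  have "\<exists>p. P p \<and> \<gamma> \<in> c p" if "\<gamma> \<in> K" for \<gamma>
  proof -
    obtain s U z where s: "openin Z U" "U \<subseteq> source s" "z \<in> U" "\<gamma> = germ \<theta> s z" "germ \<theta> s ` U \<subseteq> W"
      using openin_arrows_basis[OF Wo subsetD[OF K(2) \<open>\<gamma> \<in> K\<close>]] by (elim exE conjE) (rule that)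
    obtain \<rho> V where "\<rho> \<in> Cc (subtopology Z U)" "openin Z V" "z \<in> V" "V \<subseteq> U" "\<And>y. y \<in> V \<Longrightarrow> \<rho> y = 1"
      using local_bump_function[OF locally_compact Hausdorff s(1,3)] by metis
    then show ?thesis using s by (intro exI[of _ "(s, U, V, \<rho>)"]) (auto simp: P_def c_def)
  qed
  then have cover: "K \<subseteq> \<Union>(c ` {p. P p})" by blast
  have "openin (arrows GG) D" if "D \<in> c ` {p. P p}" for D
    using that by (auto simp: c_def P_def intro!: openin_germ_image)
  then obtain \<F> where "finite \<F>" "\<F> \<subseteq> c ` {p. P p}" "K \<subseteq> \<Union>\<F>" using compactinD[OF K(1) _ cover] by metis
  then obtain Q where Q: "finite Q" "Q \<subseteq> {p. P p}" "K \<subseteq> \<Union>(c ` Q)" by (metis finite_subset_image)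
  obtain q where q: "bij_betw q {0..<card Q} Q" using ex_bij_betw_nat_finite[OF Q(1)] by blast
  define n where "n = card Q"
  define s U V \<rho> where "s = (\<lambda>i. fst (q i))" and "U = (\<lambda>i. fst (snd (q i)))"
    and "V = (\<lambda>i. fst (snd (snd (q i))))" and "\<rho> = (\<lambda>i. snd (snd (snd (q i))))"
  have qi: "q i = (s i, U i, V i, \<rho> i)" for i by (simp add: s_def U_def V_def \<rho>_def)
  have "P (q i)" if "i < n" for i using q Q(2) that by (auto simp: n_def bij_betw_def)
  then have pr: "openin Z (U i)" "U i \<subseteq> source (s i)" "germ \<theta> (s i) ` U i \<subseteq> W" "openin Z (V i)" "V i \<subseteq> U i"
      "\<rho> i \<in> Cc (subtopology Z (U i))" "\<And>z. z \<in> V i \<Longrightarrow> \<rho> i z = 1" if "i < n" for i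
    using that by (auto simp: qi P_def)
  have Kc: "\<exists>i<n. \<gamma> \<in> germ \<theta> (s i) ` V i" if \<gamma>K: "\<gamma> \<in> K" for \<gamma>
  proof -
    obtain p where "p \<in> Q" "\<gamma> \<in> c p" using Q(3) \<gamma>K by blast
    have "p \<in> q ` {0..<n}" using q \<open>p \<in> Q\<close> by (simp add: n_def bij_betw_def)
    then obtain i where "i < n" "q i = p" by auto
    then show ?thesis using \<open>\<gamma> \<in> c p\<close> by (auto simp: c_def qi)
  qed
  \<comment> \<open>The i-th weight of the telescoping sum, read on the unit space and attached to
    the i-th piece.\<close>
  define h where "h = (\<lambda>i z. if z \<in> U i then f (germ \<theta> (s i) z) * (\<rho> i z * (\<Prod>j<i. 1 - \<rho> j z)) else 0)"
  have \<rho>0: "\<rho> i z = 0" if "i < n" "z \<notin> U i" for i z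
    using pr(6)[OF that(1)] pr(1)[OF that(1)] that(2) Cc_subtopology_iff[OF Hausdorff] by blast
  have "h i \<in> Cc (subtopology Z (source (s i)))" if i: "i < n" for i
  proof -
    have topU: "topspace (subtopology Z (U i)) = U i" using openin_subset[OF pr(1)[OF i]] by (simp add: Int_absorb1)
    have "continuous_map (subtopology Z (U i)) (subtopology (arrows GG) W) (germ \<theta> (s i))"
      using continuous_map_from_subtopology_mono[OF continuous_map_germ pr(2)[OF i]] pr(3)[OF i]
      by (intro continuous_map_into_subtopology) auto
    then have 1: "continuous_map (subtopology Z (U i)) euclidean (f \<circ> germ \<theta> (s i))"
      using fcont by (rule continuous_map_compose)
    have cr: "continuous_map Z euclidean (\<rho> j)" if "j < n" for j
      using pr(1,6)[OF that] Cc_subtopology_iff[OF Hausdorff] by blast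
    have 2: "continuous_map (subtopology Z (U i)) euclidean (\<lambda>z. \<rho> i z * (\<Prod>j<i. 1 - \<rho> j z))"
      using i by (intro continuous_map_from_subtopology continuous_map_complex_mult continuous_map_prod
          continuous_map_diff cr) auto
    have hc: "continuous_map (subtopology Z (U i)) euclidean (h i)"
      by (rule continuous_map_eq[OF continuous_map_complex_mult[OF 1 2]]) (use topU in \<open>simp add: h_def\<close>)
    obtain L where L: "compactin Z L" "L \<subseteq> U i" "\<And>z. z \<notin> L \<Longrightarrow> \<rho> i z = 0"
      using pr(1,6)[OF i] Cc_subtopology_iff[OF Hausdorff] by metis
    have "h i \<in> Cc (subtopology Z (U i))"
      by (rule CcI[OF Hausdorff_space_subtopology[OF Hausdorff] hc, of L]) (use L in \<open>auto simp: compactin_subtopology h_def\<close>)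
    then have c: "continuous_map Z euclidean (h i)"
      and "\<exists>L. compactin Z L \<and> L \<subseteq> U i \<and> (\<forall>z. z \<notin> L \<longrightarrow> h i z = 0)"
      by (simp_all only: Cc_subtopology_iff[OF Hausdorff pr(1)[OF i]])
    then obtain L' where "compactin Z L'" "L' \<subseteq> U i" "\<forall>z. z \<notin> L' \<longrightarrow> h i z = 0" by (elim exE conjE) (rule that)
    then show ?thesis
      unfolding Cc_source_iff using pr(2)[OF i] by (intro conjI c exI[of _ L']) auto
  qed
  moreover have "f = (\<Sum>i<n. section_function (s i) (h i))"
  proof
    fix \<gamma>
    have sf: "section_function (s i) (h i) \<gamma> = f \<gamma> * (\<rho> i (dm GG \<gamma>) * (\<Prod>j<i. 1 - \<rho> j (dm GG \<gamma>)))" if i: "i < n" for i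
    proof (cases "\<gamma> \<in> W")
      case True
      then have "\<gamma> \<in> topspace (arrows GG)" using openin_subset[OF Wo] by blast
      then obtain t z where tz: "z \<in> source t" "\<gamma> = germ \<theta> t z" by (rule arrowE)
      show ?thesis
      proof (cases "z \<in> U i")
        case True
        have "germ \<theta> (s i) z \<in> W" "z \<in> source (s i)" using True pr(2,3)[OF i] by auto
        then have "\<gamma> = germ \<theta> (s i) z" using Wi \<open>\<gamma> \<in> W\<close> tz by (auto simp: inj_on_def)
        then show ?thesis using True \<open>z \<in> source (s i)\<close> by (simp add: section_function_germ h_def)
      next
        case False
        then show ?thesis using \<rho>0[OF i False] tz by (simp add: section_function_germ h_def)
      qed
    next
      case False
      then have "f \<gamma> = 0" using K(2,3) by blast
      moreover have "section_function (s i) (h i) \<gamma> = 0"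
        using False pr(3)[OF i] by (auto simp: section_function_def h_def)
      ultimately show ?thesis by simp
    qed
    have "(\<Sum>i<n. section_function (s i) (h i)) \<gamma> = (\<Sum>i<n. f \<gamma> * (\<rho> i (dm GG \<gamma>) * (\<Prod>j<i. 1 - \<rho> j (dm GG \<gamma>))))"
      by (simp add: sum_fun_apply sf)
    also have "\<dots> = f \<gamma> * (1 - (\<Prod>j<n. 1 - \<rho> j (dm GG \<gamma>)))"
      by (simp only: prod_one_minus_telescope flip: sum_distrib_left)
    also have "\<dots> = f \<gamma>"
    proof (cases "f \<gamma> = 0")
      case False
      then obtain i z where i: "i < n" "z \<in> V i" "\<gamma> = germ \<theta> (s i) z" using Kc K(3) by blast
      moreover have "z \<in> source (s i)" using i(2) pr(2,5)[OF i(1)] by blast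
      ultimately have "dm GG \<gamma> = z" by simp
      \<comment> \<open>On the support of f one of the factors vanishes, so there the weights add up
        to 1.\<close>
      then have "1 - \<rho> i (dm GG \<gamma>) = 0" using i pr(7) by simp
      then have "(\<Prod>j<n. 1 - \<rho> j (dm GG \<gamma>)) = 0" using i(1) by (intro prod_zero) auto
      then show ?thesis by simp
    qed simp
    finally show "f \<gamma> = (\<Sum>i<n. section_function (s i) (h i)) \<gamma>" ..
  qed
  ultimately show thesis using that by blast
qed

section \<open>\<C>(G) as a *-subalgebra of the functions with bounded kernels\<close>

definition section_functions :: "(('s \<times> 'z) set \<Rightarrow> complex) set" where
  "section_functions = {section_function s h | s h. h \<in> Cc (subtopology Z (source s))}"

lemma groupoid_functions_eq: "groupoid_functions GG = fun_module.span section_functions"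
  unfolding groupoid_functions_def
proof (intro equalityI fun_module.span_minimal fun_module.subspace_span subsetI)
  fix f assume "f \<in> (\<Union>U\<in>{U. open_bisection GG U}. Cc (subtopology (arrows GG) U))"
  then obtain W where "open_bisection GG W" "f \<in> Cc (subtopology (arrows GG) W)" by blast
  then obtain n s h where h: "\<And>i. i < n \<Longrightarrow> h i \<in> Cc (subtopology Z (source (s i)))"
    and f: "f = (\<Sum>i<(n::nat). section_function (s i) (h i))"
    using Cc_bisection_decomposition by blast
  show "f \<in> fun_module.span section_functions"
    unfolding f by (intro fun_module.span_sum fun_module.span_base) (use h in \<open>auto simp: section_functions_def\<close>)
next
  fix f assume "f \<in> section_functions"
  then show "f \<in> fun_module.span (\<Union>U\<in>{U. open_bisection GG U}. Cc (subtopology (arrows GG) U))"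
    using open_bisection_sheet section_function_Cc
    by (intro fun_module.span_base) (auto simp: section_functions_def)
qed

lemma section_function_C0_bounded_kernels:
  assumes h: "h \<in> C0 T" shows "section_function s h \<in> bounded_kernels"
proof -
  obtain M where M: "0 \<le> M" "\<And>x. cmod (h x) \<le> M" using C0_bounded[OF h] by blast
  then show ?thesis by (intro bounded_section_function(1)[of _ _ M]) auto
qed

lemma section_functions_bounded_kernels: "f \<in> section_functions \<Longrightarrow> f \<in> bounded_kernels"
  by (auto simp: section_functions_def intro: section_function_C0_bounded_kernels Cc_subset_C0)

lemma subspace_bounded_kernels: "fun_module.subspace bounded_kernels"
  by (auto simp: fun_module.subspace_def bounded_kernels_zero bounded_kernels_add bounded_kernels_scale)

lemma groupoid_functions_bounded: "groupoid_functions GG \<subseteq> bounded_kernels"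
  unfolding groupoid_functions_eq
  by (intro fun_module.span_minimal subspace_bounded_kernels) (auto simp: section_functions_bounded_kernels)

lemma groupoid_functions_add: "f \<in> groupoid_functions GG \<Longrightarrow> g \<in> groupoid_functions GG \<Longrightarrow> f + g \<in> groupoid_functions GG"
  and groupoid_functions_scale: "f \<in> groupoid_functions GG \<Longrightarrow> (\<lambda>\<gamma>. c * f \<gamma>) \<in> groupoid_functions GG"
  and groupoid_functions_zero: "0 \<in> groupoid_functions GG"
  unfolding groupoid_functions_eq
  by (auto intro: fun_module.span_add fun_module.span_scale fun_module.span_zero)

lemma section_function_in_groupoid_functions:
  "h \<in> Cc (subtopology Z (source s)) \<Longrightarrow> section_function s h \<in> groupoid_functions GG"
  unfolding groupoid_functions_eq by (rule fun_module.span_base) (auto simp: section_functions_def)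

lemma groupoid_functions_adjoint:
  assumes "f \<in> groupoid_functions GG" shows "groupoid_adjoint GG f \<in> groupoid_functions GG"
  using assms unfolding groupoid_functions_eq
proof (induction f rule: fun_module.span_induct_alt)
  case base
  have "groupoid_adjoint GG 0 = 0" by (auto simp: groupoid_adjoint_def)
  then show ?case by (simp only: fun_module.span_zero)
next
  case (step c f g)
  obtain s h where f: "f = section_function s h" "h \<in> Cc (subtopology Z (source s))" using step by (auto simp: section_functions_def)
  then have "groupoid_adjoint GG f \<in> fun_module.span section_functions"
    unfolding f(1) section_function_adjoint
    using section_function_in_groupoid_functions[OF Cc_adjoint[OF f(2)]] by (simp add: groupoid_functions_eq)
  then show ?case using step(2)
    by (simp only: groupoid_adjoint_add groupoid_adjoint_scale fun_module.span_add fun_module.span_scale)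
qed

lemma groupoid_functions_convolution:
  assumes "f \<in> groupoid_functions GG" and g: "g \<in> groupoid_functions GG"
  shows "convolution GG f g \<in> groupoid_functions GG"
proof -
  have 1: "convolution GG (section_function s h) g \<in> groupoid_functions GG"
    if h: "h \<in> Cc (subtopology Z (source s))" for s h
  proof -
    \<comment> \<open>Membership in \<open>bounded_kernels\<close> is carried through the induction
      because additivity in the second factor requires it.\<close>
    have "g \<in> bounded_kernels \<and> convolution GG (section_function s h) g \<in> fun_module.span section_functions"
      using g unfolding groupoid_functions_eq
    proof (induction g rule: fun_module.span_induct_alt)
      case base
      have "convolution GG (section_function s h) 0 = 0" by (auto simp: convolution_def)
      then show ?case by (simp only: fun_module.span_zero bounded_kernels_zero)
    next
      case (step c k g)
      obtain t h' where k: "k = section_function t h'" "h' \<in> Cc (subtopology Z (source t))" using step by (auto simp: section_functions_def)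
      have kb: "k \<in> bounded_kernels" "(\<lambda>\<gamma>. c * k \<gamma>) \<in> bounded_kernels"
        using step section_functions_bounded_kernels bounded_kernels_scale by auto
      have "convolution GG (section_function s h) k \<in> fun_module.span section_functions"
        using section_function_convolution[of t h' s h] kb(1) section_function_in_groupoid_functions[OF Cc_product[OF h k(2)]] k(1)
        by (simp add: groupoid_functions_eq)
      with step(2) kb show ?case
        by (simp only: convolution_add_right convolution_scale_right fun_module.span_add fun_module.span_scale bounded_kernels_add)
    qed
    then show ?thesis by (simp add: groupoid_functions_eq)
  qed
  have gb: "g \<in> bounded_kernels" using g groupoid_functions_bounded by blast
  show ?thesis
    using assms(1) unfolding groupoid_functions_eq
  proof (induction f rule: fun_module.span_induct_alt)
    case base
    have "convolution GG 0 g = 0" by (auto simp: convolution_def)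
    then show ?case by (simp only: fun_module.span_zero)
  next
    case (step c k f)
    then have "convolution GG k g \<in> fun_module.span section_functions"
      using 1 by (auto simp: section_functions_def groupoid_functions_eq)
    then show ?case using step(2)
      by (simp only: convolution_add_left[OF gb] convolution_scale_left[OF gb] fun_module.span_add fun_module.span_scale)
  qed
qed

end

section \<open>Hilbert modules of square-summable families\<close>

lemma norm_sum_squares:
  "(\<Sum>i\<in>F. cnj (\<xi> i x) * \<xi> i x) = complex_of_real (\<Sum>i\<in>F. (cmod (\<xi> i x))\<^sup>2)"
  unfolding of_real_sum complex_norm_square by (simp add: mult.commute)

text \<open>The Cauchy criterion for uniform convergence of the sums of squares;
  \<open>l2_moduleI\<close> is its converse. That operators preserve the module is checked on such
  tails.\<close>

lemma l2_module_tails: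
  assumes "\<xi> \<in> l2_module I B" and e: "0 < e"
  obtains F where "finite F" "F \<subseteq> I"
    "\<And>F' x. finite F' \<Longrightarrow> F' \<subseteq> I \<Longrightarrow> F' \<inter> F = {} \<Longrightarrow> (\<Sum>i\<in>F'. (cmod (\<xi> i x))\<^sup>2) \<le> e"
proof -
  obtain h where h: "uniform_limit UNIV (\<lambda>F x. \<Sum>i\<in>F. cnj (\<xi> i x) * \<xi> i x) h (finite_subsets_at_top I)"
    using assms by (auto simp: l2_module_def)
  then have "\<forall>\<^sub>F F in finite_subsets_at_top I. \<forall>x\<in>UNIV. dist (\<Sum>i\<in>F. cnj (\<xi> i x) * \<xi> i x) (h x) < e / 2"
    using e by (intro uniform_limitD) auto
  then obtain F where F: "finite F" "F \<subseteq> I"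
    and d: "\<And>Y x. finite Y \<Longrightarrow> F \<subseteq> Y \<Longrightarrow> Y \<subseteq> I \<Longrightarrow> dist (\<Sum>i\<in>Y. cnj (\<xi> i x) * \<xi> i x) (h x) < e / 2"
    unfolding eventually_finite_subsets_at_top by auto
  show thesis
  proof (rule that[OF F])
    fix F' x assume F': "finite F'" "F' \<subseteq> I" "F' \<inter> F = {}"
    have "dist (\<Sum>i\<in>F \<union> F'. cnj (\<xi> i x) * \<xi> i x) (\<Sum>i\<in>F. cnj (\<xi> i x) * \<xi> i x) < e"
      using F F' by (intro dist_triangle_half_l[OF d d]) auto
    then have "dist (complex_of_real (\<Sum>i\<in>F \<union> F'. (cmod (\<xi> i x))\<^sup>2)) (complex_of_real (\<Sum>i\<in>F. (cmod (\<xi> i x))\<^sup>2)) < e"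
      by (simp only: norm_sum_squares)
    then have "\<bar>(\<Sum>i\<in>F \<union> F'. (cmod (\<xi> i x))\<^sup>2) - (\<Sum>i\<in>F. (cmod (\<xi> i x))\<^sup>2)\<bar> < e"
      by (simp only: dist_of_real dist_real_def)
    moreover have "(\<Sum>i\<in>F \<union> F'. (cmod (\<xi> i x))\<^sup>2) = (\<Sum>i\<in>F. (cmod (\<xi> i x))\<^sup>2) + (\<Sum>i\<in>F'. (cmod (\<xi> i x))\<^sup>2)"
      using F F' by (intro sum.union_disjoint) auto
    ultimately show "(\<Sum>i\<in>F'. (cmod (\<xi> i x))\<^sup>2) \<le> e" by linarith
  qed
qed

lemma l2_module_summable:
  assumes "\<xi> \<in> l2_module I B"
  shows "(\<lambda>i. (cmod (\<xi> i x))\<^sup>2) summable_on I"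
proof -
  obtain F where F: "finite F" "F \<subseteq> I"
    "\<And>F' x. finite F' \<Longrightarrow> F' \<subseteq> I \<Longrightarrow> F' \<inter> F = {} \<Longrightarrow> (\<Sum>i\<in>F'. (cmod (\<xi> i x))\<^sup>2) \<le> 1"
    using l2_module_tails[OF assms, of 1] by auto
  show ?thesis
  proof (rule nonneg_bdd_above_summable_on)
    show "bdd_above (sum (\<lambda>i. (cmod (\<xi> i x))\<^sup>2) ` {G. G \<subseteq> I \<and> finite G})"
    proof (rule bdd_aboveI2)
      fix G assume G: "G \<in> {G. G \<subseteq> I \<and> finite G}"
      have "sum (\<lambda>i. (cmod (\<xi> i x))\<^sup>2) G \<le> sum (\<lambda>i. (cmod (\<xi> i x))\<^sup>2) (F \<union> (G - F))"
        using F G by (intro sum_mono2) auto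
      also have "\<dots> = sum (\<lambda>i. (cmod (\<xi> i x))\<^sup>2) F + sum (\<lambda>i. (cmod (\<xi> i x))\<^sup>2) (G - F)"
        using F G by (intro sum.union_disjoint) auto
      also have "\<dots> \<le> sum (\<lambda>i. (cmod (\<xi> i x))\<^sup>2) F + 1"
        using F(3)[of "G - F" x] G by auto
      finally show "sum (\<lambda>i. (cmod (\<xi> i x))\<^sup>2) G \<le> sum (\<lambda>i. (cmod (\<xi> i x))\<^sup>2) F + 1" .
    qed
  qed auto
qed

lemma module_inner_self:
  assumes "\<xi> \<in> l2_module I B"
  shows "module_inner I \<xi> \<xi> x = complex_of_real (\<Sum>\<^sub>\<infinity>i\<in>I. (cmod (\<xi> i x))\<^sup>2)"
proof -
  have "module_inner I \<xi> \<xi> x = (\<Sum>\<^sub>\<infinity>i\<in>I. complex_of_real ((cmod (\<xi> i x))\<^sup>2))"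
    unfolding module_inner_def unfolding complex_norm_square by (simp add: mult.commute)
  also have "\<dots> = complex_of_real (\<Sum>\<^sub>\<infinity>i\<in>I. (cmod (\<xi> i x))\<^sup>2)"
    by (rule infsumI[OF has_sum_of_real_iff[THEN iffD2, OF has_sum_infsum[OF l2_module_summable[OF assms]]]])
  finally show ?thesis .
qed

text \<open>Uniformly small tails make the pointwise sum of squares a uniform limit of finite sums
  from C_0(T), so it lies in C_0(T) and is the function that membership in the module asks
  for.\<close>

lemma l2_moduleI:
  assumes B: "\<And>i. i \<in> I \<Longrightarrow> \<xi> i \<in> C0 T" and z: "\<And>i. i \<notin> I \<Longrightarrow> \<xi> i = 0"
    and tails: "\<And>e. 0 < e \<Longrightarrow> \<exists>F. finite F \<and> F \<subseteq> I \<and> (\<forall>F' x. finite F' \<and> F' \<subseteq> I \<and> F' \<inter> F = {} \<longrightarrow>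
      (\<Sum>i\<in>F'. (cmod (\<xi> i x))\<^sup>2) \<le> e)"
  shows "\<xi> \<in> l2_module I (C0 T)"
proof -
  define S where "S = (\<lambda>F x. \<Sum>i\<in>F. (cmod (\<xi> i x))\<^sup>2)"
  have tails': "\<exists>F. finite F \<and> F \<subseteq> I \<and> (\<forall>F' x. finite F' \<and> F' \<subseteq> I \<and> F' \<inter> F = {} \<longrightarrow> S F' x \<le> e)"
    if "0 < e" for e unfolding S_def by (rule tails[OF that])
  have S: "S (F \<union> F') x = S F x + S F' x" if "finite F" "finite F'" "F' \<inter> F = {}" for F F' x
    unfolding S_def using that by (intro sum.union_disjoint) auto
  have S0: "0 \<le> S F x" for F x by (simp add: S_def sum_nonneg)
  have sm: "(\<lambda>i. (cmod (\<xi> i x))\<^sup>2) summable_on I" for x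
  proof -
    obtain F where F': "finite F" "F \<subseteq> I" "\<forall>F' x. finite F' \<and> F' \<subseteq> I \<and> F' \<inter> F = {} \<longrightarrow> S F' x \<le> 1"
      using tails'[OF zero_less_one] by (elim exE conjE) (rule that)
    have F: "finite F" "F \<subseteq> I" "\<And>F' x. finite F' \<Longrightarrow> F' \<subseteq> I \<Longrightarrow> F' \<inter> F = {} \<Longrightarrow> S F' x \<le> 1"
      using F' by simp_all
    show ?thesis
    proof (rule nonneg_bdd_above_summable_on)
      show "bdd_above (sum (\<lambda>i. (cmod (\<xi> i x))\<^sup>2) ` {G. G \<subseteq> I \<and> finite G})"
      proof (rule bdd_aboveI2)
        fix G assume G: "G \<in> {G. G \<subseteq> I \<and> finite G}"
        have "S G x \<le> S (F \<union> (G - F)) x"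
          unfolding S_def using F G by (intro sum_mono2) auto
        also have "\<dots> = S F x + S (G - F) x" using F G by (intro S) auto
        also have "\<dots> \<le> S F x + 1" using F(3)[of "G - F" x] G by auto
        finally show "sum (\<lambda>i. (cmod (\<xi> i x))\<^sup>2) G \<le> S F x + 1" by (simp add: S_def)
      qed
    qed auto
  qed
  define h where "h = (\<lambda>x. \<Sum>\<^sub>\<infinity>i\<in>I. (cmod (\<xi> i x))\<^sup>2)"
  have unif: "\<exists>F. finite F \<and> F \<subseteq> I \<and> (\<forall>G. finite G \<and> F \<subseteq> G \<and> G \<subseteq> I \<longrightarrow> (\<forall>x. \<bar>S G x - h x\<bar> \<le> e))" if e: "0 < e" for e
  proof -
    obtain F where F': "finite F" "F \<subseteq> I" "\<forall>F' x. finite F' \<and> F' \<subseteq> I \<and> F' \<inter> F = {} \<longrightarrow> S F' x \<le> e"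
      using tails'[OF e] by (elim exE conjE) (rule that)
    have F: "finite F" "F \<subseteq> I" "\<And>F' x. finite F' \<Longrightarrow> F' \<subseteq> I \<Longrightarrow> F' \<inter> F = {} \<Longrightarrow> S F' x \<le> e"
      using F' by simp_all
    have "\<bar>S G x - h x\<bar> \<le> e" if G: "finite G" "F \<subseteq> G" "G \<subseteq> I" for G x
    proof -
      have "S G x \<le> h x" unfolding S_def h_def using G by (intro finite_sum_le_infsum sm) auto
      moreover have "h x \<le> S G x + e"
        unfolding h_def
      proof (rule infsum_le_finite_sums[OF sm])
        fix H assume H: "finite H" "H \<subseteq> I"
        have "S H x \<le> S (G \<union> (H - G)) x"
          unfolding S_def using H G by (intro sum_mono2) auto
        also have "\<dots> = S G x + S (H - G) x" using H G by (intro S) auto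
        also have "\<dots> \<le> S G x + e" using F(3)[of "H - G" x] H G by auto
        finally show "(\<Sum>i\<in>H. (cmod (\<xi> i x))\<^sup>2) \<le> S G x + e" by (simp add: S_def)
      qed
      ultimately show ?thesis by linarith
    qed
    then show ?thesis using F by (intro exI[of _ F]) auto
  qed
  have Seq: "(\<Sum>i\<in>F. cnj (\<xi> i x) * \<xi> i x) = complex_of_real (S F x)" for F x
    by (simp only: norm_sum_squares S_def)
  have SB: "(\<lambda>x. complex_of_real (S F x)) \<in> C0 T" if "F \<subseteq> I" for F
  proof -
    have "(\<Sum>i\<in>F. (\<lambda>x. cnj (\<xi> i x)) * \<xi> i) \<in> C0 T"
      using that B by (intro C0_sum C0_mult C0_cnj) auto
    moreover have "(\<Sum>i\<in>F. (\<lambda>x. cnj (\<xi> i x)) * \<xi> i) = (\<lambda>x. complex_of_real (S F x))"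
      by (simp add: fun_eq_iff sum_fun_apply flip: Seq)
    ultimately show ?thesis by simp
  qed
  have dn: "cmod (complex_of_real a - complex_of_real b) = \<bar>a - b\<bar>" for a b
    by (simp only: norm_of_real flip: of_real_diff)
  have hB: "(\<lambda>x. complex_of_real (h x)) \<in> C0 T"
  proof (rule C0_uniform_closed)
    fix e :: real assume e: "0 < e"
    obtain F where F: "finite F" "F \<subseteq> I" "\<forall>G. finite G \<and> F \<subseteq> G \<and> G \<subseteq> I \<longrightarrow> (\<forall>x. \<bar>S G x - h x\<bar> \<le> e)"
      using unif[OF e] by (elim exE conjE) (rule that)
    then have "\<bar>S F x - h x\<bar> \<le> e" for x by simp
    with F(2) show "\<exists>g\<in>C0 T. \<forall>x. cmod (complex_of_real (h x) - g x) \<le> e"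
      using SB[of F] by (intro bexI[of _ "\<lambda>x. complex_of_real (S F x)"]) (auto simp only: dn abs_minus_commute)
  qed
  have "uniform_limit UNIV (\<lambda>F x. \<Sum>i\<in>F. cnj (\<xi> i x) * \<xi> i x) (\<lambda>x. complex_of_real (h x)) (finite_subsets_at_top I)"
  proof (rule uniform_limitI)
    fix e :: real assume e: "0 < e"
    then obtain F where F: "finite F" "F \<subseteq> I" "\<And>G x. finite G \<Longrightarrow> F \<subseteq> G \<Longrightarrow> G \<subseteq> I \<Longrightarrow> \<bar>S G x - h x\<bar> \<le> e / 2"
      using unif[of "e/2"] by auto
    show "\<forall>\<^sub>F F in finite_subsets_at_top I. \<forall>x\<in>UNIV. dist (\<Sum>i\<in>F. cnj (\<xi> i x) * \<xi> i x) (complex_of_real (h x)) < e"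
      unfolding eventually_finite_subsets_at_top Seq dist_norm dn
    proof (intro exI[of _ F] conjI allI impI ballI F(1,2))
      fix G x assume "finite G \<and> F \<subseteq> G \<and> G \<subseteq> I"
      then show "\<bar>S G x - h x\<bar> < e" using F(3)[of G x] e by auto
    qed
  qed
  then show ?thesis unfolding l2_module_def using B z hB by blast
qed

lemma l2_moduleD: "\<xi> \<in> l2_module I B \<Longrightarrow> i \<in> I \<Longrightarrow> \<xi> i \<in> B" "\<xi> \<in> l2_module I B \<Longrightarrow> i \<notin> I \<Longrightarrow> \<xi> i = 0"
  by (auto simp: l2_module_def)

lemma module_inner_self_bounded:
  assumes \<xi>: "\<xi> \<in> l2_module I (C0 T)"
  shows "bdd_above (range (\<lambda>x. cmod (module_inner I \<xi> \<xi> x)))"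
proof -
  obtain F where F: "finite F" "F \<subseteq> I"
    "\<And>F' x. finite F' \<Longrightarrow> F' \<subseteq> I \<Longrightarrow> F' \<inter> F = {} \<Longrightarrow> (\<Sum>i\<in>F'. (cmod (\<xi> i x))\<^sup>2) \<le> 1"
    using l2_module_tails[OF \<xi>, of 1] by auto
  have "\<exists>M\<ge>0. \<forall>x. cmod (\<xi> i x) \<le> M" if "i \<in> F" for i
    by (rule C0_bounded[OF l2_moduleD(1)[OF \<xi> subsetD[OF F(2) that]]]) blast
  then obtain M where M: "\<And>i x. i \<in> F \<Longrightarrow> cmod (\<xi> i x) \<le> M i" by metis
  have "cmod (module_inner I \<xi> \<xi> x) \<le> (\<Sum>i\<in>F. (M i)\<^sup>2) + 1" for x
  proof -
    have "(\<Sum>\<^sub>\<infinity>i\<in>I. (cmod (\<xi> i x))\<^sup>2) \<le> (\<Sum>i\<in>F. (M i)\<^sup>2) + 1"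
    proof (rule infsum_le_finite_sums[OF l2_module_summable[OF \<xi>]])
      fix G assume G: "finite G" "G \<subseteq> I"
      have "sum (\<lambda>i. (cmod (\<xi> i x))\<^sup>2) G \<le> sum (\<lambda>i. (cmod (\<xi> i x))\<^sup>2) (F \<union> (G - F))"
        using F G by (intro sum_mono2) auto
      also have "\<dots> = sum (\<lambda>i. (cmod (\<xi> i x))\<^sup>2) F + sum (\<lambda>i. (cmod (\<xi> i x))\<^sup>2) (G - F)"
        using F G by (intro sum.union_disjoint) auto
      also have "\<dots> \<le> (\<Sum>i\<in>F. (M i)\<^sup>2) + 1"
        using F(3)[of "G - F" x] G by (intro add_mono sum_mono power_mono M) auto
      finally show "sum (\<lambda>i. (cmod (\<xi> i x))\<^sup>2) G \<le> (\<Sum>i\<in>F. (M i)\<^sup>2) + 1" .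
    qed
    moreover have "0 \<le> (\<Sum>\<^sub>\<infinity>i\<in>I. (cmod (\<xi> i x))\<^sup>2)" by (rule infsum_nonneg) simp
    ultimately show ?thesis by (simp add: module_inner_self[OF \<xi>])
  qed
  then show ?thesis by (intro bdd_aboveI2) auto
qed

text \<open>The module norm is the supremum over x of the l^2 norms of the values at x, so it
  reduces to finite sums at single points. This is what reduces operators on the module to fields of
  matrices.\<close>

lemma module_norm_le_iff:
  assumes \<xi>: "\<xi> \<in> l2_module I (C0 T)" and c: "0 \<le> c"
  shows "module_norm I \<xi> \<le> c \<longleftrightarrow> (\<forall>x F. finite F \<and> F \<subseteq> I \<longrightarrow> L2_set (\<lambda>i. cmod (\<xi> i x)) F \<le> c)"
proof -
  have nn: "0 \<le> (\<Sum>\<^sub>\<infinity>i\<in>I. (cmod (\<xi> i x))\<^sup>2)" for x by (rule infsum_nonneg) simp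
  have "module_norm I \<xi> \<le> c \<longleftrightarrow> sup_norm (module_inner I \<xi> \<xi>) \<le> c\<^sup>2"
    unfolding module_norm_def using c by (metis real_sqrt_le_iff real_sqrt_unique abs_of_nonneg real_sqrt_abs)
  also have "\<dots> \<longleftrightarrow> (\<forall>x. cmod (module_inner I \<xi> \<xi> x) \<le> c\<^sup>2)"
    unfolding sup_norm_def by (subst cSUP_le_iff[OF _ module_inner_self_bounded[OF \<xi>]]) auto
  also have "\<dots> \<longleftrightarrow> (\<forall>x. sqrt (\<Sum>\<^sub>\<infinity>i\<in>I. (cmod (\<xi> i x))\<^sup>2) \<le> c)"
    using c nn by (auto simp: module_inner_self[OF \<xi>] real_le_lsqrt sqrt_le_D)
  also have "\<dots> \<longleftrightarrow> (\<forall>x. (\<lambda>i. (cmod (\<xi> i x))\<^sup>2) summable_on I \<and> sqrt (\<Sum>\<^sub>\<infinity>i\<in>I. (cmod (\<xi> i x))\<^sup>2) \<le> c)"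
    using l2_module_summable[OF \<xi>] by simp
  finally show ?thesis unfolding square_summable_iff[OF c] .
qed

lemma module_norm_nonneg: 
  assumes "\<xi> \<in> l2_module I (C0 T)" shows "0 \<le> module_norm I \<xi>"
proof -
  have "0 \<le> sup_norm (module_inner I \<xi> \<xi>)"
    unfolding sup_norm_def
    by (rule order_trans[OF norm_ge_zero cSUP_upper[OF UNIV_I module_inner_self_bounded[OF assms]]])
  then show ?thesis by (simp add: module_norm_def)
qed

lemma L2_set_le_module_norm:
  "\<xi> \<in> l2_module I (C0 T) \<Longrightarrow> finite F \<Longrightarrow> F \<subseteq> I \<Longrightarrow> L2_set (\<lambda>i. cmod (\<xi> i x)) F \<le> module_norm I \<xi>"
  using module_norm_le_iff[of \<xi> I T "module_norm I \<xi>"] module_norm_nonneg[of \<xi> I T] by auto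

lemma l2_module_finite_support:
  assumes "finite F" "F \<subseteq> I" "\<And>i. i \<in> F \<Longrightarrow> \<xi> i \<in> C0 T" "\<And>i. i \<notin> F \<Longrightarrow> \<xi> i = 0"
  shows "\<xi> \<in> l2_module I (C0 T)"
proof (rule l2_moduleI)
  show "\<xi> i \<in> C0 T" if "i \<in> I" for i using assms by (cases "i \<in> F") auto
  show "\<xi> i = 0" if "i \<notin> I" for i using assms that by blast
  show "\<exists>F. finite F \<and> F \<subseteq> I \<and> (\<forall>F' x. finite F' \<and> F' \<subseteq> I \<and> F' \<inter> F = {} \<longrightarrow> (\<Sum>i\<in>F'. (cmod (\<xi> i x))\<^sup>2) \<le> e)"
    if "0 < e" for e
  proof (intro exI[of _ F] conjI allI impI assms(1,2))
    fix F' x assume "finite F' \<and> F' \<subseteq> I \<and> F' \<inter> F = {}"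
    then have "\<xi> i = 0" if "i \<in> F'" for i using assms(4)[of i] that by blast
    then have "(\<Sum>i\<in>F'. (cmod (\<xi> i x))\<^sup>2) = 0" by simp
    then show "(\<Sum>i\<in>F'. (cmod (\<xi> i x))\<^sup>2) \<le> e" using that by simp
  qed
qed

lemma delta_in_l2_module: "i \<in> I \<Longrightarrow> y \<in> C0 T \<Longrightarrow> delta i y \<in> l2_module I (C0 T)"
  by (rule l2_module_finite_support[of "{i}"]) (auto simp: delta_def)

lemma module_inner_delta_left: "i \<in> I \<Longrightarrow> module_inner I (delta i y) \<zeta> x = cnj (y x) * \<zeta> i x"
proof -
  assume "i \<in> I"
  then have "module_inner I (delta i y) \<zeta> x = (\<Sum>\<^sub>\<infinity>j\<in>{i}. cnj (delta i y j x) * \<zeta> j x)"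
    unfolding module_inner_def by (intro infsum_cong_neutral) (auto simp: delta_def)
  then show ?thesis by (simp add: delta_def)
qed

lemma module_inner_delta_right: "i \<in> I \<Longrightarrow> module_inner I \<zeta> (delta i y) x = cnj (\<zeta> i x) * y x"
proof -
  assume "i \<in> I"
  then have "module_inner I \<zeta> (delta i y) x = (\<Sum>\<^sub>\<infinity>j\<in>{i}. cnj (\<zeta> j x) * delta i y j x)"
    unfolding module_inner_def by (intro infsum_cong_neutral) (auto simp: delta_def)
  then show ?thesis by (simp add: delta_def)
qed

text \<open>Pairing with \<open>delta i y\<close>, where y(x) = 1, reads off the entry i at x. It
  first shows that the adjoints agree and then, the adjoints being equal, that the operators do.
  This is the uniqueness behind \<open>KS_rep\<close>.\<close>

lemma adjointable_operators_determined:
  assumes L: "L \<in> adjointable_operators I (C0 T)" and L': "L' \<in> adjointable_operators I (C0 T)"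
    and eq: "\<And>i y. i \<in> I \<Longrightarrow> y \<in> C0 T \<Longrightarrow> L (delta i y) = L' (delta i y)"
    and sep: "\<And>x. x \<in> topspace T \<Longrightarrow> \<exists>y\<in>C0 T. y x = 1"
  shows "L = L'"
proof
  fix \<xi>
  let ?E = "l2_module I (C0 T)"
  obtain M where M: "M \<in> ?E \<rightarrow> ?E" "\<And>\<xi> \<eta>. \<xi> \<in> ?E \<Longrightarrow> \<eta> \<in> ?E \<Longrightarrow> module_inner I (L \<xi>) \<eta> = module_inner I \<xi> (M \<eta>)"
    and LE: "L \<in> ?E \<rightarrow>\<^sub>E ?E"
    using L by (auto simp: adjointable_operators_def)
  obtain M' where M': "M' \<in> ?E \<rightarrow> ?E" "\<And>\<xi> \<eta>. \<xi> \<in> ?E \<Longrightarrow> \<eta> \<in> ?E \<Longrightarrow> module_inner I (L' \<xi>) \<eta> = module_inner I \<xi> (M' \<eta>)"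
    and L'E: "L' \<in> ?E \<rightarrow>\<^sub>E ?E"
    using L' by (auto simp: adjointable_operators_def)
  have zero: "\<zeta> i x = 0" if "\<zeta> \<in> ?E" "x \<notin> topspace T" for \<zeta> i x
    using l2_moduleD[OF that(1), of i] C0D(2)[of "\<zeta> i" T x] that(2) by (cases "i \<in> I") auto
  have ext: "\<zeta> = \<zeta>'" if "\<zeta> \<in> ?E" "\<zeta>' \<in> ?E" "\<And>i x. i \<in> I \<Longrightarrow> x \<in> topspace T \<Longrightarrow> \<zeta> i x = \<zeta>' i x" for \<zeta> \<zeta>'
  proof (intro ext)
    fix i x
    show "\<zeta> i x = \<zeta>' i x"
      using that zero[of \<zeta> x i] zero[of \<zeta>' x i] l2_moduleD(2)[OF that(1), of i] l2_moduleD(2)[OF that(2), of i]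
      by (cases "i \<in> I"; cases "x \<in> topspace T") auto
  qed
  have MM: "M \<eta> = M' \<eta>" if \<eta>: "\<eta> \<in> ?E" for \<eta>
  proof (rule ext)
    show "M \<eta> \<in> ?E" "M' \<eta> \<in> ?E" using M M' \<eta> by auto
    fix i x assume i: "i \<in> I" and x: "x \<in> topspace T"
    obtain y where y: "y \<in> C0 T" "y x = 1" using sep[OF x] by blast
    note d = delta_in_l2_module[OF i y(1)]
    have "M \<eta> i x = module_inner I (delta i y) (M \<eta>) x" by (simp add: module_inner_delta_left[OF i] y)
    also have "\<dots> = module_inner I (L (delta i y)) \<eta> x" by (simp only: M(2)[OF d \<eta>])
    also have "\<dots> = module_inner I (L' (delta i y)) \<eta> x" by (simp only: eq[OF i y(1)])
    also have "\<dots> = module_inner I (delta i y) (M' \<eta>) x" by (simp only: M'(2)[OF d \<eta>])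
    also have "\<dots> = M' \<eta> i x" by (simp add: module_inner_delta_left[OF i] y)
    finally show "M \<eta> i x = M' \<eta> i x" .
  qed
  show "L \<xi> = L' \<xi>"
  proof (cases "\<xi> \<in> ?E")
    case False then show ?thesis using LE L'E by (auto simp: PiE_iff extensional_def)
  next
    case \<xi>: True
    show ?thesis
    proof (rule ext)
      show "L \<xi> \<in> ?E" "L' \<xi> \<in> ?E" using LE L'E \<xi> by auto
      fix i x assume i: "i \<in> I" and x: "x \<in> topspace T"
      obtain y where y: "y \<in> C0 T" "y x = 1" using sep[OF x] by blast
      note d = delta_in_l2_module[OF i y(1)]
      have "cnj (L \<xi> i x) = module_inner I (L \<xi>) (delta i y) x" by (simp add: module_inner_delta_right[OF i] y)
      also have "\<dots> = module_inner I (L' \<xi>) (delta i y) x" by (simp only: M(2)[OF \<xi> d] M'(2)[OF \<xi> d] MM[OF d])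
      also have "\<dots> = cnj (L' \<xi> i x)" by (simp add: module_inner_delta_right[OF i] y)
      finally show "L \<xi> i x = L' \<xi> i x" by simp
    qed
  qed
qed

text \<open>The index set of the sum collects the support of the row over all x. In
  \<open>matrix_field\<close> it is finite, so each component is a finite sum of functions in
  C_0(T).\<close>

definition module_operator ::
    "'x topology \<Rightarrow> 'i set \<Rightarrow> ('x \<Rightarrow> 'i \<Rightarrow> 'i \<Rightarrow> complex) \<Rightarrow> ('i \<Rightarrow> 'x \<Rightarrow> complex) \<Rightarrow> 'i \<Rightarrow> 'x \<Rightarrow> complex" where
  "module_operator T I m = (\<lambda>\<xi>\<in>l2_module I (C0 T). \<lambda>r x. if r \<in> I \<and> x \<in> topspace T
     then \<Sum>t\<in>{t \<in> I. \<exists>x\<in>topspace T. m x r t \<noteq> 0}. m x r t * \<xi> t x else 0)"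

text \<open>Entries need not vanish at infinity; they act on C_0(T) by multiplication. The bound is
  imposed on the matrix of moduli because \<open>module_inner_adjoint\<close> interchanges double
  sums; by \<open>matrix_bound_dominated\<close> it bounds m as well.\<close>

locale matrix_field =
  fixes T :: "'x topology" and I :: "'i set" and m :: "'x \<Rightarrow> 'i \<Rightarrow> 'i \<Rightarrow> complex" and K :: real
  assumes entry: "\<And>r t y. r \<in> I \<Longrightarrow> t \<in> I \<Longrightarrow> y \<in> C0 T \<Longrightarrow> (\<lambda>x. m x r t * y x) \<in> C0 T"
    and rows: "\<And>r. r \<in> I \<Longrightarrow> finite {t \<in> I. \<exists>x\<in>topspace T. m x r t \<noteq> 0}"
    and cols: "\<And>t. t \<in> I \<Longrightarrow> finite {r \<in> I. \<exists>x\<in>topspace T. m x r t \<noteq> 0}"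
    and bound: "\<And>x. x \<in> topspace T \<Longrightarrow> matrix_bound I (\<lambda>r t. complex_of_real (cmod (m x r t))) K"
    and bound_nonneg: "0 \<le> K"
    and point_evaluation: "\<And>x. x \<in> topspace T \<Longrightarrow> \<exists>y\<in>C0 T. y x = 1 \<and> (\<forall>z. cmod (y z) \<le> 1)"
begin

abbreviation row where "row r \<equiv> {t \<in> I. \<exists>x\<in>topspace T. m x r t \<noteq> 0}"

lemma matrix_bound_K: "x \<in> topspace T \<Longrightarrow> matrix_bound I (m x) K"
  by (rule matrix_bound_dominated, rule bound) auto

lemma module_operator_apply:
  "\<xi> \<in> l2_module I (C0 T) \<Longrightarrow> r \<in> I \<Longrightarrow> x \<in> topspace T \<Longrightarrow> finite F \<Longrightarrow> row r \<subseteq> F \<Longrightarrow> F \<subseteq> I \<Longrightarrow>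
     module_operator T I m \<xi> r x = (\<Sum>t\<in>F. m x r t * \<xi> t x)"
  by (auto simp: module_operator_def intro!: sum.mono_neutral_left)

lemma module_operator_outside:
  "\<xi> \<in> l2_module I (C0 T) \<Longrightarrow> r \<notin> I \<or> x \<notin> topspace T \<Longrightarrow> module_operator T I m \<xi> r x = 0"
  by (auto simp: module_operator_def)

lemma module_operator_L2_set:
  assumes \<xi>: "\<xi> \<in> l2_module I (C0 T)" and R: "finite R" "R \<subseteq> I"
    and C: "\<And>x. x \<in> topspace T \<Longrightarrow> matrix_bound I (m x) C" "0 \<le> C"
    and F: "finite F" "F \<subseteq> I" "\<And>r. r \<in> R \<Longrightarrow> row r \<subseteq> F"
  shows "L2_set (\<lambda>r. cmod (module_operator T I m \<xi> r x)) R \<le> C * L2_set (\<lambda>i. cmod (\<xi> i x)) F"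
proof (cases "x \<in> topspace T")
  case True
  have "L2_set (\<lambda>r. cmod (module_operator T I m \<xi> r x)) R = L2_set (\<lambda>r. cmod (\<Sum>t\<in>F. m x r t * \<xi> t x)) R"
    using R by (intro L2_set_cong refl arg_cong[of _ _ cmod] module_operator_apply \<xi> True F) auto
  also have "\<dots> \<le> C * L2_set (\<lambda>i. cmod (\<xi> i x)) F" by (intro matrix_boundD[OF C(1)[OF True]] R F)
  finally show ?thesis .
next
  case False
  then have "L2_set (\<lambda>r. cmod (module_operator T I m \<xi> r x)) R = 0"
    using module_operator_outside[OF \<xi>] by (intro L2_set_0') auto
  then show ?thesis using C(2) by simp
qed

lemma module_operator_closed:
  assumes \<xi>: "\<xi> \<in> l2_module I (C0 T)"
  shows "module_operator T I m \<xi> \<in> l2_module I (C0 T)"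
proof (rule l2_moduleI)
  fix r assume r: "r \<in> I"
  have "(\<Sum>t\<in>row r. (\<lambda>x. m x r t * \<xi> t x)) \<in> C0 T"
    using r by (intro C0_sum entry l2_moduleD(1)[OF \<xi>]) auto
  moreover have "(\<Sum>t\<in>row r. (\<lambda>x. m x r t * \<xi> t x)) = module_operator T I m \<xi> r"
  proof
    fix x
    show "(\<Sum>t\<in>row r. (\<lambda>x. m x r t * \<xi> t x)) x = module_operator T I m \<xi> r x"
    proof (cases "x \<in> topspace T")
      case True
      then show ?thesis using module_operator_apply[OF \<xi> r True rows[OF r]] by (simp add: sum_fun_apply)
    next
      case False
      have "\<xi> t x = 0" if "t \<in> I" for t using C0D(2)[OF l2_moduleD(1)[OF \<xi> that] False] .
      then show ?thesis using False module_operator_outside[OF \<xi>] by (simp add: sum_fun_apply)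
    qed
  qed
  ultimately show "module_operator T I m \<xi> r \<in> C0 T" by simp
next
  show "module_operator T I m \<xi> r = 0" if "r \<notin> I" for r
    using module_operator_outside[OF \<xi>] that by auto
next
  fix e :: real assume e: "0 < e"
  \<comment> \<open>Chosen so that (K + 1) times the square root of d has square e; K + 1 since K
    may be 0.\<close>
  define d where "d = e / (K + 1)\<^sup>2"
  have d: "0 < d" using e bound_nonneg by (simp add: d_def)
  obtain F where F: "finite F" "F \<subseteq> I"
    "\<And>F' x. finite F' \<Longrightarrow> F' \<subseteq> I \<Longrightarrow> F' \<inter> F = {} \<Longrightarrow> (\<Sum>i\<in>F'. (cmod (\<xi> i x))\<^sup>2) \<le> d"
    using l2_module_tails[OF \<xi> d] by auto
  \<comment> \<open>Rows outside R have no entries in the columns of F, so there the operator sees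
    only the tail of \<xi>.\<close>
  define R where "R = (\<Union>t\<in>F. {r \<in> I. \<exists>x\<in>topspace T. m x r t \<noteq> 0})"
  have R: "finite R" "R \<subseteq> I" using F cols by (auto simp: R_def)
  show "\<exists>R. finite R \<and> R \<subseteq> I \<and> (\<forall>R' x. finite R' \<and> R' \<subseteq> I \<and> R' \<inter> R = {} \<longrightarrow>
      (\<Sum>r\<in>R'. (cmod (module_operator T I m \<xi> r x))\<^sup>2) \<le> e)"
  proof (intro exI[of _ R] conjI allI impI R)
    fix R' x assume R': "finite R' \<and> R' \<subseteq> I \<and> R' \<inter> R = {}"
    define F' where "F' = (\<Union>r\<in>R'. row r)"
    have F': "finite F'" "F' \<subseteq> I" using R' rows by (auto simp: F'_def)
    have disj: "F' \<inter> F = {}"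
    proof (rule ccontr)
      assume "F' \<inter> F \<noteq> {}"
      then obtain t r where "t \<in> F" "r \<in> R'" "t \<in> row r" by (auto simp: F'_def)
      then have "r \<in> R' \<inter> R" using R' unfolding R_def by blast
      then show False using R' by simp
    qed
    have "L2_set (\<lambda>i. cmod (\<xi> i x)) F' \<le> sqrt d"
      using F(3)[OF F' disj, of x] d F' by (simp add: L2_set_def)
    then have "L2_set (\<lambda>r. cmod (module_operator T I m \<xi> r x)) R' \<le> (K + 1) * sqrt d"
      using module_operator_L2_set[OF \<xi> _ _ matrix_bound_K bound_nonneg F', of R' x] R' bound_nonneg
        mult_mono[of K "K + 1" "L2_set (\<lambda>i. cmod (\<xi> i x)) F'" "sqrt d"]
      by (fastforce simp: F'_def)
    then have "(\<Sum>r\<in>R'. (cmod (module_operator T I m \<xi> r x))\<^sup>2) \<le> ((K + 1) * sqrt d)\<^sup>2"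
      using R' bound_nonneg d by (subst (asm) L2_set_le_iff) auto
    also have "\<dots> = e" using d bound_nonneg by (simp add: power_mult_distrib) (simp add: d_def)
    finally show "(\<Sum>r\<in>R'. (cmod (module_operator T I m \<xi> r x))\<^sup>2) \<le> e" .
  qed
qed

lemma module_operator_bound:
  assumes \<xi>: "\<xi> \<in> l2_module I (C0 T)" and C: "\<And>x. x \<in> topspace T \<Longrightarrow> matrix_bound I (m x) C" "0 \<le> C"
  shows "module_norm I (module_operator T I m \<xi>) \<le> C * module_norm I \<xi>"
proof (subst module_norm_le_iff[OF module_operator_closed[OF \<xi>]])
  show "0 \<le> C * module_norm I \<xi>" using C(2) module_norm_nonneg[OF \<xi>] by simp
  show "\<forall>x R. finite R \<and> R \<subseteq> I \<longrightarrow> L2_set (\<lambda>r. cmod (module_operator T I m \<xi> r x)) R \<le> C * module_norm I \<xi>"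
  proof (intro allI impI)
    fix x R assume R: "finite R \<and> R \<subseteq> I"
    define F where "F = (\<Union>r\<in>R. row r)"
    have F: "finite F" "F \<subseteq> I" using R rows by (auto simp: F_def)
    have "L2_set (\<lambda>r. cmod (module_operator T I m \<xi> r x)) R \<le> C * L2_set (\<lambda>i. cmod (\<xi> i x)) F"
      using R by (intro module_operator_L2_set \<xi> C F) (auto simp: F_def)
    also have "\<dots> \<le> C * module_norm I \<xi>" by (intro mult_left_mono L2_set_le_module_norm[OF \<xi>] F C)
    finally show "L2_set (\<lambda>r. cmod (module_operator T I m \<xi> r x)) R \<le> C * module_norm I \<xi>" .
  qed
qed

lemma adjoint_matrix_field: "matrix_field T I (\<lambda>x r t. cnj (m x t r)) K"
proof
  fix r t and y :: "'x \<Rightarrow> complex" assume *: "r \<in> I" "t \<in> I" "y \<in> C0 T"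
  have "(\<lambda>x. cnj (m x t r * cnj (y x))) \<in> C0 T"
    using * by (intro C0_cnj entry)
  then show "(\<lambda>x. cnj (m x t r) * y x) \<in> C0 T" by simp
next
  show "matrix_bound I (\<lambda>r t. complex_of_real (cmod (cnj (m x t r)))) K" if "x \<in> topspace T" for x
    using matrix_bound_adjoint[OF bound[OF that]] by simp
qed (use rows cols bound_nonneg point_evaluation in auto)

text \<open>Only the order of summation is at issue. The double sum converges absolutely, with K
  times the two module norms as a bound, by the bound on the moduli and the Cauchy-Schwarz
  inequality.\<close>

lemma module_inner_adjoint:
  assumes \<xi>: "\<xi> \<in> l2_module I (C0 T)" and \<eta>: "\<eta> \<in> l2_module I (C0 T)"
  shows "module_inner I (module_operator T I m \<xi>) \<eta> = module_inner I \<xi> (module_operator T I (\<lambda>x r t. cnj (m x t r)) \<eta>)"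
proof
  fix x
  interpret adj: matrix_field T I "\<lambda>x r t. cnj (m x t r)" K by (rule adjoint_matrix_field)
  show "module_inner I (module_operator T I m \<xi>) \<eta> x = module_inner I \<xi> (module_operator T I (\<lambda>x r t. cnj (m x t r)) \<eta>) x"
  proof (cases "x \<in> topspace T")
    case False
    then show ?thesis using module_operator_outside[OF \<xi>] adj.module_operator_outside[OF \<eta>]
      by (simp add: module_inner_def)
  next
    case x: True
    define g where "g = (\<lambda>r t. cnj (m x r t * \<xi> t x) * \<eta> r x)"
    have "(\<lambda>p. norm (case p of (r, t) \<Rightarrow> g r t)) summable_on I \<times> I"
    proof (rule nonneg_bdd_above_summable_on)
      show "bdd_above (sum (\<lambda>p. norm (case p of (r, t) \<Rightarrow> g r t)) ` {P. P \<subseteq> I \<times> I \<and> finite P})"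
      proof (rule bdd_aboveI2)
        fix P assume "P \<in> {P. P \<subseteq> I \<times> I \<and> finite P}"
        then have P: "P \<subseteq> I \<times> I" "finite P" by auto
        define R F where "R = fst ` P" and "F = snd ` P"
        have RF: "finite R" "finite F" "R \<subseteq> I" "F \<subseteq> I" "P \<subseteq> R \<times> F"
          using P by (auto simp: R_def F_def) force+
        have "sum (\<lambda>p. norm (case p of (r, t) \<Rightarrow> g r t)) P \<le> sum (\<lambda>p. norm (case p of (r, t) \<Rightarrow> g r t)) (R \<times> F)"
          using RF by (intro sum_mono2) auto
        also have "\<dots> = (\<Sum>r\<in>R. \<Sum>t\<in>F. cmod (m x r t) * cmod (\<xi> t x) * cmod (\<eta> r x))"
          by (simp add: g_def norm_mult sum.cartesian_product case_prod_unfold)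
        also have "\<dots> = (\<Sum>r\<in>R. \<bar>cmod (\<Sum>t\<in>F. complex_of_real (cmod (m x r t)) * complex_of_real (cmod (\<xi> t x)))\<bar> * \<bar>cmod (\<eta> r x)\<bar>)"
        proof (rule sum.cong[OF refl])
          fix r
          have "(\<Sum>t\<in>F. complex_of_real (cmod (m x r t)) * complex_of_real (cmod (\<xi> t x))) = complex_of_real (\<Sum>t\<in>F. cmod (m x r t) * cmod (\<xi> t x))"
            by simp
          then show "(\<Sum>t\<in>F. cmod (m x r t) * cmod (\<xi> t x) * cmod (\<eta> r x)) =
              \<bar>cmod (\<Sum>t\<in>F. complex_of_real (cmod (m x r t)) * complex_of_real (cmod (\<xi> t x)))\<bar> * \<bar>cmod (\<eta> r x)\<bar>"
            by (simp only: norm_of_real abs_abs) (simp add: sum_nonneg sum_distrib_right)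
        qed
        also have "\<dots> \<le> L2_set (\<lambda>r. cmod (\<Sum>t\<in>F. complex_of_real (cmod (m x r t)) * complex_of_real (cmod (\<xi> t x)))) R * L2_set (\<lambda>r. cmod (\<eta> r x)) R"
          by (rule L2_set_mult_ineq)
        also have "\<dots> \<le> (K * L2_set (\<lambda>t. cmod (complex_of_real (cmod (\<xi> t x)))) F) * L2_set (\<lambda>r. cmod (\<eta> r x)) R"
          by (intro mult_right_mono matrix_boundD[OF bound[OF x]] RF) simp
        also have "\<dots> \<le> (K * module_norm I \<xi>) * module_norm I \<eta>"
          using L2_set_le_module_norm[OF \<xi> RF(2,4), of x] L2_set_le_module_norm[OF \<eta> RF(1,3), of x] bound_nonneg module_norm_nonneg[OF \<xi>]
          by (intro mult_mono mult_left_mono) simp_all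
        finally show "sum (\<lambda>p. norm (case p of (r, t) \<Rightarrow> g r t)) P \<le> (K * module_norm I \<xi>) * module_norm I \<eta>" .
      qed
    qed auto
    then have sm: "(\<lambda>(r, t). g r t) summable_on I \<times> I" by (rule abs_summable_summable)
    have "module_inner I (module_operator T I m \<xi>) \<eta> x = (\<Sum>\<^sub>\<infinity>r\<in>I. \<Sum>\<^sub>\<infinity>t\<in>I. g r t)"
      unfolding module_inner_def
    proof (rule infsum_cong)
      fix r assume r: "r \<in> I"
      have "(\<Sum>\<^sub>\<infinity>t\<in>I. g r t) = (\<Sum>\<^sub>\<infinity>t\<in>row r. g r t)"
        by (rule infsum_cong_neutral) (use x in \<open>auto simp: g_def\<close>)
      also have "\<dots> = (\<Sum>t\<in>row r. g r t)" using rows[OF r] by simp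
      also have "\<dots> = cnj (module_operator T I m \<xi> r x) * \<eta> r x"
        using module_operator_apply[OF \<xi> r x rows[OF r]] by (simp add: g_def sum_distrib_right)
      finally show "cnj (module_operator T I m \<xi> r x) * \<eta> r x = (\<Sum>\<^sub>\<infinity>t\<in>I. g r t)" ..
    qed
    also have "\<dots> = (\<Sum>\<^sub>\<infinity>t\<in>I. \<Sum>\<^sub>\<infinity>r\<in>I. g r t)" by (rule infsum_swap_banach[OF sm])
    also have "\<dots> = module_inner I \<xi> (module_operator T I (\<lambda>x r t. cnj (m x t r)) \<eta>) x"
      unfolding module_inner_def
    proof (rule infsum_cong)
      fix t assume t: "t \<in> I"
      have "(\<Sum>\<^sub>\<infinity>r\<in>I. g r t) = (\<Sum>\<^sub>\<infinity>r\<in>adj.row t. g r t)"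
        by (rule infsum_cong_neutral) (use x in \<open>auto simp: g_def\<close>)
      also have "\<dots> = (\<Sum>r\<in>adj.row t. g r t)" using adj.rows[OF t] by simp
      also have "\<dots> = cnj (\<xi> t x) * module_operator T I (\<lambda>x r t. cnj (m x t r)) \<eta> t x"
        using adj.module_operator_apply[OF \<eta> t x adj.rows[OF t]] by (simp add: g_def sum_distrib_left mult_ac)
      finally show "(\<Sum>\<^sub>\<infinity>r\<in>I. g r t) = cnj (\<xi> t x) * module_operator T I (\<lambda>x r t. cnj (m x t r)) \<eta> t x" .
    qed
    finally show ?thesis .
  qed
qed

lemma module_operator_adjointable: "module_operator T I m \<in> adjointable_operators I (C0 T)"
proof -
  interpret adj: matrix_field T I "\<lambda>x r t. cnj (m x t r)" K by (rule adjoint_matrix_field)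
  have "module_operator T I m \<in> l2_module I (C0 T) \<rightarrow>\<^sub>E l2_module I (C0 T)"
    using module_operator_closed by (auto simp: PiE_iff module_operator_def)
  then show ?thesis
    unfolding adjointable_operators_def using adj.module_operator_closed module_inner_adjoint
    by (auto intro!: bexI[of _ "module_operator T I (\<lambda>x r t. cnj (m x t r))"])
qed

lemma module_operator_delta:
  assumes t: "t \<in> I" and y: "y \<in> C0 T"
  shows "module_operator T I m (delta t y) r x = (if r \<in> I then m x r t * y x else 0)"
proof (cases "r \<in> I \<and> x \<in> topspace T")
  case True
  then have "module_operator T I m (delta t y) r x = (\<Sum>j\<in>insert t (row r). m x r j * delta t y j x)"
    using t rows by (intro module_operator_apply delta_in_l2_module y) auto
  also have "\<dots> = m x r t * delta t y t x"
    by (rule sum_at_most_one) (use rows True in \<open>auto simp: delta_def\<close>)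
  finally show ?thesis using True by (simp add: delta_def)
next
  case False
  then show ?thesis using module_operator_outside[OF delta_in_l2_module[OF t y]] C0D(2)[OF y] by auto
qed

text \<open>A vector at one point x is spread over the base by a function y with y(x) = 1 and
  modulus at most 1: the resulting family has module norm at most 1 and its value at x is the
  normalized vector, so the operator norm bounds the matrix at x.\<close>

lemma module_op_norm_le_iff:
  assumes C: "0 \<le> C"
  shows "module_op_norm I (C0 T) (module_operator T I m) \<le> C \<longleftrightarrow> (\<forall>x\<in>topspace T. matrix_bound I (m x) C)"
proof
  assume le: "\<forall>x\<in>topspace T. matrix_bound I (m x) C"
  have z: "0 \<in> l2_module I (C0 T)" by (rule l2_module_finite_support[of "{}"]) auto
  have "module_norm I (0 :: 'i \<Rightarrow> 'x \<Rightarrow> complex) \<le> 1" using module_norm_le_iff[OF z, of 1] by (simp add: L2_set_def)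
  then show "module_op_norm I (C0 T) (module_operator T I m) \<le> C"
    unfolding module_op_norm_def
  proof (intro cSUP_least)
    fix \<xi> assume "\<xi> \<in> {\<xi> \<in> l2_module I (C0 T). module_norm I \<xi> \<le> 1}"
    then show "module_norm I (module_operator T I m \<xi>) \<le> C"
      using order_trans[OF module_operator_bound[of \<xi> C] mult_left_mono[of "module_norm I \<xi>" 1 C]] le C by simp
  qed (use z in auto)
next
  assume le: "module_op_norm I (C0 T) (module_operator T I m) \<le> C"
  have bdd: "bdd_above ((\<lambda>\<xi>. module_norm I (module_operator T I m \<xi>)) ` {\<xi> \<in> l2_module I (C0 T). module_norm I \<xi> \<le> 1})"
  proof (rule bdd_aboveI2)
    fix \<xi> assume "\<xi> \<in> {\<xi> \<in> l2_module I (C0 T). module_norm I \<xi> \<le> 1}"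
    then show "module_norm I (module_operator T I m \<xi>) \<le> K"
      using order_trans[OF module_operator_bound[of \<xi> K] mult_left_mono[of "module_norm I \<xi>" 1 K]] matrix_bound_K bound_nonneg
      by simp
  qed
  show "\<forall>x\<in>topspace T. matrix_bound I (m x) C"
  proof (intro ballI matrix_boundI)
    fix x F R and v :: "'i \<Rightarrow> complex"
    assume x: "x \<in> topspace T" and *: "finite F" "F \<subseteq> I" "finite R" "R \<subseteq> I"
    let ?c = "L2_set (\<lambda>i. cmod (v i)) F"
    obtain y where y: "y \<in> C0 T" "y x = 1" "\<And>z. cmod (y z) \<le> 1" using point_evaluation[OF x] by blast
    show "L2_set (\<lambda>r. cmod (\<Sum>i\<in>F. m x r i * v i)) R \<le> C * ?c"
    proof (cases "?c = 0")
      case True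
      then have "v i = 0" if "i \<in> F" for i using * that by (simp add: L2_set_eq_0_iff)
      then show ?thesis by (simp add: True L2_set_def)
    next
      case False
      then have c: "0 < ?c" by (simp add: order_less_le)
      define a where "a = 1 / ?c"
      have a: "0 < a" "a * ?c = 1" using c by (simp_all add: a_def)
      define \<zeta> where "\<zeta> = (\<lambda>i. if i \<in> F then (\<lambda>z. (of_real a * v i) * y z) else 0)"
      have \<zeta>: "\<zeta> \<in> l2_module I (C0 T)"
        using * y by (intro l2_module_finite_support[of F]) (auto simp: \<zeta>_def intro: C0_scale)
      have n1: "module_norm I \<zeta> \<le> 1"
        unfolding module_norm_le_iff[OF \<zeta> zero_le_one]
      proof (intro allI impI)
        fix z G assume G: "finite G \<and> G \<subseteq> I"
        have "L2_set (\<lambda>i. cmod (\<zeta> i z)) G \<le> L2_set (\<lambda>i. if i \<in> F then a * cmod (v i) else 0) G"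
          using y(3)[of z] a by (intro L2_set_mono) (auto simp: \<zeta>_def norm_mult mult_left_le)
        also have "\<dots> \<le> L2_set (\<lambda>i. a * cmod (v i)) F"
        proof -
          have "(\<Sum>i\<in>G. (if i \<in> F then a * cmod (v i) else 0)\<^sup>2) = (\<Sum>i\<in>G \<inter> F. (a * cmod (v i))\<^sup>2)"
            using G by (intro sum.mono_neutral_cong_right) auto
          also have "\<dots> \<le> (\<Sum>i\<in>F. (a * cmod (v i))\<^sup>2)" using * by (intro sum_mono2) auto
          finally show ?thesis by (simp add: L2_set_def)
        qed
        also have "\<dots> = 1" using a by (simp flip: L2_set_right_distrib)
        finally show "L2_set (\<lambda>i. cmod (\<zeta> i z)) G \<le> 1" .
      qed
      have eq: "module_operator T I m \<zeta> r x = of_real a * (\<Sum>i\<in>F. m x r i * v i)" if "r \<in> R" for r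
      proof -
        have "module_operator T I m \<zeta> r x = (\<Sum>i\<in>F \<union> row r. m x r i * \<zeta> i x)"
          using that * rows by (intro module_operator_apply \<zeta> x) auto
        also have "\<dots> = (\<Sum>i\<in>F. m x r i * \<zeta> i x)"
        proof (rule sum.mono_neutral_right)
          show "finite (F \<union> row r)" using that *(1,4) rows[of r] by blast
        qed (simp_all add: \<zeta>_def)
        also have "\<dots> = of_real a * (\<Sum>i\<in>F. m x r i * v i)"
          unfolding sum_distrib_left by (rule sum.cong) (simp_all add: \<zeta>_def y(2))
        finally show ?thesis .
      qed
      have "a * L2_set (\<lambda>r. cmod (\<Sum>i\<in>F. m x r i * v i)) R = L2_set (\<lambda>r. a * cmod (\<Sum>i\<in>F. m x r i * v i)) R"
        using a by (simp add: L2_set_right_distrib)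
      also have "\<dots> = L2_set (\<lambda>r. cmod (module_operator T I m \<zeta> r x)) R"
        using a by (intro L2_set_cong) (auto simp: eq norm_mult)
      also have "\<dots> \<le> module_norm I (module_operator T I m \<zeta>)"
        using * by (intro L2_set_le_module_norm[OF module_operator_closed[OF \<zeta>]])
      also have "\<dots> \<le> module_op_norm I (C0 T) (module_operator T I m)"
        unfolding module_op_norm_def by (rule cSUP_upper) (use \<zeta> n1 bdd in auto)
      finally have "a * L2_set (\<lambda>r. cmod (\<Sum>i\<in>F. m x r i * v i)) R \<le> C" using le by simp
      then show ?thesis using c by (simp add: a_def field_simps)
    qed
  qed
qed

end

section \<open>The reduced KS-crossed product\<close>

context matrix_field
begin

lemma module_operator_unit_ball_bounded:
  "bdd_above ((\<lambda>\<xi>. module_norm I (module_operator T I m \<xi>)) ` {\<xi> \<in> l2_module I (C0 T). module_norm I \<xi> \<le> 1})"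
proof (rule bdd_aboveI2)
  fix \<xi> assume "\<xi> \<in> {\<xi> \<in> l2_module I (C0 T). module_norm I \<xi> \<le> 1}"
  then show "module_norm I (module_operator T I m \<xi>) \<le> K"
    using order_trans[OF module_operator_bound[of \<xi> K] mult_left_mono[of "module_norm I \<xi>" 1 K]] matrix_bound_K bound_nonneg
    by simp
qed

lemma module_op_norm_nonneg: "0 \<le> module_op_norm I (C0 T) (module_operator T I m)"
proof -
  have z: "0 \<in> l2_module I (C0 T)" by (rule l2_module_finite_support[of "{}"]) auto
  have "module_norm I (0 :: 'i \<Rightarrow> 'x \<Rightarrow> complex) \<le> 1" using module_norm_le_iff[OF z, of 1] by (simp add: L2_set_def)
  with z have "0 \<in> {\<xi> \<in> l2_module I (C0 T). module_norm I \<xi> \<le> 1}" by blast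
  then have "module_norm I (module_operator T I m 0) \<le> module_op_norm I (C0 T) (module_operator T I m)"
    unfolding module_op_norm_def by (rule cSUP_upper[OF _ module_operator_unit_ball_bounded])
  then show ?thesis using module_norm_nonneg[OF module_operator_closed[OF z]] by simp
qed

end

lemma delta_zero [simp]: "delta i 0 = 0"
  by (simp add: delta_def fun_eq_iff)

context locally_compact_action
begin

lemma KS_algebraic_iff:
  "T \<in> KS_algebraic Z \<theta> \<longleftrightarrow> (\<forall>s. T s \<in> C0 (subtopology Z (source s))) \<and> finite {s. T s \<noteq> 0}"
  by (simp add: KS_algebraic_def ideal_at_def)

lemma source_in_fiber: "t \<in> source_fiber e \<Longrightarrow> source t = idset \<theta> e"
  by (simp add: source_fiber_def)

text \<open>The matrix of l_e(T) at the point x of X_e. The idempotent e does not occur in the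
  entries; it selects the index set \<open>source_fiber e\<close>.\<close>

definition fiber_matrix :: "('s \<Rightarrow> 'z \<Rightarrow> complex) \<Rightarrow> 'z \<Rightarrow> 's \<Rightarrow> 's \<Rightarrow> complex" where
  "fiber_matrix T x r t = (\<Sum>s\<in>{s. T s \<noteq> 0}. if s\<^sup>\<star> * s * t = t \<and> s * t = r then T s (act t x) else 0)"

lemma topspace_idset: "e \<in> idempotents \<Longrightarrow> topspace (subtopology Z (idset \<theta> e)) = idset \<theta> e"
  using idset_subset by (simp add: Int_absorb1)

lemma source_mult_absorb: "s\<^sup>\<star> * s * t = t \<Longrightarrow> source (s * t) = source t"
  by (simp add: istar_mult_self_mult mult.assoc)

lemma evaluation_function:
  assumes U: "openin Z U" and x: "x \<in> U"
  shows "\<exists>y\<in>C0 (subtopology Z U). y x = 1 \<and> (\<forall>z. cmod (y z) \<le> 1)"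
proof -
  have "compactin Z {x}" using x openin_subset[OF U] by auto
  then show ?thesis
    using bump_function[OF locally_compact Hausdorff U, of "{x}"] x Cc_subset_C0 by (metis empty_subsetI insert_subset singletonI)
qed

text \<open>The constant is the sum of bounds for the coefficients, the same for every e, which
  makes the supremum over e in \<open>KS_reduced_norm\<close> finite. Each s contributes a partial
  permutation, since r = st and \<open>t = s\<^sup>\<star> * r\<close> determine each other.\<close>

lemma fiber_matrix_field:
  assumes e: "e \<in> idempotents" and T: "T \<in> KS_algebraic Z \<theta>"
  shows "\<exists>K. \<forall>e\<in>idempotents. matrix_field (subtopology Z (idset \<theta> e)) (source_fiber e) (fiber_matrix T) K"
proof -
  let ?S = "{s. T s \<noteq> 0}"
  have fin: "finite ?S" and Ts: "\<And>s. T s \<in> C0 (subtopology Z (source s))" using T by (auto simp: KS_algebraic_iff)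
  have "\<exists>M\<ge>0. \<forall>x. cmod (T s x) \<le> M" for s by (rule C0_bounded[OF Ts[of s]]) blast
  then obtain M where M: "\<And>s. 0 \<le> M s" "\<And>s x. cmod (T s x) \<le> M s" by metis
  have "matrix_field (subtopology Z (idset \<theta> e)) (source_fiber e) (fiber_matrix T) (\<Sum>s\<in>?S. M s)" if e: "e \<in> idempotents" for e
  proof
    fix r t y assume r: "r \<in> source_fiber e" and t: "t \<in> source_fiber e" and y: "y \<in> C0 (subtopology Z (idset \<theta> e))"
    have src: "source t = idset \<theta> e" using t by (rule source_in_fiber)
    have "(\<Sum>s\<in>?S. if s\<^sup>\<star> * s * t = t \<and> s * t = r then (\<lambda>z. if z \<in> source t then T s (act t z) * y z else 0) else 0)
        \<in> C0 (subtopology Z (idset \<theta> e))"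
    proof (rule C0_sum)
      fix s
      have "(\<lambda>z. if z \<in> source t then T s (act t z) * y z else 0) \<in> C0 (subtopology Z (idset \<theta> e))"
        if "s\<^sup>\<star> * s * t = t"
        using C0_product[OF Ts[of s], of y t] y src source_mult_absorb[OF that] by simp
      then show "(if s\<^sup>\<star> * s * t = t \<and> s * t = r then (\<lambda>z. if z \<in> source t then T s (act t z) * y z else 0) else 0)
        \<in> C0 (subtopology Z (idset \<theta> e))" by simp
    qed
    moreover have "(\<Sum>s\<in>?S. if s\<^sup>\<star> * s * t = t \<and> s * t = r then (\<lambda>z. if z \<in> source t then T s (act t z) * y z else 0) else 0)
        = (\<lambda>x. fiber_matrix T x r t * y x)"
    proof
      fix x
      have "y x = 0" if "x \<notin> source t" using C0D(2)[OF y, of x] that src topspace_idset[OF e] by simp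
      then show "(\<Sum>s\<in>?S. if s\<^sup>\<star> * s * t = t \<and> s * t = r then (\<lambda>z. if z \<in> source t then T s (act t z) * y z else 0) else 0) x
        = fiber_matrix T x r t * y x"
        unfolding sum_fun_apply fiber_matrix_def sum_distrib_right by (intro sum.cong) auto
    qed
    ultimately show "(\<lambda>x. fiber_matrix T x r t * y x) \<in> C0 (subtopology Z (idset \<theta> e))" by simp
  next
    have nz: "\<exists>s\<in>?S. s\<^sup>\<star> * s * t = t \<and> s * t = r" if "fiber_matrix T x r t \<noteq> 0" for x r t
    proof (rule ccontr)
      assume "\<not> ?thesis"
      then have "fiber_matrix T x r t = 0" unfolding fiber_matrix_def by (intro sum.neutral) auto
      then show False using that by simp
    qed
    have tr: "t = s\<^sup>\<star> * r" if "s\<^sup>\<star> * s * t = t" "s * t = r" for s t r using that by (metis mult.assoc)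
    show "finite {t \<in> source_fiber e. \<exists>x\<in>topspace (subtopology Z (idset \<theta> e)). fiber_matrix T x r t \<noteq> 0}" for r
      by (rule finite_subset[of _ "(\<lambda>s. s\<^sup>\<star> * r) ` ?S"]) (use fin nz tr in blast)+
    show "finite {r \<in> source_fiber e. \<exists>x\<in>topspace (subtopology Z (idset \<theta> e)). fiber_matrix T x r t \<noteq> 0}" for t
      by (rule finite_subset[of _ "(\<lambda>s. s * t) ` ?S"]) (use fin nz in blast)+
    fix x
    let ?m = "\<lambda>s r t. if s\<^sup>\<star> * s * t = t \<and> s * t = r then cmod (T s (act t x)) else 0"
    have "matrix_bound (source_fiber e) (\<lambda>r t. \<Sum>s\<in>?S. complex_of_real (?m s r t)) (\<Sum>s\<in>?S. M s)"
    proof (intro matrix_bound_sum fin matrix_bound_partial_permutation)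
      show "i = j" if "complex_of_real (?m s r i) \<noteq> 0" "complex_of_real (?m s r j) \<noteq> 0" for s r i j
        using that tr[of s i r] tr[of s j r] by (auto split: if_splits)
    qed (use M in \<open>auto split: if_splits\<close>)
    then have "matrix_bound (source_fiber e) (\<lambda>r t. complex_of_real (\<Sum>s\<in>?S. ?m s r t)) (\<Sum>s\<in>?S. M s)"
      by (simp only: of_real_sum)
    then show "matrix_bound (source_fiber e) (\<lambda>r t. complex_of_real (cmod (fiber_matrix T x r t))) (\<Sum>s\<in>?S. M s)"
    proof (rule matrix_bound_dominated)
      show "cmod (complex_of_real (cmod (fiber_matrix T x r t))) \<le> (\<Sum>s\<in>?S. ?m s r t)" for r t
        unfolding norm_of_real abs_norm_cancel fiber_matrix_def by (rule sum_norm_le) auto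
    qed
  next
    show "\<exists>y\<in>C0 (subtopology Z (idset \<theta> e)). y x = 1 \<and> (\<forall>z. cmod (y z) \<le> 1)"
      if "x \<in> topspace (subtopology Z (idset \<theta> e))" for x
      using evaluation_function[OF openin_idset[OF e]] that topspace_idset[OF e] by simp
  qed (use M in \<open>auto intro: sum_nonneg\<close>)
  then show ?thesis by blast
qed

text \<open>Existence for the definite description in \<open>KS_rep\<close> is
  \<open>module_operator_adjointable\<close>, uniqueness is
  \<open>adjointable_operators_determined\<close>.\<close>

lemma KS_rep_eq:
  assumes e: "e \<in> idempotents" and T: "T \<in> KS_algebraic Z \<theta>"
  shows "KS_rep Z \<theta> e T = module_operator (subtopology Z (idset \<theta> e)) (source_fiber e) (fiber_matrix T)"
proof -
  let ?U = "subtopology Z (idset \<theta> e)"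
  obtain K where "matrix_field ?U (source_fiber e) (fiber_matrix T) K" using fiber_matrix_field[OF e T] e by blast
  then interpret matrix_field ?U "source_fiber e" "fiber_matrix T" K .
  let ?L = "module_operator ?U (source_fiber e) (fiber_matrix T)"
  have eq: "(\<Sum>s\<in>{s. T s \<noteq> 0}. if s\<^sup>\<star> * s * t = t then delta (s * t) (induced \<theta> (t\<^sup>\<star>) (T s * induced \<theta> t y)) else 0)
      = ?L (delta t y)" if t: "t \<in> source_fiber e" and y: "y \<in> C0 ?U" for t y
  proof (intro ext)
    fix r x
    have src: "source t = idset \<theta> e" using t by (rule source_in_fiber)
    have y0: "y x = 0" if "x \<notin> source t" using C0D(2)[OF y, of x] that src topspace_idset[OF e] by simp
    have st: "s * t \<in> source_fiber e" if "s\<^sup>\<star> * s * t = t" for s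
      using that t by (simp add: source_fiber_def istar_mult_self_mult mult.assoc)
    have "(\<Sum>s\<in>{s. T s \<noteq> 0}. if s\<^sup>\<star> * s * t = t then delta (s * t) (induced \<theta> (t\<^sup>\<star>) (T s * induced \<theta> t y)) else 0) r x
        = (\<Sum>s\<in>{s. T s \<noteq> 0}. (if s\<^sup>\<star> * s * t = t \<and> s * t = r then T s (act t x) else 0) * y x)"
      unfolding sum_fun_apply by (intro sum.cong refl) (auto simp: delta_def induced_product y0)
    also have "\<dots> = fiber_matrix T x r t * y x" by (simp add: fiber_matrix_def sum_distrib_right)
    also have "\<dots> = ?L (delta t y) r x"
    proof (cases "r \<in> source_fiber e")
      case False
      then have "fiber_matrix T x r t = 0" unfolding fiber_matrix_def using st by (intro sum.neutral) auto
      then show ?thesis using False by (simp add: module_operator_delta[OF t y])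
    qed (simp add: module_operator_delta[OF t y])
    finally show "(\<Sum>s\<in>{s. T s \<noteq> 0}. if s\<^sup>\<star> * s * t = t then delta (s * t) (induced \<theta> (t\<^sup>\<star>) (T s * induced \<theta> t y)) else 0) r x
      = ?L (delta t y) r x" .
  qed
  have sep: "\<exists>y\<in>C0 ?U. y x = 1" if "x \<in> topspace ?U" for x
    using evaluation_function[OF openin_idset[OF e], of x] that unfolding topspace_idset[OF e] by blast
  show ?thesis unfolding KS_rep_def ideal_at_def
  proof (rule the_equality)
    show "?L \<in> adjointable_operators (source_fiber e) (C0 ?U) \<and> (\<forall>t\<in>source_fiber e. \<forall>y\<in>C0 ?U. ?L (delta t y) =
      (\<Sum>s\<in>{s. T s \<noteq> 0}. if s\<^sup>\<star> * s * t = t then delta (s * t) (induced \<theta> (t\<^sup>\<star>) (T s * induced \<theta> t y)) else 0))"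
      using module_operator_adjointable eq by simp
    show "L = ?L" if "L \<in> adjointable_operators (source_fiber e) (C0 ?U) \<and> (\<forall>t\<in>source_fiber e. \<forall>y\<in>C0 ?U. L (delta t y) =
      (\<Sum>s\<in>{s. T s \<noteq> 0}. if s\<^sup>\<star> * s * t = t then delta (s * t) (induced \<theta> (t\<^sup>\<star>) (T s * induced \<theta> t y)) else 0))" for L
      using that module_operator_adjointable eq sep by (intro adjointable_operators_determined[of L "source_fiber e" ?U]) auto
  qed
qed

lemma idempotents_nonempty: "(idempotents :: 's set) \<noteq> {}"
  using istar_mult_idem(1) by blast

text \<open>The bound K common to all e is kept in the statement because a supremum of reals has
  content only over a bounded set.\<close>

lemma KS_op_norm:
  assumes T: "T \<in> KS_algebraic Z \<theta>"
  shows "\<exists>K\<ge>0. \<forall>e\<in>idempotents.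
      0 \<le> module_op_norm (source_fiber e) (ideal_at Z \<theta> e) (KS_rep Z \<theta> e T) \<and>
      module_op_norm (source_fiber e) (ideal_at Z \<theta> e) (KS_rep Z \<theta> e T) \<le> K \<and>
      (\<forall>C\<ge>0. module_op_norm (source_fiber e) (ideal_at Z \<theta> e) (KS_rep Z \<theta> e T) \<le> C \<longleftrightarrow>
        (\<forall>x\<in>idset \<theta> e. matrix_bound (source_fiber e) (fiber_matrix T x) C))"
proof -
  obtain e0 :: 's where e0: "e0 \<in> idempotents" using idempotents_nonempty by blast
  obtain K where K: "\<forall>e\<in>idempotents. matrix_field (subtopology Z (idset \<theta> e)) (source_fiber e) (fiber_matrix T) K"
    using fiber_matrix_field[OF e0 T] by blast
  have "0 \<le> K" using K e0 matrix_field.bound_nonneg by blast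
  show ?thesis
  proof (intro exI[of _ K] conjI ballI \<open>0 \<le> K\<close>)
    fix e :: 's assume e: "e \<in> idempotents"
    interpret matrix_field "subtopology Z (idset \<theta> e)" "source_fiber e" "fiber_matrix T" K using K e by blast
    show "0 \<le> module_op_norm (source_fiber e) (ideal_at Z \<theta> e) (KS_rep Z \<theta> e T)"
      unfolding KS_rep_eq[OF e T] ideal_at_def by (rule module_op_norm_nonneg)
    show "module_op_norm (source_fiber e) (ideal_at Z \<theta> e) (KS_rep Z \<theta> e T) \<le> K"
      unfolding KS_rep_eq[OF e T] ideal_at_def module_op_norm_le_iff[OF bound_nonneg] using matrix_bound_K by blast
    show "\<forall>C\<ge>0. module_op_norm (source_fiber e) (ideal_at Z \<theta> e) (KS_rep Z \<theta> e T) \<le> C \<longleftrightarrow>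
        (\<forall>x\<in>idset \<theta> e. matrix_bound (source_fiber e) (fiber_matrix T x) C)"
      unfolding KS_rep_eq[OF e T] ideal_at_def using module_op_norm_le_iff topspace_idset[OF e] by simp
  qed
qed

text \<open>Of the same shape as \<open>reduced_norm_le_iff\<close>, so that equality of the two
  norms becomes an equivalence of matrix bounds.\<close>

lemma KS_reduced_norm_le_iff:
  assumes T: "T \<in> KS_algebraic Z \<theta>" and C: "0 \<le> C"
  shows "KS_reduced_norm Z \<theta> T \<le> C \<longleftrightarrow>
    (\<forall>e\<in>idempotents. \<forall>x\<in>idset \<theta> e. matrix_bound (source_fiber e) (fiber_matrix T x) C)"
    and "0 \<le> KS_reduced_norm Z \<theta> T"
proof -
  let ?n = "\<lambda>e. module_op_norm (source_fiber e) (ideal_at Z \<theta> e) (KS_rep Z \<theta> e T)"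
  obtain K where K: "\<And>e. e \<in> idempotents \<Longrightarrow> 0 \<le> ?n e" "\<And>e. e \<in> idempotents \<Longrightarrow> ?n e \<le> K"
    "\<And>e. e \<in> idempotents \<Longrightarrow> ?n e \<le> C \<longleftrightarrow> (\<forall>x\<in>idset \<theta> e. matrix_bound (source_fiber e) (fiber_matrix T x) C)"
    using KS_op_norm[OF T] C by auto
  have bdd: "bdd_above (?n ` idempotents)" using K(2) by (rule bdd_aboveI2)
  show "KS_reduced_norm Z \<theta> T \<le> C \<longleftrightarrow>
    (\<forall>e\<in>idempotents. \<forall>x\<in>idset \<theta> e. matrix_bound (source_fiber e) (fiber_matrix T x) C)"
    unfolding KS_reduced_norm_def using K(3) by (subst cSUP_le_iff[OF idempotents_nonempty bdd]) auto
  obtain e :: 's where e: "e \<in> idempotents" using idempotents_nonempty by blast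
  show "0 \<le> KS_reduced_norm Z \<theta> T"
    unfolding KS_reduced_norm_def by (rule order_trans[OF K(1)[OF e] cSUP_upper[OF e bdd]])
qed

section \<open>Closure of the algebraic crossed product under its operations\<close>

lemma KS_algebraic_add: 
  assumes "T \<in> KS_algebraic Z \<theta>" "U \<in> KS_algebraic Z \<theta>" shows "T + U \<in> KS_algebraic Z \<theta>"
proof -
  have "finite {s. (T + U) s \<noteq> 0}"
    by (rule finite_subset[of _ "{s. T s \<noteq> 0} \<union> {s. U s \<noteq> 0}"]) (use assms in \<open>auto simp: KS_algebraic_iff\<close>)
  then show ?thesis using assms by (auto simp: KS_algebraic_iff intro: C0_add)
qed

lemma KS_algebraic_scale: 
  assumes "T \<in> KS_algebraic Z \<theta>" shows "(\<lambda>s x. c * T s x) \<in> KS_algebraic Z \<theta>"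
proof -
  have "finite {s. (\<lambda>x. c * T s x) \<noteq> 0}"
    by (rule finite_subset[of _ "{s. T s \<noteq> 0}"]) (use assms in \<open>auto simp: KS_algebraic_iff fun_eq_iff\<close>)
  then show ?thesis using assms by (auto simp: KS_algebraic_iff intro: C0_scale)
qed

lemma KS_algebraic_delta:
  assumes "a \<in> C0 (subtopology Z (source s))" shows "delta s a \<in> KS_algebraic Z \<theta>"
proof -
  have "finite {t. delta s a t \<noteq> 0}" by (rule finite_subset[of _ "{s}"]) (auto simp: delta_def)
  then show ?thesis using assms by (auto simp: KS_algebraic_iff delta_def)
qed

lemma KS_algebraic_zero: "0 \<in> KS_algebraic Z \<theta>"
  by (simp add: KS_algebraic_iff)

lemma KS_algebraic_sum: "(\<And>i. i \<in> I \<Longrightarrow> T i \<in> KS_algebraic Z \<theta>) \<Longrightarrow> (\<Sum>i\<in>I. T i) \<in> KS_algebraic Z \<theta>"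
  by (induction I rule: infinite_finite_induct) (auto intro: KS_algebraic_add KS_algebraic_zero)

lemma induced_product_C0:
  assumes "a \<in> C0 (subtopology Z (source s))" "b \<in> C0 (subtopology Z (source t))"
  shows "induced \<theta> (t\<^sup>\<star>) (a * induced \<theta> t b) \<in> C0 (subtopology Z (source (s * t)))"
proof -
  have "induced \<theta> (t\<^sup>\<star>) (a * induced \<theta> t b) = (\<lambda>z. if z \<in> source t then a (act t z) * b z else 0)"
    by (simp add: induced_product fun_eq_iff)
  then show ?thesis using C0_product[OF assms] by simp
qed

lemma induced_cnj_C0:
  assumes "a \<in> C0 (subtopology Z (source s))"
  shows "induced \<theta> s (\<lambda>x. cnj (a x)) \<in> C0 (subtopology Z (source (s\<^sup>\<star>)))"
proof -
  have "induced \<theta> s (\<lambda>x. cnj (a x)) = (\<lambda>z. if z \<in> source (s\<^sup>\<star>) then cnj (a (act (s\<^sup>\<star>) z)) else 0)"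
    by (simp add: induced_eq fun_eq_iff)
  then show ?thesis using C0_adjoint[OF assms] by simp
qed

lemma KS_mult_closed:
  assumes "T \<in> KS_algebraic Z \<theta>" "U \<in> KS_algebraic Z \<theta>" shows "KS_mult \<theta> T U \<in> KS_algebraic Z \<theta>"
  unfolding KS_mult_def using assms
  by (intro KS_algebraic_sum KS_algebraic_delta induced_product_C0) (auto simp: KS_algebraic_iff)

lemma KS_adjoint_closed:
  assumes "T \<in> KS_algebraic Z \<theta>" shows "KS_adjoint \<theta> T \<in> KS_algebraic Z \<theta>"
  unfolding KS_adjoint_def using assms
  by (intro KS_algebraic_sum KS_algebraic_delta induced_cnj_C0) (auto simp: KS_algebraic_iff)

end

section \<open>The space and the action of Khoshkam and Skandalis\<close>

definition eval_at :: "('x \<Rightarrow> complex) \<Rightarrow> 's \<Rightarrow> ('s \<Rightarrow> 'x option) \<Rightarrow> complex" where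
  "eval_at a e \<tau> = (case \<tau> e of None \<Rightarrow> 0 | Some x \<Rightarrow> a x)"

text \<open>Continuity at the added point is vanishing at infinity: for V containing 0, the points
  of T with value outside V form a closed subset of a compact superlevel set.\<close>

lemma continuous_map_Alexandroff_C0:
  assumes T: "Hausdorff_space T" and a: "a \<in> C0 T"
  shows "continuous_map (Alexandroff_compactification T) euclidean (case_option 0 a)"
  unfolding continuous_map_def
proof (intro conjI allI impI)
  fix V :: "complex set" assume V: "openin euclidean V"
  show "openin (Alexandroff_compactification T) {p \<in> topspace (Alexandroff_compactification T). case_option 0 a p \<in> V}"
  proof (cases "0 \<in> V")
    case False
    then have "{p \<in> topspace (Alexandroff_compactification T). case_option 0 a p \<in> V} = Some ` {x \<in> topspace T. a x \<in> V}"
      by auto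
    then show ?thesis using openin_continuous_map_preimage[OF C0D(1)[OF a] V] by simp
  next
    case True
    then obtain d where d: "0 < d" "ball 0 d \<subseteq> V" using V open_contains_ball[of V] by (auto simp flip: open_openin)
    let ?C = "{x \<in> topspace T. a x \<in> - V}"
    have "closedin euclidean (- V)" using V by (simp add: closed_Compl flip: open_openin closed_closedin)
    then have c: "closedin T ?C" by (rule closedin_continuous_map_preimage[OF C0D(1)[OF a]])
    have "?C \<subseteq> {x \<in> topspace T. d \<le> cmod (a x)}" using d(2) by (auto simp: subset_iff not_le) (meson not_le)
    then have "compactin T ?C" using closed_compactin[OF C0D(3)[OF a d(1)] _ c] by blast
    moreover have "{p \<in> topspace (Alexandroff_compactification T). case_option 0 a p \<in> V} = insert None (Some ` (topspace T - ?C))"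
      using True by auto
    ultimately show ?thesis using c by (auto simp only: openin_Alexandroff_compactification)
  qed
qed auto

context locally_compact_action
begin

abbreviation "KS \<equiv> KS_space Z \<theta>"
abbreviation "KSa \<equiv> KS_action Z \<theta>"

section \<open>Elements of X^KS as points with filters of idempotents\<close>

lemma topspace_KS_product:
  "\<tau> \<in> topspace (KS_product Z \<theta>) \<longleftrightarrow> \<tau> \<in> extensional idempotents \<and> (\<forall>e\<in>idempotents. \<forall>x. \<tau> e = Some x \<longrightarrow> x \<in> idset \<theta> e)"
proof -
  have "o' \<in> insert None (Some ` (topspace Z \<inter> idset \<theta> e)) \<longleftrightarrow> (\<forall>x. o' = Some x \<longrightarrow> x \<in> idset \<theta> e)"
    if "e \<in> idempotents" for o' e
    using idset_subset[OF that] by (cases o') auto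
  then show ?thesis by (auto simp: KS_product_def PiE_iff)
qed

lemma KS_tilde_value: "\<tau> \<in> KS_tilde Z \<theta> \<Longrightarrow> e \<in> idempotents \<Longrightarrow> \<tau> e = Some x \<Longrightarrow> x \<in> idset \<theta> e"
  unfolding KS_tilde_def using topspace_KS_product by blast

lemma KS_tilde_up:
  assumes "\<tau> \<in> KS_tilde Z \<theta>" "e \<in> idempotents" "f \<in> idempotents" "f * e = e" "\<tau> e = Some x"
  shows "\<tau> f = Some x"
proof -
  have "natural_le e f \<and> \<tau> e \<noteq> None" using assms by (simp add: natural_le_idem)
  then have "\<tau> f = \<tau> e" using assms(1-3) unfolding KS_tilde_def by blast
  then show ?thesis using assms(5) by simp
qed

text \<open>Conditions (1) and (2) compare both values with the value at the product ef. So all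
  finite values of \<tau> agree, and a \<tau> other than infinity amounts to a point x together with
  the filter of idempotents at which \<tau> is finite.\<close>

lemma KS_tilde_same:
  assumes \<tau>: "\<tau> \<in> KS_tilde Z \<theta>" and e: "e \<in> idempotents" and f: "f \<in> idempotents"
    and x: "\<tau> e = Some x" and y: "\<tau> f = Some y"
  shows "x = y" "\<tau> (e * f) = Some x"
proof -
  have "\<tau> e \<noteq> None \<and> \<tau> f \<noteq> None" using x y by simp
  then have "\<tau> (e * f) \<noteq> None" using \<tau> e f unfolding KS_tilde_def by blast
  then obtain z where z: "\<tau> (e * f) = Some z" by auto
  have "e * (e * f) = e * f" using e by (simp add: idem_assoc)
  then have 1: "\<tau> e = Some z" using KS_tilde_up[OF \<tau> _ e _ z] e f by simp
  have "f * (e * f) = e * f" using e f by (simp add: idem_assoc idem_left_commute)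
  then have 2: "\<tau> f = Some z" using KS_tilde_up[OF \<tau> _ f _ z] e f by simp
  show "x = y" "\<tau> (e * f) = Some x" using 1 2 x y z by auto
qed

lemma KS_tilde_mult_iff:
  assumes \<tau>: "\<tau> \<in> KS_tilde Z \<theta>" and e: "e \<in> idempotents" and f: "f \<in> idempotents"
  shows "\<tau> (e * f) = Some x \<longleftrightarrow> \<tau> e = Some x \<and> \<tau> f = Some x"
proof
  assume z: "\<tau> (e * f) = Some x"
  have "e * (e * f) = e * f" "f * (e * f) = e * f" using e f by (simp_all add: idem_assoc idem_left_commute)
  then show "\<tau> e = Some x \<and> \<tau> f = Some x" using KS_tilde_up[OF \<tau> _ e _ z] KS_tilde_up[OF \<tau> _ f _ z] e f by simp
qed (use KS_tilde_same[OF \<tau> e f] in auto)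

lemma KS_tilde_extensional: "\<tau> \<in> KS_tilde Z \<theta> \<Longrightarrow> \<tau> \<in> extensional idempotents"
  unfolding KS_tilde_def using topspace_KS_product by auto

lemma topspace_KS: "\<tau> \<in> topspace KS \<longleftrightarrow> \<tau> \<in> KS_tilde Z \<theta> \<and> (\<exists>e\<in>idempotents. \<tau> e \<noteq> None)"
proof -
  have "\<tau> = KS_infinity \<longleftrightarrow> (\<forall>e\<in>idempotents. \<tau> e = None)" if "\<tau> \<in> extensional idempotents"
    using that by (auto simp: KS_infinity_def extensional_def fun_eq_iff)
  moreover have "topspace KS = KS_tilde Z \<theta> - {KS_infinity}"
    by (auto simp: KS_space_def KS_tilde_def)
  ultimately show ?thesis using KS_tilde_extensional by auto
qed

text \<open>By \<open>KS_tilde_same\<close> every element of X^KS has this form with F its filter;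
  the action then moves the point and the filter separately.\<close>

definition KS_point :: "'s set \<Rightarrow> 'z \<Rightarrow> 's \<Rightarrow> 'z option" where
  "KS_point F x = (\<lambda>e\<in>idempotents. if e \<in> F then Some x else None)"

lemma KS_point_apply: "e \<in> idempotents \<Longrightarrow> KS_point F x e = (if e \<in> F then Some x else None)"
  by (simp add: KS_point_def)

lemma KS_point_tilde:
  assumes "\<And>e. e \<in> idempotents \<Longrightarrow> e \<in> F \<Longrightarrow> x \<in> idset \<theta> e"
    and "\<And>e f. e \<in> idempotents \<Longrightarrow> f \<in> idempotents \<Longrightarrow> e \<in> F \<Longrightarrow> f * e = e \<Longrightarrow> f \<in> F"
    and "\<And>e f. e \<in> idempotents \<Longrightarrow> f \<in> idempotents \<Longrightarrow> e \<in> F \<Longrightarrow> f \<in> F \<Longrightarrow> e * f \<in> F"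
  shows "KS_point F x \<in> KS_tilde Z \<theta>"
  unfolding KS_tilde_def
proof (intro CollectI conjI ballI impI)
  show "KS_point F x \<in> topspace (KS_product Z \<theta>)"
    unfolding topspace_KS_product using assms(1) by (auto simp: KS_point_def)
next
  fix e f :: 's assume e: "e \<in> idempotents" and f: "f \<in> idempotents" and le: "natural_le e f \<and> KS_point F x e \<noteq> None"
  then have "e \<in> F" "f * e = e" by (simp_all add: KS_point_apply natural_le_idem split: if_splits)
  then show "KS_point F x f = KS_point F x e" using assms(2)[OF e f] e f by (simp add: KS_point_apply)
next
  fix e f :: 's assume e: "e \<in> idempotents" and f: "f \<in> idempotents" and "KS_point F x e \<noteq> None \<and> KS_point F x f \<noteq> None"
  then have "e \<in> F" "f \<in> F" by (simp_all add: KS_point_apply split: if_splits)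
  then show "KS_point F x (e * f) \<noteq> None" using assms(3)[OF e f] e f by (simp add: KS_point_apply)
qed

section \<open>The action on points and filters\<close>

lemma idem_conj_mult:
  fixes s :: 's
  assumes "e \<in> idempotents" "f \<in> idempotents"
  shows "s\<^sup>\<star> * e * s * (s\<^sup>\<star> * f * s) = s\<^sup>\<star> * (e * f) * s"
proof -
  have "s\<^sup>\<star> * e * s * (s\<^sup>\<star> * f * s) = s\<^sup>\<star> * e * ((s * s\<^sup>\<star>) * f) * s" by (simp add: mult.assoc)
  also have "\<dots> = s\<^sup>\<star> * e * (f * (s * s\<^sup>\<star>)) * s" using assms by (subst idem_commute) simp_all
  finally show ?thesis by (simp add: mult.assoc istar_assoc)
qed

lemma source_conj: "e \<in> idempotents \<Longrightarrow> source (e * s) = idset \<theta> (s\<^sup>\<star> * e * s)"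
  by (simp add: istar_mult_self_idem_left)

text \<open>The formula for the action applies \<theta>_{es} to the value of \<tau> at
  \<open>s\<^sup>\<star> * e * s\<close>, but every finite value of \<tau> is x, so the result is
  \<theta>_s(x) or infinity.\<close>

lemma KS_action_value:
  assumes \<tau>: "\<tau> \<in> KS_tilde Z \<theta>" and x: "\<tau> (s\<^sup>\<star> * s) = Some x" and e: "e \<in> idempotents"
  shows "(case \<tau> (s\<^sup>\<star> * e * s) of None \<Rightarrow> None | Some x \<Rightarrow> \<theta> (e * s) x) = (if \<tau> (s\<^sup>\<star> * e * s) \<noteq> None then Some (act s x) else None)"
    "\<tau> (s\<^sup>\<star> * e * s) \<noteq> None \<Longrightarrow> \<tau> (s\<^sup>\<star> * e * s) = Some x \<and> x \<in> source (e * s) \<and> act s x \<in> idset \<theta> e"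
proof -
  show 1: "\<tau> (s\<^sup>\<star> * e * s) = Some x \<and> x \<in> source (e * s) \<and> act s x \<in> idset \<theta> e" if ne: "\<tau> (s\<^sup>\<star> * e * s) \<noteq> None"
  proof -
    obtain y where y: "\<tau> (s\<^sup>\<star> * e * s) = Some y" using ne by auto
    then have "y = x" using KS_tilde_same(1)[OF \<tau> _ _ y x] e by simp
    then have "x \<in> source (e * s)" using KS_tilde_value[OF \<tau> _ y] e source_conj[OF e, of s] by simp
    then show ?thesis using y \<open>y = x\<close> source_mult[of x e s] e source_idem[OF e] by simp
  qed
  have "\<theta> (e * s) x = Some (act s x)" if "\<tau> (s\<^sup>\<star> * e * s) \<noteq> None"
    using 1[OF that] act_mult[of x e s] act_idem[OF e, of "act s x"] by (simp add: map_eq_Some_iff)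
  then show "(case \<tau> (s\<^sup>\<star> * e * s) of None \<Rightarrow> None | Some x \<Rightarrow> \<theta> (e * s) x) = (if \<tau> (s\<^sup>\<star> * e * s) \<noteq> None then Some (act s x) else None)"
    using 1 by (auto split: option.split)
qed

definition pushed_filter :: "('s \<Rightarrow> 'z option) \<Rightarrow> 's \<Rightarrow> 's set" where
  "pushed_filter \<tau> s = {e \<in> idempotents. \<tau> (s\<^sup>\<star> * e * s) \<noteq> None}"

lemma KS_action_eq:
  assumes \<tau>: "\<tau> \<in> topspace KS" and x: "\<tau> (s\<^sup>\<star> * s) = Some x"
  shows "KSa s \<tau> = Some (KS_point (pushed_filter \<tau> s) (act s x))"
  using \<tau> x KS_action_value(1)[of \<tau> s x]
  by (auto simp: KS_action_def KS_point_def pushed_filter_def topspace_KS fun_eq_iff restrict_def)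

lemma KS_action_None: "\<tau> \<notin> topspace KS \<or> \<tau> (s\<^sup>\<star> * s) = None \<Longrightarrow> KSa s \<tau> = None"
  by (auto simp: KS_action_def)

lemma KS_point_pushed:
  assumes \<tau>: "\<tau> \<in> topspace KS" and x: "\<tau> (s\<^sup>\<star> * s) = Some x"
  shows "KS_point (pushed_filter \<tau> s) (act s x) \<in> topspace KS"
proof -
  have \<tau>': "\<tau> \<in> KS_tilde Z \<theta>" using \<tau> topspace_KS by blast
  have "KS_point (pushed_filter \<tau> s) (act s x) \<in> KS_tilde Z \<theta>"
  proof (rule KS_point_tilde)
    show "act s x \<in> idset \<theta> e" if "e \<in> pushed_filter \<tau> s" for e
      using that KS_action_value(2)[OF \<tau>' x] by (auto simp: pushed_filter_def)
    show "f \<in> pushed_filter \<tau> s" if "e \<in> pushed_filter \<tau> s" "f \<in> idempotents" "f * e = e" for e f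
    proof -
      have e: "e \<in> idempotents" and "\<tau> (s\<^sup>\<star> * e * s) \<noteq> None" using that by (auto simp: pushed_filter_def)
      then obtain y where y: "\<tau> (s\<^sup>\<star> * e * s) = Some y" by auto
      have "s\<^sup>\<star> * f * s * (s\<^sup>\<star> * e * s) = s\<^sup>\<star> * e * s" using idem_conj_mult[OF that(2) e, of s] that(3) by simp
      from KS_tilde_up[OF \<tau>' _ _ this y] show ?thesis using that e by (simp add: pushed_filter_def)
    qed
    show "e * f \<in> pushed_filter \<tau> s" if "e \<in> pushed_filter \<tau> s" "f \<in> pushed_filter \<tau> s" for e f
    proof -
      have e: "e \<in> idempotents" "f \<in> idempotents" and "\<tau> (s\<^sup>\<star> * e * s) \<noteq> None" "\<tau> (s\<^sup>\<star> * f * s) \<noteq> None"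
        using that by (auto simp: pushed_filter_def)
      then obtain y w where y: "\<tau> (s\<^sup>\<star> * e * s) = Some y" "\<tau> (s\<^sup>\<star> * f * s) = Some w" by auto
      from KS_tilde_same(2)[OF \<tau>' _ _ y] e show ?thesis
        by (simp add: pushed_filter_def idem_conj_mult)
    qed
  qed
  moreover have "KS_point (pushed_filter \<tau> s) (act s x) (s * s\<^sup>\<star>) \<noteq> None"
    using x by (simp add: KS_point_apply pushed_filter_def mult.assoc istar_assoc)
  ultimately show ?thesis using istar_mult_idem(2) topspace_KS by blast
qed

text \<open>Point and filter compose separately: the point by \<theta>, the filter because
  \<open>t\<^sup>\<star> * (s\<^sup>\<star> * e * s) * t\<close> is the conjugate of e by
  \<open>s * t\<close>. The domains agree since
  \<open>t\<^sup>\<star> * (s\<^sup>\<star> * s) * t\<close> lies below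
  \<open>t\<^sup>\<star> * t\<close>.\<close>

lemma KS_action_mult: "KSa (s * t) = KSa s \<circ>\<^sub>m KSa t"
proof
  fix \<tau>
  show "KSa (s * t) \<tau> = (KSa s \<circ>\<^sub>m KSa t) \<tau>"
  proof (cases "\<tau> \<in> topspace KS \<and> \<tau> (t\<^sup>\<star> * t) \<noteq> None")
    case False
    have "KSa (s * t) \<tau> = None"
    proof (rule KS_action_None, rule ccontr)
      assume "\<not> (\<tau> \<notin> topspace KS \<or> \<tau> ((s * t)\<^sup>\<star> * (s * t)) = None)"
      then obtain y where \<tau>: "\<tau> \<in> topspace KS" and y: "\<tau> (t\<^sup>\<star> * (s\<^sup>\<star> * s) * t) = Some y" by (auto simp: istar_mult_self_mult)
      have "t\<^sup>\<star> * t * (t\<^sup>\<star> * (s\<^sup>\<star> * s) * t) = t\<^sup>\<star> * (s\<^sup>\<star> * s) * t" by (simp add: mult.assoc istar_assoc)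
      then have "\<tau> (t\<^sup>\<star> * t) = Some y" using KS_tilde_up[of \<tau> "t\<^sup>\<star> * (s\<^sup>\<star> * s) * t" "t\<^sup>\<star> * t" y] y \<tau> topspace_KS by simp
      then show False using False \<tau> by simp
    qed
    then show ?thesis using False KS_action_None[of \<tau> t] by (simp add: map_comp_def)
  next
    case True
    then obtain x where \<tau>: "\<tau> \<in> topspace KS" and x: "\<tau> (t\<^sup>\<star> * t) = Some x" by auto
    have \<tau>': "\<tau> \<in> KS_tilde Z \<theta>" using \<tau> topspace_KS by blast
    define \<sigma> where "\<sigma> = KS_point (pushed_filter \<tau> t) (act t x)"
    have \<sigma>: "\<sigma> \<in> topspace KS" "KSa t \<tau> = Some \<sigma>"
      using KS_point_pushed[OF \<tau> x] KS_action_eq[OF \<tau> x] by (simp_all add: \<sigma>_def)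
    have \<sigma>e: "\<sigma> e = (if \<tau> (t\<^sup>\<star> * e * t) \<noteq> None then Some (act t x) else None)" if "e \<in> idempotents" for e
      using that by (simp add: \<sigma>_def KS_point_apply pushed_filter_def)
    show ?thesis
    proof (cases "\<tau> (t\<^sup>\<star> * (s\<^sup>\<star> * s) * t) = None")
      case True
      then show ?thesis using \<sigma> \<sigma>e[of "s\<^sup>\<star> * s"] KS_action_None[of \<tau> "s * t"] KS_action_None[of \<sigma> s]
        by (simp add: map_comp_def istar_mult_self_mult)
    next
      case False
      then have st: "\<tau> (t\<^sup>\<star> * (s\<^sup>\<star> * s) * t) = Some x" using KS_action_value(2)[OF \<tau>' x, of "s\<^sup>\<star> * s"] by simp
      then have \<sigma>s: "\<sigma> (s\<^sup>\<star> * s) = Some (act t x)" using \<sigma>e[of "s\<^sup>\<star> * s"] by simp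
      have "x \<in> idset \<theta> (t\<^sup>\<star> * (s\<^sup>\<star> * s) * t)" using KS_tilde_value[OF \<tau>' _ st] by simp
      then have "act (s * t) x = act s (act t x)" using act_mult[of x s t] istar_mult_self_mult[of s t] by simp
      moreover have "pushed_filter \<tau> (s * t) = pushed_filter \<sigma> s"
        by (auto simp: pushed_filter_def \<sigma>e istar_mult mult.assoc split: if_splits)
      ultimately show ?thesis
        using KS_action_eq[OF \<sigma>(1) \<sigma>s] KS_action_eq[of \<tau> "s * t" x] \<tau> st \<sigma> by (simp add: map_comp_def istar_mult_self_mult)
    qed
  qed
qed

text \<open>Conjugation by e takes f to ef, and \<tau>, being finite at e, is finite at ef exactly
  if it is finite at f; so the filter is unchanged.\<close>

lemma KS_action_idem:
  assumes e: "e \<in> idempotents" and \<tau>: "\<tau> \<in> topspace KS" and x: "\<tau> e = Some x"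
  shows "KSa e \<tau> = Some \<tau>"
proof -
  have \<tau>': "\<tau> \<in> KS_tilde Z \<theta>" using \<tau> topspace_KS by blast
  have "KS_point (pushed_filter \<tau> e) (act e x) = \<tau>"
  proof
    fix f
    show "KS_point (pushed_filter \<tau> e) (act e x) f = \<tau> f"
    proof (cases "f \<in> idempotents")
      case True
      have "e\<^sup>\<star> * f * e = e * f" using e True by (simp add: mult.assoc idem_commute[of f e] idem_assoc)
      moreover have "\<tau> (e * f) = (if \<tau> f = None then None else Some x)"
        using KS_tilde_mult_iff[OF \<tau>' e True] KS_tilde_same[OF \<tau>' e True x] x
        by (cases "\<tau> f"; cases "\<tau> (e * f)") auto
      moreover have "\<tau> f = Some x" if "\<tau> f \<noteq> None" using KS_tilde_same[OF \<tau>' e True x] that by auto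
      moreover have "act e x = x" using act_idem[OF e] KS_tilde_value[OF \<tau>' e x] by simp
      ultimately show ?thesis using True by (auto simp: KS_point_apply pushed_filter_def)
    next
      case False
      then show ?thesis using KS_tilde_extensional[OF \<tau>'] by (simp add: KS_point_def extensional_def)
    qed
  qed
  then show ?thesis using KS_action_eq[OF \<tau>, of e x] x e by (simp add: idem_assoc)
qed

lemma KS_idset: "e \<in> idempotents \<Longrightarrow> idset KSa e = {\<tau> \<in> topspace KS. \<tau> e \<noteq> None}"
proof (intro set_eqI iffI)
  fix \<tau> assume e: "e \<in> idempotents" and "\<tau> \<in> idset KSa e"
  then have "KSa e \<tau> \<noteq> None" by (simp add: in_idset)
  then have "\<not> (\<tau> \<notin> topspace KS \<or> \<tau> (e\<^sup>\<star> * e) = None)" using KS_action_None[of \<tau> e] by argo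
  then show "\<tau> \<in> {\<tau> \<in> topspace KS. \<tau> e \<noteq> None}" using e by (simp add: idem_assoc)
next
  fix \<tau> assume e: "e \<in> idempotents" and "\<tau> \<in> {\<tau> \<in> topspace KS. \<tau> e \<noteq> None}"
  then show "\<tau> \<in> idset KSa e" using KS_action_idem[OF e] by (auto simp: in_idset)
qed

section \<open>Continuity of the action\<close>

lemma openin_KS_coordinate:
  assumes "e \<in> idempotents" "openin (Alexandroff_compactification (subtopology Z (idset \<theta> e))) V"
  shows "openin KS {\<tau> \<in> topspace KS. \<tau> e \<in> V}"
proof (rule openin_continuous_map_preimage[OF _ assms(2)])
  show "continuous_map KS (Alexandroff_compactification (subtopology Z (idset \<theta> e))) (\<lambda>\<tau>. \<tau> e)"
    unfolding KS_space_def KS_product_def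
    using continuous_map_product_projection[OF assms(1)] by (intro continuous_map_from_subtopology)
qed

lemma compactin_preimage_act:
  assumes L: "compactin Z L" "L \<subseteq> source s" and K: "compactin Z K"
  shows "compactin Z {x \<in> L. act s x \<in> K}"
proof -
  have "closedin (subtopology Z (source s)) {x \<in> source s. act s x \<in> K}"
    using closedin_continuous_map_preimage[OF continuous_map_act_full compactin_imp_closedin[OF Hausdorff K], of s] unfolding topspace_source .
  then have "compactin (subtopology Z (source s)) ({x \<in> source s. act s x \<in> K} \<inter> L)"
    using L by (intro closed_Int_compactin) (simp_all add: compactin_subtopology)
  moreover have "{x \<in> source s. act s x \<in> K} \<inter> L = {x \<in> L. act s x \<in> K}" using L(2) by blast
  ultimately show ?thesis by (simp add: compactin_subtopology)
qed

text \<open>For open subsets of X_e the preimage is read off at the coordinate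
  \<open>s\<^sup>\<star> * e * s\<close>. Neighbourhoods of infinity are the difficulty: for compact
  K in X_e the preimage under \<theta>_s need not be compact, since K may leave the range of
  \<theta>_s; it becomes compact after intersection with a compact neighbourhood of the value at
  \<open>s\<^sup>\<star> * s\<close>.\<close>

lemma KS_action_coordinate_continuous:
  assumes e: "e \<in> idempotents"
  shows "continuous_map (subtopology KS (idset KSa (s\<^sup>\<star> * s))) (Alexandroff_compactification (subtopology Z (idset \<theta> e)))
    (\<lambda>\<tau>. the (KSa s \<tau>) e)"
proof -
  let ?D = "idset KSa (s\<^sup>\<star> * s)" and ?X = "subtopology Z (idset \<theta> e)" and ?f = "s\<^sup>\<star> * e * s"
  let ?A = "Alexandroff_compactification ?X"
  have f: "?f \<in> idempotents" using e by simp
  have D: "?D = {\<tau> \<in> topspace KS. \<tau> (s\<^sup>\<star> * s) \<noteq> None}" by (simp add: KS_idset)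
  have topD: "topspace (subtopology KS ?D) = ?D" unfolding D by auto
  have "openin KS {\<tau> \<in> topspace KS. \<tau> (s\<^sup>\<star> * s) \<in> Some ` source s}"
    by (intro openin_KS_coordinate) (simp_all add: openin_open_subtopology)
  moreover have "{\<tau> \<in> topspace KS. \<tau> (s\<^sup>\<star> * s) \<in> Some ` source s} = ?D"
    unfolding D using KS_tilde_value[of _ "s\<^sup>\<star> * s"] topspace_KS by (auto simp: image_iff)
  ultimately have Do: "openin KS ?D" by simp
  have val: "the (KSa s \<tau>) e = (if \<tau> ?f = None then None else Some (act s x))"
    if "\<tau> \<in> topspace KS" "\<tau> (s\<^sup>\<star> * s) = Some x" for \<tau> x
    using KS_action_eq[OF that] e by (auto simp: KS_point_apply pushed_filter_def)
  have fx: "x = y \<and> x \<in> source (e * s) \<and> act s x \<in> idset \<theta> e"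
    if "\<tau> \<in> topspace KS" "\<tau> (s\<^sup>\<star> * s) = Some x" "\<tau> ?f = Some y" for \<tau> x y
    using KS_action_value(2)[of \<tau> s x e] that e topspace_KS by auto
  show ?thesis unfolding continuous_map_def topD
  proof (intro conjI allI impI)
    show "(\<lambda>\<tau>. the (KSa s \<tau>) e) \<in> ?D \<rightarrow> topspace ?A"
    proof
      fix \<tau> assume "\<tau> \<in> ?D"
      then obtain x where x: "\<tau> \<in> topspace KS" "\<tau> (s\<^sup>\<star> * s) = Some x" unfolding D by auto
      show "the (KSa s \<tau>) e \<in> topspace ?A"
        using fx[OF x] idset_subset[OF e] by (cases "\<tau> ?f") (auto simp: val[OF x])
    qed
    fix V assume V: "openin ?A V"
    let ?W = "{\<tau> \<in> ?D. the (KSa s \<tau>) e \<in> V}"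
    consider U where "openin ?X U" "V = Some ` U"
      | K where "compactin ?X K" "closedin ?X K" "V = insert None (Some ` (topspace ?X - K))"
      using V unfolding openin_Alexandroff_compactification by blast
    then have "openin KS ?W"
    proof cases
      case 1
      have U: "openin Z U" "U \<subseteq> idset \<theta> e" using 1 openin_idset[OF e] by (auto simp: openin_open_subtopology)
      let ?U = "{x \<in> source (e * s). act (e * s) x \<in> U}"
      have "openin (subtopology Z (source (e * s))) ?U"
        using openin_continuous_map_preimage[OF continuous_map_act_full U(1), of "e * s"] unfolding topspace_source .
      then have oU: "openin (subtopology Z (idset \<theta> ?f)) ?U" unfolding source_conj[OF e] .
      have actes: "act (e * s) x = act s x" if "x \<in> source (e * s)" for x
        using act_mult[OF that] source_mult[of x e s] that act_idem[OF e] source_idem[OF e] by simp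
      have "?W = ?D \<inter> {\<tau> \<in> topspace KS. \<tau> ?f \<in> Some ` ?U}"
      proof (intro set_eqI)
        fix \<tau>
        show "\<tau> \<in> ?W \<longleftrightarrow> \<tau> \<in> ?D \<inter> {\<tau> \<in> topspace KS. \<tau> ?f \<in> Some ` ?U}"
        proof (cases "\<tau> \<in> ?D")
          case True
          then obtain x where x: "\<tau> \<in> topspace KS" "\<tau> (s\<^sup>\<star> * s) = Some x" unfolding D by auto
          show ?thesis
          proof (cases "\<tau> ?f")
            case None
            then show ?thesis using True x by (auto simp: val[OF x] 1)
          next
            case (Some y)
            then show ?thesis using True x fx[OF x Some] actes[of x] by (auto simp: val[OF x] 1)
          qed
        qed simp
      qed
      then show ?thesis using Do openin_KS_coordinate[OF f, of "Some ` ?U"] oU by (simp add: openin_Int)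
    next
      case 2
      have K: "compactin Z K" "K \<subseteq> idset \<theta> e" using 2(1) by (auto simp: compactin_subtopology)
      show ?thesis
      proof (subst openin_subopen, intro ballI)
        fix \<tau>0 assume \<tau>0: "\<tau>0 \<in> ?W"
        then obtain x0 where x0: "\<tau>0 \<in> topspace KS" "\<tau>0 (s\<^sup>\<star> * s) = Some x0" unfolding D by auto
        have "x0 \<in> source s" using KS_tilde_value[of \<tau>0 "s\<^sup>\<star> * s" x0] x0 topspace_KS by simp
        then have "compactin (subtopology Z (source s)) {x0}" using source_subset by (auto simp: compactin_subtopology)
        moreover have "locally_compact_space (subtopology Z (source s))" "Hausdorff_space (subtopology Z (source s))"
          using locally_compact Hausdorff by (auto intro: locally_compact_space_open_subset Hausdorff_space_subtopology)
        ultimately obtain N L where N: "openin (subtopology Z (source s)) N" "compactin (subtopology Z (source s)) L" "{x0} \<subseteq> N" "N \<subseteq> L"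
          using locally_compact_space_compact_closed_compact[of "subtopology Z (source s)"] by metis
        have L: "compactin Z L" "L \<subseteq> source s" using N(2) by (auto simp: compactin_subtopology)
        \<comment> \<open>K' is compact in the set fixed by \<open>?f\<close>, so avoiding K' at the
          coordinate \<open>?f\<close> is an open condition, which infinity satisfies; for values in
          N at \<open>s\<^sup>\<star> * s\<close> it keeps the moved point out of K.\<close>
        define K' where "K' = {x \<in> L. act s x \<in> K}"
        have "K' \<subseteq> source (e * s)" using K(2) L(2) e by (auto simp: K'_def source_mult idem_assoc)
        moreover have "compactin Z K'" unfolding K'_def by (rule compactin_preimage_act[OF L K(1)])
        ultimately have K': "compactin (subtopology Z (idset \<theta> ?f)) K'" by (simp add: compactin_subtopology source_conj[OF e])
        let ?B = "Alexandroff_compactification (subtopology Z (idset \<theta> ?f))"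
        have "closedin (subtopology Z (idset \<theta> ?f)) K'"
          by (rule compactin_imp_closedin[OF Hausdorff_space_subtopology[OF Hausdorff] K'])
        then have "openin ?B (topspace ?B - Some ` K')"
          using K' by (intro openin_diff openin_topspace) simp
        then have o1: "openin KS {\<tau> \<in> topspace KS. \<tau> ?f \<in> topspace ?B - Some ` K'}" by (rule openin_KS_coordinate[OF f])
        have o2: "openin KS {\<tau> \<in> topspace KS. \<tau> (s\<^sup>\<star> * s) \<in> Some ` N}"
          using N(1) by (intro openin_KS_coordinate) simp_all
        let ?Q = "{\<tau> \<in> topspace KS. \<tau> (s\<^sup>\<star> * s) \<in> Some ` N} \<inter> {\<tau> \<in> topspace KS. \<tau> ?f \<in> topspace ?B - Some ` K'}"
        have topB: "\<tau> ?f \<in> topspace ?B" if "\<tau> \<in> topspace KS" for \<tau>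
          using that KS_tilde_value[of \<tau> ?f] f idset_subset[OF f] topspace_KS by (cases "\<tau> ?f") auto
        have "\<tau>0 \<in> ?Q"
        proof -
          have "\<tau>0 ?f \<notin> Some ` K'"
          proof
            assume "\<tau>0 ?f \<in> Some ` K'"
            then obtain y where y: "\<tau>0 ?f = Some y" "y \<in> K'" by auto
            then have "act s x0 \<in> K" using fx[OF x0 y(1)] by (simp add: K'_def)
            then show False using \<tau>0 y by (auto simp: val[OF x0] 2)
          qed
          then show ?thesis using topB[OF x0(1)] x0 N(3) by auto
        qed
        moreover have "?Q \<subseteq> ?W"
        proof
          fix \<tau> assume Q: "\<tau> \<in> ?Q"
          then obtain x where x: "\<tau> \<in> topspace KS" "\<tau> (s\<^sup>\<star> * s) = Some x" "x \<in> N" by auto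
          then have "\<tau> \<in> ?D" unfolding D by simp
          moreover have "the (KSa s \<tau>) e \<in> V"
          proof (cases "\<tau> ?f")
            case None
            then show ?thesis by (simp add: val[OF x(1,2)] 2)
          next
            case (Some y)
            have "x \<notin> K'" using Q Some fx[OF x(1,2) Some] by auto
            then have "act s x \<notin> K" using x(3) N(4) by (auto simp: K'_def)
            then show ?thesis using Some fx[OF x(1,2) Some] idset_subset[OF e] by (auto simp: val[OF x(1,2)] 2)
          qed
          ultimately show "\<tau> \<in> ?W" by simp
        qed
        ultimately show "\<exists>Q. openin KS Q \<and> \<tau>0 \<in> Q \<and> Q \<subseteq> ?W" using openin_Int[OF o2 o1] by blast
      qed
    qed
    then show "openin (subtopology KS ?D) ?W" using Do by (simp add: openin_open_subtopology)
  qed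
qed

lemma KS_semigroup_action: "semigroup_action KS KSa"
  unfolding semigroup_action_def
proof (intro conjI allI ballI)
  have dom: "\<tau> \<in> topspace KS \<and> \<tau> (s\<^sup>\<star> * s) \<noteq> None" if "KSa s \<tau> = Some \<sigma>" for s \<tau> \<sigma>
    using that KS_action_None[of \<tau> s] by (cases "\<tau> (s\<^sup>\<star> * s)") auto
  have ran: "\<sigma> \<in> topspace KS" if "KSa s \<tau> = Some \<sigma>" for s \<tau> \<sigma>
    using dom[OF that] KS_action_eq[of \<tau> s] KS_point_pushed[of \<tau> s] that by auto
  show "partial_bijection (topspace KS) (KSa s)" for s
    unfolding partial_bijection_def
  proof (intro conjI inj_onI)
    show "dom (KSa s) \<subseteq> topspace KS" using dom by blast
    show "ran (KSa s) \<subseteq> topspace KS" using ran by (auto simp: ran_def)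
    fix \<tau> \<sigma> assume *: "\<tau> \<in> dom (KSa s)" "\<sigma> \<in> dom (KSa s)" "KSa s \<tau> = KSa s \<sigma>"
    have "KSa (s\<^sup>\<star> * s) \<rho> = Some \<rho>" if "\<rho> \<in> dom (KSa s)" for \<rho>
      using that dom[of s \<rho>] KS_action_idem[of "s\<^sup>\<star> * s" \<rho>] by auto
    moreover have "KSa (s\<^sup>\<star> * s) \<tau> = KSa (s\<^sup>\<star> * s) \<sigma>" using *(3) by (simp add: KS_action_mult map_comp_def)
    ultimately show "\<tau> = \<sigma>" using *(1,2) by simp
  qed
  show "KSa (s * t) = KSa s \<circ>\<^sub>m KSa t" for s t by (rule KS_action_mult)
  show "openin KS (idset KSa e)" if e: "e \<in> idempotents" for e
  proof -
    have "openin KS {\<tau> \<in> topspace KS. \<tau> e \<in> Some ` idset \<theta> e}"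
      using e by (intro openin_KS_coordinate) (simp_all add: openin_open_subtopology openin_idset)
    moreover have "{\<tau> \<in> topspace KS. \<tau> e \<in> Some ` idset \<theta> e} = idset KSa e"
      unfolding KS_idset[OF e] using KS_tilde_value[OF _ e] topspace_KS by (auto simp: image_iff)
    ultimately show ?thesis by simp
  qed
  show "continuous_map (subtopology KS (idset KSa (s\<^sup>\<star> * s))) (subtopology KS (idset KSa (s * s\<^sup>\<star>))) (\<lambda>\<tau>. the (KSa s \<tau>))" for s
  proof (rule continuous_map_into_subtopology)
    let ?D = "idset KSa (s\<^sup>\<star> * s)"
    have D: "?D = {\<tau> \<in> topspace KS. \<tau> (s\<^sup>\<star> * s) \<noteq> None}" by (simp add: KS_idset)
    have im: "the (KSa s \<tau>) \<in> idset KSa (s * s\<^sup>\<star>)" if \<tau>D: "\<tau> \<in> topspace (subtopology KS ?D)" for \<tau>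
    proof -
      obtain x where x: "\<tau> \<in> topspace KS" "\<tau> (s\<^sup>\<star> * s) = Some x" using \<tau>D unfolding D by auto
      then show ?thesis
        using KS_action_eq[OF x] KS_point_pushed[OF x]
        by (simp add: KS_idset KS_point_apply pushed_filter_def mult.assoc istar_assoc)
    qed
    show "(\<lambda>\<tau>. the (KSa s \<tau>)) \<in> topspace (subtopology KS ?D) \<rightarrow> idset KSa (s * s\<^sup>\<star>)" using im by blast
    have imKS: "the (KSa s \<tau>) \<in> topspace KS" if "\<tau> \<in> topspace (subtopology KS ?D)" for \<tau>
      using im[OF that] KS_idset[of "s * s\<^sup>\<star>"] by simp
    have "continuous_map (subtopology KS ?D) (KS_product Z \<theta>) (\<lambda>\<tau>. the (KSa s \<tau>))"
      unfolding KS_product_def continuous_map_componentwise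
      using KS_action_coordinate_continuous KS_tilde_extensional imKS topspace_KS by blast
    moreover have "(\<lambda>\<tau>. the (KSa s \<tau>)) \<in> topspace (subtopology KS ?D) \<rightarrow> KS_tilde Z \<theta> - {KS_infinity}"
      using imKS by (auto simp: KS_space_def)
    ultimately show "continuous_map (subtopology KS ?D) KS (\<lambda>\<tau>. the (KSa s \<tau>))"
      unfolding KS_space_def[of Z \<theta>] by (rule continuous_map_into_subtopology)
  qed
  show "\<Union> (idset KSa ` idempotents) = topspace KS"
  proof (intro equalityI subsetI)
    fix \<tau> assume "\<tau> \<in> topspace KS"
    then obtain e where "e \<in> idempotents" "\<tau> \<in> topspace KS" "\<tau> e \<noteq> None" using topspace_KS by blast
    then show "\<tau> \<in> \<Union> (idset KSa ` idempotents)" using KS_idset by blast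
  qed (use KS_idset in blast)
qed

section \<open>Compactness of X^KS with infinity added\<close>

lemma continuous_map_eval_at:
  assumes "e \<in> idempotents" "a \<in> C0 (subtopology Z (idset \<theta> e))"
  shows "continuous_map (KS_product Z \<theta>) euclidean (eval_at a e)"
proof -
  have "continuous_map (KS_product Z \<theta>) (Alexandroff_compactification (subtopology Z (idset \<theta> e))) (\<lambda>\<tau>. \<tau> e)"
    unfolding KS_product_def by (rule continuous_map_product_projection[OF assms(1)])
  from continuous_map_compose[OF this continuous_map_Alexandroff_C0[OF Hausdorff_space_subtopology[OF Hausdorff] assms(2)]]
  show ?thesis by (simp add: o_def eval_at_def[abs_def])
qed

lemma C0_idset_iff: "e \<in> idempotents \<Longrightarrow> f \<in> C0 (subtopology Z (idset \<theta> e)) \<longleftrightarrow> f \<in> C0 Z \<and> (\<forall>z. z \<notin> idset \<theta> e \<longrightarrow> f z = 0)"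
  by (rule C0_subtopology_iff[OF Hausdorff openin_idset])

lemma C0_idset_mult:
  assumes "e \<in> idempotents" "f \<in> idempotents" "a \<in> C0 (subtopology Z (idset \<theta> e))" "b \<in> C0 (subtopology Z (idset \<theta> f))"
  shows "a * b \<in> C0 (subtopology Z (idset \<theta> (e * f)))"
  using assms C0_mult[of a Z b] unfolding C0_idset_iff[OF idem_mult[OF assms(1,2)]] 
  by (auto simp: C0_idset_iff idset_mult)

lemma eval_at_mult:
  assumes \<tau>: "\<tau> \<in> KS_tilde Z \<theta>" and e: "e \<in> idempotents" and f: "f \<in> idempotents"
  shows "eval_at a e \<tau> * eval_at b f \<tau> = eval_at (a * b) (e * f) \<tau>"
proof (cases "\<tau> (e * f)")
  case None
  then have "\<tau> e = None \<or> \<tau> f = None" 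
    using KS_tilde_same(2)[OF \<tau> e f] by (cases "\<tau> e"; cases "\<tau> f") simp_all
  then show ?thesis using None by (elim disjE) (simp_all add: eval_at_def)
next
  case (Some x)
  then show ?thesis using KS_tilde_mult_iff[OF \<tau> e f, of x] by (simp add: eval_at_def)
qed

lemma C0_separation:
  assumes U: "openin Z U" and x: "x \<in> U" and y: "x \<noteq> y"
  shows "\<exists>a\<in>C0 (subtopology Z U). a x = 1 \<and> a y = 0"
proof -
  have U': "openin Z (U - {y})" using open_in_Hausdorff_delete[OF Hausdorff U] .
  have xU: "x \<in> U - {y}" using x y by simp
  show ?thesis
  proof (rule bexE[OF evaluation_function[OF U' xU]])
    fix a assume a: "a \<in> C0 (subtopology Z (U - {y}))" and ax: "a x = 1 \<and> (\<forall>z. cmod (a z) \<le> 1)"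
    have "a \<in> C0 Z \<and> (\<forall>z. z \<notin> U - {y} \<longrightarrow> a z = 0)" using a C0_subtopology_iff[OF Hausdorff U', of a] by (rule iffD1[rotated])
    then have "a \<in> C0 (subtopology Z U)" "a y = 0" using C0_subtopology_iff[OF Hausdorff U, of a] by blast+
    then show ?thesis using ax by blast
  qed
qed

text \<open>Conditions (1) and (2) become multiplicativity of the evaluations, that is, equations
  between continuous functions on the product. In this form they define a closed subset of a compact
  space.\<close>

lemma KS_tilde_characterization:
  "KS_tilde Z \<theta> = {\<tau> \<in> topspace (KS_product Z \<theta>). \<forall>e\<in>idempotents. \<forall>f\<in>idempotents.
     \<forall>a\<in>C0 (subtopology Z (idset \<theta> e)). \<forall>b\<in>C0 (subtopology Z (idset \<theta> f)).
       eval_at a e \<tau> * eval_at b f \<tau> = eval_at (a * b) (e * f) \<tau>}" (is "_ = ?R")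
proof (intro equalityI subsetI)
  fix \<tau> assume "\<tau> \<in> KS_tilde Z \<theta>"
  then show "\<tau> \<in> ?R" using eval_at_mult[of \<tau>] unfolding KS_tilde_def by blast
next
  fix \<tau> assume \<tau>: "\<tau> \<in> ?R"
  then have top: "\<tau> \<in> topspace (KS_product Z \<theta>)" by blast
  have eq: "eval_at a e \<tau> * eval_at b f \<tau> = eval_at (a * b) (e * f) \<tau>"
    if "e \<in> idempotents" "f \<in> idempotents" "a \<in> C0 (subtopology Z (idset \<theta> e))" "b \<in> C0 (subtopology Z (idset \<theta> f))" for a b e f
    using \<tau> that by blast
  have val: "x \<in> idset \<theta> e" if "e \<in> idempotents" "\<tau> e = Some x" for e x using that top topspace_KS_product by blast
  show "\<tau> \<in> KS_tilde Z \<theta>" unfolding KS_tilde_def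
  proof (intro CollectI conjI ballI impI top)
    fix e f :: 's assume e: "e \<in> idempotents" and f: "f \<in> idempotents" and le: "natural_le e f \<and> \<tau> e \<noteq> None"
    have ef: "f * e = e" using le e by (simp add: natural_le_idem)
    obtain x where x: "\<tau> e = Some x" using le by (cases "\<tau> e") auto
    have ef': "e * f = e" using ef idem_commute[OF e f] by simp
    have xe: "x \<in> idset \<theta> e" using val[OF e x] .
    then have xf: "x \<in> idset \<theta> f" using idset_mono[OF e f ef] by blast
    obtain a where a: "a \<in> C0 (subtopology Z (idset \<theta> e))" "a x = 1" using evaluation_function[OF openin_idset[OF e] xe] by blast
    \<comment> \<open>Since \<open>e * f = e\<close> and a(x) = 1, multiplicativity says that
      evaluating at \<tau>(f) is evaluating at x; as functions in C_0 separate points, \<tau>(f) =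
      x.\<close>
    have b: "eval_at b f \<tau> = b x" if "b \<in> C0 (subtopology Z (idset \<theta> f))" for b
      using eq[OF e f a(1) that] a(2) x ef' by (simp add: eval_at_def)
    obtain b' where "b' \<in> C0 (subtopology Z (idset \<theta> f))" "b' x = 1" using evaluation_function[OF openin_idset[OF f] xf] by blast
    then have "eval_at b' f \<tau> = 1" using b by simp
    then have "\<tau> f \<noteq> None" by (cases "\<tau> f") (simp_all add: eval_at_def)
    then obtain y where y: "\<tau> f = Some y" by auto
    have "y = x"
    proof (rule ccontr)
      assume "y \<noteq> x"
      then obtain b where "b \<in> C0 (subtopology Z (idset \<theta> f))" "b x = 1" "b y = 0" using C0_separation[OF openin_idset[OF f] xf, of y] by auto
      then show False using b[of b] y by (simp add: eval_at_def)
    qed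
    then show "\<tau> f = \<tau> e" using x y by simp
  next
    fix e f :: 's assume e: "e \<in> idempotents" and f: "f \<in> idempotents" and "\<tau> e \<noteq> None \<and> \<tau> f \<noteq> None"
    then obtain x y where x: "\<tau> e = Some x" and y: "\<tau> f = Some y" by auto
    obtain a where a: "a \<in> C0 (subtopology Z (idset \<theta> e))" "a x = 1" using evaluation_function[OF openin_idset[OF e] val[OF e x]] by blast
    obtain b where b: "b \<in> C0 (subtopology Z (idset \<theta> f))" "b y = 1" using evaluation_function[OF openin_idset[OF f] val[OF f y]] by blast
    show "\<tau> (e * f) \<noteq> None" using eq[OF e f a(1) b(1)] a(2) b(2) x y by (cases "\<tau> (e * f)") (simp_all add: eval_at_def)
  qed
qed

abbreviation "KS_compact \<equiv> subtopology (KS_product Z \<theta>) (KS_tilde Z \<theta>)"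

lemma Hausdorff_KS_product: "Hausdorff_space (KS_product Z \<theta>)"
  unfolding KS_product_def Hausdorff_space_product_topology Hausdorff_space_Alexandroff_compactification
  using Hausdorff locally_compact openin_idset by (auto intro: Hausdorff_space_subtopology locally_compact_space_open_subset)

lemma closedin_KS_tilde: "closedin (KS_product Z \<theta>) (KS_tilde Z \<theta>)"
proof -
  have "KS_product Z \<theta> closure_of KS_tilde Z \<theta> \<subseteq> KS_tilde Z \<theta>"
  proof
    fix \<tau> assume \<tau>: "\<tau> \<in> KS_product Z \<theta> closure_of KS_tilde Z \<theta>"
    have "eval_at a e \<tau> * eval_at b f \<tau> = eval_at (a * b) (e * f) \<tau>"
      if "e \<in> idempotents" "f \<in> idempotents" "a \<in> C0 (subtopology Z (idset \<theta> e))" "b \<in> C0 (subtopology Z (idset \<theta> f))" for a b e f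
    proof (rule forall_in_closure_of_eq[OF \<tau>, of euclidean])
      show "Hausdorff_space (euclidean :: complex topology)" by simp
      show "continuous_map (KS_product Z \<theta>) euclidean (\<lambda>\<tau>. eval_at a e \<tau> * eval_at b f \<tau>)"
        using that by (intro continuous_map_complex_mult continuous_map_eval_at)
      show "continuous_map (KS_product Z \<theta>) euclidean (eval_at (a * b) (e * f))"
        using that by (intro continuous_map_eval_at C0_idset_mult idem_mult)
      show "eval_at a e \<tau> * eval_at b f \<tau> = eval_at (a * b) (e * f) \<tau>" if "\<tau> \<in> KS_tilde Z \<theta>" for \<tau>
        using that \<open>e \<in> idempotents\<close> \<open>f \<in> idempotents\<close> by (rule eval_at_mult)
    qed
    then show "\<tau> \<in> KS_tilde Z \<theta>"
      unfolding KS_tilde_characterization using \<tau> closure_of_subset_topspace[of "KS_product Z \<theta>"] by blast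
  qed
  moreover have "KS_tilde Z \<theta> \<subseteq> topspace (KS_product Z \<theta>)" by (auto simp: KS_tilde_def)
  ultimately show ?thesis using closure_of_subset_eq by blast
qed

lemma compact_space_KS_compact: "compact_space KS_compact"
proof -
  have "compact_space (KS_product Z \<theta>)" unfolding KS_product_def by (simp add: compact_space_product_topology)
  then show ?thesis using closedin_compact_space[OF _ closedin_KS_tilde] compact_space_subtopology by blast
qed

lemma Hausdorff_KS_compact: "Hausdorff_space KS_compact"
  by (rule Hausdorff_space_subtopology[OF Hausdorff_KS_product])

lemma topspace_KS_compact: "topspace KS_compact = KS_tilde Z \<theta>"
  by (auto simp: KS_tilde_def)

lemma KS_eq_subtopology: "KS = subtopology KS_compact (KS_tilde Z \<theta> - {KS_infinity})"
  by (simp add: KS_space_def subtopology_subtopology Int_absorb1)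

lemma openin_KS_compact: "openin KS_compact (KS_tilde Z \<theta> - {KS_infinity})"
  using open_in_Hausdorff_delete[OF Hausdorff_KS_compact openin_topspace] unfolding topspace_KS_compact .

lemma KS_locally_compact_action: "locally_compact_action KS KSa"
proof
  show "semigroup_action KS KSa" by (rule KS_semigroup_action)
  show "Hausdorff_space KS" unfolding KS_eq_subtopology by (rule Hausdorff_space_subtopology[OF Hausdorff_KS_compact])
  show "locally_compact_space KS" unfolding KS_eq_subtopology
    by (rule locally_compact_space_open_subset[OF disjI1[OF Hausdorff_KS_compact]
        compact_imp_locally_compact_space[OF compact_space_KS_compact] openin_KS_compact])
qed

end

section \<open>The comparison map\<close>

locale KS_comparison = locally_compact_action X \<theta>
  for X :: "'x topology" and \<theta> :: "'s::inverse_semigroup \<Rightarrow> 'x \<rightharpoonup> 'x"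

text \<open>Unprefixed facts concern \<theta> on X, those prefixed by \<open>ks\<close> the action
  on X^KS; \<open>ks.GG\<close> is the KS-groupoid.\<close>

sublocale KS_comparison \<subseteq> ks: locally_compact_action "KS_space X \<theta>" "KS_action X \<theta>"
  by (rule KS_locally_compact_action)

lemma (in partial_action) section_function_cong:
  assumes "\<And>z. z \<in> source s \<Longrightarrow> h z = k z"
  shows "section_function s h = section_function s k"
  using assms by (auto simp: section_function_def fun_eq_iff)

lemma eval_at_add: "eval_at (a + b) e = eval_at a e + eval_at b e"
  by (auto simp: eval_at_def fun_eq_iff split: option.split)

lemma eval_at_scale: "eval_at (\<lambda>x. c * a x) e = (\<lambda>\<tau>. c * eval_at a e \<tau>)"
  by (auto simp: eval_at_def fun_eq_iff split: option.split)

lemma eval_at_zero: "eval_at 0 e = 0"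
  by (auto simp: eval_at_def fun_eq_iff split: option.split)

lemma eval_at_bound: "(\<And>x. cmod (a x) \<le> M) \<Longrightarrow> 0 \<le> M \<Longrightarrow> cmod (eval_at a e \<tau>) \<le> M"
  by (auto simp: eval_at_def split: option.split)

context algebraic_groupoid
begin

lemma convolution_zero_left: "convolution G 0 g = 0"
  by (auto simp: convolution_def)

lemma convolution_zero_right: "convolution G f 0 = 0"
  by (auto simp: convolution_def)

lemma groupoid_adjoint_zero: "groupoid_adjoint G 0 = 0"
  by (auto simp: groupoid_adjoint_def)

lemma bounded_kernels_sum: "(\<And>i. i \<in> I \<Longrightarrow> f i \<in> bounded_kernels) \<Longrightarrow> (\<Sum>i\<in>I. f i) \<in> bounded_kernels"
  by (induction I rule: infinite_finite_induct) (simp_all only: sum.infinite sum.empty sum.insert bounded_kernels_zero bounded_kernels_add insert_iff simp_thms)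

lemma convolution_sum_left:
  assumes g: "g \<in> bounded_kernels"
  shows "convolution G (\<Sum>i\<in>I. f i) g = (\<Sum>i\<in>I. convolution G (f i) g)"
  by (induction I rule: infinite_finite_induct)
    (simp_all only: sum.infinite sum.empty sum.insert convolution_zero_left convolution_add_left[OF g] not_False_eq_True)

lemma convolution_sum_right:
  assumes g: "\<And>i. i \<in> I \<Longrightarrow> g i \<in> bounded_kernels"
  shows "convolution G f (\<Sum>i\<in>I. g i) = (\<Sum>i\<in>I. convolution G f (g i))"
  using g
proof (induction I rule: infinite_finite_induct)
  case (insert i I)
  have "convolution G f (g i + (\<Sum>i\<in>I. g i)) = convolution G f (g i) + convolution G f (\<Sum>i\<in>I. g i)"
    using insert.prems by (intro convolution_add_right bounded_kernels_sum) auto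
  also have "convolution G f (\<Sum>i\<in>I. g i) = (\<Sum>i\<in>I. convolution G f (g i))" using insert by blast
  finally show ?case by (simp only: sum.insert[OF insert.hyps(1,2)])
qed (simp_all only: sum.infinite sum.empty convolution_zero_right not_False_eq_True)

lemma groupoid_adjoint_sum: "groupoid_adjoint G (\<Sum>i\<in>I. f i) = (\<Sum>i\<in>I. groupoid_adjoint G (f i))"
  by (induction I rule: infinite_finite_induct)
    (simp_all only: sum.infinite sum.empty sum.insert groupoid_adjoint_zero groupoid_adjoint_add not_False_eq_True)

end

context KS_comparison
begin

lemma ks_source: "\<tau> \<in> ks.source s \<longleftrightarrow> \<tau> \<in> topspace KS \<and> \<tau> (s\<^sup>\<star> * s) \<noteq> None"
  using KS_idset[OF istar_mult_idem(1)] by auto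

lemma ks_idset: "e \<in> idempotents \<Longrightarrow> \<tau> \<in> idset KSa e \<longleftrightarrow> \<tau> \<in> topspace KS \<and> \<tau> e \<noteq> None"
  using KS_idset by auto

lemma ks_source_mult: "\<tau> \<in> ks.source (s * t) \<longleftrightarrow> \<tau> \<in> topspace KS \<and> \<tau> (t\<^sup>\<star> * (s\<^sup>\<star> * s) * t) \<noteq> None"
  using ks_source[of \<tau> "s * t"] by (simp only: istar_mult_self_mult)

lemma topspace_KS_tilde: "\<tau> \<in> topspace KS \<Longrightarrow> \<tau> \<in> KS_tilde X \<theta>"
  using topspace_KS by blast

lemma KS_value_unique:
  "\<tau> \<in> topspace KS \<Longrightarrow> e \<in> idempotents \<Longrightarrow> f \<in> idempotents \<Longrightarrow> \<tau> e = Some x \<Longrightarrow> \<tau> f \<noteq> None \<Longrightarrow> \<tau> f = Some x"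
  using KS_tilde_same(1)[of \<tau> e f x] topspace_KS_tilde by auto

lemma ks_act_value:
  assumes "\<tau> \<in> topspace KS" "\<tau> (s\<^sup>\<star> * s) = Some x" "e \<in> idempotents"
  shows "ks.act s \<tau> e = (if \<tau> (s\<^sup>\<star> * e * s) \<noteq> None then Some (act s x) else None)"
  using KS_action_eq[OF assms(1,2)] assms(3) by (simp add: KS_point_apply pushed_filter_def)

definition comparison :: "('s \<Rightarrow> 'x \<Rightarrow> complex) \<Rightarrow> ('s \<times> ('s \<Rightarrow> 'x option)) set \<Rightarrow> complex" where
  "comparison T = (\<Sum>s\<in>{s. T s \<noteq> 0}. ks.section_function s (eval_at (T s) (s\<^sup>\<star> * s)))"

lemma comparison_superset:
  assumes "finite S" "{s. T s \<noteq> 0} \<subseteq> S"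
  shows "comparison T = (\<Sum>s\<in>S. ks.section_function s (eval_at (T s) (s\<^sup>\<star> * s)))"
  unfolding comparison_def
proof (rule sum.mono_neutral_left[OF assms], intro ballI)
  fix s assume "s \<in> S - {s. T s \<noteq> 0}"
  then have "T s = 0" by simp
  then show "ks.section_function s (eval_at (T s) (s\<^sup>\<star> * s)) = 0" by (simp only: eval_at_zero ks.section_function_zero)
qed

lemma comparison_zero: "comparison 0 = 0"
  by (simp add: comparison_def)

lemma comparison_add:
  assumes "T \<in> KS_algebraic X \<theta>" "U \<in> KS_algebraic X \<theta>"
  shows "comparison (T + U) = comparison T + comparison U"
proof -
  let ?S = "{s. T s \<noteq> 0} \<union> {s. U s \<noteq> 0}"
  have S: "finite ?S" using assms by (simp add: KS_algebraic_iff)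
  have "comparison (T + U) = (\<Sum>s\<in>?S. ks.section_function s (eval_at ((T + U) s) (s\<^sup>\<star> * s)))"
    by (rule comparison_superset[OF S]) auto
  also have "\<dots> = (\<Sum>s\<in>?S. ks.section_function s (eval_at (T s) (s\<^sup>\<star> * s)) + ks.section_function s (eval_at (U s) (s\<^sup>\<star> * s)))"
  proof (rule sum.cong[OF refl])
    fix s
    have "(T + U) s = T s + U s" by simp
    then show "ks.section_function s (eval_at ((T + U) s) (s\<^sup>\<star> * s)) =
        ks.section_function s (eval_at (T s) (s\<^sup>\<star> * s)) + ks.section_function s (eval_at (U s) (s\<^sup>\<star> * s))"
      by (simp only: eval_at_add ks.section_function_add)
  qed
  also have "\<dots> = comparison T + comparison U"
    using comparison_superset[OF S, of T] comparison_superset[OF S, of U] by (simp only: sum.distrib Un_upper1 Un_upper2)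
  finally show ?thesis .
qed

lemma comparison_scale:
  assumes "T \<in> KS_algebraic X \<theta>"
  shows "comparison (\<lambda>s x. c * T s x) = (\<lambda>\<gamma>. c * comparison T \<gamma>)"
proof -
  let ?S = "{s. T s \<noteq> 0}"
  have S: "finite ?S" using assms by (simp add: KS_algebraic_iff)
  have "comparison (\<lambda>s x. c * T s x) = (\<Sum>s\<in>?S. ks.section_function s (eval_at (\<lambda>x. c * T s x) (s\<^sup>\<star> * s)))"
    by (rule comparison_superset[OF S]) (auto simp: fun_eq_iff)
  then show ?thesis
    by (simp add: eval_at_scale ks.section_function_scale comparison_def fun_eq_iff sum_fun_apply sum_distrib_left)
qed

lemma comparison_delta: "comparison (delta s a) = ks.section_function s (eval_at a (s\<^sup>\<star> * s))"
proof -
  have "{t. delta s a t \<noteq> 0} \<subseteq> {s}" by (auto simp: delta_def)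
  then show ?thesis using comparison_superset[of "{s}" "delta s a"] by (simp add: delta_def)
qed

lemma comparison_sum:
  assumes "\<And>i. i \<in> I \<Longrightarrow> T i \<in> KS_algebraic X \<theta>"
  shows "comparison (\<Sum>i\<in>I. T i) = (\<Sum>i\<in>I. comparison (T i))"
  using assms
proof (induction I rule: infinite_finite_induct)
  case (insert i I)
  have "comparison (T i + (\<Sum>i\<in>I. T i)) = comparison (T i) + comparison (\<Sum>i\<in>I. T i)"
    using insert.prems by (intro comparison_add KS_algebraic_sum) auto
  also have "comparison (\<Sum>i\<in>I. T i) = (\<Sum>i\<in>I. comparison (T i))" using insert by blast
  finally show ?case by (simp only: sum.insert[OF insert.hyps(1,2)])
qed (simp_all only: sum.infinite sum.empty comparison_zero not_False_eq_True)

lemma section_eval_bounded: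
  assumes a: "a \<in> C0 T" shows "ks.section_function s (eval_at a e) \<in> ks.bounded_kernels"
proof -
  obtain M where M: "0 \<le> M" "\<And>x. cmod (a x) \<le> M" using C0_bounded[OF a] by blast
  show ?thesis by (rule ks.bounded_section_function(1)[OF eval_at_bound[OF M(2,1)] M(1)])
qed

lemma comparison_bounded:
  assumes "T \<in> KS_algebraic X \<theta>" shows "comparison T \<in> ks.bounded_kernels"
  unfolding comparison_def using assms
  by (intro ks.bounded_kernels_sum section_eval_bounded) (auto simp: KS_algebraic_iff)

lemma comparison_mult:
  assumes T: "T \<in> KS_algebraic X \<theta>" and U: "U \<in> KS_algebraic X \<theta>"
  shows "comparison (KS_mult \<theta> T U) = convolution ks.GG (comparison T) (comparison U)"
proof -
  let ?S = "{s. T s \<noteq> 0}" and ?R = "{t. U t \<noteq> 0}"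
  let ?p = "\<lambda>s t. induced \<theta> (t\<^sup>\<star>) (T s * induced \<theta> t (U t))"
  have Ts: "T s \<in> C0 (subtopology X (source s))" and Us: "U s \<in> C0 (subtopology X (source s))" for s
    using T U by (simp_all add: KS_algebraic_iff)
  have eq: "convolution ks.GG (ks.section_function s (eval_at (T s) (s\<^sup>\<star> * s))) (ks.section_function t (eval_at (U t) (t\<^sup>\<star> * t)))
      = comparison (delta (s * t) (?p s t))" for s t
  proof -
    have "convolution ks.GG (ks.section_function s (eval_at (T s) (s\<^sup>\<star> * s))) (ks.section_function t (eval_at (U t) (t\<^sup>\<star> * t)))
      = ks.section_function (s * t) (\<lambda>\<tau>. if \<tau> \<in> ks.source t then eval_at (T s) (s\<^sup>\<star> * s) (ks.act t \<tau>) * eval_at (U t) (t\<^sup>\<star> * t) \<tau> else 0)"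
      by (rule ks.section_function_convolution[OF section_eval_bounded[OF Us]])
    also have "\<dots> = ks.section_function (s * t) (eval_at (?p s t) ((s * t)\<^sup>\<star> * (s * t)))"
    proof (rule ks.section_function_cong)
      \<comment> \<open>A point \<tau> in the source of \<open>s * t\<close> has the one value x at
        all idempotents involved, so both coefficients become T_s(\<theta>_t x) U_t(x).\<close>
      fix \<tau> assume st: "\<tau> \<in> ks.source (s * t)"
      then have \<tau>: "\<tau> \<in> topspace KS" by (simp only: ks_source)
      obtain x where x: "\<tau> ((s * t)\<^sup>\<star> * (s * t)) = Some x" using st unfolding ks_source by auto
      have t: "\<tau> \<in> ks.source t" using st ks.source_mult by blast
      then have xt: "\<tau> (t\<^sup>\<star> * t) = Some x"
        using KS_value_unique[OF \<tau> istar_mult_idem(1) istar_mult_idem(1) x] unfolding ks_source by blast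
      have "\<tau> (t\<^sup>\<star> * (s\<^sup>\<star> * s) * t) \<noteq> None" using x by (simp add: istar_mult_self_mult)
      then have "ks.act t \<tau> (s\<^sup>\<star> * s) = Some (act t x)" using ks_act_value[OF \<tau> xt, of "s\<^sup>\<star> * s"] by simp
      moreover have "x \<in> source t" using KS_tilde_value[OF topspace_KS_tilde[OF \<tau>] _ xt] by simp
      ultimately show "(if \<tau> \<in> ks.source t then eval_at (T s) (s\<^sup>\<star> * s) (ks.act t \<tau>) * eval_at (U t) (t\<^sup>\<star> * t) \<tau> else 0)
          = eval_at (?p s t) ((s * t)\<^sup>\<star> * (s * t)) \<tau>"
        using t x xt induced_product[of t "T s" "U t" x] by (simp add: eval_at_def)
    qed
    also have "\<dots> = comparison (delta (s * t) (?p s t))" by (simp only: comparison_delta)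
    finally show ?thesis .
  qed
  have "convolution ks.GG (comparison T) (comparison U) = (\<Sum>s\<in>?S. \<Sum>t\<in>?R. comparison (delta (s * t) (?p s t)))"
  proof -
    have "convolution ks.GG (comparison T) (comparison U)
        = (\<Sum>s\<in>?S. convolution ks.GG (ks.section_function s (eval_at (T s) (s\<^sup>\<star> * s))) (comparison U))"
      unfolding comparison_def[of T] by (rule ks.convolution_sum_left[OF comparison_bounded[OF U]])
    also have "\<dots> = (\<Sum>s\<in>?S. \<Sum>t\<in>?R. convolution ks.GG (ks.section_function s (eval_at (T s) (s\<^sup>\<star> * s)))
        (ks.section_function t (eval_at (U t) (t\<^sup>\<star> * t))))"
      unfolding comparison_def[of U] by (intro sum.cong[OF refl] ks.convolution_sum_right section_eval_bounded[OF Us])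
    finally show ?thesis by (simp only: eq)
  qed
  also have "\<dots> = (\<Sum>s\<in>?S. comparison (\<Sum>t\<in>?R. delta (s * t) (?p s t)))"
    by (intro sum.cong[OF refl] comparison_sum[symmetric] KS_algebraic_delta induced_product_C0 Ts Us)
  also have "\<dots> = comparison (\<Sum>s\<in>?S. \<Sum>t\<in>?R. delta (s * t) (?p s t))"
    by (intro comparison_sum[symmetric] KS_algebraic_sum KS_algebraic_delta induced_product_C0 Ts Us)
  finally show ?thesis by (simp only: KS_mult_def)
qed

lemma comparison_adjoint:
  assumes T: "T \<in> KS_algebraic X \<theta>"
  shows "comparison (KS_adjoint \<theta> T) = groupoid_adjoint ks.GG (comparison T)"
proof -
  let ?S = "{s. T s \<noteq> 0}"
  let ?p = "\<lambda>s. induced \<theta> s (\<lambda>x. cnj (T s x))"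
  have Ts: "T s \<in> C0 (subtopology X (source s))" for s using T by (simp add: KS_algebraic_iff)
  have eq: "groupoid_adjoint ks.GG (ks.section_function s (eval_at (T s) (s\<^sup>\<star> * s))) = comparison (delta (s\<^sup>\<star>) (?p s))" for s
  proof -
    have "groupoid_adjoint ks.GG (ks.section_function s (eval_at (T s) (s\<^sup>\<star> * s))) =
      ks.section_function (s\<^sup>\<star>) (\<lambda>\<tau>. if \<tau> \<in> ks.source (s\<^sup>\<star>) then cnj (eval_at (T s) (s\<^sup>\<star> * s) (ks.act (s\<^sup>\<star>) \<tau>)) else 0)"
      by (rule ks.section_function_adjoint)
    also have "\<dots> = ks.section_function (s\<^sup>\<star>) (eval_at (?p s) ((s\<^sup>\<star>)\<^sup>\<star> * s\<^sup>\<star>))"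
    proof (rule ks.section_function_cong)
      fix \<tau> assume s: "\<tau> \<in> ks.source (s\<^sup>\<star>)"
      then have \<tau>: "\<tau> \<in> topspace KS" by (simp only: ks_source)
      obtain x where x: "\<tau> ((s\<^sup>\<star>)\<^sup>\<star> * s\<^sup>\<star>) = Some x" using s unfolding ks_source by auto
      have "(s\<^sup>\<star>)\<^sup>\<star> * (s\<^sup>\<star> * s) * s\<^sup>\<star> = (s\<^sup>\<star>)\<^sup>\<star> * s\<^sup>\<star>" by (simp add: mult.assoc istar_assoc)
      then have "ks.act (s\<^sup>\<star>) \<tau> (s\<^sup>\<star> * s) = Some (act (s\<^sup>\<star>) x)" using ks_act_value[OF \<tau> x, of "s\<^sup>\<star> * s"] x by simp
      moreover have "x \<in> source (s\<^sup>\<star>)" using KS_tilde_value[OF topspace_KS_tilde[OF \<tau>] _ x] by simp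
      ultimately show "(if \<tau> \<in> ks.source (s\<^sup>\<star>) then cnj (eval_at (T s) (s\<^sup>\<star> * s) (ks.act (s\<^sup>\<star>) \<tau>)) else 0)
          = eval_at (?p s) ((s\<^sup>\<star>)\<^sup>\<star> * s\<^sup>\<star>) \<tau>"
        using s x induced_eq[of s "\<lambda>x. cnj (T s x)" x] by (simp add: eval_at_def)
    qed
    also have "\<dots> = comparison (delta (s\<^sup>\<star>) (?p s))" by (simp only: comparison_delta)
    finally show ?thesis .
  qed
  have "groupoid_adjoint ks.GG (comparison T) = (\<Sum>s\<in>?S. comparison (delta (s\<^sup>\<star>) (?p s)))"
    by (simp only: comparison_def[of T] ks.groupoid_adjoint_sum eq)
  also have "\<dots> = comparison (\<Sum>s\<in>?S. delta (s\<^sup>\<star>) (?p s))"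
    by (intro comparison_sum[symmetric] KS_algebraic_delta induced_cnj_C0 Ts)
  finally show ?thesis by (simp only: KS_adjoint_def)
qed

section \<open>Equality of the two reduced norms\<close>

lemma ks_germ_eq_iff:
  assumes "\<tau> \<in> ks.source s" "\<tau> \<in> ks.source t"
  shows "germ KSa s \<tau> = germ KSa t \<tau> \<longleftrightarrow> (\<exists>e\<in>idempotents. s * e = t * e \<and> \<tau> e \<noteq> None)"
  using ks.germ_eq_iff[OF assms] assms by (auto simp: ks_idset ks_source)

text \<open>The entries are those of \<open>fiber_matrix\<close> at x, except that equality in S is
  replaced by equality of germs, and the condition \<open>s\<^sup>\<star> * s * t = t\<close> by
  \<tau> lying in the source of \<open>s * t\<close>. The isometry compares the two kinds of
  condition.\<close>

lemma kernel_comparison: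
  assumes T: "T \<in> KS_algebraic X \<theta>" and t: "\<tau> \<in> ks.source t" and r: "\<tau> \<in> ks.source r"
    and x: "\<tau> e = Some x" "e \<in> idempotents"
  shows "ks.kernel (comparison T) (germ KSa r \<tau>) (germ KSa t \<tau>) =
    (\<Sum>s\<in>{s. T s \<noteq> 0}. if \<tau> \<in> ks.source (s * t) \<and> germ KSa r \<tau> = germ KSa (s * t) \<tau> then T s (act t x) else 0)"
proof -
  have \<tau>: "\<tau> \<in> topspace KS" using t by (simp only: ks_source)
  have xt: "\<tau> (t\<^sup>\<star> * t) = Some x" using KS_value_unique[OF \<tau> x(2) _ x(1)] t by (simp add: ks_source)
  have "ks.kernel (comparison T) (germ KSa r \<tau>) (germ KSa t \<tau>) =
      (\<Sum>s\<in>{s. T s \<noteq> 0}. ks.kernel (ks.section_function s (eval_at (T s) (s\<^sup>\<star> * s))) (germ KSa r \<tau>) (germ KSa t \<tau>))"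
    unfolding ks.kernel_def comparison_def sum_fun_apply ..
  also have "\<dots> = (\<Sum>s\<in>{s. T s \<noteq> 0}. if \<tau> \<in> ks.source (s * t) \<and> germ KSa r \<tau> = germ KSa (s * t) \<tau> then T s (act t x) else 0)"
  proof (rule sum.cong[OF refl])
    fix s
    have "eval_at (T s) (s\<^sup>\<star> * s) (ks.act t \<tau>) = T s (act t x)" if "\<tau> \<in> ks.source (s * t)"
    proof -
      have "\<tau> (t\<^sup>\<star> * (s\<^sup>\<star> * s) * t) \<noteq> None" using that unfolding ks_source_mult by blast
      then show ?thesis using ks_act_value[OF \<tau> xt, of "s\<^sup>\<star> * s"] by (simp add: eval_at_def)
    qed
    then show "ks.kernel (ks.section_function s (eval_at (T s) (s\<^sup>\<star> * s))) (germ KSa r \<tau>) (germ KSa t \<tau>) =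
       (if \<tau> \<in> ks.source (s * t) \<and> germ KSa r \<tau> = germ KSa (s * t) \<tau> then T s (act t x) else 0)"
      using ks.kernel_section_function[OF t r] by auto
  qed
  finally show ?thesis .
qed

text \<open>The idempotents at which \<tau> is finite are closed under products and there is at
  least one, so finitely many conditions that each hold below some such e hold together below a
  product.\<close>

lemma filter_finite:
  assumes \<tau>: "\<tau> \<in> topspace KS" and Q: "finite Q"
    and P: "\<And>q. q \<in> Q \<Longrightarrow> \<exists>e\<in>idempotents. \<tau> e \<noteq> None \<and> (\<forall>f\<in>idempotents. \<tau> f \<noteq> None \<longrightarrow> e * f = f \<longrightarrow> P q f)"
  shows "\<exists>e\<in>idempotents. \<tau> e \<noteq> None \<and> (\<forall>f\<in>idempotents. \<tau> f \<noteq> None \<longrightarrow> e * f = f \<longrightarrow> (\<forall>q\<in>Q. P q f))"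
  using Q P
proof (induction Q rule: finite_induct)
  case empty
  then show ?case using \<tau> topspace_KS by blast
next
  case (insert q Q)
  obtain e where e: "e \<in> idempotents" "\<tau> e \<noteq> None" "\<And>f. f \<in> idempotents \<Longrightarrow> \<tau> f \<noteq> None \<Longrightarrow> e * f = f \<Longrightarrow> \<forall>q\<in>Q. P q f"
    using insert.IH insert.prems by (metis insertI2)
  obtain e' where e': "e' \<in> idempotents" "\<tau> e' \<noteq> None" "\<And>f. f \<in> idempotents \<Longrightarrow> \<tau> f \<noteq> None \<Longrightarrow> e' * f = f \<Longrightarrow> P q f"
    using insert.prems by (metis insertI1)
  have "\<tau> (e * e') \<noteq> None" using KS_tilde_same(2)[OF topspace_KS_tilde[OF \<tau>] e(1) e'(1)] e(2) e'(2) by auto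
  moreover have "\<forall>q\<in>insert q Q. P q f" if f: "f \<in> idempotents" "\<tau> f \<noteq> None" "e * e' * f = f" for f
  proof -
    have "e * f = f" "e' * f = f"
      using f(3) e(1) e'(1) idem_assoc(2)[of e "e' * f"] idem_assoc(2)[of e' "e * f"] idem_left_commute[of e e' f]
      by (metis mult.assoc)+
    then show ?thesis using e(3) e'(3) f by blast
  qed
  ultimately show ?case using idem_mult[OF e(1) e'(1)] by blast
qed

text \<open>Equality of germs over \<tau> becomes equality in S after restriction to f, once f is
  small enough in the filter of \<tau>. If the germs agree, f is taken below a witness of this and
  below the source projection of \<open>s * t\<close>; if not, any f below the source projection of
  t works, because an equation at f would itself witness equality of germs.\<close>

lemma finite_section_matching:
  assumes t: "\<tau> \<in> ks.source t" and r: "\<tau> \<in> ks.source r"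
  shows "\<exists>e\<in>idempotents. \<tau> e \<noteq> None \<and> (\<forall>f\<in>idempotents. \<tau> f \<noteq> None \<longrightarrow> e * f = f \<longrightarrow>
    (\<tau> \<in> ks.source (s * t) \<and> germ KSa r \<tau> = germ KSa (s * t) \<tau> \<longleftrightarrow> s\<^sup>\<star> * s * (t * f) = t * f \<and> s * (t * f) = r * f))"
proof -
  have \<tau>: "\<tau> \<in> topspace KS" using t by (simp only: ks_source)
  note \<tau>' = topspace_KS_tilde[OF \<tau>]
  let ?A = "\<tau> \<in> ks.source (s * t) \<and> germ KSa r \<tau> = germ KSa (s * t) \<tau>"
  let ?e1 = "t\<^sup>\<star> * (s\<^sup>\<star> * s) * t"
  show ?thesis
  proof (cases ?A)
    case True
    then obtain f where f: "f \<in> idempotents" "r * f = s * t * f" "\<tau> f \<noteq> None" using ks_germ_eq_iff[OF r] by blast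
    have e1: "\<tau> ?e1 \<noteq> None" using True unfolding ks_source_mult by blast
    have e1i: "?e1 \<in> idempotents" by simp
    have te1: "t * ?e1 = s\<^sup>\<star> * s * t"
    proof -
      have "t * ?e1 = (t * t\<^sup>\<star>) * (s\<^sup>\<star> * s) * t" by (simp add: mult.assoc)
      also have "\<dots> = (s\<^sup>\<star> * s) * (t * t\<^sup>\<star>) * t" by (subst idem_commute) simp_all
      finally show ?thesis by (simp add: mult.assoc istar_assoc)
    qed
    have "\<tau> (?e1 * f) \<noteq> None" using KS_tilde_same(2)[OF \<tau>' e1i f(1)] e1 f(3) by auto
    moreover have "s\<^sup>\<star> * s * (t * g) = t * g \<and> s * (t * g) = r * g" if g: "g \<in> idempotents" "?e1 * f * g = g" for g
    proof -
      have g1: "?e1 * g = g" and g2: "f * g = g"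
        using g e1i f(1) idem_assoc(2)[of ?e1 "f * g"] idem_assoc(2)[of f "?e1 * g"] idem_left_commute[of ?e1 f g]
        by (metis mult.assoc)+
      have tg: "t * g = s\<^sup>\<star> * s * t * g" using te1 g1 by (metis mult.assoc)
      have "s\<^sup>\<star> * s * (t * g) = t * g" using tg by (simp add: mult.assoc)
      moreover have "s * (t * g) = s * t * (f * g)" using g2 by (simp add: mult.assoc)
      moreover have "\<dots> = r * (f * g)" using f(2) by (metis mult.assoc)
      ultimately show ?thesis using g2 by simp
    qed
    ultimately show ?thesis using True idem_mult[OF e1i f(1)] by blast
  next
    case False
    have tt: "\<tau> (t\<^sup>\<star> * t) \<noteq> None" using t by (simp add: ks_source)
    have "\<not> (s\<^sup>\<star> * s * (t * g) = t * g \<and> s * (t * g) = r * g)" if g: "g \<in> idempotents" "\<tau> g \<noteq> None" "t\<^sup>\<star> * t * g = g" for g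
    proof
      assume h: "s\<^sup>\<star> * s * (t * g) = t * g \<and> s * (t * g) = r * g"
      have "?e1 * g = t\<^sup>\<star> * (s\<^sup>\<star> * s * (t * g))" by (simp add: mult.assoc)
      also have "\<dots> = g" using conjunct1[OF h] g(3) by (simp add: mult.assoc)
      finally have "?e1 * g = g" .
      then have "\<tau> ?e1 \<noteq> None" using KS_tilde_up[OF \<tau>' g(1), of ?e1] g(2) by auto
      then have "\<tau> \<in> ks.source (s * t)" using \<tau> unfolding ks_source_mult by blast
      moreover from this have "germ KSa r \<tau> = germ KSa (s * t) \<tau>"
        using ks_germ_eq_iff[OF r] h g by (metis mult.assoc)
      ultimately show False using False by blast
    qed
    then show ?thesis using tt False istar_mult_idem(1) by blast
  qed
qed

lemma fiber_bound_from_modules: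
  assumes T: "T \<in> KS_algebraic X \<theta>" and \<tau>: "\<tau> \<in> topspace KS"
    and C: "\<And>e x. e \<in> idempotents \<Longrightarrow> x \<in> idset \<theta> e \<Longrightarrow> matrix_bound (source_fiber e) (fiber_matrix T x) C"
  shows "matrix_bound (fiber ks.GG \<tau>) (ks.kernel (comparison T)) C"
proof (rule matrix_bound_locally)
  fix F assume F: "finite F" "F \<subseteq> fiber ks.GG \<tau>"
  let ?S = "{s. T s \<noteq> 0}"
  have "\<exists>t. \<tau> \<in> ks.source t \<and> \<gamma> = germ KSa t \<tau>" if "\<gamma> \<in> F" for \<gamma> using that F(2) ks.fiber_eq by blast
  then obtain rep where rep: "\<And>\<gamma>. \<gamma> \<in> F \<Longrightarrow> \<tau> \<in> ks.source (rep \<gamma>)" "\<And>\<gamma>. \<gamma> \<in> F \<Longrightarrow> germ KSa (rep \<gamma>) \<tau> = \<gamma>" by metis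
  \<comment> \<open>One condition for each s in the support of T and each pair of germs in F; T has
    finite support, so \<open>filter_finite\<close> applies.\<close>
  let ?P = "\<lambda>(s, \<eta>, \<beta>) f. (\<tau> \<in> ks.source (s * rep \<beta>) \<and> germ KSa (rep \<eta>) \<tau> = germ KSa (s * rep \<beta>) \<tau> \<longleftrightarrow>
      s\<^sup>\<star> * s * (rep \<beta> * f) = rep \<beta> * f \<and> s * (rep \<beta> * f) = rep \<eta> * f)"
  have "finite (?S \<times> F \<times> F)" using T F by (simp add: KS_algebraic_iff)
  moreover have "\<exists>e\<in>idempotents. \<tau> e \<noteq> None \<and> (\<forall>f\<in>idempotents. \<tau> f \<noteq> None \<longrightarrow> e * f = f \<longrightarrow> ?P q f)" if qF: "q \<in> ?S \<times> F \<times> F" for q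
  proof -
    obtain s \<eta> \<beta> where q: "q = (s, \<eta>, \<beta>)" "\<eta> \<in> F" "\<beta> \<in> F" using qF by blast
    show ?thesis unfolding q(1) prod.case by (rule finite_section_matching[OF rep(1)[OF q(3)] rep(1)[OF q(2)]])
  qed
  ultimately have "\<exists>e\<in>idempotents. \<tau> e \<noteq> None \<and> (\<forall>f\<in>idempotents. \<tau> f \<noteq> None \<longrightarrow> e * f = f \<longrightarrow> (\<forall>q\<in>?S \<times> F \<times> F. ?P q f))"
    by (rule filter_finite[OF \<tau>])
  then obtain e1 where e1: "e1 \<in> idempotents" "\<tau> e1 \<noteq> None"
    "\<forall>f\<in>idempotents. \<tau> f \<noteq> None \<longrightarrow> e1 * f = f \<longrightarrow> (\<forall>q\<in>?S \<times> F \<times> F. ?P q f)" by (elim bexE conjE) (rule that)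
  \<comment> \<open>Below the source projections of all representatives, so that each
    \<open>rep \<gamma> * e\<close> has source projection exactly e.\<close>
  have "\<exists>e\<in>idempotents. \<tau> e \<noteq> None \<and> (\<forall>f\<in>idempotents. \<tau> f \<noteq> None \<longrightarrow> e * f = f \<longrightarrow> (\<forall>\<gamma>\<in>F. (rep \<gamma>)\<^sup>\<star> * rep \<gamma> * f = f))"
  proof (rule filter_finite[OF \<tau> F(1)])
    fix \<gamma> assume "\<gamma> \<in> F"
    then have "\<tau> ((rep \<gamma>)\<^sup>\<star> * rep \<gamma>) \<noteq> None" using rep(1) ks_source by blast
    then show "\<exists>e\<in>idempotents. \<tau> e \<noteq> None \<and> (\<forall>f\<in>idempotents. \<tau> f \<noteq> None \<longrightarrow> e * f = f \<longrightarrow> (rep \<gamma>)\<^sup>\<star> * rep \<gamma> * f = f)"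
      using istar_mult_idem(1) by blast
  qed
  then obtain e2 where e2: "e2 \<in> idempotents" "\<tau> e2 \<noteq> None"
    "\<forall>f\<in>idempotents. \<tau> f \<noteq> None \<longrightarrow> e2 * f = f \<longrightarrow> (\<forall>\<gamma>\<in>F. (rep \<gamma>)\<^sup>\<star> * rep \<gamma> * f = f)" by (elim bexE conjE) (rule that)
  define e where "e = e1 * e2"
  have e: "e \<in> idempotents" "\<tau> e \<noteq> None"
    using KS_tilde_same(2)[OF topspace_KS_tilde[OF \<tau>] e1(1) e2(1)] e1 e2 by (auto simp: e_def)
  have ee: "e1 * e = e" "e2 * e = e" using e1(1) e2(1) by (simp_all add: e_def idem_assoc idem_left_commute)
  have P: "?P (s, \<eta>, \<beta>) e" if "s \<in> ?S" "\<eta> \<in> F" "\<beta> \<in> F" for s \<eta> \<beta>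
    by (rule bspec[OF mp[OF mp[OF bspec[OF e1(3) e(1)] e(2)] ee(1)]]) (use that in blast)
  have re: "(rep \<gamma>)\<^sup>\<star> * rep \<gamma> * e = e" if "\<gamma> \<in> F" for \<gamma>
    by (rule bspec[OF mp[OF mp[OF bspec[OF e2(3) e(1)] e(2)] ee(2)] that])
  obtain x where x: "\<tau> e = Some x" using e(2) by auto
  have xe: "x \<in> idset \<theta> e" by (rule KS_tilde_value[OF topspace_KS_tilde[OF \<tau>] e(1) x])
  \<comment> \<open>Restricting representatives to e sends germs over \<tau> to elements of the
    fibre S_e; it is injective since elements that agree on e have the same germ.\<close>
  let ?j = "\<lambda>\<gamma>. rep \<gamma> * e"
  have "inj_on ?j F"
  proof (rule inj_onI)
    fix \<gamma> \<beta> assume *: "\<gamma> \<in> F" "\<beta> \<in> F" "rep \<gamma> * e = rep \<beta> * e"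
    then have "germ KSa (rep \<gamma>) \<tau> = germ KSa (rep \<beta>) \<tau>" using ks_germ_eq_iff[OF rep(1) rep(1)] e by blast
    then show "\<gamma> = \<beta>" using rep(2) * by simp
  qed
  moreover have "?j ` F \<subseteq> source_fiber e"
    using re e(1) by (auto simp: source_fiber_def istar_mult_self_idem_right)
  moreover have "ks.kernel (comparison T) \<eta> \<beta> = fiber_matrix T x (?j \<eta>) (?j \<beta>)" if "\<eta> \<in> F" "\<beta> \<in> F" for \<eta> \<beta>
  proof -
    have "\<tau> ((rep \<beta>)\<^sup>\<star> * rep \<beta>) = Some x"
      using KS_value_unique[OF \<tau> e(1) istar_mult_idem(1) x] rep(1)[OF that(2)] ks_source by blast
    then have "x \<in> source (rep \<beta>)" using KS_tilde_value[OF topspace_KS_tilde[OF \<tau>]] istar_mult_idem(1) by blast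
    then have a: "act (rep \<beta> * e) x = act (rep \<beta>) x" by (rule act_mult_idem[OF e(1) _ xe])
    have "ks.kernel (comparison T) \<eta> \<beta> = (\<Sum>s\<in>?S. if \<tau> \<in> ks.source (s * rep \<beta>) \<and> germ KSa (rep \<eta>) \<tau> = germ KSa (s * rep \<beta>) \<tau> then T s (act (rep \<beta>) x) else 0)"
      using kernel_comparison[OF T rep(1)[OF that(2)] rep(1)[OF that(1)] x e(1)] rep(2) that by simp
    also have "\<dots> = (\<Sum>s\<in>?S. if s\<^sup>\<star> * s * (rep \<beta> * e) = rep \<beta> * e \<and> s * (rep \<beta> * e) = rep \<eta> * e then T s (act (rep \<beta> * e) x) else 0)"
      using P that unfolding a by (intro sum.cong refl) auto
    finally show ?thesis by (simp add: fiber_matrix_def)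
  qed
  ultimately have "matrix_bound (source_fiber e) (fiber_matrix T x) C \<and> inj_on ?j F \<and> ?j ` F \<subseteq> source_fiber e \<and>
      (\<forall>r\<in>F. \<forall>i\<in>F. ks.kernel (comparison T) r i = fiber_matrix T x (?j r) (?j i))"
    using C[OF e(1) xe] by simp
  then show "\<exists>(J :: 's set) n j. matrix_bound J n C \<and> inj_on j F \<and> j ` F \<subseteq> J \<and> (\<forall>r\<in>F. \<forall>i\<in>F. ks.kernel (comparison T) r i = n (j r) (j i))"
    by (rule exI[of _ "source_fiber e", OF exI[of _ "fiber_matrix T x", OF exI[of _ ?j]]])
qed

lemma module_bound_from_fibers:
  assumes T: "T \<in> KS_algebraic X \<theta>" and e: "e \<in> idempotents" and x: "x \<in> idset \<theta> e"
    and C: "\<And>\<tau>. \<tau> \<in> topspace KS \<Longrightarrow> matrix_bound (fiber ks.GG \<tau>) (ks.kernel (comparison T)) C"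
  shows "matrix_bound (source_fiber e) (fiber_matrix T x) C"
proof -
  let ?F = "{f. f * e = e}"
  define \<tau> where "\<tau> = KS_point ?F x"
  have \<tau>f: "\<tau> f \<noteq> None \<longleftrightarrow> f * e = e" if "f \<in> idempotents" for f
    using that by (simp add: \<tau>_def KS_point_apply)
  have \<tau>e: "\<tau> e = Some x" using e by (simp add: \<tau>_def KS_point_apply idem_assoc)
  have "\<tau> \<in> KS_tilde X \<theta>" unfolding \<tau>_def
  proof (rule KS_point_tilde)
    show "x \<in> idset \<theta> f" if "f \<in> idempotents" "f \<in> ?F" for f
      using idset_mono[OF e that(1)] that(2) x by blast
    show "g \<in> ?F" if "f \<in> ?F" "g * f = f" for f g using that by (simp) (metis mult.assoc)
    show "f * g \<in> ?F" if "f \<in> ?F" "g \<in> ?F" for f g using that by (simp add: mult.assoc)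
  qed
  then have \<tau>: "\<tau> \<in> topspace KS" using \<tau>e e topspace_KS by auto
  have src: "\<tau> \<in> ks.source t" if "t \<in> source_fiber e" for t
    using that \<tau> \<tau>e unfolding ks_source source_fiber_def by auto
  have te: "t * e = t" if "t \<in> source_fiber e" for t using that istar_assoc(1)[of t] by (simp add: source_fiber_def)
  \<comment> \<open>Membership of f in the filter of this \<tau> means that f lies above e, so
    agreement on f implies agreement on e, and elements of the fibre S_e are told apart by their
    germs.\<close>
  have germ_iff: "germ KSa t \<tau> = germ KSa u \<tau> \<longleftrightarrow> t = u" if tu: "t * e = t" "u * e = u" "\<tau> \<in> ks.source t" "\<tau> \<in> ks.source u" for t u
  proof
    assume "germ KSa t \<tau> = germ KSa u \<tau>"
    then obtain f where f: "f \<in> idempotents" "t * f = u * f" "\<tau> f \<noteq> None" using ks_germ_eq_iff[OF tu(3,4)] by blast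
    then have "f * e = e" using \<tau>f by blast
    then show "t = u" using f(2) tu(1,2) by (metis mult.assoc)
  qed simp
  show ?thesis
  proof (rule matrix_bound_reindex[OF C[OF \<tau>]])
    show "inj_on (\<lambda>t. germ KSa t \<tau>) (source_fiber e)"
      using germ_iff te src by (intro inj_onI) blast
    show "(\<lambda>t. germ KSa t \<tau>) ` source_fiber e \<subseteq> fiber ks.GG \<tau>" using src ks.germ_in_fiber by blast
    fix r t assume r: "r \<in> source_fiber e" and t: "t \<in> source_fiber e"
    have iff: "\<tau> \<in> ks.source (s * t) \<and> germ KSa r \<tau> = germ KSa (s * t) \<tau> \<longleftrightarrow> s\<^sup>\<star> * s * t = t \<and> s * t = r" for s
    proof -
      have "\<tau> \<in> ks.source (s * t) \<longleftrightarrow> t\<^sup>\<star> * (s\<^sup>\<star> * s) * t * e = e"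
        using \<tau> \<tau>f[of "t\<^sup>\<star> * (s\<^sup>\<star> * s) * t"] unfolding ks_source_mult by simp
      also have "\<dots> \<longleftrightarrow> t\<^sup>\<star> * (s\<^sup>\<star> * s) * t = t\<^sup>\<star> * t"
        using te[OF t] t by (simp add: mult.assoc source_fiber_def)
      also have "\<dots> \<longleftrightarrow> s\<^sup>\<star> * s * t = t" using idem_absorb_iff[OF istar_mult_idem(1), of s t] by blast
      finally have 1: "\<tau> \<in> ks.source (s * t) \<longleftrightarrow> s\<^sup>\<star> * s * t = t" .
      have "germ KSa r \<tau> = germ KSa (s * t) \<tau> \<longleftrightarrow> r = s * t" if "\<tau> \<in> ks.source (s * t)"
        using germ_iff[OF te[OF r] _ src[OF r] that] te[OF t] by (simp add: mult.assoc)
      then show ?thesis using 1 by blast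
    qed
    show "fiber_matrix T x r t = ks.kernel (comparison T) (germ KSa r \<tau>) (germ KSa t \<tau>)"
      unfolding kernel_comparison[OF T src[OF t] src[OF r] \<tau>e e] iff fiber_matrix_def ..
  qed
qed

text \<open>Both norms are nonnegative and have the same nonnegative upper bounds; taking each as a
  bound for the other gives equality.\<close>

theorem comparison_isometric:
  assumes T: "T \<in> KS_algebraic X \<theta>"
  shows "reduced_norm ks.GG (comparison T) = KS_reduced_norm X \<theta> T"
proof -
  have iff: "reduced_norm ks.GG (comparison T) \<le> C \<longleftrightarrow> KS_reduced_norm X \<theta> T \<le> C" if C: "0 \<le> C" for C
    unfolding ks.reduced_norm_le_iff[OF comparison_bounded[OF T] C] KS_reduced_norm_le_iff(1)[OF T C] ks.topspace_units
    using fiber_bound_from_modules[OF T] module_bound_from_fibers[OF T] by blast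
  show ?thesis
    using iff[OF ks.reduced_norm_nonneg[OF comparison_bounded[OF T]]] iff[OF KS_reduced_norm_le_iff(2)[OF T order_refl]] by simp
qed

end

section \<open>Density\<close>

lemma open_coordinate_vimage: "open U \<Longrightarrow> open ((\<lambda>f :: 'i \<Rightarrow> 'b::topological_space. f i) -` U)"
  by (rule open_vimage) (auto intro: continuous_on_product_coordinates)

text \<open>The target of \<open>embed\<close> is a function type, and it has to belong to the class
  of Hausdorff types; the two weaker separation axioms are its superclasses.\<close>

instance "fun" :: (type, t0_space) t0_space
proof
  fix x y :: "'a \<Rightarrow> 'b" assume "x \<noteq> y"
  then obtain i where i: "x i \<noteq> y i" by blast
  then obtain U where "open U" "\<not> (x i \<in> U \<longleftrightarrow> y i \<in> U)" using i separation_t0 by blast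
  then show "\<exists>U. open U \<and> \<not> (x \<in> U \<longleftrightarrow> y \<in> U)"
    using open_coordinate_vimage[of U i] by (intro exI[of _ "(\<lambda>f. f i) -` U"]) simp
qed

instance "fun" :: (type, t1_space) t1_space
proof
  fix x y :: "'a \<Rightarrow> 'b" assume "x \<noteq> y"
  then obtain i where i: "x i \<noteq> y i" by blast
  then obtain U where "open U" "x i \<in> U" "y i \<notin> U" using t1_space[OF i] by blast
  then show "\<exists>U. open U \<and> x \<in> U \<and> y \<notin> U"
    using open_coordinate_vimage[of U i] by (intro exI[of _ "(\<lambda>f. f i) -` U"]) simp
qed

instance "fun" :: (type, t2_space) t2_space
proof
  fix x y :: "'a \<Rightarrow> 'b" assume "x \<noteq> y"
  then obtain i where i: "x i \<noteq> y i" by blast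
  then obtain U V where UV: "open U" "open V" "x i \<in> U" "y i \<in> V" "U \<inter> V = {}" using hausdorff[OF i] by blast
  have "(\<lambda>f :: 'a \<Rightarrow> 'b. f i) -` U \<inter> (\<lambda>f. f i) -` V = {}" using UV(5) by blast
  then show "\<exists>U V. open U \<and> open V \<and> x \<in> U \<and> y \<in> V \<and> U \<inter> V = {}"
    using open_coordinate_vimage[OF UV(1), of i] open_coordinate_vimage[OF UV(2), of i] UV(3,4)
    by (intro exI[of _ "(\<lambda>f. f i) -` U"] exI[of _ "(\<lambda>f. f i) -` V"]) simp
qed

lemma C0_Re: 
  assumes f: "f \<in> C0 T" shows "(\<lambda>x. complex_of_real (Re (f x))) \<in> C0 T"
proof (rule C0_dominated[OF _ f])
  show "continuous_map T euclidean (\<lambda>x. complex_of_real (Re (f x)))"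
    using C0D(1)[OF f] by (simp add: continuous_map_atin tendsto_of_real tendsto_Re)
  show "cmod (complex_of_real (Re (f x))) \<le> 1 * cmod (f x)" for x by (simp add: abs_Re_le_cmod)
qed

lemma C0_Im: 
  assumes f: "f \<in> C0 T" shows "(\<lambda>x. complex_of_real (Im (f x))) \<in> C0 T"
proof (rule C0_dominated[OF _ f])
  show "continuous_map T euclidean (\<lambda>x. complex_of_real (Im (f x)))"
    using C0D(1)[OF f] by (simp add: continuous_map_atin tendsto_of_real tendsto_Im)
  show "cmod (complex_of_real (Im (f x))) \<le> 1 * cmod (f x)" for x by (simp add: abs_Im_le_cmod)
qed

context KS_comparison
begin

text \<open>Closure under addition is enough to obtain an algebra of functions on
  \<open>KS_tilde\<close>: scalars are absorbed by a, and a product of two generators is a generator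
  at ef by \<open>eval_at_mult\<close>.\<close>

inductive_set evaluations :: "(('s \<Rightarrow> 'x option) \<Rightarrow> complex) set" where
  eval: "e \<in> idempotents \<Longrightarrow> a \<in> C0 (subtopology X (idset \<theta> e)) \<Longrightarrow> eval_at a e \<in> evaluations"
| add: "d \<in> evaluations \<Longrightarrow> d' \<in> evaluations \<Longrightarrow> (\<lambda>\<tau>. d \<tau> + d' \<tau>) \<in> evaluations"

lemma evaluations_zero: "(\<lambda>_. 0) \<in> evaluations"
proof -
  obtain e :: 's where e: "e \<in> idempotents" using idempotents_nonempty by blast
  have "eval_at (0 :: 'x \<Rightarrow> complex) e = (\<lambda>_. 0)" by (auto simp: eval_at_def split: option.split)
  then show ?thesis using evaluations.eval[OF e C0_zero(1)] by (metis (lifting))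
qed

lemma evaluations_scale: "d \<in> evaluations \<Longrightarrow> (\<lambda>\<tau>. c * d \<tau>) \<in> evaluations"
proof (induction rule: evaluations.induct)
  case (eval e a)
  have "eval_at (\<lambda>x. c * a x) e \<in> evaluations" by (rule evaluations.eval[OF eval(1) C0_scale[OF eval(2)]])
  then show ?case by (simp only: eval_at_scale)
next
  case (add d d')
  then have "(\<lambda>\<tau>. c * d \<tau> + c * d' \<tau>) \<in> evaluations" by (intro evaluations.add)
  then show ?case by (simp only: distrib_left)
qed

text \<open>The product is matched on \<open>KS_tilde\<close> only: for general points of the
  product space the values at e, f and ef are unrelated.\<close>

lemma evaluations_mult:
  assumes "d \<in> evaluations" "d' \<in> evaluations"
  shows "\<exists>d''\<in>evaluations. \<forall>\<tau>\<in>KS_tilde X \<theta>. d \<tau> * d' \<tau> = d'' \<tau>"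
  using assms
proof (induction rule: evaluations.induct)
  case (eval e a)
  note ea = eval(1,2)
  from eval(3) show ?case
  proof (induction rule: evaluations.induct)
    case (eval f b)
    have "eval_at (a * b) (e * f) \<in> evaluations"
      using ea eval by (intro evaluations.eval idem_mult C0_idset_mult)
    then show ?case using eval_at_mult[OF _ ea(1) eval(1)] by blast
  next
    case (add d d')
    then obtain c c' where c: "c \<in> evaluations" "\<forall>\<tau>\<in>KS_tilde X \<theta>. eval_at a e \<tau> * d \<tau> = c \<tau>"
      and c': "c' \<in> evaluations" "\<forall>\<tau>\<in>KS_tilde X \<theta>. eval_at a e \<tau> * d' \<tau> = c' \<tau>" by blast
    have "\<forall>\<tau>\<in>KS_tilde X \<theta>. eval_at a e \<tau> * (d \<tau> + d' \<tau>) = c \<tau> + c' \<tau>"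
      using c(2) c'(2) by (simp add: distrib_left)
    then show ?case using evaluations.add[OF c(1) c'(1)] by (intro bexI[of _ "\<lambda>\<tau>. c \<tau> + c' \<tau>"]) auto
  qed
next
  case (add d1 d2)
  then obtain c c' where c: "c \<in> evaluations" "\<forall>\<tau>\<in>KS_tilde X \<theta>. d1 \<tau> * d' \<tau> = c \<tau>"
    and c': "c' \<in> evaluations" "\<forall>\<tau>\<in>KS_tilde X \<theta>. d2 \<tau> * d' \<tau> = c' \<tau>" by blast
  have "\<forall>\<tau>\<in>KS_tilde X \<theta>. (d1 \<tau> + d2 \<tau>) * d' \<tau> = c \<tau> + c' \<tau>"
    using c(2) c'(2) by (simp add: distrib_right)
  then show ?case using evaluations.add[OF c(1) c'(1)] by (intro bexI[of _ "\<lambda>\<tau>. c \<tau> + c' \<tau>"]) auto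
qed

lemma evaluations_infinity: "d \<in> evaluations \<Longrightarrow> d KS_infinity = 0"
  by (induction rule: evaluations.induct) (simp_all add: eval_at_def KS_infinity_def)

text \<open>The library has the theorem of Stone and Weierstrass for compact subsets of a type that is a Hausdorff
  space, so the compact space of all \<open>\<tau>\<close> is moved into a power of the complex numbers.\<close>

definition embed :: "('s \<Rightarrow> 'x option) \<Rightarrow> 's \<times> ('x \<Rightarrow> complex) \<Rightarrow> complex" where
  "embed \<tau> = (\<lambda>(e, a). if e \<in> idempotents \<and> a \<in> C0 (subtopology X (idset \<theta> e)) then eval_at a e \<tau> else 0)"

lemma continuous_map_embed: "continuous_map KS_compact euclidean embed"
proof -
  have "continuous_map KS_compact (product_topology (\<lambda>i. euclidean) UNIV) embed"
    unfolding continuous_map_componentwise_UNIV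
  proof
    fix k :: "'s \<times> ('x \<Rightarrow> complex)"
    obtain e a where k: "k = (e, a)" by (cases k)
    show "continuous_map KS_compact euclidean (\<lambda>\<tau>. embed \<tau> k)"
      unfolding k embed_def prod.case
      using continuous_map_eval_at[of e a] by (auto intro: continuous_map_from_subtopology)
  qed
  then show ?thesis by (simp only: euclidean_product_topology)
qed

text \<open>With x the finite value of one point at e, a function a with a(x) = 1 forces the other
  point to be finite at e, and \<open>C0_separation\<close> forces its value to be x.\<close>

lemma inj_on_embed: "inj_on embed (KS_tilde X \<theta>)"
proof (rule inj_onI, rule ccontr)
  fix \<tau> \<sigma> assume \<tau>: "\<tau> \<in> KS_tilde X \<theta>" and \<sigma>: "\<sigma> \<in> KS_tilde X \<theta>" and eq: "embed \<tau> = embed \<sigma>" and ne: "\<tau> \<noteq> \<sigma>"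
  have ev: "eval_at a e \<tau> = eval_at a e \<sigma>" if "e \<in> idempotents" "a \<in> C0 (subtopology X (idset \<theta> e))" for a e
    using fun_cong[OF eq, of "(e, a)"] that by (simp add: embed_def)
  have sep: "\<rho> e = \<rho>' e"
    if \<rho>: "\<rho> \<in> KS_tilde X \<theta>" and e: "e \<in> idempotents" and x: "\<rho> e = Some x"
      and ev: "\<And>a. a \<in> C0 (subtopology X (idset \<theta> e)) \<Longrightarrow> eval_at a e \<rho> = eval_at a e \<rho>'" for \<rho> \<rho>' e x
  proof -
    have xe: "x \<in> idset \<theta> e" by (rule KS_tilde_value[OF \<rho> e x])
    obtain a where a: "a \<in> C0 (subtopology X (idset \<theta> e))" "a x = 1"
      using evaluation_function[OF openin_idset[OF e] xe] by blast
    obtain y where y: "\<rho>' e = Some y" using ev[OF a(1)] a(2) x by (cases "\<rho>' e") (simp_all add: eval_at_def)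
    have "x = y"
    proof (rule ccontr)
      assume "x \<noteq> y"
      then obtain b where b: "b \<in> C0 (subtopology X (idset \<theta> e))" "b x = 1" "b y = 0"
        using C0_separation[OF openin_idset[OF e] xe, of y] by auto
      then show False using ev[OF b(1)] x y by (simp add: eval_at_def)
    qed
    then show ?thesis using x y by simp
  qed
  have "\<tau> e = \<sigma> e" for e
  proof (cases "e \<in> idempotents")
    case True
    show ?thesis
    proof (cases "\<tau> e")
      case (Some x)
      show ?thesis by (rule sep[OF \<tau> True Some ev[OF True]])
    next
      case None
      show ?thesis
      proof (cases "\<sigma> e")
        case (Some x)
        show ?thesis by (rule sep[OF \<sigma> True Some ev[OF True, symmetric], symmetric])
      qed (use None in simp)
    qed
  next
    case False
    then show ?thesis using KS_tilde_extensional[OF \<tau>] KS_tilde_extensional[OF \<sigma>] by (simp add: extensional_def)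
  qed
  then show False using ne by blast
qed

lemma Stone_Weierstrass_KS_real:
  fixes h :: "('s \<Rightarrow> 'x option) \<Rightarrow> real"
  assumes h: "continuous_map KS_compact euclideanreal h" and eps: "0 < \<epsilon>"
  shows "\<exists>c. \<exists>d\<in>evaluations. \<forall>\<tau>\<in>KS_tilde X \<theta>. cmod (complex_of_real (h \<tau>) - (complex_of_real c + d \<tau>)) < \<epsilon>"
proof -
  define K where "K = embed ` KS_tilde X \<theta>"
  \<comment> \<open>The real functions on the embedded space that pull back to a constant plus an
    evaluation. A function ring has to contain the constants, while evaluations vanish at
    infinity.\<close>
  define R where "R = {g. continuous_on K g \<and>
     (\<exists>c. \<exists>d\<in>evaluations. \<forall>\<tau>\<in>KS_tilde X \<theta>. complex_of_real (g (embed \<tau>)) = complex_of_real c + d \<tau>)}"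
  have cK: "compact K"
  proof -
    have "compactin KS_compact (topspace KS_compact)" using compact_space_KS_compact by (simp only: compact_space_def)
    then have "compactin euclidean (embed ` topspace KS_compact)" by (rule image_compactin[OF _ continuous_map_embed])
    then show ?thesis unfolding topspace_KS_compact K_def by simp
  qed
  have R: "function_ring_on R K"
  proof
    show "compact K" by (rule cK)
    show "continuous_on K g" if "g \<in> R" for g using that by (simp add: R_def)
    fix f g assume fg: "f \<in> R" "g \<in> R"
    obtain c1 d1 where 1: "d1 \<in> evaluations" "\<forall>\<tau>\<in>KS_tilde X \<theta>. complex_of_real (f (embed \<tau>)) = complex_of_real c1 + d1 \<tau>"
      using fg(1) unfolding R_def by blast
    obtain c2 d2 where 2: "d2 \<in> evaluations" "\<forall>\<tau>\<in>KS_tilde X \<theta>. complex_of_real (g (embed \<tau>)) = complex_of_real c2 + d2 \<tau>"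
      using fg(2) unfolding R_def by blast
    have cont: "continuous_on K f" "continuous_on K g" using fg by (simp_all add: R_def)
    have "\<forall>\<tau>\<in>KS_tilde X \<theta>. complex_of_real (f (embed \<tau>) + g (embed \<tau>)) = complex_of_real (c1 + c2) + (d1 \<tau> + d2 \<tau>)"
      using 1(2) 2(2) by simp
    then show "(\<lambda>x. f x + g x) \<in> R"
      unfolding R_def using evaluations.add[OF 1(1) 2(1)] cont
      by (intro CollectI conjI exI[of _ "c1 + c2"] bexI[of _ "\<lambda>\<tau>. d1 \<tau> + d2 \<tau>"]) (auto intro: continuous_on_add)
    obtain d3 where 3: "d3 \<in> evaluations" "\<forall>\<tau>\<in>KS_tilde X \<theta>. d1 \<tau> * d2 \<tau> = d3 \<tau>" using evaluations_mult[OF 1(1) 2(1)] by blast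
    let ?d = "\<lambda>\<tau>. (complex_of_real c1 * d2 \<tau> + complex_of_real c2 * d1 \<tau>) + d3 \<tau>"
    have "?d \<in> evaluations" using 1(1) 2(1) 3(1) by (intro evaluations.add evaluations_scale)
    moreover have "\<forall>\<tau>\<in>KS_tilde X \<theta>. complex_of_real (f (embed \<tau>) * g (embed \<tau>)) = complex_of_real (c1 * c2) + ?d \<tau>"
      using 1(2) 2(2) 3(2) by (simp add: algebra_simps)
    ultimately show "(\<lambda>x. f x * g x) \<in> R"
      unfolding R_def using cont
      by (intro CollectI conjI exI[of _ "c1 * c2"] bexI[of _ ?d]) (auto intro: continuous_on_mult)
  next
    show "(\<lambda>_. c) \<in> R" for c
      unfolding R_def using evaluations_zero by (intro CollectI conjI exI[of _ c] bexI[of _ "\<lambda>_. 0"]) auto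
    fix x y assume "x \<in> K" "y \<in> K" "x \<noteq> y"
    then obtain i where i: "x i \<noteq> y i" and x: "x \<in> embed ` KS_tilde X \<theta>" and y: "y \<in> embed ` KS_tilde X \<theta>"
      unfolding K_def by blast
    obtain e a where ea: "i = (e, a)" by (cases i)
    have e: "e \<in> idempotents" and a: "a \<in> C0 (subtopology X (idset \<theta> e))"
      using i x y by (auto simp: ea embed_def split: if_splits)
    have ci: "continuous_on K (\<lambda>f :: 's \<times> ('x \<Rightarrow> complex) \<Rightarrow> complex. f i)"
      by (rule continuous_on_subset[OF continuous_on_product_coordinates]) simp
    \<comment> \<open>The function ring is real, so separation by a complex coordinate is split into
      real and imaginary parts, which come from functions in C_0 again.\<close>
    have "(\<lambda>f. Re (f i)) \<in> R" unfolding R_def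
    proof (intro CollectI conjI exI[of _ 0] bexI[of _ "eval_at (\<lambda>x. complex_of_real (Re (a x))) e"] ballI)
      show "continuous_on K (\<lambda>f :: 's \<times> ('x \<Rightarrow> complex) \<Rightarrow> complex. Re (f i))" using ci by (intro continuous_intros)
      show "complex_of_real (Re (embed \<tau> i)) = complex_of_real 0 + eval_at (\<lambda>x. complex_of_real (Re (a x))) e \<tau>" for \<tau>
        using e a by (auto simp: ea embed_def eval_at_def split: option.split)
      show "eval_at (\<lambda>x. complex_of_real (Re (a x))) e \<in> evaluations" using e a by (intro evaluations.eval C0_Re)
    qed
    moreover have "(\<lambda>f. Im (f i)) \<in> R" unfolding R_def
    proof (intro CollectI conjI exI[of _ 0] bexI[of _ "eval_at (\<lambda>x. complex_of_real (Im (a x))) e"] ballI)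
      show "continuous_on K (\<lambda>f :: 's \<times> ('x \<Rightarrow> complex) \<Rightarrow> complex. Im (f i))" using ci by (intro continuous_intros)
      show "complex_of_real (Im (embed \<tau> i)) = complex_of_real 0 + eval_at (\<lambda>x. complex_of_real (Im (a x))) e \<tau>" for \<tau>
        using e a by (auto simp: ea embed_def eval_at_def split: option.split)
      show "eval_at (\<lambda>x. complex_of_real (Im (a x))) e \<in> evaluations" using e a by (intro evaluations.eval C0_Im)
    qed
    moreover have "Re (x i) \<noteq> Re (y i) \<or> Im (x i) \<noteq> Im (y i)" using i by (simp add: complex_eq_iff)
    ultimately show "\<exists>f\<in>R. f x \<noteq> f y" by (elim disjE) (rule bexI, assumption+)+
  qed
  define k where "k = (\<lambda>p. h (inv_into (KS_tilde X \<theta>) embed p))"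
  have kh: "k (embed \<tau>) = h \<tau>" if "\<tau> \<in> KS_tilde X \<theta>" for \<tau>
    using inv_into_f_f[OF inj_on_embed that] by (simp add: k_def)
  \<comment> \<open>As a closed continuous map onto its image, the embedding is a quotient map, so h
    descends to a continuous function k there.\<close>
  have "quotient_map KS_compact (top_of_set K) embed"
  proof (rule continuous_closed_imp_quotient_map)
    show c: "continuous_map KS_compact (top_of_set K) embed"
      using continuous_map_embed topspace_KS_compact by (intro continuous_map_into_subtopology) (auto simp: K_def)
    show "closed_map KS_compact (top_of_set K) embed"
      by (rule continuous_imp_closed_map_gen[OF compact_space_KS_compact _ c])
        (intro Hausdorff_imp_kc_space Hausdorff_space_subtopology,
         simp add: Hausdorff_space_product_topology flip: euclidean_product_topology)
    show "embed ` topspace KS_compact = topspace (top_of_set K)" unfolding topspace_KS_compact by (simp add: K_def)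
  qed
  moreover have "continuous_map KS_compact euclideanreal (k \<circ> embed)"
    by (rule continuous_map_eq[OF h]) (use kh topspace_KS_compact in auto)
  ultimately have "continuous_map (top_of_set K) euclideanreal k" by (simp add: continuous_compose_quotient_map_eq)
  then have "continuous_on K k" by simp
  then obtain g where g: "g \<in> R" "\<forall>x\<in>K. \<bar>k x - g x\<bar> < \<epsilon>"
    using function_ring_on.Stone_Weierstrass_basic[OF R _ eps] by blast
  obtain c d where d: "d \<in> evaluations" "\<forall>\<tau>\<in>KS_tilde X \<theta>. complex_of_real (g (embed \<tau>)) = complex_of_real c + d \<tau>"
    using g(1) unfolding R_def by blast
  have "cmod (complex_of_real (h \<tau>) - (complex_of_real c + d \<tau>)) < \<epsilon>" if "\<tau> \<in> KS_tilde X \<theta>" for \<tau>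
  proof -
    have "complex_of_real (h \<tau>) - (complex_of_real c + d \<tau>) = complex_of_real (k (embed \<tau>) - g (embed \<tau>))"
      using d(2) kh that by simp
    then have "cmod (complex_of_real (h \<tau>) - (complex_of_real c + d \<tau>)) = \<bar>k (embed \<tau>) - g (embed \<tau>)\<bar>"
      by (simp only: norm_of_real)
    then show ?thesis using g(2) that by (simp add: K_def)
  qed
  then show ?thesis using d(1) by blast
qed

lemma KS_infinity_tilde: "KS_infinity \<in> KS_tilde X \<theta>"
proof -
  have "KS_point {} x \<in> KS_tilde X \<theta>" for x by (rule KS_point_tilde) auto
  moreover have "KS_point {} x = KS_infinity" for x by (simp add: KS_point_def KS_infinity_def)
  ultimately show ?thesis by metis
qed

lemma Stone_Weierstrass_KS:
  assumes h: "continuous_map KS_compact euclidean h" and h0: "h KS_infinity = (0::complex)" and eps: "0 < \<epsilon>"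
  shows "\<exists>d\<in>evaluations. \<forall>\<tau>\<in>KS_tilde X \<theta>. cmod (h \<tau> - d \<tau>) \<le> \<epsilon>"
proof -
  have "continuous_map KS_compact euclideanreal (\<lambda>\<tau>. Re (h \<tau>))" "continuous_map KS_compact euclideanreal (\<lambda>\<tau>. Im (h \<tau>))"
    using h by (simp_all add: continuous_map_atin tendsto_Re tendsto_Im)
  note cont = this
  have e4: "0 < \<epsilon> / 4" using eps by simp
  obtain c1 d1 where 1: "d1 \<in> evaluations" "\<And>\<tau>. \<tau> \<in> KS_tilde X \<theta> \<Longrightarrow> cmod (complex_of_real (Re (h \<tau>)) - (complex_of_real c1 + d1 \<tau>)) < \<epsilon> / 4"
    using Stone_Weierstrass_KS_real[OF cont(1) e4] by blast
  obtain c2 d2 where 2: "d2 \<in> evaluations" "\<And>\<tau>. \<tau> \<in> KS_tilde X \<theta> \<Longrightarrow> cmod (complex_of_real (Im (h \<tau>)) - (complex_of_real c2 + d2 \<tau>)) < \<epsilon> / 4"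
    using Stone_Weierstrass_KS_real[OF cont(2) e4] by blast
  let ?d = "\<lambda>\<tau>. d1 \<tau> + \<i> * d2 \<tau>"
  have d: "?d \<in> evaluations" using 1(1) 2(1) by (intro evaluations.add evaluations_scale)
  have c: "cmod (complex_of_real c1) < \<epsilon> / 4" "cmod (complex_of_real c2) < \<epsilon> / 4"
    using 1(2)[OF KS_infinity_tilde] 2(2)[OF KS_infinity_tilde]
    by (simp_all only: evaluations_infinity[OF 1(1)] evaluations_infinity[OF 2(1)] h0 zero_complex.simps of_real_0
      add_0_right diff_0 norm_minus_cancel )
  have "cmod (h \<tau> - ?d \<tau>) \<le> \<epsilon>" if \<tau>: "\<tau> \<in> KS_tilde X \<theta>" for \<tau>
  proof -
    let ?u = "complex_of_real (Re (h \<tau>)) - (complex_of_real c1 + d1 \<tau>)" and ?v = "complex_of_real (Im (h \<tau>)) - (complex_of_real c2 + d2 \<tau>)"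
    have "h \<tau> = complex_of_real (Re (h \<tau>)) + \<i> * complex_of_real (Im (h \<tau>))" by (rule complex_eq)
    then have "h \<tau> - ?d \<tau> = (?u + complex_of_real c1) + \<i> * (?v + complex_of_real c2)" by (simp add: algebra_simps)
    then have "cmod (h \<tau> - ?d \<tau>) \<le> cmod (?u + complex_of_real c1) + cmod (\<i> * (?v + complex_of_real c2))"
      by (simp only: norm_triangle_ineq)
    also have "\<dots> \<le> (cmod ?u + cmod (complex_of_real c1)) + (cmod ?v + cmod (complex_of_real c2))"
      using norm_triangle_ineq[of ?u "complex_of_real c1"] norm_triangle_ineq[of ?v "complex_of_real c2"] by (simp add: norm_mult)
    also have "\<dots> \<le> \<epsilon>" using 1(2)[OF \<tau>] 2(2)[OF \<tau>] c by linarith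
    finally show ?thesis .
  qed
  then show ?thesis by (intro bexI[OF _ d] ballI)
qed

text \<open>Multiplying the image of \<delta>_s a by b(\<tau>(f)) amounts to restricting s to f: the
  result is the image of \<delta>_{sf}(ba). So on the sheet of s, a fixed a multiplied by any
  evaluation stays in the image.\<close>

lemma evaluations_in_range:
  assumes "d \<in> evaluations" and a: "a \<in> C0 (subtopology X (source s))"
  shows "\<exists>T\<in>KS_algebraic X \<theta>. comparison T = ks.section_function s (\<lambda>\<tau>. d \<tau> * eval_at a (s\<^sup>\<star> * s) \<tau>)"
  using assms(1)
proof (induction rule: evaluations.induct)
  case (eval f b)
  have src: "source (s * f) = idset \<theta> (f * (s\<^sup>\<star> * s))"
    using eval(1) by (simp add: istar_mult_self_idem_right idem_commute)
  have ba: "b * a \<in> C0 (subtopology X (source (s * f)))"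
    unfolding src using eval a by (intro C0_idset_mult) simp_all
  have "comparison (delta (s * f) (b * a)) = ks.section_function (s * f) (eval_at (b * a) ((s * f)\<^sup>\<star> * (s * f)))"
    by (rule comparison_delta)
  also have "(s * f)\<^sup>\<star> * (s * f) = f * (s\<^sup>\<star> * s)"
    using eval(1) by (simp add: istar_mult_self_idem_right idem_commute)
  also have "ks.section_function (s * f) (eval_at (b * a) (f * (s\<^sup>\<star> * s))) = ks.section_function s (\<lambda>\<tau>. eval_at b f \<tau> * eval_at a (s\<^sup>\<star> * s) \<tau>)"
  proof
    fix \<gamma>
    show "ks.section_function (s * f) (eval_at (b * a) (f * (s\<^sup>\<star> * s))) \<gamma> = ks.section_function s (\<lambda>\<tau>. eval_at b f \<tau> * eval_at a (s\<^sup>\<star> * s) \<tau>) \<gamma>"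
    proof (cases "\<gamma> \<in> topspace (arrows ks.GG)")
      case False
      then have "\<gamma> \<notin> germ KSa t ` ks.source t" for t using ks.germ_in_arrows by blast
      then show ?thesis by (simp add: ks.section_function_def)
    next
      case True
      then obtain r \<tau> where r: "\<tau> \<in> ks.source r" "\<gamma> = germ KSa r \<tau>" by (rule ks.arrowE)
      have \<tau>: "\<tau> \<in> topspace KS" using r(1) unfolding ks_source by blast
      have m: "eval_at b f \<tau> * eval_at a (s\<^sup>\<star> * s) \<tau> = eval_at (b * a) (f * (s\<^sup>\<star> * s)) \<tau>"
        by (rule eval_at_mult[OF topspace_KS_tilde[OF \<tau>] eval(1)]) simp
      show ?thesis
      proof (cases "\<tau> \<in> ks.source s \<and> \<tau> f \<noteq> None")
        case True
        then have "\<tau> \<in> idset KSa f" using \<tau> ks_idset[OF eval(1)] by blast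
        then have "\<tau> \<in> ks.source (s * f)" "germ KSa (s * f) \<tau> = germ KSa s \<tau>"
          using True eval(1) ks.source_mult_idem[OF eval(1), of s] ks.germ_mult_idem[of \<tau> s f] by blast+
        then show ?thesis using True m by (simp only: r(2) ks.section_function_germ[OF r(1)] simp_thms)
      next
        case False
        then have "\<tau> \<notin> ks.source (s * f)" using ks.source_mult_idem[OF eval(1), of s] ks_idset[OF eval(1)] by blast
        moreover have "\<tau> \<in> ks.source s \<Longrightarrow> eval_at b f \<tau> = 0" using False by (simp add: eval_at_def)
        ultimately show ?thesis by (simp add: r(2) ks.section_function_germ[OF r(1)])
      qed
    qed
  qed
  finally show ?case using KS_algebraic_delta[OF ba] by blast
next
  case (add d d')
  then obtain T U where T: "T \<in> KS_algebraic X \<theta>" "comparison T = ks.section_function s (\<lambda>\<tau>. d \<tau> * eval_at a (s\<^sup>\<star> * s) \<tau>)"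
    and U: "U \<in> KS_algebraic X \<theta>" "comparison U = ks.section_function s (\<lambda>\<tau>. d' \<tau> * eval_at a (s\<^sup>\<star> * s) \<tau>)" by blast
  have "comparison (T + U) = ks.section_function s ((\<lambda>\<tau>. d \<tau> * eval_at a (s\<^sup>\<star> * s) \<tau>) + (\<lambda>\<tau>. d' \<tau> * eval_at a (s\<^sup>\<star> * s) \<tau>))"
    by (simp only: comparison_add[OF T(1) U(1)] T(2) U(2) ks.section_function_add)
  also have "(\<lambda>\<tau>. d \<tau> * eval_at a (s\<^sup>\<star> * s) \<tau>) + (\<lambda>\<tau>. d' \<tau> * eval_at a (s\<^sup>\<star> * s) \<tau>) = (\<lambda>\<tau>. (d \<tau> + d' \<tau>) * eval_at a (s\<^sup>\<star> * s) \<tau>)"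
    by (simp add: fun_eq_iff distrib_right)
  finally show ?case using KS_algebraic_add[OF T(1) U(1)] by blast
qed

section \<open>The image of the crossed product and \<C>(G) approximate each other\<close>

lemma continuous_map_value:
  assumes e: "e \<in> idempotents"
  shows "continuous_map (subtopology KS (idset KSa e)) X (\<lambda>\<tau>. the (\<tau> e))"
  unfolding continuous_map_def
proof (intro conjI allI impI)
  have D: "idset KSa e = {\<tau> \<in> topspace KS. \<tau> e \<noteq> None}" by (rule KS_idset[OF e])
  have top: "topspace (subtopology KS (idset KSa e)) = idset KSa e" unfolding D by auto
  have v: "the (\<tau> e) \<in> idset \<theta> e" "\<tau> e = Some (the (\<tau> e))" if "\<tau> \<in> idset KSa e" for \<tau>
    using that KS_tilde_value[OF topspace_KS_tilde e] unfolding D by auto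
  show "(\<lambda>\<tau>. the (\<tau> e)) \<in> topspace (subtopology KS (idset KSa e)) \<rightarrow> topspace X"
    unfolding top using v(1) idset_subset[OF e] by blast
  fix U assume U: "openin X U"
  have "openin KS {\<tau> \<in> topspace KS. \<tau> e \<in> Some ` (U \<inter> idset \<theta> e)}"
    using U openin_idset[OF e] by (intro openin_KS_coordinate[OF e]) (simp add: openin_open_subtopology openin_Int)
  moreover have "{\<tau> \<in> topspace KS. \<tau> e \<in> Some ` (U \<inter> idset \<theta> e)} = {\<tau> \<in> idset KSa e. the (\<tau> e) \<in> U}"
  proof (intro set_eqI iffI)
    fix \<tau> assume "\<tau> \<in> {\<tau> \<in> topspace KS. \<tau> e \<in> Some ` (U \<inter> idset \<theta> e)}"
    then show "\<tau> \<in> {\<tau> \<in> idset KSa e. the (\<tau> e) \<in> U}" unfolding D by auto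
  next
    fix \<tau> assume "\<tau> \<in> {\<tau> \<in> idset KSa e. the (\<tau> e) \<in> U}"
    then show "\<tau> \<in> {\<tau> \<in> topspace KS. \<tau> e \<in> Some ` (U \<inter> idset \<theta> e)}"
      using v[of \<tau>] unfolding D by (auto intro!: image_eqI[of "\<tau> e" Some "the (\<tau> e)"])
  qed
  ultimately have "openin KS {\<tau> \<in> idset KSa e. the (\<tau> e) \<in> U}" by simp
  then show "openin (subtopology KS (idset KSa e)) {\<tau> \<in> topspace (subtopology KS (idset KSa e)). the (\<tau> e) \<in> U}"
    unfolding top using ks.openin_idset[OF e] by (subst openin_open_subtopology) auto
qed

text \<open>Evaluations approximate h uniformly, but \<open>evaluations_in_range\<close> puts them
  into the image on the sheet of s after multiplication by an evaluation of some a at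
  \<open>s\<^sup>\<star> * s\<close>. This a is a bump equal to 1 on the values taken on the support
  of h, so h is unchanged by the factor and the error does not grow.\<close>

lemma section_function_approximation:
  assumes h: "h \<in> Cc (subtopology KS (ks.source s))" and eps: "0 < \<epsilon>"
  shows "\<exists>T\<in>KS_algebraic X \<theta>. reduced_norm ks.GG (ks.section_function s h + (\<lambda>\<gamma>. - 1 * comparison T \<gamma>)) \<le> \<epsilon>"
proof -
  let ?e = "s\<^sup>\<star> * s"
  have e: "?e \<in> idempotents" by simp
  obtain K where K: "compactin KS K" "K \<subseteq> ks.source s" "\<And>\<tau>. \<tau> \<notin> K \<Longrightarrow> h \<tau> = 0" using h ks.Cc_source_iff by blast
  let ?K0 = "(\<lambda>\<tau>. the (\<tau> ?e)) ` K"
  have "compactin (subtopology KS (ks.source s)) K" using K by (simp add: compactin_subtopology)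
  then have K0: "compactin X ?K0" by (rule image_compactin[OF _ continuous_map_value[OF e]])
  have Kv: "\<tau> \<in> topspace KS" "\<tau> ?e = Some (the (\<tau> ?e))" if "\<tau> \<in> K" for \<tau>
  proof -
    have "\<tau> \<in> ks.source s" using that K(2) by blast
    then show "\<tau> \<in> topspace KS" "\<tau> ?e = Some (the (\<tau> ?e))" unfolding ks_source by auto
  qed
  have "?K0 \<subseteq> source s" using KS_tilde_value[OF topspace_KS_tilde e] Kv by blast
  then obtain a where a: "a \<in> Cc (subtopology X (source s))" "\<And>y. y \<in> ?K0 \<Longrightarrow> a y = 1" "\<And>y. cmod (a y) \<le> 1"
    using bump_function[OF locally_compact Hausdorff openin_source K0] by blast
  have ha: "h \<tau> = h \<tau> * eval_at a ?e \<tau>" for \<tau>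
  proof (cases "\<tau> \<in> K")
    case True
    then have "eval_at a ?e \<tau> = a (the (\<tau> ?e))" using Kv(2)[OF True] unfolding eval_at_def by (metis option.simps(5))
    then show ?thesis using a(2) True by simp
  qed (use K(3) in simp)
  have "h \<in> C0 KS" using Cc_subset_C0[OF h] ks.C0_source_iff by blast
  then have "h \<in> C0 KS_compact \<and> (\<forall>\<tau>. \<tau> \<notin> KS_tilde X \<theta> - {KS_infinity} \<longrightarrow> h \<tau> = 0)"
    unfolding KS_eq_subtopology C0_subtopology_iff[OF Hausdorff_KS_compact openin_KS_compact] .
  then have "continuous_map KS_compact euclidean h" "h KS_infinity = 0" using C0D(1) by auto
  then obtain d where d: "d \<in> evaluations" "\<And>\<tau>. \<tau> \<in> KS_tilde X \<theta> \<Longrightarrow> cmod (h \<tau> - d \<tau>) \<le> \<epsilon>"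
    using Stone_Weierstrass_KS[OF _ _ eps] by blast
  obtain T where T: "T \<in> KS_algebraic X \<theta>" "comparison T = ks.section_function s (\<lambda>\<tau>. d \<tau> * eval_at a ?e \<tau>)"
    using evaluations_in_range[OF d(1) Cc_subset_C0[OF a(1)]] by blast
  have "ks.section_function s h + (\<lambda>\<gamma>. - 1 * comparison T \<gamma>) = ks.section_function s (h + (\<lambda>\<tau>. - 1 * (d \<tau> * eval_at a ?e \<tau>)))"
    by (simp only: T(2) ks.section_function_add ks.section_function_scale)
  moreover have "reduced_norm ks.GG (ks.section_function s (h + (\<lambda>\<tau>. - 1 * (d \<tau> * eval_at a ?e \<tau>)))) \<le> \<epsilon>"
  proof (rule ks.bounded_section_function(2))
    fix \<tau> assume "\<tau> \<in> ks.source s"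
    then have "\<tau> \<in> KS_tilde X \<theta>" unfolding ks_source using topspace_KS_tilde by blast
    have "(h + (\<lambda>\<tau>. - 1 * (d \<tau> * eval_at a ?e \<tau>))) \<tau> = (h \<tau> - d \<tau>) * eval_at a ?e \<tau>"
      using ha[of \<tau>] by (simp add: left_diff_distrib)
    then have "cmod ((h + (\<lambda>\<tau>. - 1 * (d \<tau> * eval_at a ?e \<tau>))) \<tau>) = cmod (h \<tau> - d \<tau>) * cmod (eval_at a ?e \<tau>)"
      by (simp only: norm_mult)
    also have "\<dots> \<le> \<epsilon> * 1"
      using eps by (intro mult_mono d(2)[OF \<open>\<tau> \<in> KS_tilde X \<theta>\<close>] eval_at_bound a(3)) auto
    finally show "cmod ((h + (\<lambda>\<tau>. - 1 * (d \<tau> * eval_at a ?e \<tau>))) \<tau>) \<le> \<epsilon>" by simp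
  qed (use eps in simp)
  ultimately have "reduced_norm ks.GG (ks.section_function s h + (\<lambda>\<gamma>. - 1 * comparison T \<gamma>)) \<le> \<epsilon>" by (simp only:)
  then show ?thesis using T(1) by blast
qed

text \<open>The \<tau> whose value at \<open>s\<^sup>\<star> * s\<close> lies in the compact support
  of a form a closed set of the compact space that misses infinity, hence a compact subset of X^KS.
  The case distinction makes the function zero outside X^KS, as \<open>Cc\<close> demands.\<close>

lemma eval_at_Cc:
  assumes a: "a \<in> Cc (subtopology X (source s))"
  shows "(\<lambda>\<tau>. if \<tau> \<in> ks.source s then eval_at a (s\<^sup>\<star> * s) \<tau> else 0) \<in> Cc (subtopology KS (ks.source s))"
  unfolding ks.Cc_source_iff
proof (intro conjI)
  let ?e = "s\<^sup>\<star> * s"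
  have e: "?e \<in> idempotents" by simp
  have "continuous_map KS euclidean (eval_at a ?e)"
    unfolding KS_space_def by (intro continuous_map_from_subtopology continuous_map_eval_at e Cc_subset_C0 a)
  moreover have "eval_at a ?e \<tau> = (if \<tau> \<in> ks.source s then eval_at a ?e \<tau> else 0)" if "\<tau> \<in> topspace KS" for \<tau>
    using that unfolding ks_source by (auto simp: eval_at_def split: option.split)
  ultimately show "continuous_map KS euclidean (\<lambda>\<tau>. if \<tau> \<in> ks.source s then eval_at a ?e \<tau> else 0)"
    by (rule continuous_map_eq)
  obtain L where L: "compactin (subtopology X (idset \<theta> ?e)) L" "\<And>x. x \<notin> L \<Longrightarrow> a x = 0" using Cc_compact_support[OF a] by blast
  let ?A = "Alexandroff_compactification (subtopology X (idset \<theta> ?e))"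
  let ?Q = "{\<tau> \<in> topspace KS_compact. \<tau> ?e \<in> Some ` L}"
  have cL: "closedin ?A (Some ` L)"
    using L(1) compactin_imp_closedin[OF Hausdorff_space_subtopology[OF Hausdorff] L(1)] by simp
  have "continuous_map KS_compact ?A (\<lambda>\<tau>. \<tau> ?e)"
    unfolding KS_product_def by (intro continuous_map_from_subtopology continuous_map_product_projection e)
  then have "closedin KS_compact ?Q" by (rule closedin_continuous_map_preimage[OF _ cL])
  then have cQ: "compactin KS_compact ?Q" by (rule closedin_compact_space[OF compact_space_KS_compact])
  have Q: "\<tau> \<in> ks.source s" if "\<tau> \<in> ?Q" for \<tau>
  proof -
    have "\<tau> \<in> KS_tilde X \<theta>" "\<tau> ?e \<noteq> None" using that unfolding topspace_KS_compact by auto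
    then show ?thesis unfolding ks_source topspace_KS using e by blast
  qed
  have "?Q \<subseteq> KS_tilde X \<theta> - {KS_infinity}"
  proof
    fix \<tau> assume \<tau>: "\<tau> \<in> ?Q"
    then have "\<tau> \<in> topspace KS" using Q unfolding ks_source by blast
    then show "\<tau> \<in> KS_tilde X \<theta> - {KS_infinity}" by (simp add: KS_space_def)
  qed
  then have "compactin KS ?Q" using cQ unfolding KS_eq_subtopology by (simp only: compactin_subtopology simp_thms)
  moreover have "?Q \<subseteq> ks.source s" using Q by blast
  moreover have "eval_at a ?e \<tau> = 0" if "\<tau> \<notin> ?Q" "\<tau> \<in> ks.source s" for \<tau>
  proof -
    have "\<tau> \<in> topspace KS" using that(2) unfolding ks_source by blast
    then show ?thesis
      using that(1) topspace_KS_tilde L(2) unfolding topspace_KS_compact by (auto simp: eval_at_def split: option.split)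
  qed
  ultimately show "\<exists>K. compactin KS K \<and> K \<subseteq> ks.source s \<and> (\<forall>\<tau>. \<tau> \<notin> K \<longrightarrow> (if \<tau> \<in> ks.source s then eval_at a ?e \<tau> else 0) = 0)"
    by (intro exI[of _ ?Q]) simp
qed

end

lemma (in algebraic_groupoid) reduced_norm_zero: "reduced_norm G 0 = 0"
proof -
  have "(\<lambda>\<gamma>. 0 * (0 :: 'g \<Rightarrow> complex) \<gamma>) = 0" by auto
  then have "reduced_norm G 0 \<le> cmod 0 * reduced_norm G 0"
    using bounded_kernels_scale(2)[OF bounded_kernels_zero, of 0] by metis
  then show ?thesis using reduced_norm_nonneg[OF bounded_kernels_zero] by simp
qed

context KS_comparison
begin

lemma comparison_approximates_groupoid_functions:
  assumes f: "f \<in> groupoid_functions ks.GG" and eps: "0 < \<epsilon>"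
  shows "\<exists>T\<in>KS_algebraic X \<theta>. reduced_norm ks.GG (f - comparison T) \<le> \<epsilon>"
proof -
  \<comment> \<open>The induction is over all \<epsilon>, since a scalar in the span changes the
    accuracy needed, and it carries membership in \<open>bounded_kernels\<close> along for the norm
    inequalities.\<close>
  have "f \<in> ks.bounded_kernels \<and> (\<forall>\<epsilon>>0. \<exists>T\<in>KS_algebraic X \<theta>. reduced_norm ks.GG (f - comparison T) \<le> \<epsilon>)"
    using f unfolding ks.groupoid_functions_eq
  proof (induction f rule: fun_module.span_induct_alt)
    case base
    have "\<exists>T\<in>KS_algebraic X \<theta>. reduced_norm ks.GG (0 - comparison T) \<le> \<epsilon>" if "0 < \<epsilon>" for \<epsilon>
    proof -
      have "reduced_norm ks.GG (0 - comparison 0) \<le> \<epsilon>"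
        using that by (simp only: comparison_zero diff_zero ks.reduced_norm_zero less_imp_le)
      then show ?thesis using KS_algebraic_zero by blast
    qed
    then show ?case using ks.bounded_kernels_zero by blast
  next
    case (step c f g)
    then have fg: "f \<in> ks.bounded_kernels" "g \<in> ks.bounded_kernels" using ks.section_functions_bounded_kernels by blast+
    have "\<exists>T\<in>KS_algebraic X \<theta>. reduced_norm ks.GG ((\<lambda>\<gamma>. c * f \<gamma>) + g - comparison T) \<le> \<epsilon>" if eps: "0 < \<epsilon>" for \<epsilon>
    proof -
      obtain s h where h: "f = ks.section_function s h" "h \<in> Cc (subtopology KS (ks.source s))"
        using step(1) by (auto simp: ks.section_functions_def)
      obtain U where U: "U \<in> KS_algebraic X \<theta>" "reduced_norm ks.GG (g - comparison U) \<le> \<epsilon> / 2"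
        using step(2) half_gt_zero[OF eps] by blast
      \<comment> \<open>The denominator has cmod c + 1 rather than cmod c, to allow c = 0.\<close>
      have e: "0 < \<epsilon> / (2 * (cmod c + 1))" using eps by (simp add: add_nonneg_pos)
      obtain T where T: "T \<in> KS_algebraic X \<theta>" "reduced_norm ks.GG (f + (\<lambda>\<gamma>. - 1 * comparison T \<gamma>)) \<le> \<epsilon> / (2 * (cmod c + 1))"
        using section_function_approximation[OF h(2) e] h(1) by blast
      have cT: "(\<lambda>s x. c * T s x) \<in> KS_algebraic X \<theta>" by (rule KS_algebraic_scale[OF T(1)])
      let ?W = "(\<lambda>s x. c * T s x) + U"
      have fT: "f + (\<lambda>\<gamma>. - 1 * comparison T \<gamma>) \<in> ks.bounded_kernels"
        using fg(1) comparison_bounded[OF T(1)]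
        by (intro ks.bounded_kernels_add(1) ks.bounded_kernels_scale(1))
      have g: "g - comparison U \<in> ks.bounded_kernels"
        by (rule fun_module.subspace_diff[OF ks.subspace_bounded_kernels fg(2) comparison_bounded[OF U(1)]])
      have "(\<lambda>\<gamma>. c * f \<gamma>) + g - comparison ?W = (\<lambda>\<gamma>. c * (f + (\<lambda>\<gamma>. - 1 * comparison T \<gamma>)) \<gamma>) + (g - comparison U)"
        unfolding comparison_add[OF cT U(1)] comparison_scale[OF T(1)] by (simp add: fun_eq_iff algebra_simps)
      then have "reduced_norm ks.GG ((\<lambda>\<gamma>. c * f \<gamma>) + g - comparison ?W)
          \<le> reduced_norm ks.GG (\<lambda>\<gamma>. c * (f + (\<lambda>\<gamma>. - 1 * comparison T \<gamma>)) \<gamma>) + reduced_norm ks.GG (g - comparison U)"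
        using ks.bounded_kernels_add(2)[OF ks.bounded_kernels_scale(1)[OF fT] g] by (simp only:)
      also have "\<dots> \<le> cmod c * (\<epsilon> / (2 * (cmod c + 1))) + \<epsilon> / 2"
        by (intro add_mono U(2) order_trans[OF ks.bounded_kernels_scale(2)[OF fT]] mult_left_mono T(2)) simp
      also have "\<dots> \<le> (cmod c + 1) * (\<epsilon> / (2 * (cmod c + 1))) + \<epsilon> / 2"
        using e by (intro add_right_mono mult_right_mono) auto
      also have "\<dots> = \<epsilon>" by (simp add: field_simps add_nonneg_eq_0_iff)
      finally show ?thesis using KS_algebraic_add[OF cT U(1)] by blast
    qed
    then show ?case using ks.bounded_kernels_add(1)[OF ks.bounded_kernels_scale(1)[OF fg(1)] fg(2)] by blast
  qed
  then show ?thesis using eps by blast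
qed

text \<open>Truncate a by a bump \<rho> equal to 1 where a has modulus at least \<delta>. Elsewhere
  a(1 - \<rho>) is at most 2\<delta>, as \<rho> is complex of modulus at most 1; hence \<delta> =
  \<epsilon> / 2.\<close>

lemma section_eval_approximation:
  assumes a: "a \<in> C0 (subtopology X (source s))" and eps: "0 < \<epsilon>"
  shows "\<exists>f\<in>groupoid_functions ks.GG. reduced_norm ks.GG (ks.section_function s (eval_at a (s\<^sup>\<star> * s)) - f) \<le> \<epsilon>"
proof -
  define \<delta> where "\<delta> = \<epsilon> / 2"
  have d: "0 < \<delta>" using eps by (simp add: \<delta>_def)
  let ?e = "s\<^sup>\<star> * s"
  have aX: "a \<in> C0 X" "\<And>x. x \<notin> source s \<Longrightarrow> a x = 0" using a C0_source_iff by blast+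
  let ?K = "{x \<in> topspace X. \<delta> \<le> cmod (a x)}"
  have K: "compactin X ?K" "?K \<subseteq> source s" using C0D(3)[OF aX(1) d] aX(2) d by force+
  obtain \<rho> where r: "\<rho> \<in> Cc (subtopology X (source s))" "\<And>x. x \<in> ?K \<Longrightarrow> \<rho> x = 1" "\<And>x. cmod (\<rho> x) \<le> 1"
    using bump_function[OF locally_compact Hausdorff openin_source K] by blast
  obtain L where L: "compactin X L" "L \<subseteq> source s" "\<forall>x. x \<notin> L \<longrightarrow> \<rho> x = 0" using r(1) Cc_source_iff by blast
  have b: "(\<lambda>x. a x * \<rho> x) \<in> Cc (subtopology X (source s))"
    unfolding Cc_source_iff
  proof (intro conjI exI[of _ L] L(1,2) allI impI)
    show "continuous_map X euclidean (\<lambda>x. a x * \<rho> x)"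
      using C0D(1)[OF aX(1)] r(1) Cc_source_iff by (intro continuous_map_complex_mult) blast+
    show "a x * \<rho> x = 0" if "x \<notin> L" for x using L(3) that by simp
  qed
  let ?b = "\<lambda>\<tau>. if \<tau> \<in> ks.source s then eval_at (\<lambda>x. a x * \<rho> x) ?e \<tau> else 0"
  have "ks.section_function s ?b \<in> groupoid_functions ks.GG"
    by (rule ks.section_function_in_groupoid_functions[OF eval_at_Cc[OF b]])
  moreover have "ks.section_function s ?b = ks.section_function s (eval_at (\<lambda>x. a x * \<rho> x) ?e)"
    by (rule ks.section_function_cong) simp
  moreover have "ks.section_function s (eval_at a ?e) - ks.section_function s (eval_at (\<lambda>x. a x * \<rho> x) ?e) =
      ks.section_function s (eval_at (\<lambda>x. a x - a x * \<rho> x) ?e)"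
    by (auto simp: fun_eq_iff ks.section_function_def eval_at_def split: option.split)
  moreover have "reduced_norm ks.GG (ks.section_function s (eval_at (\<lambda>x. a x - a x * \<rho> x) ?e)) \<le> 2 * \<delta>"
  proof (intro ks.bounded_section_function(2) eval_at_bound)
    show "cmod (a x - a x * \<rho> x) \<le> 2 * \<delta>" for x
    proof (cases "x \<in> ?K")
      case False
      then have "cmod (a x) \<le> \<delta>" using C0D(2)[OF aX(1), of x] d by (cases "x \<in> topspace X") auto
      then have "cmod (a x) * cmod (1 - \<rho> x) \<le> \<delta> * 2"
        using r(3)[of x] norm_triangle_ineq4[of 1 "\<rho> x"] d by (intro mult_mono) auto
      then show ?thesis by (simp add: right_diff_distrib flip: norm_mult)
    qed (use r(2) d in simp)
  qed (use d in simp_all)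
  ultimately have "ks.section_function s ?b \<in> groupoid_functions ks.GG"
    "reduced_norm ks.GG (ks.section_function s (eval_at a ?e) - ks.section_function s ?b) \<le> 2 * \<delta>" by (simp_all only:)
  then show ?thesis by (auto simp: \<delta>_def)
qed

lemma groupoid_functions_approximate_comparison:
  assumes T: "T \<in> KS_algebraic X \<theta>" and eps: "0 < \<epsilon>"
  shows "\<exists>f\<in>groupoid_functions ks.GG. reduced_norm ks.GG (comparison T - f) \<le> \<epsilon>"
proof -
  have step: "\<exists>f\<in>groupoid_functions ks.GG. reduced_norm ks.GG ((\<Sum>s\<in>S. ks.section_function s (eval_at (T s) (s\<^sup>\<star> * s))) - f) \<le> \<epsilon>"
    if "finite S" "0 < \<epsilon>" for S \<epsilon>
    using that
  proof (induction S arbitrary: \<epsilon> rule: finite_induct)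
    case empty
    have "(0 :: _ \<Rightarrow> complex) \<in> groupoid_functions ks.GG" unfolding ks.groupoid_functions_eq by (rule fun_module.span_zero)
    moreover have "reduced_norm ks.GG ((\<Sum>s\<in>{}. ks.section_function s (eval_at (T s) (s\<^sup>\<star> * s))) - 0) \<le> \<epsilon>"
      using empty by (simp only: sum.empty diff_zero ks.reduced_norm_zero less_imp_le)
    ultimately show ?case by blast
  next
    case (insert s S)
    let ?u = "\<lambda>s. ks.section_function s (eval_at (T s) (s\<^sup>\<star> * s))"
    have a: "T t \<in> C0 (subtopology X (source t))" for t using T by (simp add: KS_algebraic_iff)
    obtain f where f: "f \<in> groupoid_functions ks.GG" "reduced_norm ks.GG (?u s - f) \<le> \<epsilon> / 2"
      using section_eval_approximation[OF a, of "\<epsilon> / 2"] half_gt_zero[OF insert(4)] by blast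
    obtain g where g: "g \<in> groupoid_functions ks.GG" "reduced_norm ks.GG ((\<Sum>s\<in>S. ?u s) - g) \<le> \<epsilon> / 2"
      using insert(3)[OF half_gt_zero[OF insert(4)]] by blast
    have b: "?u s - f \<in> ks.bounded_kernels" "(\<Sum>s\<in>S. ?u s) - g \<in> ks.bounded_kernels"
      using f(1) g(1) section_eval_bounded[OF a] ks.groupoid_functions_bounded
      by (blast intro: fun_module.subspace_diff[OF ks.subspace_bounded_kernels] ks.bounded_kernels_sum)+
    have "(\<Sum>s\<in>insert s S. ?u s) - (f + g) = (?u s - f) + ((\<Sum>s\<in>S. ?u s) - g)"
      by (simp only: sum.insert[OF insert(1,2)] add_diff_add)
    then have "reduced_norm ks.GG ((\<Sum>s\<in>insert s S. ?u s) - (f + g)) \<le> \<epsilon> / 2 + \<epsilon> / 2"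
      using ks.bounded_kernels_add(2)[OF b] f(2) g(2) by (simp only:)
    then show ?case using ks.groupoid_functions_add[OF f(1) g(1)] unfolding field_sum_of_halves by (rule bexI)
  qed
  have "finite {s. T s \<noteq> 0}" using T by (simp add: KS_algebraic_iff)
  from step[OF this eps] show ?thesis unfolding comparison_def .
qed

end

section \<open>Completions\<close>

text \<open>The ambient algebra in which both *-algebras are compared; it will be
  \<open>bounded_kernels\<close> with the reduced norm. Limits are represented by Cauchy sequences
  throughout.\<close>

locale seminormed_star_algebra =
  fixes C :: "'c::ab_group_add set" and N :: "'c \<Rightarrow> real" and sc :: "complex \<Rightarrow> 'c \<Rightarrow> 'c"
    and cv :: "'c \<Rightarrow> 'c \<Rightarrow> 'c" and ad :: "'c \<Rightarrow> 'c"
  assumes C_add: "f \<in> C \<Longrightarrow> g \<in> C \<Longrightarrow> f + g \<in> C"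
    and C_sc: "f \<in> C \<Longrightarrow> sc c f \<in> C"
    and C_cv: "f \<in> C \<Longrightarrow> g \<in> C \<Longrightarrow> cv f g \<in> C"
    and C_ad: "f \<in> C \<Longrightarrow> ad f \<in> C"
    and N_zero: "N 0 = 0"
    and N_nonneg: "f \<in> C \<Longrightarrow> 0 \<le> N f"
    and N_add: "f \<in> C \<Longrightarrow> g \<in> C \<Longrightarrow> N (f + g) \<le> N f + N g"
    and N_sc: "f \<in> C \<Longrightarrow> N (sc c f) \<le> cmod c * N f"
    and N_cv: "f \<in> C \<Longrightarrow> g \<in> C \<Longrightarrow> N (cv f g) \<le> N f * N g"
    and N_ad: "f \<in> C \<Longrightarrow> N (ad f) \<le> N f"
    and sc_minus_one: "sc (- 1) f = - f"
    and sc_add: "sc c (f + g) = sc c f + sc c g"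
    and cv_add_left: "f \<in> C \<Longrightarrow> g \<in> C \<Longrightarrow> h \<in> C \<Longrightarrow> cv (f + g) h = cv f h + cv g h"
    and cv_add_right: "f \<in> C \<Longrightarrow> g \<in> C \<Longrightarrow> h \<in> C \<Longrightarrow> cv h (f + g) = cv h f + cv h g"
    and ad_add: "ad (f + g) = ad f + ad g"
begin

lemma C_minus: "f \<in> C \<Longrightarrow> - f \<in> C"
  using C_sc[of f "- 1"] by (simp add: sc_minus_one)

lemma C_diff: "f \<in> C \<Longrightarrow> g \<in> C \<Longrightarrow> f - g \<in> C"
  using C_add[of f "- g"] C_minus[of g] by simp

lemma N_minus: assumes "f \<in> C" shows "N (- f) = N f"
proof (rule antisym)
  show "N (- f) \<le> N f" using N_sc[OF assms, of "- 1"] by (simp add: sc_minus_one)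
  show "N f \<le> N (- f)" using N_sc[OF C_minus[OF assms], of "- 1"] by (simp add: sc_minus_one)
qed

lemma N_minus_commute: assumes "f \<in> C" "g \<in> C" shows "N (f - g) = N (g - f)"
  using N_minus[OF C_diff[OF assms]] by simp

lemma N_triangle: assumes "f \<in> C" "g \<in> C" "h \<in> C" shows "N (f - h) \<le> N (f - g) + N (g - h)"
  using N_add[OF C_diff[OF assms(1,2)] C_diff[OF assms(2,3)]] by simp

lemma N_diff_abs: assumes "f \<in> C" "g \<in> C" shows "\<bar>N f - N g\<bar> \<le> N (f - g)"
  using N_add[OF C_diff[OF assms] assms(2)] N_add[OF C_diff[OF assms(2,1)] assms(1)] N_minus_commute[OF assms]
  by simp

text \<open>The filter is arbitrary so that one set of lemmas serves sequences and pairs of indices.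
  Membership in C is required at every index, which makes the norm inequalities available without
  passing to eventual statements.\<close>

definition null :: "'i filter \<Rightarrow> ('i \<Rightarrow> 'c) \<Rightarrow> ('i \<Rightarrow> 'c) \<Rightarrow> bool" where
  "null F w w' \<longleftrightarrow> range w \<subseteq> C \<and> range w' \<subseteq> C \<and> ((\<lambda>i. N (w i - w' i)) \<longlongrightarrow> 0) F"

lemma nullD:
  assumes "null F w w'"
  shows "w i \<in> C" "w' i \<in> C" "((\<lambda>i. N (w i - w' i)) \<longlongrightarrow> 0) F"
  using assms by (auto simp: null_def)

lemma null_dominated:
  assumes "\<And>i. w i \<in> C" "\<And>i. w' i \<in> C" "\<And>i. N (w i - w' i) \<le> b i" "(b \<longlongrightarrow> 0) F"
  shows "null F w w'"
  unfolding null_def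
proof (intro conjI)
  show "((\<lambda>i. N (w i - w' i)) \<longlongrightarrow> 0) F"
    by (rule tendsto_sandwich[OF _ _ tendsto_const assms(4)]) (use assms(1-3) in \<open>auto intro!: always_eventually N_nonneg C_diff\<close>)
qed (use assms in auto)

lemma null_refl: "range w \<subseteq> C \<Longrightarrow> null F w w"
  by (simp add: null_def N_zero)

lemma null_sym: assumes "null F w w'" shows "null F w' w"
  by (rule null_dominated[OF nullD(2,1)[OF assms] _ nullD(3)[OF assms]])
    (simp add: N_minus_commute nullD(1,2)[OF assms])

lemma null_trans: assumes "null F w w'" "null F w' w''" shows "null F w w''"
proof (rule null_dominated)
  show "((\<lambda>i. N (w i - w' i) + N (w' i - w'' i)) \<longlongrightarrow> 0) F"
    using tendsto_add[OF nullD(3)[OF assms(1)] nullD(3)[OF assms(2)]] by simp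
qed (use nullD[OF assms(1)] nullD[OF assms(2)] in \<open>auto intro: N_triangle\<close>)

lemma null_filterlim:
  assumes "null F w w'" "filterlim r F F'" shows "null F' (\<lambda>i. w (r i)) (\<lambda>i. w' (r i))"
  using assms filterlim_compose[OF nullD(3)[OF assms(1)] assms(2)] by (auto simp: null_def)

lemma null_add: assumes "null F v v'" "null F w w'" shows "null F (\<lambda>i. v i + w i) (\<lambda>i. v' i + w' i)"
proof (rule null_dominated)
  show "((\<lambda>i. N (v i - v' i) + N (w i - w' i)) \<longlongrightarrow> 0) F"
    using tendsto_add[OF nullD(3)[OF assms(1)] nullD(3)[OF assms(2)]] by simp
  show "N (v i + w i - (v' i + w' i)) \<le> N (v i - v' i) + N (w i - w' i)" for i
    using N_add[OF C_diff[OF nullD(1,2)[OF assms(1)]] C_diff[OF nullD(1,2)[OF assms(2)]]] by (simp only: add_diff_add)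
qed (use nullD[OF assms(1)] nullD[OF assms(2)] in \<open>auto intro: C_add\<close>)

lemma null_sc: assumes "null F w w'" shows "null F (\<lambda>i. sc c (w i)) (\<lambda>i. sc c (w' i))"
proof (rule null_dominated)
  show "((\<lambda>i. cmod c * N (w i - w' i)) \<longlongrightarrow> 0) F"
    using tendsto_mult_left[OF nullD(3)[OF assms]] by simp
  have "sc c f - sc c g = sc c (f - g)" for f g using sc_add[of c "f - g" g] by simp
  then show "N (sc c (w i) - sc c (w' i)) \<le> cmod c * N (w i - w' i)" for i
    using N_sc[OF C_diff[OF nullD(1,2)[OF assms]]] by simp
qed (use nullD[OF assms] in \<open>auto intro: C_sc\<close>)

lemma null_ad: assumes "null F w w'" shows "null F (\<lambda>i. ad (w i)) (\<lambda>i. ad (w' i))"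
proof (rule null_dominated[OF _ _ _ nullD(3)[OF assms]])
  have "ad f - ad g = ad (f - g)" for f g using ad_add[of "f - g" g] by simp
  then show "N (ad (w i) - ad (w' i)) \<le> N (w i - w' i)" for i
    using N_ad[OF C_diff[OF nullD(1,2)[OF assms]]] by simp
qed (use nullD[OF assms] in \<open>auto intro: C_ad\<close>)

text \<open>In the splitting vw - v'w' = v(w - w') + (v - v')w' the factors v and w' have to be
  bounded, one from each pair.\<close>

lemma null_cv:
  assumes v: "null F v v'" and w: "null F w w'" and B: "\<And>i. N (v i) \<le> B" "\<And>i. N (w' i) \<le> B"
  shows "null F (\<lambda>i. cv (v i) (w i)) (\<lambda>i. cv (v' i) (w' i))"
proof (rule null_dominated)
  note [simp] = nullD(1,2)[OF v] nullD(1,2)[OF w] C_diff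
  show "((\<lambda>i. B * N (w i - w' i) + N (v i - v' i) * B) \<longlongrightarrow> 0) F"
    using tendsto_add[OF tendsto_mult_left[OF nullD(3)[OF w], of B] tendsto_mult_right[OF nullD(3)[OF v], of B]] by simp
  show "cv (v i) (w i) \<in> C" "cv (v' i) (w' i) \<in> C" for i by (simp_all add: C_cv)
  show "N (cv (v i) (w i) - cv (v' i) (w' i)) \<le> B * N (w i - w' i) + N (v i - v' i) * B" for i
  proof -
    have "cv (v i) (w i) = cv (v i) (w i - w' i) + cv (v i) (w' i)"
      using cv_add_right[of "w i - w' i" "w' i" "v i"] by simp
    moreover have "cv (v i) (w' i) = cv (v i - v' i) (w' i) + cv (v' i) (w' i)"
      using cv_add_left[of "v i - v' i" "v' i" "w' i"] by simp
    ultimately have "cv (v i) (w i) - cv (v' i) (w' i) = cv (v i) (w i - w' i) + cv (v i - v' i) (w' i)" by simp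
    then have "N (cv (v i) (w i) - cv (v' i) (w' i)) \<le> N (cv (v i) (w i - w' i)) + N (cv (v i - v' i) (w' i))"
      by (simp add: N_add C_cv)
    also have "\<dots> \<le> N (v i) * N (w i - w' i) + N (v i - v' i) * N (w' i)" by (intro add_mono N_cv) simp_all
    also have "\<dots> \<le> B * N (w i - w' i) + N (v i - v' i) * B"
      by (intro add_mono mult_mono B N_nonneg order_trans[OF N_nonneg B(1)[of i]]) (simp_all add: N_nonneg)
    finally show ?thesis .
  qed
qed

text \<open>In this form, operations preserve Cauchy sequences for the same reason that they preserve
  \<^const>\<open>null\<close>.\<close>

definition fundamental :: "(nat \<Rightarrow> 'c) \<Rightarrow> bool" where
  "fundamental w \<longleftrightarrow> null (sequentially \<times>\<^sub>F sequentially) (\<lambda>i. w (fst i)) (\<lambda>i. w (snd i))"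

lemma fundamental_iff:
  "fundamental w \<longleftrightarrow> range w \<subseteq> C \<and> (\<forall>\<epsilon>>0. \<exists>M. \<forall>m\<ge>M. \<forall>n\<ge>M. N (w m - w n) < \<epsilon>)"
proof -
  have "((\<lambda>i. N (w (fst i) - w (snd i))) \<longlongrightarrow> 0) (sequentially \<times>\<^sub>F sequentially) \<longleftrightarrow>
      (\<forall>\<epsilon>>0. \<exists>M. \<forall>m\<ge>M. \<forall>n\<ge>M. N (w m - w n) < \<epsilon>)" if w: "range w \<subseteq> C"
  proof -
    have "\<bar>N (w m - w n)\<bar> = N (w n - w m)" for m n using w N_minus_commute[of "w m" "w n"] by (simp add: N_nonneg C_diff range_subsetD)
    then show ?thesis by (simp add: tendsto_iff eventually_prod_sequentially dist_real_def)
  qed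
  moreover have "range (\<lambda>i :: nat \<times> nat. w (fst i)) \<subseteq> C \<longleftrightarrow> range w \<subseteq> C"
    "range (\<lambda>i :: nat \<times> nat. w (snd i)) \<subseteq> C \<longleftrightarrow> range w \<subseteq> C"
    by (simp_all add: image_subset_iff)
  ultimately show ?thesis unfolding fundamental_def null_def by blast
qed

lemma fundamentalD:
  assumes "fundamental w" "0 < \<epsilon>"
  obtains M where "\<And>m n. m \<ge> M \<Longrightarrow> n \<ge> M \<Longrightarrow> N (w m - w n) < \<epsilon>"
proof -
  have "\<exists>M. \<forall>m\<ge>M. \<forall>n\<ge>M. N (w m - w n) < \<epsilon>" using assms unfolding fundamental_iff by simp
  then show ?thesis using that by blast
qed

lemma fundamental_range: "fundamental w \<Longrightarrow> w n \<in> C"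
  by (auto simp: fundamental_iff)

text \<open>In the density argument this shows that a sequence of approximants to a Cauchy sequence
  is Cauchy in its own algebra.\<close>

lemma fundamental_null: assumes "fundamental w" "null sequentially w w'" shows "fundamental w'"
  unfolding fundamental_def
  by (rule null_trans[OF null_filterlim[OF null_sym[OF assms(2)] filterlim_fst]
      null_trans[OF assms(1)[unfolded fundamental_def] null_filterlim[OF assms(2) filterlim_snd]]])

lemma fundamental_bounded: assumes "fundamental w" obtains B where "\<And>n. N (w n) \<le> B"
proof -
  obtain M where M: "\<And>m n. m \<ge> M \<Longrightarrow> n \<ge> M \<Longrightarrow> N (w m - w n) < 1" using fundamentalD[OF assms zero_less_one] by blast
  define B where "B = Max ((\<lambda>n. N (w n)) ` {..M}) + 1"
  have le: "N (w n) \<le> B - 1" if "n \<le> M" for n using that by (auto simp: B_def intro!: Max_ge)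
  have "N (w n) \<le> B" for n
  proof (cases "n \<le> M")
    case False
    then have "N (w n - w M) < 1" using M by simp
    then show ?thesis using N_diff_abs[OF fundamental_range[OF assms] fundamental_range[OF assms], of n M] le[of M] by simp
  qed (use le[of n] in simp)
  then show ?thesis by (rule that)
qed

lemma fundamental_add: "fundamental v \<Longrightarrow> fundamental w \<Longrightarrow> fundamental (\<lambda>n. v n + w n)"
  unfolding fundamental_def by (rule null_add)

lemma fundamental_sc: "fundamental w \<Longrightarrow> fundamental (\<lambda>n. sc c (w n))"
  unfolding fundamental_def by (rule null_sc)

lemma fundamental_ad: "fundamental w \<Longrightarrow> fundamental (\<lambda>n. ad (w n))"
  unfolding fundamental_def by (rule null_ad)

lemma fundamental_bounded2:
  assumes "fundamental v" "fundamental w" obtains B where "\<And>n. N (v n) \<le> B" "\<And>n. N (w n) \<le> B"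
proof -
  obtain A B where "\<And>n. N (v n) \<le> A" "\<And>n. N (w n) \<le> B" using fundamental_bounded assms by metis
  then show ?thesis using that[of "max A B"] by (simp add: le_max_iff_disj)
qed

lemma fundamental_cv: assumes "fundamental v" "fundamental w" shows "fundamental (\<lambda>n. cv (v n) (w n))"
proof -
  obtain B where "\<And>n. N (v n) \<le> B" "\<And>n. N (w n) \<le> B" using fundamental_bounded2[OF assms] by blast
  then show ?thesis using assms unfolding fundamental_def by (intro null_cv)
qed

lemma null_cv_fundamental:
  assumes "fundamental v" "fundamental w'" "null sequentially v v'" "null sequentially w w'"
  shows "null sequentially (\<lambda>n. cv (v n) (w n)) (\<lambda>n. cv (v' n) (w' n))"
proof -
  obtain B where "\<And>n. N (v n) \<le> B" "\<And>n. N (w' n) \<le> B" using fundamental_bounded2[OF assms(1,2)] by blast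
  then show ?thesis by (intro null_cv assms(3,4))
qed

text \<open>That w is Cauchy makes both limits exist, so that \<open>lim\<close> has its meaning;
  the norm of a class in the completion is then well defined.\<close>

lemma lim_norm_null:
  assumes "fundamental w" "null sequentially w w'"
  shows "lim (\<lambda>n. N (w n)) = lim (\<lambda>n. N (w' n))"
proof -
  have "Cauchy (\<lambda>n. N (w n))"
  proof (rule CauchyI)
    fix \<epsilon> :: real assume e: "0 < \<epsilon>"
    obtain M where M: "\<And>m n. m \<ge> M \<Longrightarrow> n \<ge> M \<Longrightarrow> N (w m - w n) < \<epsilon>" using fundamentalD[OF assms(1) e] by blast
    have "norm (N (w m) - N (w n)) < \<epsilon>" if "m \<ge> M" "n \<ge> M" for m n
      using N_diff_abs[OF fundamental_range[OF assms(1)] fundamental_range[OF assms(1)], of m n] M[OF that] by simp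
    then show "\<exists>M. \<forall>m\<ge>M. \<forall>n\<ge>M. norm (N (w m) - N (w n)) < \<epsilon>" by blast
  qed
  then obtain l where l: "(\<lambda>n. N (w n)) \<longlonglongrightarrow> l" using Cauchy_convergent convergent_def by blast
  have "(\<lambda>n. N (w n) - N (w' n)) \<longlonglongrightarrow> 0"
    by (rule tendsto_rabs_zero_cancel, rule tendsto_sandwich[OF _ _ tendsto_const nullD(3)[OF assms(2)]])
      (auto intro!: always_eventually N_diff_abs nullD(1,2)[OF assms(2)])
  then have "(\<lambda>n. N (w' n)) \<longlonglongrightarrow> l" using tendsto_diff[OF l] by fastforce
  then show ?thesis using l by (simp add: limI)
qed

end

lemma constant_UN2:
  assumes "x \<in> p" "y \<in> q" "\<And>u v. u \<in> p \<Longrightarrow> v \<in> q \<Longrightarrow> f u v = c"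
  shows "(\<Union>u\<in>p. \<Union>v\<in>q. f u v) = c"
  using assms by auto

text \<open>The norm of A is pulled back along \<phi>, so Cauchy sequences in A and their
  equivalence are tested in C.\<close>

locale represented_algebra = seminormed_star_algebra C N sc cv ad
  for C :: "'c::ab_group_add set" and N sc cv ad +
  fixes A :: "'a normed_star_algebra" and \<phi> :: "'a \<Rightarrow> 'c"
  assumes carr_add: "a \<in> carr A \<Longrightarrow> b \<in> carr A \<Longrightarrow> add A a b \<in> carr A"
    and carr_scl: "a \<in> carr A \<Longrightarrow> scl A c a \<in> carr A"
    and carr_mul: "a \<in> carr A \<Longrightarrow> b \<in> carr A \<Longrightarrow> mul A a b \<in> carr A"
    and carr_adj: "a \<in> carr A \<Longrightarrow> adj A a \<in> carr A"
    and rep_in: "a \<in> carr A \<Longrightarrow> \<phi> a \<in> C"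
    and rep_add: "a \<in> carr A \<Longrightarrow> b \<in> carr A \<Longrightarrow> \<phi> (add A a b) = \<phi> a + \<phi> b"
    and rep_scl: "a \<in> carr A \<Longrightarrow> \<phi> (scl A c a) = sc c (\<phi> a)"
    and rep_mul: "a \<in> carr A \<Longrightarrow> b \<in> carr A \<Longrightarrow> \<phi> (mul A a b) = cv (\<phi> a) (\<phi> b)"
    and rep_adj: "a \<in> carr A \<Longrightarrow> \<phi> (adj A a) = ad (\<phi> a)"
    and rep_nrm: "a \<in> carr A \<Longrightarrow> nrm A a = N (\<phi> a)"
begin

lemma nsa_dist_rep: "a \<in> carr A \<Longrightarrow> b \<in> carr A \<Longrightarrow> nsa_dist A a b = N (\<phi> a - \<phi> b)"
  by (simp add: nsa_dist_def rep_nrm rep_add rep_scl carr_add carr_scl sc_minus_one)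

lemma Cauchy_seqs_iff: "u \<in> Cauchy_seqs A \<longleftrightarrow> range u \<subseteq> carr A \<and> fundamental (\<lambda>n. \<phi> (u n))"
proof -
  have "nsa_dist A (u m) (u n) = N (\<phi> (u m) - \<phi> (u n))" if "range u \<subseteq> carr A" for m n
    using that by (intro nsa_dist_rep) auto
  then show ?thesis unfolding Cauchy_seqs_def fundamental_iff using rep_in by (auto simp: image_subset_iff)
qed

lemma Cauchy_seqs_carr: "u \<in> Cauchy_seqs A \<Longrightarrow> u n \<in> carr A"
  by (auto simp: Cauchy_seqs_def)

lemma Cauchy_rel_iff: "(u, v) \<in> Cauchy_rel A \<longleftrightarrow>
    u \<in> Cauchy_seqs A \<and> v \<in> Cauchy_seqs A \<and> null sequentially (\<lambda>n. \<phi> (u n)) (\<lambda>n. \<phi> (v n))"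
proof -
  have "(\<lambda>n. nsa_dist A (u n) (v n)) = (\<lambda>n. N (\<phi> (u n) - \<phi> (v n)))" if "u \<in> Cauchy_seqs A" "v \<in> Cauchy_seqs A"
    using that by (intro ext nsa_dist_rep Cauchy_seqs_carr)
  then show ?thesis unfolding Cauchy_rel_def null_def using Cauchy_seqs_carr rep_in by (auto simp: image_subset_iff)
qed

lemma equiv_Cauchy_rel: "equiv (Cauchy_seqs A) (Cauchy_rel A)"
proof (rule equivI)
  show "refl_on (Cauchy_seqs A) (Cauchy_rel A)"
    using Cauchy_seqs_carr rep_in by (auto simp: refl_on_def Cauchy_rel_iff intro!: null_refl)
  show "sym (Cauchy_rel A)" by (auto simp: sym_def Cauchy_rel_iff intro: null_sym)
  show "trans (Cauchy_rel A)" by (auto simp: trans_def Cauchy_rel_iff intro: null_trans)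
  show "Cauchy_rel A \<subseteq> Cauchy_seqs A \<times> Cauchy_seqs A" by (auto simp: Cauchy_rel_iff)
qed

abbreviation cls :: "(nat \<Rightarrow> 'a) \<Rightarrow> (nat \<Rightarrow> 'a) set" where "cls u \<equiv> Cauchy_rel A `` {u}"

lemma cls_self: "u \<in> Cauchy_seqs A \<Longrightarrow> u \<in> cls u"
  by (rule equiv_class_self[OF equiv_Cauchy_rel])

lemma cls_eq_iff: "u \<in> Cauchy_seqs A \<Longrightarrow> v \<in> Cauchy_seqs A \<Longrightarrow>
    cls u = cls v \<longleftrightarrow> null sequentially (\<lambda>n. \<phi> (u n)) (\<lambda>n. \<phi> (v n))"
  using equiv_class_eq_iff[OF equiv_Cauchy_rel, of u v] Cauchy_rel_iff[of u v] eq_equiv_class_iff[OF equiv_Cauchy_rel, of u v]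
  by blast

lemma carr_completion: "carr (completion_of A) = cls ` Cauchy_seqs A"
  by (auto simp: completion_of_def quotient_def)

lemma Cauchy_seqs_ops:
  assumes u: "u \<in> Cauchy_seqs A" and v: "v \<in> Cauchy_seqs A"
  shows "(\<lambda>n. add A (u n) (v n)) \<in> Cauchy_seqs A" "(\<lambda>n. scl A c (u n)) \<in> Cauchy_seqs A"
    "(\<lambda>n. mul A (u n) (v n)) \<in> Cauchy_seqs A" "(\<lambda>n. adj A (u n)) \<in> Cauchy_seqs A"
proof -
  note uv = Cauchy_seqs_carr[OF u] Cauchy_seqs_carr[OF v]
  have f: "fundamental (\<lambda>n. \<phi> (u n))" "fundamental (\<lambda>n. \<phi> (v n))" using u v Cauchy_seqs_iff by blast+
  show "(\<lambda>n. add A (u n) (v n)) \<in> Cauchy_seqs A" "(\<lambda>n. scl A c (u n)) \<in> Cauchy_seqs A"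
    "(\<lambda>n. mul A (u n) (v n)) \<in> Cauchy_seqs A" "(\<lambda>n. adj A (u n)) \<in> Cauchy_seqs A"
    using fundamental_add[OF f] fundamental_sc[OF f(1), of c] fundamental_cv[OF f] fundamental_ad[OF f(1)]
    by (auto simp: Cauchy_seqs_iff uv rep_add rep_scl rep_mul rep_adj carr_add carr_scl carr_mul carr_adj)
qed

lemma completion_add:
  assumes u: "u \<in> Cauchy_seqs A" and v: "v \<in> Cauchy_seqs A"
  shows "add (completion_of A) (cls u) (cls v) = cls (\<lambda>n. add A (u n) (v n))"
proof -
  have "cls (\<lambda>n. add A (u' n) (v' n)) = cls (\<lambda>n. add A (u n) (v n))" if "u' \<in> cls u" "v' \<in> cls v" for u' v'
  proof -
    have w: "u' \<in> Cauchy_seqs A" "v' \<in> Cauchy_seqs A" "null sequentially (\<lambda>n. \<phi> (u' n)) (\<lambda>n. \<phi> (u n))"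
      "null sequentially (\<lambda>n. \<phi> (v' n)) (\<lambda>n. \<phi> (v n))"
      using that by (auto simp: Cauchy_rel_iff intro: null_sym)
    show ?thesis unfolding cls_eq_iff[OF Cauchy_seqs_ops(1)[OF w(1,2)] Cauchy_seqs_ops(1)[OF u v]]
      using null_add[OF w(3,4)] by (simp add: rep_add Cauchy_seqs_carr u v w(1,2))
  qed
  then show ?thesis
    unfolding completion_of_def normed_star_algebra.simps by (rule constant_UN2[OF cls_self[OF u] cls_self[OF v]])
qed

lemma completion_mul:
  assumes u: "u \<in> Cauchy_seqs A" and v: "v \<in> Cauchy_seqs A"
  shows "mul (completion_of A) (cls u) (cls v) = cls (\<lambda>n. mul A (u n) (v n))"
proof -
  have "cls (\<lambda>n. mul A (u' n) (v' n)) = cls (\<lambda>n. mul A (u n) (v n))" if "u' \<in> cls u" "v' \<in> cls v" for u' v'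
  proof -
    have w: "u' \<in> Cauchy_seqs A" "v' \<in> Cauchy_seqs A" "null sequentially (\<lambda>n. \<phi> (u' n)) (\<lambda>n. \<phi> (u n))"
      "null sequentially (\<lambda>n. \<phi> (v' n)) (\<lambda>n. \<phi> (v n))"
      using that by (auto simp: Cauchy_rel_iff intro: null_sym)
    have "fundamental (\<lambda>n. \<phi> (u' n))" "fundamental (\<lambda>n. \<phi> (v n))" using w(1) v Cauchy_seqs_iff by blast+
    from null_cv_fundamental[OF this w(3,4)] show ?thesis
      unfolding cls_eq_iff[OF Cauchy_seqs_ops(3)[OF w(1,2)] Cauchy_seqs_ops(3)[OF u v]]
      by (simp add: rep_mul Cauchy_seqs_carr u v w(1,2))
  qed
  then show ?thesis
    unfolding completion_of_def normed_star_algebra.simps by (rule constant_UN2[OF cls_self[OF u] cls_self[OF v]])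
qed

lemma completion_scl:
  assumes u: "u \<in> Cauchy_seqs A"
  shows "scl (completion_of A) c (cls u) = cls (\<lambda>n. scl A c (u n))"
proof -
  have "cls (\<lambda>n. scl A c (u' n)) = cls (\<lambda>n. scl A c (u n))" if "u' \<in> cls u" for u'
  proof -
    have w: "u' \<in> Cauchy_seqs A" "null sequentially (\<lambda>n. \<phi> (u' n)) (\<lambda>n. \<phi> (u n))"
      using that by (auto simp: Cauchy_rel_iff intro: null_sym)
    show ?thesis unfolding cls_eq_iff[OF Cauchy_seqs_ops(2)[OF w(1) w(1)] Cauchy_seqs_ops(2)[OF u u]]
      using null_sc[OF w(2)] by (simp add: rep_scl Cauchy_seqs_carr u w(1))
  qed
  moreover have "cls u \<noteq> {}" using cls_self[OF u] by blast
  ultimately show ?thesis unfolding completion_of_def normed_star_algebra.simps by (intro constant_UN)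
qed

lemma completion_adj:
  assumes u: "u \<in> Cauchy_seqs A"
  shows "adj (completion_of A) (cls u) = cls (\<lambda>n. adj A (u n))"
proof -
  have "cls (\<lambda>n. adj A (u' n)) = cls (\<lambda>n. adj A (u n))" if "u' \<in> cls u" for u'
  proof -
    have w: "u' \<in> Cauchy_seqs A" "null sequentially (\<lambda>n. \<phi> (u' n)) (\<lambda>n. \<phi> (u n))"
      using that by (auto simp: Cauchy_rel_iff intro: null_sym)
    show ?thesis unfolding cls_eq_iff[OF Cauchy_seqs_ops(4)[OF w(1) w(1)] Cauchy_seqs_ops(4)[OF u u]]
      using null_ad[OF w(2)] by (simp add: rep_adj Cauchy_seqs_carr u w(1))
  qed
  moreover have "cls u \<noteq> {}" using cls_self[OF u] by blast
  ultimately show ?thesis unfolding completion_of_def normed_star_algebra.simps by (intro constant_UN)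
qed

lemma completion_nrm:
  assumes u: "u \<in> Cauchy_seqs A"
  shows "nrm (completion_of A) (cls u) = lim (\<lambda>n. N (\<phi> (u n)))"
proof -
  have "lim (\<lambda>n. nrm A (u' n)) = lim (\<lambda>n. N (\<phi> (u n)))" if "u' \<in> cls u" for u'
  proof -
    have w: "u' \<in> Cauchy_seqs A" "null sequentially (\<lambda>n. \<phi> (u n)) (\<lambda>n. \<phi> (u' n))"
      using that by (auto simp: Cauchy_rel_iff)
    have "fundamental (\<lambda>n. \<phi> (u n))" using u Cauchy_seqs_iff by blast
    from lim_norm_null[OF this w(2)] show ?thesis by (simp add: rep_nrm Cauchy_seqs_carr[OF w(1)])
  qed
  then have "(\<lambda>u. lim (\<lambda>n. nrm A (u n))) ` cls u = {lim (\<lambda>n. N (\<phi> (u n)))}" using cls_self[OF u] by auto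
  then show ?thesis by (simp add: completion_of_def)
qed

end

text \<open>Neither image is assumed to lie in the other. Mutual approximation means that every
  Cauchy sequence of one algebra has a partner in the other with the same limit.\<close>

locale mutually_dense_algebras =
  a: represented_algebra C N sc cv ad A \<phi> + b: represented_algebra C N sc cv ad B \<psi>
  for C :: "'c::ab_group_add set" and N sc cv ad
    and A :: "'a normed_star_algebra" and \<phi> and B :: "'b normed_star_algebra" and \<psi> +
  assumes dense_left: "a \<in> carr A \<Longrightarrow> 0 < \<epsilon> \<Longrightarrow> \<exists>b\<in>carr B. N (\<phi> a - \<psi> b) \<le> \<epsilon>"
    and dense_right: "b \<in> carr B \<Longrightarrow> 0 < \<epsilon> \<Longrightarrow> \<exists>a\<in>carr A. N (\<psi> b - \<phi> a) \<le> \<epsilon>"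
begin

text \<open>Equality of the limits of two Cauchy sequences from different algebras, expressed
  without naming a limit.\<close>

definition close :: "(nat \<Rightarrow> 'a) \<Rightarrow> (nat \<Rightarrow> 'b) \<Rightarrow> bool" where
  "close u v \<longleftrightarrow> u \<in> Cauchy_seqs A \<and> v \<in> Cauchy_seqs B \<and> a.null sequentially (\<lambda>n. \<phi> (u n)) (\<lambda>n. \<psi> (v n))"

lemma null_inverse_Suc:
  assumes "\<And>n. w n \<in> C" "\<And>n. w' n \<in> C" "\<And>n. N (w n - w' n) \<le> inverse (real (Suc n))"
  shows "a.null sequentially w w'"
  by (rule a.null_dominated[OF assms LIMSEQ_inverse_real_of_nat])

lemma close_left: assumes u: "u \<in> Cauchy_seqs A" obtains v where "close u v"
proof -
  have "\<exists>b\<in>carr B. N (\<phi> (u n) - \<psi> b) \<le> inverse (real (Suc n))" for n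
    by (rule dense_left[OF a.Cauchy_seqs_carr[OF u]]) simp
  then obtain v where v: "\<And>n. v n \<in> carr B" "\<And>n. N (\<phi> (u n) - \<psi> (v n)) \<le> inverse (real (Suc n))" by metis
  have n: "a.null sequentially (\<lambda>n. \<phi> (u n)) (\<lambda>n. \<psi> (v n))"
    by (rule null_inverse_Suc) (use v a.rep_in b.rep_in a.Cauchy_seqs_carr[OF u] in auto)
  have "a.fundamental (\<lambda>n. \<psi> (v n))" using a.fundamental_null[OF _ n] u a.Cauchy_seqs_iff by blast
  then have "v \<in> Cauchy_seqs B" using v(1) by (auto simp: b.Cauchy_seqs_iff)
  then show ?thesis using that u n by (simp add: close_def)
qed

lemma close_right: assumes v: "v \<in> Cauchy_seqs B" obtains u where "close u v"
proof -
  have "\<exists>a\<in>carr A. N (\<psi> (v n) - \<phi> a) \<le> inverse (real (Suc n))" for n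
    by (rule dense_right[OF b.Cauchy_seqs_carr[OF v]]) simp
  then obtain u where u: "\<And>n. u n \<in> carr A" "\<And>n. N (\<psi> (v n) - \<phi> (u n)) \<le> inverse (real (Suc n))" by metis
  have n: "a.null sequentially (\<lambda>n. \<psi> (v n)) (\<lambda>n. \<phi> (u n))"
    by (rule null_inverse_Suc) (use u a.rep_in b.rep_in b.Cauchy_seqs_carr[OF v] in auto)
  have "a.fundamental (\<lambda>n. \<phi> (u n))" using a.fundamental_null[OF _ n] v b.Cauchy_seqs_iff by blast
  then have "u \<in> Cauchy_seqs A" using u(1) by (auto simp: a.Cauchy_seqs_iff)
  then show ?thesis using that v a.null_sym[OF n] by (simp add: close_def)
qed

text \<open>Serves twice: one direction makes the extension well defined, the other makes it
  injective.\<close>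

lemma close_cls_iff: assumes "close u v" "close u' v'" shows "a.cls u = a.cls u' \<longleftrightarrow> b.cls v = b.cls v'"
proof -
  have *: "u \<in> Cauchy_seqs A" "u' \<in> Cauchy_seqs A" "v \<in> Cauchy_seqs B" "v' \<in> Cauchy_seqs B"
    and n: "a.null sequentially (\<lambda>n. \<phi> (u n)) (\<lambda>n. \<psi> (v n))" "a.null sequentially (\<lambda>n. \<phi> (u' n)) (\<lambda>n. \<psi> (v' n))"
    using assms by (simp_all add: close_def)
  show ?thesis unfolding a.cls_eq_iff[OF *(1,2)] b.cls_eq_iff[OF *(3,4)]
    using a.null_trans[OF a.null_sym[OF n(1)] a.null_trans[OF _ n(2)]]
      a.null_trans[OF n(1) a.null_trans[OF _ a.null_sym[OF n(2)]]] by blast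
qed

text \<open>Defined by a relation rather than by a choice of approximants: the value consists of all
  Cauchy sequences of B with the limit of the class p.\<close>

definition extension :: "(nat \<Rightarrow> 'a) set \<Rightarrow> (nat \<Rightarrow> 'b) set" where
  "extension p = {v. \<exists>u\<in>p. close u v}"

lemma extension_cls: assumes "close u v" shows "extension (a.cls u) = b.cls v"
proof (intro set_eqI iffI)
  have uv: "u \<in> Cauchy_seqs A" "v \<in> Cauchy_seqs B" using assms by (simp_all add: close_def)
  fix v'
  { assume "v' \<in> extension (a.cls u)"
    then obtain u' where u': "u' \<in> a.cls u" "close u' v'" by (auto simp: extension_def)
    then have "a.cls u = a.cls u'" using equiv_class_eq[OF a.equiv_Cauchy_rel] by blast
    then have "b.cls v = b.cls v'" using close_cls_iff[OF assms u'(2)] by blast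
    then show "v' \<in> b.cls v" using b.cls_self u'(2) by (auto simp: close_def) }
  { assume "v' \<in> b.cls v"
    then have "v' \<in> Cauchy_seqs B" "a.null sequentially (\<lambda>n. \<psi> (v n)) (\<lambda>n. \<psi> (v' n))" by (auto simp: b.Cauchy_rel_iff)
    then have "close u v'" using assms a.null_trans unfolding close_def by blast
    then show "v' \<in> extension (a.cls u)" using a.cls_self[OF uv(1)] by (auto simp: extension_def) }
qed

lemma close_ops:
  assumes "close u v" "close u' v'"
  shows "close (\<lambda>n. add A (u n) (u' n)) (\<lambda>n. add B (v n) (v' n))"
    "close (\<lambda>n. scl A c (u n)) (\<lambda>n. scl B c (v n))"
    "close (\<lambda>n. mul A (u n) (u' n)) (\<lambda>n. mul B (v n) (v' n))"
    "close (\<lambda>n. adj A (u n)) (\<lambda>n. adj B (v n))"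
proof -
  have *: "u \<in> Cauchy_seqs A" "u' \<in> Cauchy_seqs A" "v \<in> Cauchy_seqs B" "v' \<in> Cauchy_seqs B"
    and n: "a.null sequentially (\<lambda>n. \<phi> (u n)) (\<lambda>n. \<psi> (v n))" "a.null sequentially (\<lambda>n. \<phi> (u' n)) (\<lambda>n. \<psi> (v' n))"
    using assms by (simp_all add: close_def)
  have f: "a.fundamental (\<lambda>n. \<phi> (u n))" "a.fundamental (\<lambda>n. \<psi> (v' n))"
    using * a.Cauchy_seqs_iff b.Cauchy_seqs_iff by blast+
  note c = a.Cauchy_seqs_carr[OF *(1)] a.Cauchy_seqs_carr[OF *(2)] b.Cauchy_seqs_carr[OF *(3)] b.Cauchy_seqs_carr[OF *(4)]
  note [simp] = a.rep_add a.rep_scl a.rep_mul a.rep_adj b.rep_add b.rep_scl b.rep_mul b.rep_adj c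
    a.Cauchy_seqs_ops * b.Cauchy_seqs_ops
  show "close (\<lambda>n. add A (u n) (u' n)) (\<lambda>n. add B (v n) (v' n))"
    using a.null_add[OF n] by (simp add: close_def)
  show "close (\<lambda>n. scl A c (u n)) (\<lambda>n. scl B c (v n))"
    using a.null_sc[OF n(1)] a.Cauchy_seqs_ops(2)[OF *(1,1)] b.Cauchy_seqs_ops(2)[OF *(3,3)] by (simp add: close_def)
  show "close (\<lambda>n. mul A (u n) (u' n)) (\<lambda>n. mul B (v n) (v' n))"
    using a.null_cv_fundamental[OF f n] by (simp add: close_def)
  show "close (\<lambda>n. adj A (u n)) (\<lambda>n. adj B (v n))"
    using a.null_ad[OF n(1)] a.Cauchy_seqs_ops(4)[OF *(1,1)] b.Cauchy_seqs_ops(4)[OF *(3,3)] by (simp add: close_def)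
qed

theorem cstar_isomorphism_extension:
  "cstar_isomorphism (completion_of A) (completion_of B) extension"
proof -
  have cl: "\<exists>u v. p = a.cls u \<and> close u v \<and> extension p = b.cls v" if "p \<in> carr (completion_of A)" for p
  proof -
    obtain u where u: "u \<in> Cauchy_seqs A" "p = a.cls u" using \<open>p \<in> carr (completion_of A)\<close> unfolding a.carr_completion by blast
    obtain v where "close u v" by (rule close_left[OF u(1)])
    then show ?thesis using u(2) extension_cls by blast
  qed
  have sq: "u \<in> Cauchy_seqs A" "v \<in> Cauchy_seqs B" if "close u v" for u v using that by (simp_all add: close_def)
  show ?thesis
    unfolding cstar_isomorphism_def
  proof (intro conjI ballI allI)
    show "bij_betw extension (carr (completion_of A)) (carr (completion_of B))"
      unfolding bij_betw_def
    proof
      show "inj_on extension (carr (completion_of A))"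
      proof (rule inj_onI)
        fix p q assume "p \<in> carr (completion_of A)" "q \<in> carr (completion_of A)" and eq: "extension p = extension q"
        then obtain u v u' v' where "p = a.cls u" "close u v" "extension p = b.cls v"
          "q = a.cls u'" "close u' v'" "extension q = b.cls v'" using cl by meson
        then show "p = q" using close_cls_iff eq by simp
      qed
      show "extension ` carr (completion_of A) = carr (completion_of B)"
      proof
        show "extension ` carr (completion_of A) \<subseteq> carr (completion_of B)"
          using cl sq(2) unfolding b.carr_completion by blast
        show "carr (completion_of B) \<subseteq> extension ` carr (completion_of A)"
        proof
          fix q assume "q \<in> carr (completion_of B)"
          then obtain v where v: "v \<in> Cauchy_seqs B" "q = b.cls v" unfolding b.carr_completion by blast
          obtain u where "close u v" by (rule close_right[OF v(1)])
          then show "q \<in> extension ` carr (completion_of A)"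
            using extension_cls sq(1) v(2) unfolding a.carr_completion by blast
        qed
      qed
    qed
    fix p assume "p \<in> carr (completion_of A)"
    then obtain u v where p: "p = a.cls u" "close u v" "extension p = b.cls v" using cl by blast
    note u = sq[OF p(2)]
    show "extension (scl (completion_of A) c p) = scl (completion_of B) c (extension p)" for c
      unfolding p(3) unfolding p(1) a.completion_scl[OF u(1)] b.completion_scl[OF u(2)] by (rule extension_cls[OF close_ops(2)[OF p(2,2)]])
    show "extension (adj (completion_of A) p) = adj (completion_of B) (extension p)"
      unfolding p(3) unfolding p(1) a.completion_adj[OF u(1)] b.completion_adj[OF u(2)] by (rule extension_cls[OF close_ops(4)[OF p(2,2)]])
    show "nrm (completion_of B) (extension p) = nrm (completion_of A) p"
    proof -
      have "a.fundamental (\<lambda>n. \<phi> (u n))" "a.null sequentially (\<lambda>n. \<phi> (u n)) (\<lambda>n. \<psi> (v n))"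
        using p(2) a.Cauchy_seqs_iff by (auto simp: close_def)
      from a.lim_norm_null[OF this] show ?thesis
        unfolding p(3) unfolding p(1) a.completion_nrm[OF u(1)] b.completion_nrm[OF u(2)] by simp
    qed
    fix q assume "q \<in> carr (completion_of A)"
    then obtain u' v' where q: "q = a.cls u'" "close u' v'" "extension q = b.cls v'" using cl by blast
    note u' = sq[OF q(2)]
    show "extension (add (completion_of A) p q) = add (completion_of B) (extension p) (extension q)"
      unfolding p(3) q(3) unfolding p(1) q(1) a.completion_add[OF u(1) u'(1)] b.completion_add[OF u(2) u'(2)]
      by (rule extension_cls[OF close_ops(1)[OF p(2) q(2)]])
    show "extension (mul (completion_of A) p q) = mul (completion_of B) (extension p) (extension q)"
      unfolding p(3) q(3) unfolding p(1) q(1) a.completion_mul[OF u(1) u'(1)] b.completion_mul[OF u(2) u'(2)]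
      by (rule extension_cls[OF close_ops(3)[OF p(2) q(2)]])
  qed
qed

end

theorem theorem4p2p8:
  fixes X :: "'x topology" and \<theta> :: "'s::inverse_semigroup \<Rightarrow> 'x \<rightharpoonup> 'x"
  assumes "locally_compact_space X" and "Hausdorff_space X"
    and "semigroup_action X \<theta>"
  shows "cstar_isomorphic (KS_reduced_crossed_product X \<theta>) (reduced_groupoid_algebra (KS_groupoid X \<theta>))"
proof -
  interpret KS_comparison X \<theta> using assms by unfold_locales
  let ?G = "ks.GG"
  \<comment> \<open>The crossed product is represented by \<open>comparison\<close> and the groupoid
    algebra by inclusion, both in \<open>bounded_kernels\<close> with the reduced norm.\<close>
  interpret mutually_dense_algebras ks.bounded_kernels "reduced_norm ?G" "\<lambda>c f \<gamma>. c * f \<gamma>" "convolution ?G" "groupoid_adjoint ?G"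
    "KS_algebraic_crossed_product X \<theta>" comparison "groupoid_algebra ?G" "\<lambda>f. f"
  proof
    fix f g h assume f: "f \<in> ks.bounded_kernels" and g: "g \<in> ks.bounded_kernels"
    show "f + g \<in> ks.bounded_kernels" "reduced_norm ?G (f + g) \<le> reduced_norm ?G f + reduced_norm ?G g"
      by (rule ks.bounded_kernels_add[OF f g])+
    show "convolution ?G f g \<in> ks.bounded_kernels" "reduced_norm ?G (convolution ?G f g) \<le> reduced_norm ?G f * reduced_norm ?G g"
      by (rule ks.bounded_kernels_convolution[OF f g])+
    assume h: "h \<in> ks.bounded_kernels"
    show "convolution ?G (f + g) h = convolution ?G f h + convolution ?G g h" by (rule ks.convolution_add_left[OF h])
    show "convolution ?G h (f + g) = convolution ?G h f + convolution ?G h g" by (rule ks.convolution_add_right[OF f g])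
  next
    fix f c assume f: "f \<in> ks.bounded_kernels"
    show "(\<lambda>\<gamma>. c * f \<gamma>) \<in> ks.bounded_kernels" "reduced_norm ?G (\<lambda>\<gamma>. c * f \<gamma>) \<le> cmod c * reduced_norm ?G f"
      by (rule ks.bounded_kernels_scale[OF f])+
    show "groupoid_adjoint ?G f \<in> ks.bounded_kernels" "reduced_norm ?G (groupoid_adjoint ?G f) \<le> reduced_norm ?G f"
      by (rule ks.bounded_kernels_adjoint[OF f])+
    show "0 \<le> reduced_norm ?G f" by (rule ks.reduced_norm_nonneg[OF f])
  next
    show "reduced_norm ?G 0 = 0" by (rule ks.reduced_norm_zero)
    fix f g :: "('s \<times> ('s \<Rightarrow> 'x option)) set \<Rightarrow> complex" and c :: complex
    show "(\<lambda>\<gamma>. - 1 * f \<gamma>) = - f" "(\<lambda>\<gamma>. c * (f + g) \<gamma>) = (\<lambda>\<gamma>. c * f \<gamma>) + (\<lambda>\<gamma>. c * g \<gamma>)"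
      by (simp_all add: fun_eq_iff distrib_left)
    show "groupoid_adjoint ?G (f + g) = groupoid_adjoint ?G f + groupoid_adjoint ?G g"
      by (rule ks.groupoid_adjoint_add)
  qed (simp_all only: KS_algebraic_crossed_product_def groupoid_algebra_def normed_star_algebra.simps
      KS_algebraic_add KS_algebraic_scale KS_mult_closed KS_adjoint_closed comparison_bounded comparison_add comparison_scale
      comparison_mult comparison_adjoint comparison_isometric comparison_approximates_groupoid_functions
      ks.groupoid_functions_add ks.groupoid_functions_scale ks.groupoid_functions_convolution ks.groupoid_functions_adjoint
      subsetD[OF ks.groupoid_functions_bounded] groupoid_functions_approximate_comparison)
  show ?thesis
    unfolding cstar_isomorphic_def KS_reduced_crossed_product_def reduced_groupoid_algebra_def KS_groupoid_def
    using cstar_isomorphism_extension by blast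
qed

end
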